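(* Let $n\ge 2$, let $\Omega\subset\mathbb{R}^n$ be open and connected with $C^1$ boundary and $\mathbb{Z}^n$-periodic (i.e. $\Omega+\mathbb{Z}^n=\Omega$), and put $\Omega_\varepsilon=\varepsilon\Omega$ for $\varepsilon>0$. Assume: (A1) $H\in C(\mathbb{R}^n\times\mathbb{R}^n)$ and for each $p\in\mathbb{R}^n$ the map $y\mapsto H(y,p)$ is $\mathbb{Z}^n$-periodic; (A2) $\lim_{|p|\to\infty}\inf_{y\in\mathbb{R}^n}H(y,p)=+\infty$; (A3) for each $y\in\mathbb{R}^n$ the map $p\mapsto H(y,p)$ is convex; (A4) $g:\mathbb{R}^n\to\mathbb{R}$ is bounded, uniformly continuous and Lipschitz. For $\varepsilon>0$ let $u^\varepsilon$ be the viscosity solution of the state-constraint problem $$u^\varepsilon_t+H\left(\tfrac{x}{\varepsilon},Du^\varepsilon\right)\le 0\ \text{ in }\Omega_\varepsilon\times(0,\infty),\qquad u^\varepsilon_t+H\left(\tfrac{x}{\varepsilon},Du^\varepsilon\right)\ge 0\ \text{ on }\overline{\Omega}_\varepsilon\times(0,\infty),\qquad u^\varepsilon(\cdot,0)=g\ \text{ on }\overline{\Omega}_\varepsilon,$$ and let $u$ be the viscosity solution of $$u_t+\overline{H}(Du)=0\ \text{ in }\mathbb{R}^n\times(0,\infty),\qquad u(\cdot,0)=g\ \text{ on }\mathbb{R}^n,$$ where $\overline{H}=\overline{H}_\Omega$ is the effective Hamiltonian of the state-constraint cell problem on $\overline{\Omega}$. Then there exists a constant $C>0$ depending only on $n$,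 $\partial\Omega$, $H$ and $\|Dg\|_{L^\infty(\mathbb{R}^n)}$ such that, for all $\varepsilon\in(0,1)$, $$\|u^\varepsilon-u\|_{L^\infty(\overline{\Omega}_\varepsilon\times[0,\infty))}\le C\varepsilon .$$
   Context: State-constraint viscosity solutions: a continuous function $u^\varepsilon$ on $\overline{\Omega}_\varepsilon\times[0,\infty)$ solves the problem if it is a viscosity subsolution in the open set $\Omega_\varepsilon\times(0,\infty)$ in the usual sense and a supersolution on $\overline{\Omega}_\varepsilon\times(0,\infty)$: whenever $\varphi$ is $C^1$ and $u^\varepsilon-\varphi$ has a local minimum relative to $\overline{\Omega}_\varepsilon\times(0,\infty)$ at $(x_0,t_0)$, one has $\varphi_t(x_0,t_0)+H(x_0/\varepsilon,D\varphi(x_0,t_0))\ge0$. The problem is well posed, and $u^\varepsilon$ denotes its unique (globally Lipschitz) viscosity solution. Effective Hamiltonian: for $p\in\mathbb{R}^n$, $\overline{H}(p)=\overline{H}_\Omega(p)$ is the unique constant for which the state-constraint cell problem $$H(y,p+Dv(y))\le\overline{H}(p)\ \text{ in }\Omega,\qquad H(y,p+Dv(y))\ge\overline{H}(p)\ \text{ on }\overline{\Omega}$$ has a $\mathbb{Z}^n$-periodic viscosity solution $v$ (sub-/supersolution understood in the same state-constraint sense). *)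

theory Defs
  imports "HOL-Analysis.Analysis"
begin

definition integer_lattice :: "(real ^ 'n) set" where
  "integer_lattice = {z. \<forall>i. z $ i \<in> \<int>}"

definition C1_with_gradient :: "'a::real_inner set \<Rightarrow> ('a \<Rightarrow> real) \<Rightarrow> ('a \<Rightarrow> 'a) \<Rightarrow> bool" where
  "C1_with_gradient U f Df \<longleftrightarrow>
     open U \<and> (\<forall>x\<in>U. GDERIV f x :> Df x) \<and> continuous_on U Df"

text \<open>
  Near every boundary point the set is, after a rotation, the strict epigraph of a \<open>C\<^sup>1\<close> function
  of the remaining \<open>n - 1\<close> coordinates: \<open>e\<close> is the upward direction, and \<open>x - (x \<bullet> e) *\<^sub>R e\<close>
  is the projection of \<open>x\<close> to the hyperplane orthogonal to \<open>e\<close>, so only the restriction of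
  \<open>\<gamma>\<close> to that hyperplane matters.
\<close>

definition C1_boundary :: "'a::euclidean_space set \<Rightarrow> bool" where
  "C1_boundary \<Omega> \<longleftrightarrow>
     (\<forall>x0\<in>frontier \<Omega>. \<exists>r>0. \<exists>e \<gamma> D\<gamma>. norm e = 1 \<and> C1_with_gradient UNIV \<gamma> D\<gamma> \<and>
        \<Omega> \<inter> ball x0 r = {x \<in> ball x0 r. \<gamma> (x - (x \<bullet> e) *\<^sub>R e) < x \<bullet> e})"

text \<open>
  Viscosity sub- and supersolutions of \<open>F(z, Dw(z)) = 0\<close>. The extremum of \<open>w - \<phi>\<close> is local
  \<^emph>\<open>relative to\<close> \<open>S\<close>. If \<open>S\<close> is open (relative to the domain of \<open>w\<close>) this is the usual notion;
  if \<open>S\<close> contains boundary points, the supersolution notion is the state-constraint one.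
  Test functions need only be \<open>C\<^sup>1\<close> in a full neighbourhood of the point of contact.
\<close>

definition viscosity_subsolution ::
    "'a::euclidean_space set \<Rightarrow> ('a \<Rightarrow> 'a \<Rightarrow> real) \<Rightarrow> ('a \<Rightarrow> real) \<Rightarrow> bool" where
  "viscosity_subsolution S F w \<longleftrightarrow>
     (\<forall>z0\<in>S. \<forall>U \<phi> D\<phi>. z0 \<in> U \<and> C1_with_gradient U \<phi> D\<phi> \<and>
        (\<forall>\<^sub>F z in at z0 within S. w z - \<phi> z \<le> w z0 - \<phi> z0) \<longrightarrow> F z0 (D\<phi> z0) \<le> 0)"

definition viscosity_supersolution ::
    "'a::euclidean_space set \<Rightarrow> ('a \<Rightarrow> 'a \<Rightarrow> real) \<Rightarrow> ('a \<Rightarrow> real) \<Rightarrow> bool" where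
  "viscosity_supersolution S F w \<longleftrightarrow>
     (\<forall>z0\<in>S. \<forall>U \<phi> D\<phi>. z0 \<in> U \<and> C1_with_gradient U \<phi> D\<phi> \<and>
        (\<forall>\<^sub>F z in at z0 within S. w z - \<phi> z \<ge> w z0 - \<phi> z0) \<longrightarrow> F z0 (D\<phi> z0) \<ge> 0)"

text \<open>
  The operator \<open>w\<^sub>t + K(x, Dw)\<close> on space-time; the second argument is the space-time gradient
  \<open>(D\<^sub>x w, w\<^sub>t)\<close>.
\<close>

definition evolution_operator ::
    "('a \<Rightarrow> 'a \<Rightarrow> real) \<Rightarrow> 'a \<times> real \<Rightarrow> 'a \<times> real \<Rightarrow> real" where
  "evolution_operator K = (\<lambda>(x, t) (p, q). q + K x p)"

text \<open>
  State-constraint viscosity solutions of the Cauchy problem on \<open>closure W\<close>, for open \<open>W\<close>, in the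
  class of globally Lipschitz functions, where they are unique for the problems considered here.
  For \<open>W = UNIV\<close> there is no boundary, and these are the ordinary viscosity solutions.
\<close>

definition state_constraint_solution ::
    "'a::euclidean_space set \<Rightarrow> ('a \<Rightarrow> 'a \<Rightarrow> real) \<Rightarrow> ('a \<Rightarrow> real) \<Rightarrow> ('a \<times> real \<Rightarrow> real) \<Rightarrow> bool" where
  "state_constraint_solution W K g w \<longleftrightarrow>
     (\<exists>L. L-lipschitz_on (closure W \<times> {0..}) w) \<and>
     viscosity_subsolution (W \<times> {0<..}) (evolution_operator K) w \<and>
     viscosity_supersolution (closure W \<times> {0<..}) (evolution_operator K) w \<and>
     (\<forall>x\<in>closure W. w (x, 0) = g x)"

definition cell_solution ::
    "(real ^ 'n) set \<Rightarrow> (real ^ 'n \<Rightarrow> real ^ 'n \<Rightarrow> real) \<Rightarrow> real ^ 'n \<Rightarrow> real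
      \<Rightarrow> (real ^ 'n \<Rightarrow> real) \<Rightarrow> bool" where
  "cell_solution \<Omega> H p c v \<longleftrightarrow>
     continuous_on (closure \<Omega>) v \<and>
     (\<forall>y\<in>closure \<Omega>. \<forall>z\<in>integer_lattice. v (y + z) = v y) \<and>
     viscosity_subsolution \<Omega> (\<lambda>y q. H y (p + q) - c) v \<and>
     viscosity_supersolution (closure \<Omega>) (\<lambda>y q. H y (p + q) - c) v"

definition effective_hamiltonian ::
    "(real ^ 'n) set \<Rightarrow> (real ^ 'n \<Rightarrow> real ^ 'n \<Rightarrow> real) \<Rightarrow> real ^ 'n \<Rightarrow> real" where
  "effective_hamiltonian \<Omega> H p = (THE c. \<exists>v. cell_solution \<Omega> H p c v)"

text \<open>
  For Lipschitz \<open>g\<close>, which is differentiable almost everywhere by Rademacher's theorem,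
  \<open>is_gradient_Linf_norm g M\<close> says that \<open>M\<close> is the essential supremum of \<open>|Dg|\<close>.
\<close>

definition gradient_ess_bounded :: "('a::euclidean_space \<Rightarrow> real) \<Rightarrow> real \<Rightarrow> bool" where
  "gradient_ess_bounded g M \<longleftrightarrow> (AE x in lborel. \<exists>D. (GDERIV g x :> D) \<and> norm D \<le> M)"

definition is_gradient_Linf_norm :: "('a::euclidean_space \<Rightarrow> real) \<Rightarrow> real \<Rightarrow> bool" where
  "is_gradient_Linf_norm g M \<longleftrightarrow>
     gradient_ess_bounded g M \<and> (\<forall>M'. gradient_ess_bounded g M' \<longrightarrow> M \<le> M')"

end

(* After rescaling, eps = 1 and the claim is a bound on |w - u| uniform over all M-Lipschitz data.
   Subsolutions are described by increments: for a segment in the domain with displacement v*tau,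
   cost tau*l and p.v - H(x,p) <= l for all |p| <= R along it, f grows by at most tau*l. Segments
   concatenate to paths, and the effective Hamiltonian at p is the supremum of (p.Delta - cost)/time
   over paths whose displacement Delta is a lattice vector.

   Lower bound on w: the inf-sup (Hopf) formula for u, with planes replaced by planes plus Lipschitz
   correctors, is a subsolution of the oscillating problem.

   Upper bound on w: the set of increments (time, displacement, cost) of paths is invariant under
   addition and under halving up to a bounded error, so it is boundedly close to a convex cone.
   Additivity comes from bounded connections modulo the lattice. Halving is a discrete necklace
   splitting argument: by Tucker's lemma a sequence of small vectors in dimension d has signs with at
   most d+1 changes whose signed sum is bounded, and the selected pieces of the path are glued
   together. The infimum of g(x - Delta) + cost over the cone is a subsolution of the homogenized
   problem, hence at most u, and following the corresponding path bounds w by it up to a constant. *)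

theory Submission
  imports Defs "HOL-Library.Multiset"
begin

section \<open>A Tucker lemma for signed sets\<close>

text \<open>After rescaling, the error must stay bounded for all times, not merely grow slowly.
  Concatenation gives only one half of what is needed: if an increment is available, so is its
  double up to a constant. The converse, that half of every long increment is available too, does
  not follow from subadditivity, since a path need not make half of its displacement and cost in
  half of its time. Cutting it at boundedly many places and regluing selected pieces repairs this.
  As halving also halves earlier errors, the total error stays bounded at every scale. Each cut
  costs one connection, which is why the number of sign changes has to be bounded independently of
  the number of steps. Momenta are truncated to \<open>norm p \<le> R\<close> because
  \<open>H\<close> is only coercive, so its full Legendre transform may be infinite; this does no
  harm once \<open>R\<close> exceeds every momentum whose energy lies below the levels in play. The
  geometry enters through an interior cone condition, connectedness and compactness modulo the
  lattice.\<close>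

type_synonym signed_set = "(nat \<times> bool) set"

definition flip :: "nat \<times> bool \<Rightarrow> nat \<times> bool" where
  "flip e = (fst e, \<not> snd e)"

lemma flip_flip [simp]: "flip (flip e) = e"
  by (simp add: flip_def)

lemma fst_flip [simp]: "fst (flip e) = fst e"
  by (simp add: flip_def)

lemma flip_neq [simp]: "flip e \<noteq> e"
  by (cases e) (simp add: flip_def)

lemma flip_image_flip [simp]: "flip ` flip ` A = A"
  by (simp add: image_image)

text \<open>
  A signed set is a nonzero vector of signs: \<open>(i, b)\<close> gives coordinate \<open>i\<close> the sign \<open>b\<close>, and
  coordinates that do not occur are zero. Adding elements refines the vector.
\<close>

definition signed_vectors :: "nat \<Rightarrow> signed_set set" where
  "signed_vectors m = {A. A \<noteq> {} \<and> A \<subseteq> {..<m} \<times> UNIV \<and> inj_on fst A}"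

text \<open>
  Labels \<open>\<plusminus>k\<close> are coded as the natural numbers \<open>2 * k\<close> and \<open>2 * k + 1\<close>, so that the order of
  naturals sorts labels by absolute value.
\<close>

definition opp :: "nat \<Rightarrow> nat" where
  "opp x = (if even x then x + 1 else x - 1)"

lemma opp_opp [simp]: "opp (opp x) = x"
  by (simp add: opp_def)

lemma even_opp [simp]: "even (opp x) \<longleftrightarrow> odd x"
  by (simp add: opp_def)

lemma opp_div [simp]: "opp x div 2 = x div 2"
  by (auto simp: opp_def elim!: evenE oddE)

text \<open>The flag \<open>s\<close> is the sign required of the head: \<open>True\<close> asks for
  an even number, the code of a positive label.\<close>

fun alternating :: "bool \<Rightarrow> nat list \<Rightarrow> bool" where
  "alternating s [] = True"
| "alternating s (x # xs) = (even x = s \<and> alternating (\<not> s) xs)"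

lemma alternating_opp: "alternating s (map opp xs) \<longleftrightarrow> alternating (\<not> s) xs"
  by (induction xs arbitrary: s) auto

definition alternating_mset :: "bool \<Rightarrow> nat multiset \<Rightarrow> bool" where
  "alternating_mset s M = alternating s (sorted_list_of_multiset M)"

text \<open>The door count of Fan's combinatorial lemma for a single simplex. If the list
  alternates, exactly one deletion has the wanted pattern: that of the last or of the first entry,
  according to the starting sign. If it does not alternate, there is no such deletion or there are
  exactly two, namely those of two adjacent entries of equal parity.\<close>

lemma alternating_facet_parity_sorted:
  assumes "sorted l" "l \<noteq> []"
  shows "odd (\<Sum>x\<leftarrow>l. if alternating s (remove1 x l) then 1 else 0 :: nat) \<longleftrightarrow>
    alternating s l \<or> alternating (\<not> s) l"
  using assms
proof (induction l arbitrary: s)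
  case (Cons x xs)
  let ?c = "\<lambda>s l. \<Sum>x\<leftarrow>l. if alternating s (remove1 x l) then 1 else 0 :: nat"
  \<comment> \<open>\<open>remove1\<close> deletes the first occurrence. If \<open>y\<close> equals
    the head, sortedness makes the tail start with the same value, so both deletions agree.\<close>
  have rm: "remove1 y (x # xs) = x # remove1 y xs" if "y \<in> set xs" for y
  proof (cases "y = x")
    case True
    with that Cons.prems obtain z zs where "xs = z # zs" "z = x"
      by (cases xs) (force, fastforce)
    with True show ?thesis by simp
  qed auto
  \<comment> \<open>Deleting the head leaves \<open>xs\<close>. Any other deletion keeps the head,
    which must then have the right parity and passes the opposite flag to the tail.\<close>
  have step: "?c s (x # xs) = (if alternating s xs then 1 else 0) +
      (if even x = s then ?c (\<not> s) xs else 0)"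
  proof -
    have "(\<Sum>y\<leftarrow>xs. if alternating s (remove1 y (x # xs)) then 1 else 0 :: nat) =
        (\<Sum>y\<leftarrow>xs. if alternating s (x # remove1 y xs) then 1 else 0)"
      by (intro arg_cong[where f = sum_list] map_cong refl) (simp only: rm)
    also have "\<dots> = (if even x = s then ?c (\<not> s) xs else 0)"
      by (auto intro!: arg_cong[where f = sum_list] map_cong)
    finally show ?thesis by simp
  qed
  show ?case
  proof (cases "xs = []")
    case True
    then show ?thesis by (cases "even x"; cases s) auto
  next
    case False
    have IH: "odd (?c (\<not> s) xs) \<longleftrightarrow> alternating (\<not> s) xs \<or> alternating s xs"
      using Cons.IH[of "\<not> s"] Cons.prems False by simp
    have excl: "\<not> (alternating s xs \<and> alternating (\<not> s) xs)"
      using False by (cases xs) auto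
    show ?thesis unfolding step using IH excl by (auto split: if_splits)
  qed
qed simp

text \<open>Positions are counted rather than values, since equal labels at different vertices
  belong to different walls of the simplex. Sorting only permutes the summands.\<close>

lemma alternating_facet_parity:
  assumes "l \<noteq> []"
  shows "odd (card {i. i < length l \<and> alternating_mset s (mset l - {#l ! i#})}) \<longleftrightarrow>
    alternating_mset s (mset l) \<or> alternating_mset (\<not> s) (mset l)"
proof -
  let ?s = "sort l"
  let ?P = "\<lambda>x. if alternating_mset s (mset l - {#x#}) then 1 else 0 :: nat"
  have "card {i. i < length l \<and> alternating_mset s (mset l - {#l ! i#})} = (\<Sum>i<length l. ?P (l ! i))"
    by (simp add: sum.If_cases Int_def)
  also have "\<dots> = sum_list (map ?P l)"
    by (simp add: sum_list_sum_nth atLeast0LessThan)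
  also have "\<dots> = sum_list (map ?P ?s)"
    by (simp flip: sum_mset_sum_list)
  also have "\<dots> = (\<Sum>x\<leftarrow>?s. if alternating s (remove1 x ?s) then 1 else 0)"
  proof (intro arg_cong[where f = sum_list] map_cong refl)
    fix x
    have "mset l - {#x#} = mset (remove1 x ?s)"
      by simp
    then have "sorted_list_of_multiset (mset l - {#x#}) = sort (remove1 x ?s)"
      by (simp only: sorted_list_of_multiset_mset)
    also have "\<dots> = remove1 x ?s"
      by (intro sorted_sort_id sorted_remove1) simp
    finally have "sorted_list_of_multiset (mset l - {#x#}) = remove1 x ?s" .
    then show "?P x = (if alternating s (remove1 x ?s) then 1 else 0)"
      by (simp add: alternating_mset_def)
  qed
  also have "odd \<dots> \<longleftrightarrow> alternating s ?s \<or> alternating (\<not> s) ?s"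
    using assms by (intro alternating_facet_parity_sorted)
      (simp, metis length_0_conv length_sort)
  finally show ?thesis by (simp add: alternating_mset_def)
qed

text \<open>Neighbours with equal absolute value would differ in parity and hence be opposite
  labels.\<close>

lemma alternating_distinct:
  assumes "sorted l" "alternating s l" "\<And>x. x \<in> set l \<Longrightarrow> opp x \<notin> set l"
  shows "sorted_wrt (\<lambda>x y. x div 2 < y div 2) l"
  using assms
proof (induction l arbitrary: s)
  case (Cons x xs)
  have IH: "sorted_wrt (\<lambda>x y. x div 2 < y div 2) xs"
    using Cons by auto
  show ?case
  proof (cases xs)
    case (Cons y ys)
    have "x \<le> y" "even x \<noteq> even y" "opp x \<noteq> y"
      using Cons.prems Cons by auto
    then have "x div 2 < y div 2"
      by (auto simp: opp_def elim!: evenE oddE split: if_splits)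
    then show ?thesis using IH Cons by auto
  qed simp
qed simp

text \<open>Passing to opposite labels moves each label within its pair \<open>2 * k\<close>,
  \<open>2 * k + 1\<close>. The absolute values in an alternating multiset are distinct, so the
  sorted order survives. The converse direction applies this to the opposite multiset.\<close>

lemma alternating_mset_opp:
  assumes "\<And>x. x \<in># M \<Longrightarrow> opp x \<notin># M"
  shows "alternating_mset s (image_mset opp M) \<longleftrightarrow> alternating_mset (\<not> s) M"
proof -
  have *: "alternating_mset s (image_mset opp M)" if "alternating_mset (\<not> s) M"
      "\<And>x. x \<in># M \<Longrightarrow> opp x \<notin># M" for s M
  proof -
    let ?l = "sorted_list_of_multiset M"
    have "sorted_wrt (\<lambda>x y. x div 2 < y div 2) ?l"
      using that by (intro alternating_distinct[of _ "\<not> s"])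
        (auto simp: alternating_mset_def)
    moreover have "opp x \<le> opp y" if "x div 2 < y div 2" for x y
    proof (rule ccontr)
      assume "\<not> opp x \<le> opp y"
      then have "opp y div 2 \<le> opp x div 2" by (intro div_le_mono) simp
      with that show False by simp
    qed
    ultimately have "sorted_wrt (\<lambda>x y. opp x \<le> opp y) ?l"
      by (auto elim!: sorted_wrt_mono_rel[rotated])
    then have "sorted (map opp ?l)"
      by (simp add: sorted_wrt_map)
    then have "sorted_list_of_multiset (image_mset opp M) = map opp ?l"
      using sorted_list_of_multiset_mset[of "map opp ?l"] by (simp add: sorted_sort_id)
    then show ?thesis
      using that(1) by (simp add: alternating_mset_def alternating_opp)
  qed
  have "image_mset opp (image_mset opp M) = M"
    by (simp add: multiset.map_comp comp_def)
  moreover have "opp x \<notin># image_mset opp M" if "x \<in># image_mset opp M" for x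
    using that assms by auto
  ultimately show ?thesis
    using *[of s M] *[of "\<not> s" "image_mset opp M"] assms by auto
qed

lemma even_card_involution:
  assumes "finite A" "\<And>x. x \<in> A \<Longrightarrow> f x \<in> A" "\<And>x. x \<in> A \<Longrightarrow> f (f x) = x"
    "\<And>x. x \<in> A \<Longrightarrow> f x \<noteq> x"
  shows "even (card A)"
  using assms
proof (induction "card A" arbitrary: A rule: less_induct)
  case less
  show ?case
  proof (cases "A = {}")
    case False
    then obtain x where x: "x \<in> A" by auto
    let ?B = "A - {x, f x}"
    have "f x \<noteq> x" using less.prems(4) x by blast
    then have sub: "{x, f x} \<subseteq> A" and c2: "card {x, f x} = 2"
      using x less.prems(2) by (auto simp: card_insert_if)
    have cB: "card A = card ?B + 2"
      using sub c2 less.prems(1) by (metis card_Diff_subset card_mono finite_subset le_add_diff_inverse2)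
    have "even (card ?B)"
    proof (rule less.hyps)
      show "card ?B < card A" using cB by simp
      show "f y \<in> ?B" if "y \<in> ?B" for y
        using that less.prems x by (metis DiffD1 DiffD2 DiffI insertE insertI1 insertI2 singletonD)
    qed (use less.prems in auto)
    with cB show ?thesis by simp
  qed simp
qed

text \<open>The prefixes of such a list form a maximal chain of signed sets, so the list encodes a
  facet of the barycentric subdivision of the boundary of the cross-polytope. Its order says in
  which order the coordinates become nonzero.\<close>

definition maximal_chains :: "nat \<Rightarrow> (nat \<times> bool) list set" where
  "maximal_chains m = {xs. length xs = m \<and> distinct (map fst xs) \<and> fst ` set xs = {..<m}}"

definition chain_labels :: "(signed_set \<Rightarrow> nat) \<Rightarrow> (nat \<times> bool) list \<Rightarrow> nat list" where
  "chain_labels lab xs = map (\<lambda>i. lab (set (take (Suc i) xs))) [0..<length xs]"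

lemma length_chain_labels [simp]: "length (chain_labels lab xs) = length xs"
  by (simp add: chain_labels_def)

lemma nth_chain_labels [simp]:
  "i < length xs \<Longrightarrow> chain_labels lab xs ! i = lab (set (take (Suc i) xs))"
  by (simp add: chain_labels_def)

lemma finite_maximal_chains: "finite (maximal_chains m)"
proof (rule finite_subset)
  show "maximal_chains m \<subseteq> {xs. set xs \<subseteq> {..<m} \<times> UNIV \<and> length xs = m}"
    by (auto simp: maximal_chains_def) (metis fst_conv image_eqI lessThan_iff)
  show "finite {xs :: (nat \<times> bool) list. set xs \<subseteq> {..<m} \<times> UNIV \<and> length xs = m}"
    by (intro finite_lists_length_eq finite_cartesian_product) auto
qed

text \<open>Exchanging two consecutive entries alters only the prefix of length
  \<open>Suc i\<close>, so the two facets share the wall opposite to that vertex.\<close>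

lemma chain_labels_swap:
  assumes "Suc i < length xs" "ys = xs[i := xs ! Suc i, Suc i := xs ! i]"
  shows "mset (chain_labels lab ys) - {#chain_labels lab ys ! i#} =
    mset (chain_labels lab xs) - {#chain_labels lab xs ! i#}"
proof -
  let ?L = "chain_labels lab xs" and ?L' = "chain_labels lab ys"
  define a b where "a = take i xs" and "b = drop (Suc (Suc i)) xs"
  have xs: "xs = a @ xs ! i # xs ! Suc i # b" and la: "length a = i"
    using assms(1) by (simp_all add: a_def b_def Cons_nth_drop_Suc)
  obtain x y where xs': "xs = a @ x # y # b"
    using xs by blast
  have ys: "ys = a @ y # x # b"
    using la unfolding assms(2) xs' by (simp add: list_update_append nth_append)
  have "?L' = ?L[i := ?L' ! i]"
  proof (rule nth_equalityI)
    fix j assume "j < length ?L'"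
    then have j: "j < length ys" by simp
    have len: "length ys = length xs" using ys xs' by simp
    show "?L' ! j = ?L[i := ?L' ! i] ! j"
    proof (cases "j = i")
      case True
      then show ?thesis using j len by simp
    next
      case False
      have "set (take (Suc j) ys) = set (take (Suc j) xs)"
      proof (cases "j < i")
        case True
        then show ?thesis using la by (simp add: ys xs')
      next
        case nlt: False
        with False have "Suc j - i = Suc (Suc (j - i - 1))" by simp
        then show ?thesis using la nlt by (auto simp add: ys xs')
      qed
      then show ?thesis using False j len by simp
    qed
  qed (simp add: ys xs')
  then have "mset ?L' = add_mset (?L' ! i) (mset ?L - {#?L ! i#})"
    using assms(1) by (metis Suc_lessD length_chain_labels mset_update)
  then show ?thesis by simp
qed

text \<open>Only the full list changes as a set, so the wall opposite to the top vertex is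
  shared.\<close>

lemma chain_labels_last:
  assumes "length xs = Suc m" "ys = xs[m := z]"
  shows "mset (chain_labels lab ys) - {#chain_labels lab ys ! m#} =
    mset (chain_labels lab xs) - {#chain_labels lab xs ! m#}"
proof -
  let ?L = "chain_labels lab xs" and ?L' = "chain_labels lab ys"
  have "?L' = ?L[m := ?L' ! m]"
  proof (rule nth_equalityI)
    fix j assume "j < length ?L'"
    then show "?L' ! j = ?L[m := ?L' ! m] ! j"
      using assms by (cases "j = m") simp_all
  qed (simp add: assms)
  then have "mset ?L' = add_mset (?L' ! m) (mset ?L - {#?L ! m#})"
    using assms(1) by (metis length_chain_labels lessI mset_update)
  then show ?thesis by simp
qed

lemma set_take_signed_vectors:
  assumes "xs \<in> maximal_chains m" "i < m"
  shows "set (take (Suc i) xs) \<in> signed_vectors m"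
proof -
  have "set (take (Suc i) xs) \<subseteq> set xs" by (rule set_take_subset)
  moreover have "set xs \<subseteq> {..<m} \<times> UNIV" "inj_on fst (set xs)"
    using assms by (auto simp: maximal_chains_def distinct_map) (metis fst_conv image_eqI lessThan_iff)
  moreover have "set (take (Suc i) xs) \<noteq> {}"
    using assms by (auto simp: maximal_chains_def)
  ultimately show ?thesis
    unfolding signed_vectors_def using inj_on_subset by blast
qed

lemma signed_vectors_mono: "signed_vectors m \<subseteq> signed_vectors (Suc m)"
  by (auto simp: signed_vectors_def)

locale antipodal_labelling =
  fixes lab :: "signed_set \<Rightarrow> nat"
begin

text \<open>The second clause forbids complementary edges, so refuting validity of an antipodal
  labelling is what produces the pair in Tucker's lemma.\<close>

definition valid :: "nat \<Rightarrow> bool" where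
  "valid m \<longleftrightarrow> (\<forall>A\<in>signed_vectors m. lab (flip ` A) = opp (lab A)) \<and>
    (\<forall>A\<in>signed_vectors m. \<forall>B\<in>signed_vectors m. A \<subseteq> B \<longrightarrow> lab B \<noteq> opp (lab A))"

lemma valid_Suc: "valid (Suc m) \<Longrightarrow> valid m"
  using signed_vectors_mono unfolding valid_def by (meson subsetD)

definition alternating_chains :: "bool \<Rightarrow> nat \<Rightarrow> (nat \<times> bool) list set" where
  "alternating_chains s m = {xs \<in> maximal_chains m. alternating_mset s (mset (chain_labels lab xs))}"

lemma labels_not_opp:
  assumes "valid m" "xs \<in> maximal_chains m" "x \<in> set (chain_labels lab xs)"
  shows "opp x \<notin> set (chain_labels lab xs)"
proof
  assume "opp x \<in> set (chain_labels lab xs)"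
  with assms(3) obtain i j where ij: "i < length xs" "j < length xs"
    "x = lab (set (take (Suc i) xs))" "opp x = lab (set (take (Suc j) xs))"
    by (metis in_set_conv_nth length_chain_labels nth_chain_labels)
  have m: "length xs = m" using assms(2) by (simp add: maximal_chains_def)
  have V: "set (take (Suc i) xs) \<in> signed_vectors m" "set (take (Suc j) xs) \<in> signed_vectors m"
    using set_take_signed_vectors[OF assms(2)] ij m by auto
  have "set (take (Suc i) xs) \<subseteq> set (take (Suc j) xs) \<or> set (take (Suc j) xs) \<subseteq> set (take (Suc i) xs)"
    by (meson nat_le_linear set_take_subset_set_take)
  then show False
    using V assms(1) ij(3,4) unfolding valid_def by (metis opp_opp)
qed

lemma alternating_chains_flip:
  assumes "valid m" "xs \<in> alternating_chains s m"
  shows "map flip xs \<in> alternating_chains (\<not> s) m"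
proof -
  have xs: "xs \<in> maximal_chains m" using assms by (simp add: alternating_chains_def)
  then have xs': "map flip xs \<in> maximal_chains m"
    by (simp add: maximal_chains_def comp_def image_image)
  have "chain_labels lab (map flip xs) = map opp (chain_labels lab xs)"
  proof (rule nth_equalityI)
    fix i assume "i < length (chain_labels lab (map flip xs))"
    then have i: "i < m" "length xs = m" using xs by (auto simp: maximal_chains_def)
    then have "lab (flip ` set (take (Suc i) xs)) = opp (lab (set (take (Suc i) xs)))"
      using assms(1) set_take_signed_vectors[OF xs] unfolding valid_def by blast
    then show "chain_labels lab (map flip xs) ! i = map opp (chain_labels lab xs) ! i"
      using i by (simp add: take_map)
  qed simp
  then have "mset (chain_labels lab (map flip xs)) = image_mset opp (mset (chain_labels lab xs))"
    by simp
  moreover have "alternating_mset (\<not> s) (image_mset opp (mset (chain_labels lab xs)))"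
    using assms(2) labels_not_opp[OF assms(1) xs]
    by (subst alternating_mset_opp) (auto simp: alternating_chains_def)
  ultimately show ?thesis using xs' by (simp add: alternating_chains_def)
qed

text \<open>The induction step of Fan's lemma: alternating walls of the facets in one hemisphere are
  counted twice, modulo 2. Walls inside the hemisphere belong to two facets and cancel; the others
  lie in the equator and are the alternating chains one dimension lower. Counted by facets, the same
  number is the number of facets that alternate with either starting sign, and the antipodal map
  turns those with the wrong sign into the alternating facets of the other hemisphere.\<close>

lemma alternating_chains_parity_step:
  assumes "valid (Suc m)"
  shows "odd (card (alternating_chains True (Suc m))) \<longleftrightarrow> odd (card (alternating_chains True m))"
proof -
  let ?L = "chain_labels lab"
  let ?alt = "\<lambda>xs i. alternating_mset True (mset (?L xs) - {#?L xs ! i#})"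
  define Hemi where "Hemi = {xs \<in> maximal_chains (Suc m). (m, True) \<in> set xs}"
  define D where "D = (SIGMA xs:Hemi. {i. i < length (?L xs) \<and> ?alt xs i})"
  \<comment> \<open>The walls in the equator: the top vertex is the only one that uses coordinate
    \<open>m\<close>.\<close>
  define D0 where "D0 = {(xs, i) \<in> D. i = m \<and> xs ! m = (m, True)}"
  have finH: "finite Hemi"
    using finite_maximal_chains[of "Suc m"] by (simp add: Hemi_def)
  have len: "length xs = Suc m" if "xs \<in> Hemi" for xs
    using that by (simp add: Hemi_def maximal_chains_def)
  have finD: "finite D"
    unfolding D_def using finH by (intro finite_SigmaI) auto
  have "even (card (D - D0))"
  proof (rule even_card_involution)
    \<comment> \<open>The involution crosses a wall. An inner vertex is exchanged by swapping two
      consecutive entries, the top vertex by flipping the sign of the last entry; the latter leaves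
      the hemisphere exactly on \<open>D0\<close>.\<close>
    let ?f = "\<lambda>(xs, i). if i < m then (xs[i := xs ! Suc i, Suc i := xs ! i], i)
      else (xs[m := flip (xs ! m)], i)"
    fix z assume z: "z \<in> D - D0"
    obtain xs i where zi: "z = (xs, i)" by fastforce
    have xs: "xs \<in> Hemi" and i: "i < Suc m" and alt: "?alt xs i" and nb: "i = m \<longrightarrow> xs ! m \<noteq> (m, True)"
      using z zi len by (auto simp: D_def D0_def)
    have dist: "distinct (map fst xs)" and lxs: "length xs = Suc m"
      and img: "fst ` set xs = {..<Suc m}" and mem: "(m, True) \<in> set xs"
      using xs by (auto simp: Hemi_def maximal_chains_def)
    show "?f z \<noteq> z"
    proof (cases "i < m")
      case True
      then have "xs ! i \<noteq> xs ! Suc i"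
        using dist lxs by (metis Suc_less_eq distinct_map less_SucI n_not_Suc_n nth_eq_iff_index_eq)
      then show ?thesis
        using True lxs zi by (auto dest!: arg_cong[where f = "\<lambda>ys. ys ! i"])
    next
      case False
      then show ?thesis
        using lxs zi by (auto dest!: arg_cong[where f = "\<lambda>ys. ys ! m"])
    qed
    show "?f (?f z) = z"
    proof (cases "i < m")
      case True
      then show ?thesis
        using lxs zi by (auto intro!: nth_equalityI simp: nth_list_update)
    next
      case False
      then show ?thesis using lxs zi i by simp
    qed
    show "?f z \<in> D - D0"
    proof (cases "i < m")
      case True
      define ys where "ys = xs[i := xs ! Suc i, Suc i := xs ! i]"
      have "mset ys = mset xs"
        using True lxs mset_swap[of i xs "Suc i"] list_update_swap[of "Suc i" i xs "xs ! i" "xs ! Suc i"]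
        by (simp add: ys_def)
      then have "mset (map fst ys) = mset (map fst xs)" "set ys = set xs" "length ys = Suc m"
        using lxs by (simp, metis mset_eq_setD, metis mset_eq_length)
      moreover from this have "distinct (map fst ys)"
        using dist mset_eq_imp_distinct_iff by blast
      ultimately have "ys \<in> Hemi"
        using img mem by (auto simp: Hemi_def maximal_chains_def)
      moreover have "?alt ys i"
        using chain_labels_swap[of i xs ys] True lxs alt by (simp add: ys_def)
      ultimately show ?thesis
        using True i \<open>length ys = Suc m\<close> by (auto simp: zi D_def D0_def ys_def[symmetric])
    next
      case False
      then have im: "i = m" using i by simp
      define ys where "ys = xs[m := flip (xs ! m)]"
      have mf: "map fst ys = map fst xs"
        using lxs by (simp add: ys_def map_update list_update_same_conv)
      obtain j where j: "j < Suc m" "xs ! j = (m, True)"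
        using mem lxs by (metis in_set_conv_nth)
      then have "j \<noteq> m" using nb im by auto
      then have "ys ! j = (m, True)" "length ys = Suc m"
        using j lxs by (simp_all add: ys_def)
      then have memy: "(m, True) \<in> set ys" using j by (metis nth_mem)
      have "fst ` set ys = fst ` set xs"
        using mf by (metis set_map)
      then have "ys \<in> Hemi"
        using dist img memy mf \<open>length ys = Suc m\<close> by (auto simp: Hemi_def maximal_chains_def)
      moreover have "?alt ys m"
        using chain_labels_last[OF lxs ys_def] alt im by simp
      moreover have "ys ! m \<noteq> (m, True)"
      proof
        assume "ys ! m = (m, True)"
        then have "fst (xs ! m) = fst (xs ! j)"
          using j lxs by (auto simp: ys_def flip_def)
        then show False
          using dist lxs j \<open>j \<noteq> m\<close> by (metis distinct_conv_nth length_map lessI nth_map)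
      qed
      ultimately show ?thesis
        using im \<open>length ys = Suc m\<close> by (auto simp: zi D_def D0_def ys_def[symmetric])
    qed
  qed (use finD in auto)
  moreover have "D0 \<subseteq> D" by (auto simp: D0_def)
  moreover from this have "card D = card (D - D0) + card D0"
    using finD by (metis add.commute card_Diff_subset card_mono finite_subset le_add_diff_inverse)
  ultimately have 1: "odd (card D) \<longleftrightarrow> odd (card D0)"
    by simp
  have 2: "card D0 = card (alternating_chains True m)"
  proof (rule bij_betw_same_card[symmetric])
    show "bij_betw (\<lambda>ys. (ys @ [(m, True)], m)) (alternating_chains True m) D0"
    proof (rule bij_betwI[where g = "\<lambda>(xs, i). butlast xs"])
      have lab_app: "mset (?L (ys @ [(m, True)])) - {#?L (ys @ [(m, True)]) ! m#} = mset (?L ys)"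
        if "length ys = m" for ys
      proof -
        have "?L (ys @ [(m, True)]) = ?L ys @ [?L (ys @ [(m, True)]) ! m]"
          using that by (intro nth_equalityI) (auto simp: nth_append less_Suc_eq)
        then have "mset (?L (ys @ [(m, True)])) = add_mset (?L (ys @ [(m, True)]) ! m) (mset (?L ys))"
          by (metis mset.simps(2) mset_append union_mset_add_mset_right mset_zero_iff_right
              add_mset_add_single mset_single_iff_right)
        then show ?thesis by simp
      qed
      show "(\<lambda>ys. (ys @ [(m, True)], m)) \<in> alternating_chains True m \<rightarrow> D0"
      proof
        fix ys assume ys: "ys \<in> alternating_chains True m"
        then have "length ys = m" "distinct (map fst ys)" "fst ` set ys = {..<m}"
          "alternating_mset True (mset (?L ys))"
          by (auto simp: alternating_chains_def maximal_chains_def)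
        moreover from this have "ys @ [(m, True)] \<in> Hemi"
          by (auto simp: Hemi_def maximal_chains_def)
        ultimately show "(ys @ [(m, True)], m) \<in> D0"
          by (auto simp: D0_def D_def lab_app nth_append simp del: nth_chain_labels)
      qed
      have key: "butlast xs \<in> alternating_chains True m \<and> xs = butlast xs @ [(m, True)] \<and> i = m"
        if "(xs, i) \<in> D0" for xs i
      proof -
        have xs: "xs \<in> Hemi" "xs ! m = (m, True)" "?alt xs m" "i = m"
          using that by (auto simp: D0_def D_def)
        note l = len[OF xs(1)]
        have eq: "xs = butlast xs @ [(m, True)]"
          using l xs(2) by (metis append_butlast_last_id diff_Suc_1 last_conv_nth length_0_conv nat.distinct(1))
        then obtain ys where ys: "xs = ys @ [(m, True)]" by blast
        have lys: "length ys = m" using l ys by simp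
        have "distinct (map fst ys)" "m \<notin> fst ` set ys" "insert m (fst ` set ys) = {..<Suc m}"
          using xs(1) by (auto simp: Hemi_def maximal_chains_def ys)
        moreover from this have "fst ` set ys = {..<m}"
          unfolding lessThan_Suc by (metis insert_ident lessThan_iff less_irrefl)
        ultimately have "ys \<in> maximal_chains m"
          using lys by (simp add: maximal_chains_def)
        moreover have "alternating_mset True (mset (?L ys))"
          using xs(3) lab_app[OF lys] ys by simp
        ultimately show ?thesis
          using eq xs(4) by (simp add: alternating_chains_def ys)
      qed
      show "(\<lambda>(xs, i). butlast xs) \<in> D0 \<rightarrow> alternating_chains True m"
        using key by auto
      show "(case (ys @ [(m, True)], m) of (xs, i) \<Rightarrow> butlast xs) = ys" for ys :: "(nat \<times> bool) list"
        by simp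
      show "((case z of (xs, i) \<Rightarrow> butlast xs) @ [(m, True)], m) = z" if "z \<in> D0" for z
      proof (cases z)
        case (Pair xs i)
        then show ?thesis using key[of xs i] that by simp
      qed
    qed
  qed
  \<comment> \<open>The second count, facet by facet: a facet contributes an odd number exactly when
    its own labels alternate with one of the two starting signs.\<close>
  have "card D = (\<Sum>xs\<in>Hemi. card {i. i < length (?L xs) \<and> ?alt xs i})"
    unfolding D_def using finH by (subst card_SigmaI) auto
  then have "odd (card D) \<longleftrightarrow> odd (card {xs \<in> Hemi. odd (card {i. i < length (?L xs) \<and> ?alt xs i})})"
    using finH by (simp add: even_sum_iff)
  also have "{xs \<in> Hemi. odd (card {i. i < length (?L xs) \<and> ?alt xs i})} =
      (Hemi \<inter> alternating_chains True (Suc m)) \<union> (Hemi \<inter> alternating_chains False (Suc m))"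
  proof -
    have "odd (card {i. i < length (?L xs) \<and> ?alt xs i}) \<longleftrightarrow>
        alternating_mset True (mset (?L xs)) \<or> alternating_mset False (mset (?L xs))" if "xs \<in> Hemi" for xs
      using alternating_facet_parity[of "?L xs" True] len[OF that] 
      by (metis length_0_conv length_chain_labels nat.distinct(1))
    then show ?thesis
      unfolding alternating_chains_def Hemi_def by blast
  qed
  also have "card \<dots> = card (Hemi \<inter> alternating_chains True (Suc m)) +
      card (Hemi \<inter> alternating_chains False (Suc m))"
  proof (rule card_Un_disjoint)
    have "\<not> (alternating True l \<and> alternating False l)" if "l \<noteq> []" for l
      using that by (cases l) auto
    then have "\<not> (alternating_mset True (mset (?L xs)) \<and> alternating_mset False (mset (?L xs)))"
      if "xs \<in> Hemi" for xs
      using len[OF that] unfolding alternating_mset_def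
      by (metis length_0_conv length_chain_labels nat.distinct(1) mset_sorted_list_of_multiset mset_zero_iff)
    then show "(Hemi \<inter> alternating_chains True (Suc m)) \<inter> (Hemi \<inter> alternating_chains False (Suc m)) = {}"
      by (auto simp: alternating_chains_def)
  qed (use finH in auto)
  \<comment> \<open>The antipodal map reverses the starting sign and exchanges the
    hemispheres.\<close>
  also have "card (Hemi \<inter> alternating_chains False (Suc m)) = card (alternating_chains True (Suc m) - Hemi)"
  proof (rule bij_betw_same_card)
    have fl: "map flip xs \<in> Hemi \<longleftrightarrow> xs \<notin> Hemi" if "xs \<in> maximal_chains (Suc m)" for xs
    proof -
      have "m \<in> fst ` set xs" "inj_on fst (set xs)"
        using that by (auto simp: maximal_chains_def distinct_map)
      moreover have "map flip xs \<in> maximal_chains (Suc m)"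
        using that by (simp add: maximal_chains_def comp_def image_image)
      ultimately show ?thesis
        using that unfolding Hemi_def
        by (auto simp: flip_def inj_on_def image_iff) (metis (full_types) fst_conv snd_conv)+
    qed
    have mc: "xs \<in> maximal_chains (Suc m)" if "xs \<in> alternating_chains s (Suc m)" for xs s
      using that by (simp add: alternating_chains_def)
    show "bij_betw (map flip) (Hemi \<inter> alternating_chains False (Suc m)) (alternating_chains True (Suc m) - Hemi)"
    proof (rule bij_betwI[where g = "map flip"])
      show "map flip \<in> Hemi \<inter> alternating_chains False (Suc m) \<rightarrow> alternating_chains True (Suc m) - Hemi"
        using alternating_chains_flip[OF assms, of _ False] fl mc by auto
      show "map flip \<in> alternating_chains True (Suc m) - Hemi \<rightarrow> Hemi \<inter> alternating_chains False (Suc m)"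
        using alternating_chains_flip[OF assms, of _ True] fl mc by auto
    qed (auto simp: comp_def)
  qed
  also have "card (Hemi \<inter> alternating_chains True (Suc m)) + \<dots> = card (alternating_chains True (Suc m))"
    using finite_maximal_chains[of "Suc m"]
    by (subst card_Un_disjoint[symmetric]) (auto simp: alternating_chains_def intro!: arg_cong[where f = card])
  finally show ?thesis using 1 2 by simp
qed

lemma odd_card_alternating_chains: "valid m \<Longrightarrow> odd (card (alternating_chains True m))"
proof (induction m)
  case 0
  have "alternating_chains True 0 = {[]}"
    by (auto simp: alternating_chains_def maximal_chains_def alternating_mset_def chain_labels_def)
  then show ?case by simp
next
  case (Suc m)
  then show ?case using alternating_chains_parity_step valid_Suc by blast
qed

end

text \<open>By Fan's lemma a labelling without complementary edge has an alternating chain. Such a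
  chain carries \<open>m\<close> distinct absolute values, but only \<open>m - 1\<close> are
  available.\<close>

theorem octahedral_tucker:
  fixes lab :: "signed_set \<Rightarrow> nat"
  assumes antipodal: "\<And>A. A \<in> signed_vectors m \<Longrightarrow> lab (flip ` A) = opp (lab A)"
    and range: "\<And>A. A \<in> signed_vectors m \<Longrightarrow> 1 \<le> lab A div 2 \<and> lab A div 2 < m"
    and "0 < m"
  obtains A B where "A \<in> signed_vectors m" "B \<in> signed_vectors m" "A \<subseteq> B" "lab B = opp (lab A)"
proof (rule ccontr)
  interpret antipodal_labelling lab .
  assume "\<not> thesis"
  with that have v: "valid m"
    unfolding valid_def using antipodal by blast
  then have "alternating_chains True m \<noteq> {}"
    using odd_card_alternating_chains[OF v] by auto
  then obtain xs where xs: "xs \<in> maximal_chains m" "alternating_mset True (mset (chain_labels lab xs))"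
    by (auto simp: alternating_chains_def)
  let ?l = "sorted_list_of_multiset (mset (chain_labels lab xs))"
  have "sorted_wrt (\<lambda>x y. x div 2 < y div 2) ?l"
    using xs labels_not_opp[OF v xs(1)]
    by (intro alternating_distinct[of _ True]) (auto simp: alternating_mset_def)
  then have "sorted_wrt (<) (map (\<lambda>x. x div 2) ?l)"
    by (simp add: sorted_wrt_map)
  then have "distinct (map (\<lambda>x. x div 2) ?l)"
    using strict_sorted_iff by blast
  then have "card (set (map (\<lambda>x. x div 2) ?l)) = length ?l"
    by (metis distinct_card length_map)
  also have "length ?l = m"
    using xs(1) by (simp add: maximal_chains_def)
  finally have c: "card ((\<lambda>x. x div 2) ` set (chain_labels lab xs)) = m"
    by simp
  have "(\<lambda>x. x div 2) ` set (chain_labels lab xs) \<subseteq> {1..<m}"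
  proof safe
    fix x assume "x \<in> set (chain_labels lab xs)"
    then obtain i where i: "i < length xs" "x = lab (set (take (Suc i) xs))"
      by (metis in_set_conv_nth length_chain_labels nth_chain_labels)
    then show "x div 2 \<in> {1..<m}"
      using range[OF set_take_signed_vectors[OF xs(1)]] xs(1) by (auto simp: maximal_chains_def)
  qed
  then have "card ((\<lambda>x. x div 2) ` set (chain_labels lab xs)) \<le> card {1..<m}"
    by (intro card_mono) auto
  with c \<open>0 < m\<close> show False by simp
qed

section \<open>Approximate halving of a sequence of vectors\<close>

definition sign_changes :: "nat \<Rightarrow> (nat \<Rightarrow> bool) \<Rightarrow> nat" where
  "sign_changes N s = card {j. Suc j < N \<and> s j \<noteq> s (Suc j)}"

definition completes :: "(nat \<Rightarrow> bool) \<Rightarrow> signed_set \<Rightarrow> bool" where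
  "completes s A \<longleftrightarrow> (\<forall>(j, b)\<in>A. s j = b)"

text \<open>The maximum runs over all ways of filling in the zeros. Refinement can only lower it,
  which makes it usable as the absolute value of a Tucker label.\<close>

definition max_sign_changes :: "nat \<Rightarrow> signed_set \<Rightarrow> nat" where
  "max_sign_changes N A = Max (sign_changes N ` {s. completes s A})"

lemma finite_sign_change_set [simp]: "finite {j. Suc j < N \<and> P j}"
  by (rule finite_subset[of _ "{..<N}"]) auto

lemma sign_changes_le: "sign_changes N s \<le> N - 1"
proof -
  have "sign_changes N s \<le> card {..<N - 1}"
    unfolding sign_changes_def by (intro card_mono) auto
  then show ?thesis by simp
qed

lemma finite_sign_changes_image [simp]: "finite (sign_changes N ` S)"
  by (rule finite_subset[of _ "{..N - 1}"]) (use sign_changes_le in blast, simp)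

lemma completes_exists:
  assumes "A \<in> signed_vectors N"
  shows "completes (\<lambda>j. (j, True) \<in> A) A"
proof -
  have "inj_on fst A" using assms by (simp add: signed_vectors_def)
  then have "b = ((j, True) \<in> A)" if "(j, b) \<in> A" for j b
    using that inj_onD[of fst A "(j, True)" "(j, False)"] by (cases b) auto
  then show ?thesis by (auto simp: completes_def)
qed

lemma max_sign_changes_ge: "completes s A \<Longrightarrow> sign_changes N s \<le> max_sign_changes N A"
  unfolding max_sign_changes_def by (rule Max_ge) auto

lemma max_sign_changes_attained:
  assumes "A \<in> signed_vectors N"
  obtains s where "completes s A" "sign_changes N s = max_sign_changes N A"
proof -
  have "max_sign_changes N A \<in> sign_changes N ` {s. completes s A}"
    unfolding max_sign_changes_def using completes_exists[OF assms] by (intro Max_in) auto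
  then show ?thesis using that by force
qed

lemma completes_subset: "completes s B \<Longrightarrow> A \<subseteq> B \<Longrightarrow> completes s A"
  by (auto simp: completes_def)

lemma max_sign_changes_antimono:
  assumes "B \<in> signed_vectors N" "A \<subseteq> B"
  shows "max_sign_changes N B \<le> max_sign_changes N A"
  by (metis assms completes_subset max_sign_changes_attained max_sign_changes_ge)

lemma max_sign_changes_le: "A \<in> signed_vectors N \<Longrightarrow> max_sign_changes N A \<le> N - 1"
  by (metis max_sign_changes_attained sign_changes_le)

lemma flip_signed_vectors: "A \<in> signed_vectors N \<Longrightarrow> flip ` A \<in> signed_vectors N"
  unfolding signed_vectors_def inj_on_def by (auto simp: flip_def)

lemma completes_flip: "completes s A \<Longrightarrow> completes (\<lambda>j. \<not> s j) (flip ` A)"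
  by (auto simp: completes_def flip_def)

lemma sign_changes_not [simp]: "sign_changes N (\<lambda>j. \<not> s j) = sign_changes N s"
  by (simp add: sign_changes_def)

lemma max_sign_changes_flip:
  assumes "A \<in> signed_vectors N"
  shows "max_sign_changes N (flip ` A) = max_sign_changes N A"
proof -
  have "max_sign_changes N B \<le> max_sign_changes N (flip ` B)" if "B \<in> signed_vectors N" for B
    by (metis that completes_flip max_sign_changes_attained max_sign_changes_ge sign_changes_not)
  from this[OF assms] this[OF flip_signed_vectors[OF assms]] show ?thesis by simp
qed

text \<open>Filling each zero, from left to right, with the sign opposite to its predecessor
  produces one change per zero. Position 0 has no predecessor, whence the
  \<open>+ 1\<close>.\<close>

lemma card_zeros_le:
  assumes "A \<in> signed_vectors N"
  shows "card ({..<N} - fst ` A) \<le> max_sign_changes N A + 1"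
proof -
  define g where "g = rec_nat ((0, True) \<in> A)
    (\<lambda>j b. if Suc j \<in> fst ` A then (Suc j, True) \<in> A else \<not> b)"
  have g_simps: "g 0 = ((0, True) \<in> A)"
      "g (Suc j) = (if Suc j \<in> fst ` A then (Suc j, True) \<in> A else \<not> g j)" for j
    by (simp_all add: g_def)
  have gj: "g j = ((j, True) \<in> A)" if "j \<in> fst ` A" for j
    using that g_simps by (cases j) auto
  have "completes g A"
    using completes_exists[OF assms] gj unfolding completes_def by force
  have "Suc ` {j. Suc j < N \<and> g j \<noteq> g (Suc j)} \<supseteq> {..<N} - fst ` A - {0}"
  proof
    fix j assume j: "j \<in> {..<N} - fst ` A - {0}"
    then obtain k where k: "j = Suc k" by (cases j) auto
    with j have "g k \<noteq> g (Suc k)" using g_simps(2)[of k] by auto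
    then show "j \<in> Suc ` {j. Suc j < N \<and> g j \<noteq> g (Suc j)}" using j k by auto
  qed
  then have "card ({..<N} - fst ` A - {0}) \<le> card (Suc ` {j. Suc j < N \<and> g j \<noteq> g (Suc j)})"
    by (intro card_mono) auto
  also have "\<dots> = sign_changes N g"
    by (simp add: sign_changes_def card_image)
  also have "\<dots> \<le> max_sign_changes N A"
    by (rule max_sign_changes_ge) fact
  finally have "card ({..<N} - fst ` A - {0}) \<le> max_sign_changes N A" .
  moreover have "card ({..<N} - fst ` A) \<le> card ({..<N} - fst ` A - {0}) + 1"
    using diff_card_le_card_Diff[of "{0::nat}" "{..<N} - fst ` A"] by simp
  ultimately show ?thesis by linarith
qed

text \<open>Before the first nonzero coordinate a maximal completion has to alternate. Its initial
  sign is therefore determined by that coordinate and the parity of its index.\<close>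

lemma maximal_completion_first:
  assumes "A \<in> signed_vectors N" "completes s A" "sign_changes N s = max_sign_changes N A"
    "completes s' A" "sign_changes N s' = max_sign_changes N A"
  shows "s 0 = s' 0"
proof -
  define j0 where "j0 = Min (fst ` A)"
  have A: "A \<noteq> {}" "A \<subseteq> {..<N} \<times> UNIV"
    using assms(1) by (auto simp: signed_vectors_def)
  then have "fst ` A \<subseteq> {..<N}" by auto
  then have "finite (fst ` A)" by (rule finite_subset) simp
  have j0: "j0 \<in> fst ` A" "\<And>j. j \<in> fst ` A \<Longrightarrow> j0 \<le> j"
    unfolding j0_def using A \<open>finite (fst ` A)\<close> by auto
  then obtain b0 where b0: "(j0, b0) \<in> A" by auto
  have j0N: "j0 < N" using b0 A by auto
  have main: "s 0 = (b0 = even j0)" if s: "completes s A" "sign_changes N s = max_sign_changes N A" for s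
  proof -
    have sj0: "s j0 = b0" using s(1) b0 by (auto simp: completes_def)
    \<comment> \<open>\<open>s'\<close> agrees with \<open>s\<close> from \<open>j0\<close> on and
      alternates before. It has every change that \<open>s\<close> has, so by maximality the two
      sets of changes coincide.\<close>
    define s' where "s' j = (if j < j0 then (b0 = even (j0 - j)) else s j)" for j
    have "completes s' A"
      using s(1) j0(2) unfolding completes_def s'_def by force
    have alt: "s' j \<noteq> s' (Suc j)" if "j < j0" for j
      using that sj0 by (cases "Suc j = j0") (auto simp: s'_def Suc_diff_Suc[symmetric])
    have sub: "{j. Suc j < N \<and> s j \<noteq> s (Suc j)} \<subseteq> {j. Suc j < N \<and> s' j \<noteq> s' (Suc j)}"
    proof
      fix j assume "j \<in> {j. Suc j < N \<and> s j \<noteq> s (Suc j)}"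
      then show "j \<in> {j. Suc j < N \<and> s' j \<noteq> s' (Suc j)}"
        using alt[of j] by (cases "j < j0") (auto simp: s'_def)
    qed
    have "card {j. Suc j < N \<and> s' j \<noteq> s' (Suc j)} \<le> card {j. Suc j < N \<and> s j \<noteq> s (Suc j)}"
      using max_sign_changes_ge[OF \<open>completes s' A\<close>, of N] s(2) by (simp add: sign_changes_def)
    then have eq: "{j. Suc j < N \<and> s j \<noteq> s (Suc j)} = {j. Suc j < N \<and> s' j \<noteq> s' (Suc j)}"
      using sub by (intro card_seteq) auto
    have chg: "s j \<noteq> s (Suc j)" if "j < j0" for j
    proof -
      have "j \<in> {j. Suc j < N \<and> s' j \<noteq> s' (Suc j)}" using alt[OF that] that j0N by auto
      then show ?thesis unfolding eq[symmetric] by simp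
    qed
    have "s (j0 - k) = (b0 = even k)" if "k \<le> j0" for k
      using that
    proof (induction k)
      case (Suc k)
      have "s (j0 - Suc k) \<noteq> s (Suc (j0 - Suc k))"
        using Suc.prems by (intro chg) simp
      moreover have "Suc (j0 - Suc k) = j0 - k" using Suc.prems by simp
      ultimately show ?case using Suc by auto
    qed (simp add: sj0)
    from this[of j0] show ?thesis by simp
  qed
  show ?thesis using main assms by blast
qed

text \<open>Suppose every pattern with at most \<open>t\<close> changes is badly unbalanced in some
  colour. A signed vector with \<open>max_sign_changes\<close> at most \<open>t\<close> is labelled
  by a colour and the sign that holds its majority, any other one by \<open>max_sign_changes\<close>
  and the initial sign of a maximal completion. In both cases the sign cannot turn under a
  refinement that keeps the absolute value, which contradicts Tucker's lemma.\<close>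

theorem approximate_necklace_halving:
  fixes W :: "nat \<Rightarrow> nat \<Rightarrow> real" and N t :: nat
  assumes W: "\<And>j i. j < N \<Longrightarrow> i < t \<Longrightarrow> 0 \<le> W j i \<and> W j i \<le> B" and "0 \<le> B"
  obtains s where "sign_changes N s \<le> t"
    "\<And>i. i < t \<Longrightarrow> \<bar>\<Sum>j<N. if s j then W j i else - W j i\<bar> \<le> 2 * (real t + 1) * B"
proof (cases "N \<le> t + 1")
  \<comment> \<open>With so few terms the constant sign is balanced enough, since the whole sum is
    at most \<open>(t + 1) * B\<close>.\<close>
  case True
  show ?thesis
  proof (rule that[of "\<lambda>_. True"])
    show "sign_changes N (\<lambda>_. True) \<le> t" by (simp add: sign_changes_def)
    fix i assume i: "i < t"
    have "(\<Sum>j<N. W j i) \<le> of_nat (card {..<N}) * B"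
      using W i by (intro sum_bounded_above) auto
    also have "\<dots> \<le> (real t + 1) * B" using True \<open>0 \<le> B\<close> by (intro mult_right_mono) auto
    also have "\<dots> \<le> 2 * (real t + 1) * B" using \<open>0 \<le> B\<close> by (intro mult_right_mono) auto
    moreover have "0 \<le> (\<Sum>j<N. W j i)" using W i by (intro sum_nonneg) auto
    ultimately show "\<bar>\<Sum>j<N. if True then W j i else - W j i\<bar> \<le> 2 * (real t + 1) * B" by simp
  qed
next
  case big: False
  show ?thesis
  proof (rule ccontr)
    note halving = that
    assume "\<not> thesis"
    then have contra: "\<exists>i<t. \<bar>\<Sum>j<N. if s j then W j i else - W j i\<bar> > 2 * (real t + 1) * B"
      if "sign_changes N s \<le> t" for s
      using halving[OF that] by (meson not_le)
    define tot where "tot i = (\<Sum>j<N. W j i)" for i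
    define part where "part A b i = (\<Sum>j | j < N \<and> (j, b) \<in> A. W j i)" for A :: signed_set and b i
    define maj where "maj i A b \<longleftrightarrow> tot i / 2 < part A b i" for i and A :: signed_set and b
    define col where "col A = (LEAST i. i < t \<and> (maj i A True \<or> maj i A False))" for A
    define first where "first A \<longleftrightarrow> (\<exists>s. completes s A \<and> sign_changes N s = max_sign_changes N A \<and> s 0)" for A
    \<comment> \<open>Colours take the absolute values from \<open>1\<close> to \<open>t\<close>,
      numbers of changes those from \<open>t + 1\<close> to \<open>N - 1\<close>, so the two kinds
      of labels never meet.\<close>
    define lab where "lab A = (if max_sign_changes N A \<le> t
      then 2 * Suc (col A) + (if maj (col A) A True then 0 else 1)
      else 2 * max_sign_changes N A + (if first A then 0 else 1))" for A
    have col: "col A < t \<and> (maj (col A) A True \<or> maj (col A) A False)"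
      if A: "A \<in> signed_vectors N" "max_sign_changes N A \<le> t" for A
    proof -
      obtain s where s: "completes s A" "sign_changes N s \<le> t"
        using A by (metis max_sign_changes_attained)
      obtain i where i: "i < t" "\<bar>\<Sum>j<N. if s j then W j i else - W j i\<bar> > 2 * (real t + 1) * B"
        using contra[OF s(2)] by auto
      define P where "P b = (\<Sum>j | j < N \<and> s j = b. W j i)" for b
      have PP: "P True + P False = tot i" 
        unfolding P_def tot_def by (subst sum.union_disjoint[symmetric]) (auto intro!: sum.cong)
      have PD: "(\<Sum>j<N. if s j then W j i else - W j i) = P True - P False"
        unfolding P_def by (subst sum.If_cases) (auto simp: sum_negf intro!: arg_cong2[where f = minus] sum.cong)
      \<comment> \<open>At most \<open>t + 1\<close> zeros carry weight at most
        \<open>(t + 1) * B\<close>. If both signs held at most half of the total on the support of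
        \<open>A\<close>, no completion could be unbalanced by more than
        \<open>2 * (t + 1) * B\<close>.\<close>
      have Pb: "P b \<le> part A b i + (real t + 2) * B - B" for b
      proof -
        have "P b \<le> sum (\<lambda>j. W j i) ({j. j < N \<and> (j, b) \<in> A} \<union> ({..<N} - fst ` A))"
          unfolding P_def
        proof (rule sum_mono2)
          show "{j. j < N \<and> s j = b} \<subseteq> {j. j < N \<and> (j, b) \<in> A} \<union> ({..<N} - fst ` A)"
            using s(1) by (auto simp: completes_def)
        qed (use W i in auto)
        also have "\<dots> \<le> part A b i + sum (\<lambda>j. W j i) ({..<N} - fst ` A)"
        proof -
          have "0 \<le> sum (\<lambda>j. W j i) ({j. j < N \<and> (j, b) \<in> A} \<inter> ({..<N} - fst ` A))"
            using W i by (intro sum_nonneg) auto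
          then show ?thesis
            unfolding part_def
            using sum.union_inter[of "{j. j < N \<and> (j, b) \<in> A}" "{..<N} - fst ` A" "\<lambda>j. W j i"] by simp
        qed
        also have "sum (\<lambda>j. W j i) ({..<N} - fst ` A) \<le> of_nat (card ({..<N} - fst ` A)) * B"
          using W i by (intro sum_bounded_above) auto
        also have "\<dots> \<le> (real t + 1) * B"
          using card_zeros_le[OF A(1)] A(2) \<open>0 \<le> B\<close> by (intro mult_right_mono) auto
        finally show ?thesis by (simp add: algebra_simps)
      qed
      have "maj i A True \<or> maj i A False"
      proof (rule ccontr)
        assume "\<not> ?thesis"
        then have "part A True i \<le> tot i / 2" "part A False i \<le> tot i / 2"
          by (auto simp: maj_def)
        with Pb[of True] Pb[of False] i(2) PP PD show False
          by (simp add: algebra_simps abs_if split: if_splits)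
      qed
      then show ?thesis
        unfolding col_def using i(1) LeastI[of "\<lambda>i. i < t \<and> (maj i A True \<or> maj i A False)" i] by blast
    qed
    have maj_excl: "\<not> (maj i A True \<and> maj i A False)" if A: "A \<in> signed_vectors N" and "i < t" for A i
    proof -
      have "part A True i + part A False i \<le> tot i"
      proof -
        have "part A True i + part A False i =
            sum (\<lambda>j. W j i) ({j. j < N \<and> (j, True) \<in> A} \<union> {j. j < N \<and> (j, False) \<in> A})"
          unfolding part_def using A
          by (intro sum.union_disjoint[symmetric]) (auto simp: signed_vectors_def dest: inj_onD[of fst A "(_, True)" "(_, False)"])
        also have "\<dots> \<le> tot i"
          unfolding tot_def using W \<open>i < t\<close> by (intro sum_mono2) auto
        finally show ?thesis .
      qed
      then show ?thesis by (auto simp: maj_def)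
    qed
    have maj_mono: "maj i B b" if "maj i A b" "A \<subseteq> B" "i < t" for A B i b
    proof -
      have "part A b i \<le> part B b i"
        unfolding part_def using W that by (intro sum_mono2) auto
      then show ?thesis using that(1) by (simp add: maj_def)
    qed
    have maj_flip: "maj i (flip ` A) b = maj i A (\<not> b)" for i A b
    proof -
      have "(j, b) \<in> flip ` A \<longleftrightarrow> (j, \<not> b) \<in> A" for j
        by (force simp: flip_def image_iff)
      then show ?thesis by (simp add: maj_def part_def)
    qed
    have first_iff: "first A = s 0"
      if "A \<in> signed_vectors N" "completes s A" "sign_changes N s = max_sign_changes N A" for A s
      using maximal_completion_first[OF that(1)] that unfolding first_def by blast
    have first_flip: "first (flip ` A) = (\<not> first A)" if A: "A \<in> signed_vectors N" for A
    proof -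
      obtain s where s: "completes s A" "sign_changes N s = max_sign_changes N A"
        using max_sign_changes_attained[OF A] .
      then show ?thesis
        using first_iff[OF A s] first_iff[OF flip_signed_vectors[OF A] completes_flip[OF s(1)]]
        by (simp add: max_sign_changes_flip[OF A])
    qed
    obtain A B where AB: "A \<in> signed_vectors N" "B \<in> signed_vectors N" "A \<subseteq> B" "lab B = opp (lab A)"
    proof (rule octahedral_tucker[of N lab])
      fix A assume A: "A \<in> signed_vectors N"
      show "lab (flip ` A) = opp (lab A)"
      proof (cases "max_sign_changes N A \<le> t")
        case True
        have "col (flip ` A) = col A"
          unfolding col_def maj_flip by (simp add: disj_commute)
        then show ?thesis
          using col[OF A True] maj_excl[OF A] True max_sign_changes_flip[OF A]
          by (auto simp: lab_def maj_flip opp_def)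
      next
        case False
        then show ?thesis
          using max_sign_changes_flip[OF A] first_flip[OF A] by (simp add: lab_def opp_def)
      qed
      show "1 \<le> lab A div 2 \<and> lab A div 2 < N"
        using col[OF A] max_sign_changes_le[OF A] big by (auto simp: lab_def)
    next
      show "0 < N" using big by simp
    qed
    have d: "lab B div 2 = lab A div 2" and e: "even (lab B) \<noteq> even (lab A)"
      using AB(4) by auto
    have divs: "lab A div 2 = (if max_sign_changes N A \<le> t then Suc (col A) else max_sign_changes N A)" for A
      by (simp add: lab_def)
    have evens: "even (lab A) = (if max_sign_changes N A \<le> t then maj (col A) A True else first A)" for A
      by (simp add: lab_def)
    show False
    proof (cases "max_sign_changes N A \<le> t")
      \<comment> \<open>Refinement lowers \<open>max_sign_changes\<close>, so \<open>B\<close>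
        carries a colour as well, and it is the same colour. A majority held in \<open>A\<close>
        persists in \<open>B\<close> because the weights are nonnegative, and both signs cannot have
        it.\<close>
      case True
      then have B: "max_sign_changes N B \<le> t"
        using max_sign_changes_antimono[OF AB(2,3)] by simp
      then have "col A = col B" using d True by (simp add: divs)
      then show False
        using col[OF AB(1) True] col[OF AB(2) B] maj_excl[OF AB(1)] maj_excl[OF AB(2)]
          maj_mono[of "col A" A _ B] AB(3) e True B unfolding evens by metis
    next
      case False
      have B: "\<not> max_sign_changes N B \<le> t"
      proof
        assume "max_sign_changes N B \<le> t"
        then show False using d False col[OF AB(2)] by (auto simp: divs)
      qed
      then have eq: "max_sign_changes N B = max_sign_changes N A"
        using d False by (simp add: divs)
      \<comment> \<open>As the two maxima agree, a maximal completion of \<open>B\<close> is one of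
        \<open>A\<close> too, and the initial signs coincide.\<close>
      obtain s where s: "completes s B" "sign_changes N s = max_sign_changes N B"
        using max_sign_changes_attained[OF AB(2)] .
      have "first B = s 0" "first A = s 0"
        using first_iff[OF AB(2) s] first_iff[OF AB(1) completes_subset[OF s(1) AB(3)]] s(2) eq by auto
      then show False using e False B by (simp add: evens)
    qed
  qed
qed

text \<open>Weights have to be nonnegative, so every coordinate is shifted by one. An additional
  constant colour balances the number of signs and thereby removes the shift. With
  \<open>t = DIM('e) + 1\<close> and \<open>B = 2\<close> each of the two balances errs by
  \<open>4 * (DIM('e) + 2)\<close>, and the coordinates are then summed.\<close>

corollary approximate_vector_halving:
  fixes w :: "nat \<Rightarrow> 'e::euclidean_space"
  assumes "\<And>j. j < N \<Longrightarrow> norm (w j) \<le> 1"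
  obtains s where "sign_changes N s \<le> DIM('e) + 1"
    "norm (\<Sum>j<N. if s j then w j else - w j) \<le> 8 * real DIM('e) * (real DIM('e) + 2)"
proof -
  let ?d = "DIM('e)"
  obtain f where f: "bij_betw f {..<?d} (Basis :: 'e set)"
    using ex_bij_betw_nat_finite[OF finite_Basis] by (metis atLeast0LessThan)
  define W where "W j i = (if i < ?d then w j \<bullet> f i + 1 else 1)" for j i
  have fB: "f i \<in> Basis" if "i < ?d" for i
    using f that by (auto simp: bij_betw_def)
  have W: "0 \<le> W j i \<and> W j i \<le> 2" if "j < N" "i < ?d + 1" for j i
  proof (cases "i < ?d")
    case True
    then have "\<bar>w j \<bullet> f i\<bar> \<le> 1"
      using Basis_le_norm[OF fB[OF True], of "w j"] assms[OF that(1)] by simp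
    then show ?thesis by (auto simp: W_def)
  qed (simp add: W_def)
  obtain s where s: "sign_changes N s \<le> ?d + 1"
    "\<And>i. i < ?d + 1 \<Longrightarrow> \<bar>\<Sum>j<N. if s j then W j i else - W j i\<bar> \<le> 2 * (real (?d + 1) + 1) * 2"
  proof (rule approximate_necklace_halving[of N "?d + 1" W 2])
    show "0 \<le> W j i \<and> W j i \<le> 2" if "j < N" "i < ?d + 1" for j i
      using W that by blast
  qed (use that in auto)
  let ?S = "\<Sum>j<N. if s j then w j else - w j"
  have "\<bar>?S \<bullet> b\<bar> \<le> 8 * (real ?d + 2)" if "b \<in> Basis" for b
  proof -
    have "b \<in> f ` {..<?d}"
      using f that by (simp add: bij_betw_def)
    then obtain i where i: "i < ?d" "b = f i"
      by blast
    have "(\<Sum>j<N. if s j then W j i else - W j i) = (\<Sum>j<N. (if s j then w j else - w j) \<bullet> b) +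
        (\<Sum>j<N. if s j then W j ?d else - W j ?d)"
      unfolding sum.distrib[symmetric] by (rule sum.cong) (auto simp: W_def i)
    then have "?S \<bullet> b = (\<Sum>j<N. if s j then W j i else - W j i) - (\<Sum>j<N. if s j then W j ?d else - W j ?d)"
      by (simp add: inner_sum_left)
    then show ?thesis using s(2)[of i] s(2)[of ?d] i by simp
  qed
  then have "norm ?S \<le> (\<Sum>b\<in>(Basis :: 'e set). 8 * (real ?d + 2))"
    by (intro order_trans[OF norm_le_l1] sum_mono) auto
  then show ?thesis using that[OF s(1)] by (simp add: algebra_simps)
qed

section \<open>The comparison principle\<close>

lemma C1_add:
  assumes "C1_with_gradient U f Df" "C1_with_gradient U g Dg"
  shows "C1_with_gradient U (\<lambda>x. f x + g x) (\<lambda>x. Df x + Dg x)"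
  using assms unfolding C1_with_gradient_def
  by (auto intro!: continuous_intros GDERIV_add)

lemma C1_cmult:
  assumes "C1_with_gradient U f Df"
  shows "C1_with_gradient U (\<lambda>x. A * f x) (\<lambda>x. A *\<^sub>R Df x)"
  using assms unfolding C1_with_gradient_def gderiv_def
  by (auto intro!: continuous_intros derivative_eq_intros)

lemma C1_subset:
  assumes "C1_with_gradient U f Df" "V \<subseteq> U" "open V"
  shows "C1_with_gradient V f Df"
  using assms unfolding C1_with_gradient_def by (auto intro: continuous_on_subset)

lemma C1_const: "open U \<Longrightarrow> C1_with_gradient U (\<lambda>x. c) (\<lambda>x. 0)"
  by (simp add: C1_with_gradient_def gderiv_def)

lemma C1_norm_square: "open U \<Longrightarrow> C1_with_gradient U (\<lambda>x. (norm (x - c))\<^sup>2) (\<lambda>x. 2 *\<^sub>R (x - c))"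
  unfolding C1_with_gradient_def gderiv_def power2_norm_eq_inner
  by (auto intro!: continuous_intros derivative_eq_intros simp: inner_commute algebra_simps)

lemma C1_fst:
  fixes f :: "'a::real_inner \<Rightarrow> real"
  assumes "C1_with_gradient U f Df"
  shows "C1_with_gradient (U \<times> (UNIV :: real set)) (\<lambda>z. f (fst z)) (\<lambda>z. (Df (fst z), 0))"
  unfolding C1_with_gradient_def
proof (intro conjI ballI)
  show "open (U \<times> (UNIV :: real set))"
    using assms by (auto simp: C1_with_gradient_def intro: open_Times)
  show "continuous_on (U \<times> UNIV) (\<lambda>z. (Df (fst z), 0 :: real))"
    using assms unfolding C1_with_gradient_def
    by (intro continuous_intros continuous_on_compose2[of U Df _ fst]) auto
  fix z :: "'a \<times> real" assume "z \<in> U \<times> UNIV"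
  then have "(f has_derivative (\<lambda>h. h \<bullet> Df (fst z))) (at (fst z))"
    using assms by (auto simp: C1_with_gradient_def gderiv_def)
  then have "((\<lambda>z. f (fst z)) has_derivative (\<lambda>h. fst h \<bullet> Df (fst z))) (at z)"
    by (rule has_derivative_compose[OF has_derivative_fst[OF has_derivative_ident], rotated])
  then show "GDERIV (\<lambda>z. f (fst z)) z :> (Df (fst z), 0)"
    by (simp add: gderiv_def inner_Pair_0 inner_prod_def)
qed

lemma C1_snd:
  fixes f f' :: "real \<Rightarrow> real"
  assumes "\<And>t. (f has_real_derivative f' t) (at t)" "continuous_on UNIV f'"
  shows "C1_with_gradient UNIV (\<lambda>z :: 'a::real_inner \<times> real. f (snd z)) (\<lambda>z. (0, f' (snd z)))"
  unfolding C1_with_gradient_def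
proof (intro conjI ballI)
  show "continuous_on UNIV (\<lambda>z :: 'a \<times> real. (0 :: 'a, f' (snd z)))"
    by (intro continuous_intros continuous_on_compose2[OF assms(2)]) auto
  fix z :: "'a \<times> real"
  have "((\<lambda>z. f (snd z)) has_derivative (\<lambda>h. snd h * f' (snd z))) (at z)"
    by (rule has_derivative_compose[OF has_derivative_snd[OF has_derivative_ident], of f])
       (use assms(1)[of "snd z"] in \<open>simp add: has_field_derivative_def mult_commute_abs\<close>)
  then show "GDERIV (\<lambda>z. f (snd z)) z :> (0, f' (snd z))"
    by (simp add: gderiv_def inner_prod_def)
qed simp

lemma norm_le_if_inner_le:
  fixes p :: "'a::real_inner"
  assumes "\<And>v. p \<bullet> v \<le> B * norm v" "0 \<le> B"
  shows "norm p \<le> B"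
proof (cases "p = 0")
  case True
  then show ?thesis using assms(2) by simp
next
  case False
  have "norm p * norm p \<le> B * norm p"
    using assms(1)[of p] by (simp add: power2_norm_eq_inner[symmetric] power2_eq_square)
  then show ?thesis using False by simp
qed

text \<open>At a maximum of \<open>w - \<phi>\<close> the test function falls no faster than
  \<open>w\<close>. Only forward motion along \<open>v\<close> is used, so the direction merely has
  to stay in \<open>S\<close> on one side.\<close>

lemma touching_directional:
  assumes "C1_with_gradient U \<phi> D\<phi>" "z0 \<in> U"
    and max: "\<forall>\<^sub>F z in at z0 within S. w z - \<phi> z \<le> w z0 - \<phi> z0"
    and S: "\<forall>\<^sub>F h in at_right 0. z0 + h *\<^sub>R v \<in> S"
    and le: "\<forall>\<^sub>F h in at_right 0. w z0 - B * h \<le> w (z0 + h *\<^sub>R v)"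
  shows "- B \<le> v \<bullet> D\<phi> z0"
proof (cases "v = 0")
  case True
  from le have "\<forall>\<^sub>F h in at_right 0. - B * h \<le> 0" by (simp add: True)
  then obtain h :: real where "h > 0" "- B * h \<le> 0"
    by (metis (mono_tags, lifting) eventually_at_right_field eventually_at_right_less eventually_conj
        eventually_happens trivial_limit_at_right_real)
  then show ?thesis using True by (simp add: zero_le_mult_iff)
next
  case False
  have "(\<phi> has_derivative (\<lambda>h. h \<bullet> D\<phi> z0)) (at z0)"
    using assms(1,2) by (auto simp: C1_with_gradient_def gderiv_def)
  then have "((\<lambda>h. \<phi> (z0 + h *\<^sub>R v)) has_derivative (\<lambda>h. (h *\<^sub>R v) \<bullet> D\<phi> z0)) (at 0)"
    by (intro has_derivative_compose[where g = \<phi> and f = "\<lambda>h. z0 + h *\<^sub>R v"])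
       (auto intro!: derivative_eq_intros)
  then have "((\<lambda>h. \<phi> (z0 + h *\<^sub>R v)) has_real_derivative (v \<bullet> D\<phi> z0)) (at 0)"
    by (simp add: has_field_derivative_def mult_commute_abs)
  then have "((\<lambda>h. (\<phi> (z0 + h *\<^sub>R v) - \<phi> z0) / h) \<longlongrightarrow> v \<bullet> D\<phi> z0) (at_right 0)"
    by (auto simp: has_field_derivative_iff intro: tendsto_mono[OF at_le])
  moreover have "\<forall>\<^sub>F h in at_right 0. - B \<le> (\<phi> (z0 + h *\<^sub>R v) - \<phi> z0) / h"
  proof -
    have "filterlim (\<lambda>h. z0 + h *\<^sub>R v) (at z0 within S) (at_right 0)"
      unfolding filterlim_at
    proof
      show "((\<lambda>h. z0 + h *\<^sub>R v) \<longlongrightarrow> z0) (at_right 0)"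
        by (auto intro!: tendsto_eq_intros)
      show "\<forall>\<^sub>F h in at_right 0. z0 + h *\<^sub>R v \<in> S \<and> z0 + h *\<^sub>R v \<noteq> z0"
        using S eventually_at_right_less[of 0] by eventually_elim (use False in auto)
    qed
    from eventually_compose_filterlim[OF max this] le eventually_at_right_less[of 0]
    show ?thesis
      by eventually_elim (auto simp: field_simps)
  qed
  ultimately show ?thesis
    by (rule tendsto_lowerbound) simp
qed

lemma touching_gradient_bound:
  fixes w :: "'a::euclidean_space \<times> real \<Rightarrow> real"
  assumes "C1_with_gradient U \<phi> D\<phi>" "z0 \<in> U" "open S" "z0 \<in> S"
    and max: "\<forall>\<^sub>F z in at z0 within S. w z - \<phi> z \<le> w z0 - \<phi> z0"
    and lip: "\<And>x y t. (x, t) \<in> S \<Longrightarrow> (y, t) \<in> S \<Longrightarrow> \<bar>w (x, t) - w (y, t)\<bar> \<le> B * norm (x - y)"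
    and "0 \<le> B"
  shows "norm (fst (D\<phi> z0)) \<le> B"
proof (rule norm_le_if_inner_le[OF _ \<open>0 \<le> B\<close>])
  fix v
  have ev: "\<forall>\<^sub>F h in at_right 0. z0 + h *\<^sub>R (- v, 0) \<in> S"
  proof -
    have "((\<lambda>h. z0 + h *\<^sub>R (- v, 0)) \<longlongrightarrow> z0) (at_right 0)"
      by (auto intro!: tendsto_eq_intros simp: zero_prod_def[symmetric])
    then show ?thesis using assms(3,4) by (rule topological_tendstoD)
  qed
  have "- (B * norm v) \<le> (- v, 0) \<bullet> D\<phi> z0"
  proof (rule touching_directional[OF assms(1,2) max ev])
    show "\<forall>\<^sub>F h in at_right 0. w z0 - B * norm v * h \<le> w (z0 + h *\<^sub>R (- v, 0))"
      using ev eventually_at_right_less[of 0]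
    proof eventually_elim
      case (elim h)
      have "\<bar>w (fst z0, snd z0) - w (fst z0 - h *\<^sub>R v, snd z0)\<bar> \<le> B * norm (fst z0 - (fst z0 - h *\<^sub>R v))"
        using elim assms(4) by (intro lip) (simp_all add: prod_eq_iff plus_prod_def)
      moreover have "z0 + h *\<^sub>R (- v, 0) = (fst z0 - h *\<^sub>R v, snd z0)"
        by (simp add: prod_eq_iff)
      ultimately show ?case using elim by (simp add: abs_le_iff algebra_simps)
    qed
  qed
  then show "fst (D\<phi> z0) \<bullet> v \<le> B * norm v"
    by (simp add: inner_prod_def inner_commute)
qed

lemma C1_continuous_on:
  assumes "C1_with_gradient U f Df"
  shows "continuous_on U f"
proof (rule continuous_at_imp_continuous_on, rule ballI)
  fix x assume "x \<in> U"
  then show "isCont f x"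
    using assms has_derivative_continuous unfolding C1_with_gradient_def gderiv_def by blast
qed

text \<open>An interior cone with axis \<open>e\<close> and opening \<open>c\<close>, uniform for
  base points near \<open>x\<close>. The axis is not normalised, so an interior point can take
  \<open>e = 0\<close>.\<close>

definition cone_condition :: "'a::euclidean_space set \<Rightarrow> bool" where
  "cone_condition \<Omega> \<longleftrightarrow> (\<forall>x\<in>closure \<Omega>. \<exists>e r c. 0 < r \<and> 0 < c \<and>
     (\<forall>y\<in>closure \<Omega> \<inter> ball x r. \<forall>k w. 0 < k \<and> k < r \<and> norm w \<le> c \<longrightarrow> y + k *\<^sub>R (e + w) \<in> \<Omega>))"

text \<open>A move by \<open>k *\<^sub>R (e + w)\<close> gains height at least
  \<open>k * (1 - c)\<close>, while the graph below rises by at most \<open>k * (2 * G * c)\<close>;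
  the factor 2 comes from the projection \<open>\<pi>\<close>. Hence any \<open>c\<close> with
  \<open>c + 2 * G * c < 1\<close> serves as opening.\<close>

lemma C1_boundary_cone_condition:
  fixes \<Omega> :: "'a::euclidean_space set"
  assumes "open \<Omega>" "C1_boundary \<Omega>"
  shows "cone_condition \<Omega>"
  unfolding cone_condition_def
proof
  fix x assume x: "x \<in> closure \<Omega>"
  show "\<exists>e r c. 0 < r \<and> 0 < c \<and>
     (\<forall>y\<in>closure \<Omega> \<inter> ball x r. \<forall>k w. 0 < k \<and> k < r \<and> norm w \<le> c \<longrightarrow> y + k *\<^sub>R (e + w) \<in> \<Omega>)"
  proof (cases "x \<in> \<Omega>")
    case True
    then obtain d where d: "d > 0" "ball x d \<subseteq> \<Omega>"
      using assms(1) open_contains_ball by blast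
    have "y + k *\<^sub>R (0 + w) \<in> \<Omega>"
      if "y \<in> ball x (d / 2)" "0 < k" "k < d / 2" "norm w \<le> 1" for y w :: 'a and k :: real
    proof -
      have "norm (k *\<^sub>R w) \<le> k * 1" using that by (auto intro!: mult_left_mono)
      moreover have "dist x (y + k *\<^sub>R w) \<le> dist x y + norm (k *\<^sub>R w)"
        using norm_triangle_ineq4[of "x - y" "k *\<^sub>R w"] by (simp add: dist_norm algebra_simps)
      ultimately have "y + k *\<^sub>R w \<in> ball x d"
        using that(1,3) unfolding mem_ball by linarith
      then show ?thesis using d by auto
    qed
    then show ?thesis using d by (intro exI[of _ 0] exI[of _ "d / 2"] exI[of _ 1]) auto
  next
    case False
    then have "x \<in> frontier \<Omega>"
      using x assms(1) by (simp add: frontier_def interior_open)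
    then obtain r e \<gamma> D\<gamma> where r: "r > 0" "norm e = 1" "C1_with_gradient UNIV \<gamma> D\<gamma>"
      "\<Omega> \<inter> ball x r = {y \<in> ball x r. \<gamma> (y - (y \<bullet> e) *\<^sub>R e) < y \<bullet> e}"
      using assms(2)[unfolded C1_boundary_def, rule_format, OF \<open>x \<in> frontier \<Omega>\<close>]
      by (elim exE conjE) (rule that, assumption+)
    define \<pi> where "\<pi> y = y - (y \<bullet> e) *\<^sub>R e" for y
    have ee: "e \<bullet> e = 1" using r(2) by (simp add: norm_eq_1)
    have ip: "\<bar>w \<bullet> e\<bar> \<le> norm w" for w
      using Cauchy_Schwarz_ineq2[of w e] r(2) by simp
    have \<pi>_norm: "norm (\<pi> w) \<le> 2 * norm w" for w
      using norm_triangle_ineq4[of w "(w \<bullet> e) *\<^sub>R e"] ip[of w] r(2) by (simp add: \<pi>_def)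
    have \<pi>_lin: "\<pi> (y + k *\<^sub>R w) = \<pi> y + k *\<^sub>R \<pi> w" for y w k
      by (simp add: \<pi>_def algebra_simps inner_add_left)
    have \<pi>_e: "\<pi> (e + w) = \<pi> w" for w
      by (simp add: \<pi>_def algebra_simps inner_add_left ee)
    let ?B = "cball (\<pi> x) (2 * r)"
    have "compact ((\<lambda>y. norm (D\<gamma> y)) ` ?B)"
      using r(3) by (intro compact_continuous_image continuous_intros)
        (auto simp: C1_with_gradient_def intro: continuous_on_subset)
    from compact_imp_bounded[OF this]
    obtain G0 where G0: "\<And>y. y \<in> ?B \<Longrightarrow> norm (D\<gamma> y) \<le> G0"
      by (auto simp: bounded_iff simp del: mem_cball)
    define G where "G = max G0 0"
    have G: "\<And>y. y \<in> ?B \<Longrightarrow> norm (D\<gamma> y) \<le> G" "G \<ge> 0"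
      using G0 by (auto simp: G_def le_max_iff_disj simp del: mem_cball)
    have lip: "norm (\<gamma> a - \<gamma> b) \<le> G * norm (a - b)" if "a \<in> ?B" "b \<in> ?B" for a b
    proof (rule differentiable_bound[OF convex_cball _ _ that])
      fix y assume "y \<in> ?B"
      show "(\<gamma> has_derivative (\<lambda>h. h \<bullet> D\<gamma> y)) (at y within ?B)"
        using r(3) by (auto simp: C1_with_gradient_def gderiv_def intro: has_derivative_at_withinI)
      show "onorm (\<lambda>h. h \<bullet> D\<gamma> y) \<le> G"
        using G(1)[OF \<open>y \<in> ?B\<close>]
        by (intro onorm_le) (metis Cauchy_Schwarz_ineq2 mult.commute mult_left_mono norm_ge_zero
            order.trans real_norm_def)
    qed
    have "continuous_on UNIV \<gamma>"
      using r(3) by (rule C1_continuous_on)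
    moreover have "continuous_on UNIV \<pi>"
      unfolding \<pi>_def by (intro continuous_intros)
    ultimately have "continuous_on UNIV (\<lambda>y. \<gamma> (\<pi> y))"
      by (rule continuous_on_compose2) simp
    then have clo: "closed {y. \<gamma> (\<pi> y) \<le> y \<bullet> e}"
      by (intro closed_Collect_le continuous_intros)
    have le: "\<gamma> (\<pi> y) \<le> y \<bullet> e" if "y \<in> closure \<Omega> \<inter> ball x r" for y
    proof -
      have "y \<in> closure (\<Omega> \<inter> ball x r)"
        using that open_Int_closure_subset[of "ball x r" \<Omega>] by (auto simp: Int_commute)
      also have "\<Omega> \<inter> ball x r \<subseteq> {y. \<gamma> (\<pi> y) \<le> y \<bullet> e}"
        unfolding r(4) \<pi>_def by auto
      then have "closure (\<Omega> \<inter> ball x r) \<subseteq> {y. \<gamma> (\<pi> y) \<le> y \<bullet> e}"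
        using clo closure_minimal by blast
      finally show ?thesis by simp
    qed
    define c where "c = 1 / (2 + 2 * G)"
    have c: "0 < c" "c \<le> 1" "c + 2 * G * c < 1"
      using G(2) by (auto simp: c_def field_simps)
    \<comment> \<open>The radius is \<open>r / 3\<close> because the displacement has norm at most
      \<open>2 * k\<close>, so the whole motion stays in \<open>ball x r\<close>.\<close>
    have "y + k *\<^sub>R (e + w) \<in> \<Omega>"
      if y: "y \<in> closure \<Omega> \<inter> ball x (r / 3)" and k: "0 < k" "k < r / 3" and w: "norm w \<le> c" for y w k
    proof -
      let ?z = "y + k *\<^sub>R (e + w)"
      have "norm (e + w) \<le> 2" using norm_triangle_ineq[of e w] r(2) c w by linarith
      then have "norm (k *\<^sub>R (e + w)) \<le> k * 2" using k by (auto intro!: mult_left_mono)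
      moreover have "dist x ?z \<le> dist x y + norm (k *\<^sub>R (e + w))"
        using norm_triangle_ineq4[of "x - y" "k *\<^sub>R (e + w)"] by (simp add: dist_norm algebra_simps)
      ultimately have zB: "?z \<in> ball x r"
        using y k unfolding mem_ball Int_iff by linarith
      have B: "\<pi> v \<in> ?B" if "v \<in> ball x r" for v
      proof -
        have "\<pi> v - \<pi> x = \<pi> (v - x)" by (simp add: \<pi>_def algebra_simps inner_diff_left)
        then show ?thesis using \<pi>_norm[of "v - x"] that by (simp add: dist_norm norm_minus_commute)
      qed
      have yr: "y \<in> ball x r" using y r(1) by auto
      have pz: "\<pi> ?z = \<pi> y + k *\<^sub>R \<pi> w" by (simp only: \<pi>_lin \<pi>_e)
      have "\<gamma> (\<pi> ?z) - \<gamma> (\<pi> y) \<le> G * norm (\<pi> ?z - \<pi> y)"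
        using lip[OF B[OF zB] B[OF yr]] by simp
      also have "\<dots> = G * (k * norm (\<pi> w))" using k pz by simp
      also have "\<dots> \<le> G * (k * (2 * c))"
        using \<pi>_norm[of w] w k G(2) by (intro mult_left_mono) auto
      finally have "\<gamma> (\<pi> ?z) \<le> y \<bullet> e + k * (2 * G * c)"
        using le[of y] y r(1) by (auto simp: algebra_simps)
      also have "\<dots> < y \<bullet> e + k * (1 - c)"
        using k c by (intro add_strict_left_mono mult_strict_left_mono) auto
      also have "\<dots> \<le> y \<bullet> e + k * (1 + w \<bullet> e)"
        using ip[of w] w k by (intro add_left_mono mult_left_mono) auto
      also have "\<dots> = ?z \<bullet> e"
        by (simp add: inner_add_left ee algebra_simps)
      finally have "?z \<in> \<Omega> \<inter> ball x r"
        using zB unfolding r(4) \<pi>_def by simp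
      then show ?thesis by simp
    qed
    then show ?thesis
      using r(1) c(1) by (intro exI[of _ e] exI[of _ "r / 3"] exI[of _ c]) auto
  qed
qed

section \<open>Doubling of variables under state constraints\<close>

lemma eventually_at_within_subset_ball:
  assumes "r > 0" "\<And>z. z \<in> S \<Longrightarrow> dist z z0 < r \<Longrightarrow> P z"
  shows "\<forall>\<^sub>F z in at z0 within S. P z"
  unfolding eventually_at using assms by blast

lemma C1_penalty:
  fixes zh :: "'a::euclidean_space \<times> real"
  shows "C1_with_gradient UNIV
    (\<lambda>z. \<mu> * (snd z + (snd z)\<^sup>2) + \<delta> * (norm (fst z))\<^sup>2 + (norm (z - zh))\<^sup>2 + A * (norm (z - c))\<^sup>2)
    (\<lambda>z. ((2 * \<delta>) *\<^sub>R fst z + 2 *\<^sub>R (fst z - fst zh) + (2 * A) *\<^sub>R (fst z - fst c),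
      \<mu> * (1 + 2 * snd z) + 2 * (snd z - snd zh) + 2 * A * (snd z - snd c)))"
proof -
  have 1: "C1_with_gradient UNIV (\<lambda>z :: 'a \<times> real. snd z + (snd z)\<^sup>2) (\<lambda>z. (0, 1 + 2 * snd z))"
    by (rule C1_snd[where f = "\<lambda>t. t + t\<^sup>2" and f' = "\<lambda>t. 1 + 2 * t"])
       (auto intro!: derivative_eq_intros continuous_intros)
  have 2: "C1_with_gradient UNIV (\<lambda>z :: 'a \<times> real. (norm (fst z))\<^sup>2) (\<lambda>z. (2 *\<^sub>R fst z, 0))"
    using C1_fst[OF C1_norm_square[OF open_UNIV, of "0 :: 'a"]] by simp
  note C1_add[OF C1_add[OF C1_add[OF C1_cmult[OF 1, of \<mu>] C1_cmult[OF 2, of \<delta>]]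
    C1_norm_square[OF open_UNIV, of zh]] C1_cmult[OF C1_norm_square[OF open_UNIV, of c], of A]]
  then show ?thesis
    by (rule back_subst[of "\<lambda>g. C1_with_gradient UNIV _ g"]) (auto simp: fun_eq_iff prod_eq_iff mult_ac)
qed

lemma norm_fst_snd_diff_le:
  fixes z w :: "'a::real_normed_vector \<times> real"
  shows "norm (fst z - fst w) \<le> norm (z - w)" "\<bar>snd z - snd w\<bar> \<le> norm (z - w)"
  using dist_fst_le[of z w] dist_snd_le[of z w] by (simp_all add: dist_norm)

text \<open>Soner's device: the penalty prefers pairs that differ by a small shift along the
  interior cone, which pushes the variable of the subsolution into the open domain. The variable of
  the supersolution may lie on the boundary, where its inequality is available. What survives are
  the two inequalities at neighbouring points, with momenta that differ only by the gradient of the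
  localising terms.\<close>

lemma doubling_of_variables:
  fixes a b :: "'a::euclidean_space \<times> real \<Rightarrow> real"
  defines "q \<equiv> \<lambda>\<mu> \<delta> z. \<mu> * (snd z + (snd z)\<^sup>2) + \<delta> * (norm (fst z :: 'a))\<^sup>2"
  assumes \<Omega>: "open \<Omega>" "cone_condition \<Omega>"
    and a: "L-lipschitz_on (closure \<Omega> \<times> {0..}) a"
      "viscosity_subsolution (\<Omega> \<times> {0<..}) (evolution_operator K) a"
    and b: "L-lipschitz_on (closure \<Omega> \<times> {0..}) b"
      "viscosity_supersolution (closure \<Omega> \<times> {0<..}) (evolution_operator K) b"
    and pos: "0 < \<mu>" "0 < \<delta>" "\<delta> \<le> 1" "0 < \<eta>" "\<eta> \<le> 1"
    and zh: "zh \<in> closure \<Omega> \<times> {0..}" "\<eta> < snd zh"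
    and max: "\<And>z. z \<in> closure \<Omega> \<times> {0..} \<Longrightarrow> a z - b z - q \<mu> \<delta> z \<le> a zh - b zh - q \<mu> \<delta> zh"
  obtains x t y s p \<sigma> where
    "norm (x - fst zh) < \<eta>" "\<bar>t - snd zh\<bar> < \<eta>" "norm (y - fst zh) < \<eta>"
    "norm p \<le> L + 2 * \<delta> * norm x + 2 * norm (x - fst zh)"
    "norm (p + (2 * \<delta>) *\<^sub>R x + 2 *\<^sub>R (x - fst zh)) \<le> L"
    "\<mu> * (1 + 2 * t) + 2 * (t - snd zh) + \<sigma> + K x (p + (2 * \<delta>) *\<^sub>R x + 2 *\<^sub>R (x - fst zh)) \<le> 0"
    "0 \<le> \<sigma> + K y p"
proof -
  let ?D = "closure \<Omega> \<times> {0 :: real..}"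
  define xh th where "xh = fst zh" and "th = snd zh"
  have xh: "xh \<in> closure \<Omega>" and th: "\<eta> < th" using zh by (auto simp: xh_def th_def)
  obtain e r c where erc: "0 < r" "0 < c"
    "\<And>y k w. y \<in> closure \<Omega> \<Longrightarrow> y \<in> ball xh r \<Longrightarrow> 0 < k \<Longrightarrow> k < r \<Longrightarrow> norm w \<le> c \<Longrightarrow> y + k *\<^sub>R (e + w) \<in> \<Omega>"
    using \<Omega>(2) xh unfolding cone_condition_def by (metis IntI)
  have L0: "0 \<le> L" using a(1) lipschitz_on_nonneg by blast
  define n where "n = norm e"
  define C1 where "C1 = \<mu> * (3 + 2 * th) + 2 * (norm xh + 1)"
  define C2 where "C2 = (2 * (L + C1) + 1) * (1 + n) + 1"
  have n0: "0 \<le> n" by (simp add: n_def)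
  have C1: "0 \<le> C1" using pos th by (simp add: C1_def)
  have C2: "1 \<le> C2" using L0 C1 n0 by (simp add: C2_def)
  obtain \<kappa> where \<kappa>: "0 < \<kappa>" "\<kappa> < r" "\<kappa> < 1" "\<kappa> * n < 1" "C2 * \<kappa> * (1 + 1 / c) < c"
    "C2 * (c * \<kappa> + \<kappa>) < (min (\<eta> / 2) (r / 2))\<^sup>2" "c * \<kappa> + \<kappa> * n < min (\<eta> / 2) (r / 2)"
  proof -
    have *: "\<forall>\<^sub>F k in at_right 0. f k < m" if "(f \<longlongrightarrow> (0 :: real)) (at_right 0)" "0 < m" for f :: "real \<Rightarrow> real" and m
      using order_tendstoD(2)[OF that] .
    have "\<forall>\<^sub>F k in at_right 0. 0 < k \<and> k < r \<and> k < 1 \<and> k * n < 1 \<and> C2 * k * (1 + 1 / c) < c \<and>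
      C2 * (c * k + k) < (min (\<eta> / 2) (r / 2))\<^sup>2 \<and> c * k + k * n < min (\<eta> / 2) (r / 2)"
      using erc pos
      by (intro eventually_conj * eventually_at_right_less) (auto intro!: tendsto_eq_intros)
    then show ?thesis
      using that eventually_happens'[OF trivial_limit_at_right_real] by blast
  qed
  define E where "E = (e, 0 :: real)"
  have nE: "norm E = n" by (simp add: E_def n_def)
  let ?X = "closure \<Omega> \<inter> cball xh 1"
  let ?T = "{0..th + 1}"
  let ?Q = "(?X \<times> ?T) \<times> (?X \<times> ?T)"
  let ?P = "\<lambda>z. q \<mu> \<delta> z + (norm (z - zh))\<^sup>2"
  \<comment> \<open>The shift has size \<open>\<kappa>\<close> and the penalty weight
    \<open>1 / \<kappa>\<^sup>2\<close>, so for small \<open>\<kappa>\<close> the deviation from the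
    shift falls below \<open>c * \<kappa>\<close>, the width of the cone at that height. The square
    of the distance to \<open>zh\<close> keeps the maximum near \<open>zh\<close>.\<close>
  let ?F = "\<lambda>(z, z'). a z - b z' - ?P z - (norm (z - z' - \<kappa> *\<^sub>R E))\<^sup>2 / \<kappa>\<^sup>2"
  have sub: "?X \<times> ?T \<subseteq> ?D" by auto
  have ca: "continuous_on (?X \<times> ?T) a" and cb: "continuous_on (?X \<times> ?T) b"
    using a(1) b(1) lipschitz_on_continuous_on continuous_on_subset[OF _ sub] by blast+
  have "compact ?Q"
    by (intro compact_Times closed_Int_compact) auto
  moreover have "continuous_on ?Q ?F"
    unfolding case_prod_unfold q_def
    by (intro continuous_intros continuous_on_compose2[OF ca] continuous_on_compose2[OF cb])
       (use \<kappa>(1) in auto)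
  moreover have inQ: "(zh + \<kappa> *\<^sub>R E, zh) \<in> ?Q"
  proof -
    have "xh + \<kappa> *\<^sub>R (e + 0) \<in> \<Omega>" using erc(3)[of xh \<kappa> 0] erc \<kappa> xh by auto
    then have "xh + \<kappa> *\<^sub>R e \<in> closure \<Omega>" using closure_subset by auto
    moreover have "norm (\<kappa> *\<^sub>R e) \<le> 1" using \<kappa> by (simp add: n_def)
    ultimately show ?thesis
      using xh th pos by (auto simp: E_def xh_def th_def mem_Times_iff dist_norm)
  qed
  ultimately obtain z z' where zz: "(z, z') \<in> ?Q" "\<And>w w'. (w, w') \<in> ?Q \<Longrightarrow> ?F (w, w') \<le> ?F (z, z')"
    using continuous_attains_sup[of ?Q ?F] by (metis (no_types, lifting) empty_iff prod.collapse)
  define \<rho> where "\<rho> = norm (z - z' - \<kappa> *\<^sub>R E)"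
  have \<rho>0: "0 \<le> \<rho>" by (simp add: \<rho>_def)
  have P_lip: "\<bar>q \<mu> \<delta> w - q \<mu> \<delta> w'\<bar> \<le> C1 * norm (w - w')" if "w \<in> ?X \<times> ?T" "w' \<in> ?X \<times> ?T" for w w'
  proof -
    have n1: "\<bar>snd w - snd w'\<bar> \<le> norm (w - w')" "norm (fst w - fst w') \<le> norm (w - w')"
      by (rule norm_fst_snd_diff_le)+
    have "snd w + (snd w)\<^sup>2 - (snd w' + (snd w')\<^sup>2) = (1 + snd w + snd w') * (snd w - snd w')"
      by (simp add: power2_eq_square algebra_simps)
    moreover have "\<bar>(1 + snd w + snd w') * (snd w - snd w')\<bar> \<le> (3 + 2 * th) * norm (w - w')"
      unfolding abs_mult using that n1 th pos by (intro mult_mono) auto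
    ultimately have 1: "\<bar>\<mu> * (snd w + (snd w)\<^sup>2) - \<mu> * (snd w' + (snd w')\<^sup>2)\<bar> \<le> \<mu> * ((3 + 2 * th) * norm (w - w'))"
      using pos by (simp add: right_diff_distrib[symmetric] abs_mult)
    have nx: "norm (fst v) \<le> norm xh + 1" if "v \<in> ?X \<times> ?T" for v
      using that norm_triangle_ineq2[of "fst v" xh] by (auto simp: dist_norm norm_minus_commute)
    have "(norm (fst w))\<^sup>2 - (norm (fst w'))\<^sup>2 = (norm (fst w) + norm (fst w')) * (norm (fst w) - norm (fst w'))"
      by (simp add: power2_eq_square algebra_simps)
    moreover have "\<bar>(norm (fst w) + norm (fst w')) * (norm (fst w) - norm (fst w'))\<bar> \<le>
        (2 * (norm xh + 1)) * norm (w - w')"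
      unfolding abs_mult using nx[OF that(1)] nx[OF that(2)] n1 norm_triangle_ineq3[of "fst w" "fst w'"]
      by (intro mult_mono) auto
    ultimately have "\<bar>\<delta> * (norm (fst w))\<^sup>2 - \<delta> * (norm (fst w'))\<^sup>2\<bar> \<le> \<delta> * ((2 * (norm xh + 1)) * norm (w - w'))"
      using pos by (simp add: right_diff_distrib[symmetric] abs_mult)
    also have "\<dots> \<le> 1 * ((2 * (norm xh + 1)) * norm (w - w'))"
      using pos by (intro mult_right_mono) auto
    finally have 2: "\<bar>\<delta> * (norm (fst w))\<^sup>2 - \<delta> * (norm (fst w'))\<^sup>2\<bar> \<le> (2 * (norm xh + 1)) * norm (w - w')"
      by simp
    show ?thesis using 1 2 unfolding q_def C1_def by (simp add: algebra_simps abs_le_iff)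
  qed
  have a_lip: "\<bar>a w - a w'\<bar> \<le> L * norm (w - w')" if "w \<in> ?D" "w' \<in> ?D" for w w'
    using lipschitz_onD[OF a(1) that] by (simp add: dist_norm)
  \<comment> \<open>The competitor is the pair \<open>(zh + \<kappa> *\<^sub>R E, zh)\<close>, for
    which the shifted penalty vanishes. Maximality of \<open>zh\<close> is used at
    \<open>z'\<close>, and Lipschitz bounds transfer it to \<open>z\<close>.\<close>
  have main: "\<rho>\<^sup>2 / \<kappa>\<^sup>2 + (norm (z - zh))\<^sup>2 \<le> C2 * (\<rho> + \<kappa>)"
  proof -
    have zX: "z \<in> ?X \<times> ?T" "z' \<in> ?X \<times> ?T" "zh + \<kappa> *\<^sub>R E \<in> ?X \<times> ?T" "zh \<in> ?X \<times> ?T"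
      using zz(1) inQ by auto
    have "norm (\<kappa> *\<^sub>R E) = \<kappa> * n" using \<kappa> by (simp add: nE)
    have "?F (zh + \<kappa> *\<^sub>R E, zh) \<le> ?F (z, z')" by (rule zz(2)[OF inQ])
    then have 1: "a (zh + \<kappa> *\<^sub>R E) - b zh - q \<mu> \<delta> (zh + \<kappa> *\<^sub>R E) - (\<kappa> * n)\<^sup>2 \<le>
        a z - b z' - q \<mu> \<delta> z - (norm (z - zh))\<^sup>2 - \<rho>\<^sup>2 / \<kappa>\<^sup>2"
      using \<kappa> by (simp add: \<rho>_def nE power_mult_distrib)
    have 2: "\<bar>a (zh + \<kappa> *\<^sub>R E) - a zh\<bar> \<le> L * (\<kappa> * n)"
      using a_lip[of "zh + \<kappa> *\<^sub>R E" zh] zX sub \<kappa> by (auto simp: nE subset_iff)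
    have 3: "\<bar>q \<mu> \<delta> (zh + \<kappa> *\<^sub>R E) - q \<mu> \<delta> zh\<bar> \<le> C1 * (\<kappa> * n)"
      using P_lip[OF zX(3,4)] \<kappa> by (simp add: nE)
    have "norm (z - z') \<le> norm (z - z' - \<kappa> *\<^sub>R E) + norm (\<kappa> *\<^sub>R E)"
      using norm_triangle_ineq[of "z - z' - \<kappa> *\<^sub>R E" "\<kappa> *\<^sub>R E"] by simp
    then have nzz: "norm (z - z') \<le> \<rho> + \<kappa> * n"
      using \<kappa> by (simp add: \<rho>_def nE)
    have 4: "\<bar>a z - a z'\<bar> \<le> L * (\<rho> + \<kappa> * n)"
      using a_lip[of z z'] zX sub mult_left_mono[OF nzz L0] by (auto simp: subset_iff)
    have 5: "\<bar>q \<mu> \<delta> z - q \<mu> \<delta> z'\<bar> \<le> C1 * (\<rho> + \<kappa> * n)"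
      using P_lip[OF zX(1,2)] mult_left_mono[OF nzz C1] by linarith
    have 6: "a z' - b z' - q \<mu> \<delta> z' \<le> a zh - b zh - q \<mu> \<delta> zh"
      using zX sub by (intro max) auto
    have 7: "(\<kappa> * n)\<^sup>2 \<le> \<kappa> * n"
      using \<kappa> n0 by (simp add: power2_eq_square mult_left_le)
    have "\<rho>\<^sup>2 / \<kappa>\<^sup>2 + (norm (z - zh))\<^sup>2 \<le> (L + C1) * (\<rho> + \<kappa> * n) + (L + C1) * (\<kappa> * n) + \<kappa> * n"
      using 1 2 3 4 5 6 7 by (simp add: algebra_simps abs_le_iff)
    also have "\<dots> = (L + C1) * \<rho> + ((2 * (L + C1) + 1) * n) * \<kappa>"
      by (simp add: algebra_simps)
    also have "\<dots> \<le> C2 * \<rho> + C2 * \<kappa>"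
    proof (intro add_mono mult_right_mono)
      have "0 \<le> (2 * (L + C1) + 1) * n" "(L + C1) \<le> 2 * (L + C1) + 1" using L0 C1 n0 by auto
      then show "L + C1 \<le> C2" "(2 * (L + C1) + 1) * n \<le> C2"
        using L0 C1 n0 unfolding C2_def distrib_left by auto
    qed (use \<rho>0 \<kappa> in auto)
    finally show ?thesis by (simp add: distrib_left)
  qed
  have \<rho>c: "\<rho> < c * \<kappa>"
  proof (rule ccontr)
    assume "\<not> ?thesis"
    then have c\<rho>: "c * \<kappa> \<le> \<rho>" by simp
    then have "\<kappa> \<le> \<rho> / c" using erc by (simp add: field_simps)
    have "\<rho>\<^sup>2 / \<kappa>\<^sup>2 \<le> C2 * (\<rho> + \<kappa>)" using main zero_le_power2[of "norm (z - zh)"] by linarith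
    also have "\<dots> \<le> C2 * (\<rho> * (1 + 1 / c))"
      using \<open>\<kappa> \<le> \<rho> / c\<close> C2 by (intro mult_left_mono) (auto simp: algebra_simps)
    finally have "\<rho> * \<rho> \<le> C2 * (\<rho> * (1 + 1 / c)) * \<kappa>\<^sup>2"
      using \<kappa> by (simp add: power2_eq_square field_simps)
    moreover have "0 < \<rho>" using c\<rho> erc \<kappa> by (meson less_le_trans mult_pos_pos)
    ultimately have "\<rho> \<le> (C2 * \<kappa> * (1 + 1 / c)) * \<kappa>"
      by (simp add: power2_eq_square mult.assoc mult.left_commute)
    also have "\<dots> < c * \<kappa>" using \<kappa> by (intro mult_strict_right_mono)
    finally show False using c\<rho> by simp
  qed
  have z_near: "norm (z - zh) < min (\<eta> / 2) (r / 2)"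
  proof -
    have "0 \<le> \<rho>\<^sup>2 / \<kappa>\<^sup>2" by simp
    then have "(norm (z - zh))\<^sup>2 \<le> C2 * (\<rho> + \<kappa>)" using main by linarith
    also have "\<dots> \<le> C2 * (c * \<kappa> + \<kappa>)" using \<rho>c C2 by (intro mult_left_mono) auto
    also note \<kappa>(6)
    finally show ?thesis
      by (rule power2_less_imp_less) (use pos erc in auto)
  qed
  have z'_near: "norm (z' - zh) < min \<eta> r"
  proof -
    have "norm (z' - zh) \<le> norm (z - zh) + \<rho> + norm (\<kappa> *\<^sub>R E)"
      using norm_triangle_ineq4[of "z - zh - (z - z' - \<kappa> *\<^sub>R E)" "\<kappa> *\<^sub>R E"]
        norm_triangle_ineq4[of "z - zh" "z - z' - \<kappa> *\<^sub>R E"] by (simp add: \<rho>_def algebra_simps)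
    also have "\<dots> < min (\<eta> / 2) (r / 2) + min (\<eta> / 2) (r / 2)"
    proof -
      have "norm (\<kappa> *\<^sub>R E) = \<kappa> * n" using \<kappa>(1) by (simp add: nE)
      then show ?thesis using z_near \<rho>c \<kappa>(7) by linarith
    qed
    finally show ?thesis by linarith
  qed
  define x t y s where "x = fst z" and "t = snd z" and "y = fst z'" and "s = snd z'"
  have z_eq: "z = (x, t)" "z' = (y, s)" "zh = (xh, th)"
    by (simp_all add: x_def t_def y_def s_def xh_def th_def)
  have bounds: "norm (x - xh) \<le> norm (z - zh)" "\<bar>t - th\<bar> \<le> norm (z - zh)"
    "norm (y - xh) \<le> norm (z' - zh)" "\<bar>s - th\<bar> \<le> norm (z' - zh)"
    using norm_fst_snd_diff_le[of z zh] norm_fst_snd_diff_le[of z' zh] by (simp_all add: z_eq)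
  \<comment> \<open>A deviation below \<open>c * \<kappa>\<close> places \<open>x\<close> in the
    interior cone with vertex \<open>y\<close>.\<close>
  have x_in: "x \<in> \<Omega>"
  proof -
    define w where "w = (1 / \<kappa>) *\<^sub>R (x - y - \<kappa> *\<^sub>R e)"
    have "norm (x - y - \<kappa> *\<^sub>R e) \<le> \<rho>"
      unfolding \<rho>_def z_eq E_def using norm_fst_snd_diff_le(1)[of "(x, t) - (y, s) - \<kappa> *\<^sub>R (e, 0)" 0] by simp
    then have "norm w \<le> c" using \<rho>c \<kappa> by (simp add: w_def divide_le_eq)
    moreover have "y \<in> closure \<Omega>" "y \<in> ball xh r"
      using zz(1) z'_near bounds by (auto simp: z_eq dist_norm norm_minus_commute)
    ultimately have "y + \<kappa> *\<^sub>R (e + w) \<in> \<Omega>" using erc(3) \<kappa> by blast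
    then show ?thesis using \<kappa> by (simp add: w_def algebra_simps)
  qed
  have t_in: "0 < t" "0 < s" and y_in: "y \<in> closure \<Omega>"
    using bounds z_near z'_near th pos zz(1) by (auto simp: z_eq)
  let ?A = "1 / \<kappa>\<^sup>2"
  define p where "p = (2 * ?A) *\<^sub>R (x - y - \<kappa> *\<^sub>R e)"
  define \<sigma> where "\<sigma> = 2 * ?A * (t - s)"
  define p' where "p' = p + (2 * \<delta>) *\<^sub>R x + 2 *\<^sub>R (x - xh)"
  have near_in: "w \<in> ?X \<times> ?T"
    if "w \<in> ?D" "norm (w - zh) < 1" for w
    using that norm_fst_snd_diff_le[of w zh]
    by (cases w) (auto simp: z_eq dist_norm norm_minus_commute)
  have sub_ineq: "evolution_operator K (x, t) (p', \<mu> * (1 + 2 * t) + 2 * (t - th) + \<sigma>) \<le> 0"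
    and p'_bound: "norm p' \<le> L"
  proof -
    let ?\<phi> = "\<lambda>w. \<mu> * (snd w + (snd w)\<^sup>2) + \<delta> * (norm (fst w))\<^sup>2 + (norm (w - zh))\<^sup>2 + ?A * (norm (w - (z' + \<kappa> *\<^sub>R E)))\<^sup>2"
    note C1 = C1_penalty[of \<mu> \<delta> zh ?A "z' + \<kappa> *\<^sub>R E"]
    have ev: "\<forall>\<^sub>F w in at z within \<Omega> \<times> {0<..}. a w - ?\<phi> w \<le> a z - ?\<phi> z"
    proof (rule eventually_at_within_subset_ball)
      show "0 < 1 - norm (z - zh)" using z_near pos by auto
      fix w assume w: "w \<in> \<Omega> \<times> {0<..}" "dist w z < 1 - norm (z - zh)"
      have "norm (w - zh) < 1" using w(2) norm_triangle_ineq[of "w - z" "z - zh"] by (simp add: dist_norm)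
      moreover have "w \<in> ?D" using w(1) closure_subset by force
      ultimately have "w \<in> ?X \<times> ?T" by (rule near_in[rotated])
      then have "?F (w, z') \<le> ?F (z, z')" using zz by auto
      then show "a w - ?\<phi> w \<le> a z - ?\<phi> z" by (simp add: q_def algebra_simps)
    qed
    have grad: "((2 * \<delta>) *\<^sub>R fst z + 2 *\<^sub>R (fst z - fst zh) + (2 * ?A) *\<^sub>R (fst z - fst (z' + \<kappa> *\<^sub>R E)),
      \<mu> * (1 + 2 * snd z) + 2 * (snd z - snd zh) + 2 * ?A * (snd z - snd (z' + \<kappa> *\<^sub>R E)))
      = (p', \<mu> * (1 + 2 * t) + 2 * (t - th) + \<sigma>)"
      by (simp add: z_eq p'_def p_def \<sigma>_def E_def algebra_simps)
    have zin: "z \<in> \<Omega> \<times> {0<..}" using x_in t_in by (simp add: z_eq)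
    show "evolution_operator K (x, t) (p', \<mu> * (1 + 2 * t) + 2 * (t - th) + \<sigma>) \<le> 0"
      using a(2)[unfolded viscosity_subsolution_def, rule_format, OF zin conjI[OF UNIV_I conjI[OF C1 ev]]]
      unfolding grad by (simp add: z_eq)
    have "norm (fst (p', \<mu> * (1 + 2 * t) + 2 * (t - th) + \<sigma>)) \<le> L"
    proof (rule touching_gradient_bound[OF C1 UNIV_I _ zin ev, unfolded grad])
      show "open (\<Omega> \<times> {0 :: real<..})" using \<Omega>(1) by (intro open_Times) auto
      fix x y t assume xy: "(x, t) \<in> \<Omega> \<times> {0 :: real<..}" "(y, t) \<in> \<Omega> \<times> {0 :: real<..}"
      have "\<bar>a (x, t) - a (y, t)\<bar> \<le> L * norm ((x, t) - (y, t))"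
        using xy closure_subset[of \<Omega>] by (intro a_lip) auto
      then show "\<bar>a (x, t) - a (y, t)\<bar> \<le> L * norm (x - y)" by (simp add: norm_Pair)
    qed (use L0 in auto)
    then show "norm p' \<le> L" by simp
  qed
  have super_ineq: "0 \<le> evolution_operator K (y, s) (p, \<sigma>)"
  proof -
    let ?\<psi> = "\<lambda>w. (- ?A) * (norm (w - (z - \<kappa> *\<^sub>R E)))\<^sup>2"
    note C1 = C1_cmult[OF C1_norm_square[OF open_UNIV, of "z - \<kappa> *\<^sub>R E"], of "- ?A"]
    have ev: "\<forall>\<^sub>F w in at z' within closure \<Omega> \<times> {0<..}. b w - ?\<psi> w \<ge> b z' - ?\<psi> z'"
    proof (rule eventually_at_within_subset_ball)
      show "0 < 1 - norm (z' - zh)" using z'_near pos by auto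
      fix w assume w: "w \<in> closure \<Omega> \<times> {0<..}" "dist w z' < 1 - norm (z' - zh)"
      have "norm (w - zh) < 1" using w(2) norm_triangle_ineq[of "w - z'" "z' - zh"] by (simp add: dist_norm)
      moreover have "w \<in> ?D" using w(1) by force
      ultimately have "w \<in> ?X \<times> ?T" by (rule near_in[rotated])
      then have "?F (z, w) \<le> ?F (z, z')" using zz by auto
      moreover have "norm (v - (z - \<kappa> *\<^sub>R E)) = norm (z - v - \<kappa> *\<^sub>R E)" for v
        using norm_minus_commute[of v "z - \<kappa> *\<^sub>R E"] by (simp add: algebra_simps)
      ultimately show "b w - ?\<psi> w \<ge> b z' - ?\<psi> z'" by simp
    qed
    have grad: "(- ?A) *\<^sub>R (2 *\<^sub>R (z' - (z - \<kappa> *\<^sub>R E))) = (p, \<sigma>)"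
      by (simp add: z_eq p_def \<sigma>_def E_def algebra_simps diff_divide_distrib)
    have zin: "z' \<in> closure \<Omega> \<times> {0<..}" using y_in t_in by (simp add: z_eq)
    show ?thesis
      using b(2)[unfolded viscosity_supersolution_def, rule_format, OF zin conjI[OF UNIV_I conjI[OF C1 ev]]]
      unfolding grad by (simp add: z_eq)
  qed
  show ?thesis
  proof (rule that[of x t y p \<sigma>])
    show "norm (x - fst zh) < \<eta>" "\<bar>t - snd zh\<bar> < \<eta>" "norm (y - fst zh) < \<eta>"
      using bounds z_near z'_near pos by (auto simp: z_eq)
    show "norm (p + (2 * \<delta>) *\<^sub>R x + 2 *\<^sub>R (x - fst zh)) \<le> L"
      using p'_bound by (simp add: p'_def xh_def)
    \<comment> \<open>Only \<open>p'\<close> is a gradient at an interior point and bounded by the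
      Lipschitz constant; the bound for \<open>p\<close> is inherited by subtracting the localising
      terms.\<close>
    have "norm p = norm (p' - ((2 * \<delta>) *\<^sub>R x + 2 *\<^sub>R (x - xh)))" by (simp add: p'_def)
    then have "norm p \<le> norm p' + (norm ((2 * \<delta>) *\<^sub>R x) + norm (2 *\<^sub>R (x - xh)))"
      using norm_triangle_ineq4[of p' "(2 * \<delta>) *\<^sub>R x + 2 *\<^sub>R (x - xh)"]
        norm_triangle_ineq[of "(2 * \<delta>) *\<^sub>R x" "2 *\<^sub>R (x - xh)"] by linarith
    then show "norm p \<le> L + 2 * \<delta> * norm x + 2 * norm (x - fst zh)"
      using p'_bound pos by (simp add: xh_def)
    show "\<mu> * (1 + 2 * t) + 2 * (t - snd zh) + \<sigma> + K x (p + (2 * \<delta>) *\<^sub>R x + 2 *\<^sub>R (x - fst zh)) \<le> 0"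
      using sub_ineq by (simp add: evolution_operator_def p'_def xh_def th_def)
    show "0 \<le> \<sigma> + K y p" using super_ineq by (simp add: evolution_operator_def)
  qed
qed

text \<open>In the penalty \<open>\<mu> * (t + t\<^sup>2)\<close> the linear part makes the
  inequality strict, and the quadratic part beats the at most linear growth of \<open>a - b\<close>,
  so that the maximum is attained at a bounded time. The term with \<open>\<delta>\<close> confines
  it in space, and its gradient at the maximum is made small.\<close>

theorem comparison_principle:
  fixes a b :: "'a::euclidean_space \<times> real \<Rightarrow> real"
  assumes \<Omega>: "open \<Omega>" "cone_condition \<Omega>"
    and K: "\<And>B. uniformly_continuous_on (UNIV \<times> cball 0 B) (\<lambda>(x, p). K x p)"
    and a: "La-lipschitz_on (closure \<Omega> \<times> {0..}) a"
      "viscosity_subsolution (\<Omega> \<times> {0<..}) (evolution_operator K) a"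
    and b: "Lb-lipschitz_on (closure \<Omega> \<times> {0..}) b"
      "viscosity_supersolution (closure \<Omega> \<times> {0<..}) (evolution_operator K) b"
    and init: "\<And>x. x \<in> closure \<Omega> \<Longrightarrow> a (x, 0) \<le> b (x, 0)"
    and x1: "x1 \<in> closure \<Omega>" "0 \<le> t1"
  shows "a (x1, t1) \<le> b (x1, t1)"
proof (rule ccontr)
  let ?D = "closure \<Omega> \<times> {0 :: real..}"
  assume contra: "\<not> ?thesis"
  define L where "L = max La Lb + 1"
  have L1: "La \<le> L" "Lb \<le> L" by (auto simp: L_def)
  have L0: "0 < L" using lipschitz_on_nonneg[OF a(1)] by (simp add: L_def)
  have aL: "L-lipschitz_on ?D a" and bL: "L-lipschitz_on ?D b"
    using a(1) b(1) L1 lipschitz_on_le by blast+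
  define \<theta> where "\<theta> = a (x1, t1) - b (x1, t1)"
  have \<theta>: "0 < \<theta>" using contra by (simp add: \<theta>_def)
  define \<mu> where "\<mu> = \<theta> / (4 * (1 + t1 + t1\<^sup>2))"
  have den: "0 < 1 + t1 + t1\<^sup>2" using x1 by (intro add_pos_nonneg) auto
  have \<mu>: "0 < \<mu>" using \<theta> den by (simp add: \<mu>_def)
  have "\<mu> * (1 + t1 + t1\<^sup>2) = \<theta> / 4" using den by (simp add: \<mu>_def field_simps)
  moreover have "\<mu> * (t1 + t1\<^sup>2) \<le> \<mu> * (1 + t1 + t1\<^sup>2)" using \<mu> by (intro mult_left_mono) auto
  ultimately have \<mu>1: "\<mu> * (t1 + t1\<^sup>2) \<le> \<theta> / 4" by linarith
  obtain \<rho> where \<rho>: "0 < \<rho>" "\<And>x y p q. norm p \<le> L + 1 \<Longrightarrow> norm q \<le> L + 1 \<Longrightarrow> norm (x - y) < \<rho> \<Longrightarrow>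
      norm (p - q) < \<rho> \<Longrightarrow> \<bar>K x p - K y q\<bar> < \<mu> / 3"
  proof -
    obtain d where d: "0 < d" "\<And>z w. z \<in> UNIV \<times> cball 0 (L + 1) \<Longrightarrow> w \<in> UNIV \<times> cball 0 (L + 1) \<Longrightarrow>
        dist w z < d \<Longrightarrow> dist (case w of (x, p) \<Rightarrow> K x p) (case z of (x, p) \<Rightarrow> K x p) < \<mu> / 3"
      using K[of "L + 1"] \<mu> unfolding uniformly_continuous_on_def
      by (metis divide_pos_pos zero_less_numeral)
    show ?thesis
    proof (rule that[of "d / 2"])
      fix x y p q :: 'a
      assume *: "norm p \<le> L + 1" "norm q \<le> L + 1" "norm (x - y) < d / 2" "norm (p - q) < d / 2"
      have "dist (x, p) (y, q) \<le> norm (x - y) + norm (p - q)"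
        using norm_Pair_le[of "x - y" "p - q"] by (simp add: dist_norm)
      then show "\<bar>K x p - K y q\<bar> < \<mu> / 3"
        using d(2)[of "(y, q)" "(x, p)"] * by (auto simp: dist_real_def)
    qed (use d in auto)
  qed
  define \<rho>1 where "\<rho>1 = min (\<rho> / 8) (1 / 8)"
  have \<rho>1: "0 < \<rho>1" "\<rho>1 \<le> \<rho> / 8" "\<rho>1 \<le> 1 / 8" using \<rho>(1) by (auto simp: \<rho>1_def)
  \<comment> \<open>At the maximum \<open>\<delta> * (norm x)\<^sup>2\<close> is at most
    \<open>L\<^sup>2 / \<mu>\<close>, the largest value of
    \<open>2 * L * t - \<mu> * t\<^sup>2\<close>. The last bound on \<open>\<delta>\<close>
    therefore makes the gradient \<open>2 * \<delta> * norm x\<close> at most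
    \<open>\<rho>1\<close>.\<close>
  define \<delta> where "\<delta> = min 1 (min (\<theta> / (4 * (1 + (norm x1)\<^sup>2))) (\<rho>1\<^sup>2 * \<mu> / (4 * L\<^sup>2)))"
  have den2: "0 < 1 + (norm x1)\<^sup>2" by (simp add: add_pos_nonneg)
  have \<delta>: "0 < \<delta>" "\<delta> \<le> 1" "\<delta> \<le> \<theta> / (4 * (1 + (norm x1)\<^sup>2))" "\<delta> \<le> \<rho>1\<^sup>2 * \<mu> / (4 * L\<^sup>2)"
    using \<theta> \<mu> \<rho>1 L0 den2 by (auto simp: \<delta>_def)
  have "\<delta> * (norm x1)\<^sup>2 \<le> \<theta> / (4 * (1 + (norm x1)\<^sup>2)) * (1 + (norm x1)\<^sup>2)"
    using \<delta> \<theta> den2 by (intro mult_mono) auto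
  also have "\<dots> = \<theta> / 4" using den2 by (simp add: field_simps)
  finally have \<delta>1: "\<delta> * (norm x1)\<^sup>2 \<le> \<theta> / 4" .
  define q where "q z = \<mu> * (snd z + (snd z)\<^sup>2) + \<delta> * (norm (fst z))\<^sup>2" for z :: "'a \<times> real"
  define \<Psi> where "\<Psi> z = a z - b z - q z" for z
  have \<Psi>1: "\<theta> / 2 \<le> \<Psi> (x1, t1)" using \<mu>1 \<delta>1 by (simp add: \<Psi>_def q_def \<theta>_def)
  have growth: "a (x, t) - b (x, t) \<le> 2 * L * t" if "x \<in> closure \<Omega>" "0 \<le> t" for x t
  proof -
    have "\<bar>a (x, t) - a (x, 0)\<bar> \<le> L * t" "\<bar>b (x, t) - b (x, 0)\<bar> \<le> L * t"
      using lipschitz_onD[OF aL, of "(x, t)" "(x, 0)"] lipschitz_onD[OF bL, of "(x, t)" "(x, 0)"] that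
      by (auto simp: dist_Pair_Pair dist_real_def)
    then show ?thesis using init[OF that(1)] by linarith
  qed
  have key: "t \<le> 2 * L / \<mu> \<and> \<delta> * (norm x)\<^sup>2 \<le> L\<^sup>2 / \<mu> \<and> 0 < t"
    if "0 < \<Psi> (x, t)" "x \<in> closure \<Omega>" "0 \<le> t" for x t
  proof -
    have "0 < 2 * L * t - \<mu> * t\<^sup>2 - \<delta> * (norm x)\<^sup>2 - \<mu> * t"
      using that(1) growth[OF that(2,3)] by (simp add: \<Psi>_def q_def algebra_simps)
    then have 1: "\<mu> * t + \<mu> * t\<^sup>2 + \<delta> * (norm x)\<^sup>2 < 2 * L * t" by linarith
    moreover have "0 \<le> \<delta> * (norm x)\<^sup>2" "0 \<le> \<mu> * t" "0 \<le> \<mu> * t\<^sup>2" using \<delta> \<mu> that by auto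
    ultimately have 2: "\<mu> * t\<^sup>2 < 2 * L * t" "\<mu> * t\<^sup>2 + \<delta> * (norm x)\<^sup>2 < 2 * L * t" "0 < 2 * L * t" by linarith+
    then have t: "0 < t" using L0 by (simp add: zero_less_mult_iff)
    then have "\<mu> * t < 2 * L" using 2(1) by (simp add: power2_eq_square mult.assoc[symmetric])
    moreover have "0 \<le> (L - \<mu> * t)\<^sup>2" by simp
    then have "2 * L * t * \<mu> - \<mu> * t\<^sup>2 * \<mu> \<le> L\<^sup>2" by (simp add: power2_eq_square algebra_simps)
    then have "(2 * L * t - \<mu> * t\<^sup>2) * \<mu> \<le> L\<^sup>2" by (simp add: algebra_simps)
    then have "2 * L * t - \<mu> * t\<^sup>2 \<le> L\<^sup>2 / \<mu>" using \<mu> by (simp add: pos_le_divide_eq)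
    moreover have "t \<le> 2 * L / \<mu>" using \<open>\<mu> * t < 2 * L\<close> \<mu> by (simp add: field_simps)
    ultimately show ?thesis using t 2(2) by linarith
  qed
  define R where "R = sqrt (L\<^sup>2 / (\<mu> * \<delta>))"
  have inQ: "x \<in> closure \<Omega> \<inter> cball 0 R \<and> t \<in> {0..2 * L / \<mu>}"
    if "0 < \<Psi> (x, t)" "x \<in> closure \<Omega>" "0 \<le> t" for x t
  proof -
    have "(norm x)\<^sup>2 \<le> L\<^sup>2 / (\<mu> * \<delta>)" using key[OF that] \<delta> \<mu> by (simp add: field_simps)
    then have "norm x \<le> R" unfolding R_def by (rule real_le_rsqrt)
    then show ?thesis using key[OF that] that by auto
  qed
  let ?Q = "(closure \<Omega> \<inter> cball 0 R) \<times> {0..2 * L / \<mu>}"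
  have x1Q: "(x1, t1) \<in> ?Q" using inQ[of x1 t1] x1 \<Psi>1 \<theta> by auto
  have "compact ?Q" by (intro compact_Times closed_Int_compact) auto
  moreover have "continuous_on ?Q \<Psi>"
  proof -
    have "?Q \<subseteq> ?D" by auto
    then have "continuous_on ?Q a" "continuous_on ?Q b"
      using lipschitz_on_continuous_on[OF aL] lipschitz_on_continuous_on[OF bL] continuous_on_subset by blast+
    then show ?thesis unfolding \<Psi>_def q_def by (intro continuous_intros)
  qed
  ultimately obtain zh where zh: "zh \<in> ?Q" "\<And>z. z \<in> ?Q \<Longrightarrow> \<Psi> z \<le> \<Psi> zh"
    using x1Q continuous_attains_sup[of ?Q \<Psi>] by blast
  have \<Psi>zh: "\<theta> / 2 \<le> \<Psi> zh" using zh(2)[OF x1Q] \<Psi>1 by linarith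
  have max: "\<Psi> z \<le> \<Psi> zh" if z: "z \<in> ?D" for z
  proof (cases "0 < \<Psi> z")
    case True
    then have "z \<in> ?Q" using inQ[of "fst z" "snd z"] z by (cases z) auto
    then show ?thesis by (rule zh(2))
  next
    case False
    then show ?thesis using \<Psi>zh \<theta> by linarith
  qed
  have zhD: "fst zh \<in> closure \<Omega>" "0 \<le> snd zh" using zh(1) by (auto simp: mem_Times_iff)
  have kz: "\<delta> * (norm (fst zh))\<^sup>2 \<le> L\<^sup>2 / \<mu>" "0 < snd zh"
    using key[of "fst zh" "snd zh"] zhD \<Psi>zh \<theta> by auto
  have small: "2 * \<delta> * norm (fst zh) \<le> \<rho>1"
  proof (rule power2_le_imp_le)
    have "(2 * \<delta> * norm (fst zh))\<^sup>2 = 4 * \<delta> * (\<delta> * (norm (fst zh))\<^sup>2)"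
      by (simp add: power2_eq_square)
    also have "\<dots> \<le> 4 * \<delta> * (L\<^sup>2 / \<mu>)" using kz \<delta> by (intro mult_left_mono) auto
    also have "\<dots> \<le> 4 * (\<rho>1\<^sup>2 * \<mu> / (4 * L\<^sup>2)) * (L\<^sup>2 / \<mu>)" using \<delta> \<mu> by (intro mult_right_mono mult_left_mono) auto
    also have "\<dots> = \<rho>1\<^sup>2" using L0 \<mu> by (simp add: field_simps)
    finally show "(2 * \<delta> * norm (fst zh))\<^sup>2 \<le> \<rho>1\<^sup>2" .
  qed (use \<rho>1 in auto)
  define \<eta> where "\<eta> = min (min (\<rho>1 / 4) (\<mu> / 12)) (min 1 (snd zh / 2))"
  have \<eta>: "0 < \<eta>" "\<eta> \<le> \<rho>1 / 4" "\<eta> \<le> \<mu> / 12" "\<eta> \<le> 1" "\<eta> < snd zh"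
    using \<rho>1 \<mu> kz by (auto simp: \<eta>_def)
  have zhD': "zh \<in> ?D" using zh(1) by auto
  have max': "a z - b z - (\<mu> * (snd z + (snd z)\<^sup>2) + \<delta> * (norm (fst z))\<^sup>2) \<le>
      a zh - b zh - (\<mu> * (snd zh + (snd zh)\<^sup>2) + \<delta> * (norm (fst zh))\<^sup>2)" if "z \<in> ?D" for z
    using max[OF that] by (simp add: \<Psi>_def q_def)
  obtain x t y s p \<sigma> where d:
    "norm (x - fst zh) < \<eta>" "\<bar>t - snd zh\<bar> < \<eta>" "norm (y - fst zh) < \<eta>"
    "norm p \<le> L + 2 * \<delta> * norm x + 2 * norm (x - fst zh)"
    "norm (p + (2 * \<delta>) *\<^sub>R x + 2 *\<^sub>R (x - fst zh)) \<le> L"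
    "\<mu> * (1 + 2 * t) + 2 * (t - snd zh) + \<sigma> + K x (p + (2 * \<delta>) *\<^sub>R x + 2 *\<^sub>R (x - fst zh)) \<le> 0"
    "0 \<le> \<sigma> + K y p"
    by (rule doubling_of_variables[OF \<Omega> aL a(2) bL b(2) \<mu> \<delta>(1,2) \<eta>(1,4) zhD' \<eta>(5) max'])
  have "2 * \<delta> * norm x \<le> 2 * \<delta> * (norm (fst zh) + \<eta>)"
    using norm_triangle_ineq2[of x "fst zh"] d(1) \<delta> by (intro mult_left_mono) auto
  also have "\<dots> \<le> \<rho>1 + 2 * 1 * \<eta>"
  proof -
    have "\<delta> * \<eta> \<le> 1 * \<eta>" using \<delta>(2) \<eta>(1) by (intro mult_right_mono) auto
    then show ?thesis using small unfolding distrib_left by linarith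
  qed
  finally have dx: "2 * \<delta> * norm x \<le> \<rho>1 + 2 * \<eta>" by simp
  let ?g = "(2 * \<delta>) *\<^sub>R x + 2 *\<^sub>R (x - fst zh)"
  have "norm ?g \<le> 2 * \<delta> * norm x + 2 * norm (x - fst zh)"
    using norm_triangle_ineq[of "(2 * \<delta>) *\<^sub>R x" "2 *\<^sub>R (x - fst zh)"] \<delta> by simp
  also have "\<dots> \<le> \<rho>1 + 4 * \<eta>" using dx d(1) by linarith
  also have "\<dots> \<le> 2 * \<rho>1" using \<eta> by linarith
  finally have g: "norm ?g \<le> 2 * \<rho>1" .
  have gg: "p + (2 * \<delta>) *\<^sub>R x + 2 *\<^sub>R (x - fst zh) = p + ?g" by (simp add: add.assoc)
  define k1 k2 where "k1 = K x (p + ?g)" and "k2 = K y p"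
  have "\<bar>k1 - k2\<bar> < \<mu> / 3"
    unfolding k1_def k2_def
  proof (rule \<rho>(2))
    show "norm (p + ?g) \<le> L + 1" using d(5) unfolding gg by linarith
    show "norm p \<le> L + 1" using d(4) dx d(1) \<eta> \<rho>1 by linarith
    show "norm (x - y) < \<rho>"
      using norm_triangle_ineq4[of "x - fst zh" "y - fst zh"] d(1,3) \<eta> \<rho>1 \<rho>(1) by simp
    show "norm (p + ?g - p) < \<rho>" using g \<rho>1 \<rho>(1) by simp
  qed
  moreover have "\<mu> \<le> \<mu> * (1 + 2 * t)"
    using d(2) \<eta>(5) \<mu> by (simp add: distrib_left)
  moreover have "\<mu> * (1 + 2 * t) + 2 * (t - snd zh) + \<sigma> + k1 \<le> 0" "0 \<le> \<sigma> + k2"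
    using d(6,7) unfolding gg k1_def k2_def by blast+
  moreover have "- \<eta> < t - snd zh" using d(2) by linarith
  \<comment> \<open>The strictness \<open>\<mu>\<close> exceeds the gap \<open>\<mu> / 3\<close>
    between the Hamiltonians plus the error \<open>2 * \<eta> \<le> \<mu> / 6\<close> from the time
    penalty.\<close>
  ultimately show False
    using \<eta>(3) \<mu> by (simp only: abs_less_iff) argo
qed

section \<open>Viscosity subsolutions and inequalities along steps\<close>

lemma convex_subgradient:
  fixes f :: "'a::euclidean_space \<Rightarrow> real"
  assumes "convex_on UNIV f"
  obtains v where "\<And>q. f p + v \<bullet> (q - p) \<le> f q"
proof -
  let ?S = "{z. f (fst z) < snd z}"
  have "convex ?S"
  proof (rule convexI)
    fix z w and u v :: real
    assume *: "z \<in> ?S" "w \<in> ?S" "0 \<le> u" "0 \<le> v" "u + v = 1"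
    have "f (u *\<^sub>R fst z + v *\<^sub>R fst w) \<le> u * f (fst z) + v * f (fst w)"
      using assms * by (auto simp: convex_on_def)
    also have "\<dots> < u * snd z + v * snd w"
    proof (cases "u = 0")
      case True
      then show ?thesis using * by simp
    next
      case False
      then have "u * f (fst z) < u * snd z" using * by simp
      moreover have "v * f (fst w) \<le> v * snd w" using * by (intro mult_left_mono) auto
      ultimately show ?thesis by linarith
    qed
    finally show "u *\<^sub>R z + v *\<^sub>R w \<in> ?S" by simp
  qed
  moreover have "(p, f p + 1) \<in> ?S" by simp
  then have "?S \<noteq> {}" by blast
  ultimately have "\<exists>a b. a \<noteq> 0 \<and> (\<forall>z\<in>?S. a \<bullet> z \<le> b) \<and> (\<forall>z\<in>{(p, f p)}. b \<le> a \<bullet> z)"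
    by (intro separating_hyperplane_sets) auto
  then obtain a b where ab: "a \<noteq> 0" "\<And>z. z \<in> ?S \<Longrightarrow> a \<bullet> z \<le> b" "b \<le> a \<bullet> (p, f p)"
    by blast
  obtain u \<alpha> where a: "a = (u, \<alpha>)" by fastforce
  have sep: "u \<bullet> q + \<alpha> * r \<le> u \<bullet> p + \<alpha> * f p" if "f q < r" for q r
    using ab(2)[of "(q, r)"] ab(3) that by (simp add: a)
  have "\<alpha> \<le> 0" using sep[of p "f p + 1"] by (simp add: algebra_simps)
  moreover have "\<alpha> \<noteq> 0"
  proof
    assume "\<alpha> = 0"
    then have "u \<bullet> u \<le> 0" using sep[of "p + u" "f (p + u) + 1"] by (simp add: inner_add_right)
    then have "u = 0" using inner_ge_zero[of u] by simp
    with \<open>\<alpha> = 0\<close> ab(1) show False by (simp add: a zero_prod_def)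
  qed
  ultimately have \<alpha>: "\<alpha> < 0" by simp
  show ?thesis
  proof (rule that[of "(1 / - \<alpha>) *\<^sub>R u"])
    fix q
    have "u \<bullet> q + \<alpha> * f q \<le> u \<bullet> p + \<alpha> * f p"
    proof (rule field_le_epsilon)
      fix e :: real assume "0 < e"
      then have "0 < e / - \<alpha>" using \<alpha> by (intro divide_pos_pos) auto
      then have "u \<bullet> q + \<alpha> * (f q + e / - \<alpha>) \<le> u \<bullet> p + \<alpha> * f p" by (intro sep) simp
      moreover have "\<alpha> * (f q + e / - \<alpha>) = \<alpha> * f q - e" using \<alpha> by (simp add: field_simps)
      ultimately show "u \<bullet> q + \<alpha> * f q \<le> u \<bullet> p + \<alpha> * f p + e" by simp
    qed
    then show "f p + ((1 / - \<alpha>) *\<^sub>R u) \<bullet> (q - p) \<le> f q"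
      using \<alpha> by (simp add: inner_diff_right field_simps)
  qed
qed

text \<open>\<open>l\<close> is an upper bound for the Lagrangian at \<open>v\<close>, that is for
  the Legendre transform of \<open>H z\<close> over the ball of radius \<open>R\<close>. Larger
  values are allowed, so costs need not be optimal.\<close>

definition admissible ::
    "('a::real_inner \<Rightarrow> 'a \<Rightarrow> real) \<Rightarrow> real \<Rightarrow> 'a \<Rightarrow> 'a \<Rightarrow> real \<Rightarrow> bool" where
  "admissible H R z v l \<longleftrightarrow> (\<forall>p. norm p \<le> R \<longrightarrow> p \<bullet> v - H z p \<le> l)"

text \<open>The triple lists time, displacement and cost. A single rate \<open>l\<close> that
  dominates the Lagrangian along the whole segment replaces the integral of a running cost.\<close>

definition step ::
    "'a::real_inner set \<Rightarrow> ('a \<Rightarrow> 'a \<Rightarrow> real) \<Rightarrow> real \<Rightarrow> 'a \<Rightarrow> real \<times> 'a \<times> real \<Rightarrow> bool" where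
  "step \<Omega> H R x \<zeta> \<longleftrightarrow> (\<exists>\<tau> v l. 0 \<le> \<tau> \<and> \<zeta> = (\<tau>, \<tau> *\<^sub>R v, \<tau> * l) \<and>
     (\<forall>s\<in>{0..\<tau>}. x + s *\<^sub>R v \<in> \<Omega> \<and> admissible H R (x + s *\<^sub>R v) v l))"

lemma C1_moving_square:
  "C1_with_gradient UNIV (\<lambda>z :: 'a::euclidean_space \<times> real. (norm (fst z - x - (snd z - t) *\<^sub>R v))\<^sup>2)
    (\<lambda>z. (2 *\<^sub>R (fst z - x - (snd z - t) *\<^sub>R v), - 2 * ((fst z - x - (snd z - t) *\<^sub>R v) \<bullet> v)))"
  unfolding C1_with_gradient_def
proof (intro conjI ballI)
  show "continuous_on UNIV (\<lambda>z :: 'a \<times> real. (2 *\<^sub>R (fst z - x - (snd z - t) *\<^sub>R v), - 2 * ((fst z - x - (snd z - t) *\<^sub>R v) \<bullet> v)))"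
    by (intro continuous_intros)
  show "GDERIV (\<lambda>z. (norm (fst z - x - (snd z - t) *\<^sub>R v))\<^sup>2) z :>
    (2 *\<^sub>R (fst z - x - (snd z - t) *\<^sub>R v), - 2 * ((fst z - x - (snd z - t) *\<^sub>R v) \<bullet> v))" for z :: "'a \<times> real"
    unfolding gderiv_def power2_norm_eq_inner
    by (auto intro!: derivative_eq_intros simp: fun_eq_iff inner_prod_def inner_commute algebra_simps inner_diff_left inner_diff_right)
qed simp

text \<open>If \<open>w\<close> grew too fast along the segment, a barrier moving with velocity
  \<open>v\<close> would touch it from above inside a thin tube. As \<open>w\<close> falls in time
  at rate at most \<open>C\<close>, the equation gives \<open>K y0 p \<le> C\<close> for the
  gradient \<open>p\<close> of the barrier, hence \<open>norm p \<le> R\<close>, and admissibility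
  contradicts the subsolution inequality. Stopping at \<open>\<tau>' < \<tau>\<close> leaves room
  for the barrier at the far end of the tube.\<close>

lemma viscosity_subsolution_step_strict:
  fixes w :: "'a::euclidean_space \<times> real \<Rightarrow> real"
  assumes "open \<Omega>" and K: "uniformly_continuous_on (UNIV \<times> cball 0 R) (\<lambda>(x, p). K x p)"
    and cont: "continuous_on (\<Omega> \<times> {0..}) w"
    and sub: "viscosity_subsolution (\<Omega> \<times> {0<..}) (evolution_operator K) w"
    and lower: "\<And>x t h. x \<in> \<Omega> \<Longrightarrow> 0 < t \<Longrightarrow> 0 \<le> h \<Longrightarrow> w (x, t) - C * h \<le> w (x, t + h)"
    and coercive: "\<And>x p. x \<in> \<Omega> \<Longrightarrow> K x p \<le> C \<Longrightarrow> norm p \<le> R"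
    and path: "\<And>s. s \<in> {0..\<tau>} \<Longrightarrow> x + s *\<^sub>R v \<in> \<Omega> \<and> admissible K R (x + s *\<^sub>R v) v l"
    and \<tau>: "0 < \<tau>'" "\<tau>' < \<tau>" and t: "0 \<le> t"
  shows "w (x + \<tau>' *\<^sub>R v, t + \<tau>') \<le> w (x, t) + \<tau>' * l"
proof (rule ccontr)
  assume contra: "\<not> ?thesis"
  define \<eta> where "\<eta> = (w (x + \<tau>' *\<^sub>R v, t + \<tau>') - w (x, t) - \<tau>' * l) / (4 * \<tau>')"
  have \<eta>: "0 < \<eta>" using contra \<tau> by (simp add: \<eta>_def)
  have gap: "w (x + \<tau>' *\<^sub>R v, t + \<tau>') = w (x, t) + \<tau>' * l + 4 * \<eta> * \<tau>'"
    using \<tau> by (simp add: \<eta>_def field_simps)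
  have x\<Omega>: "x \<in> \<Omega>" using path[of 0] \<tau> by simp
  obtain \<rho>1 where \<rho>1: "0 < \<rho>1" "\<And>s h. s \<in> {0..\<tau>} \<Longrightarrow> norm h < \<rho>1 \<Longrightarrow> x + s *\<^sub>R v + h \<in> \<Omega>"
  proof -
    have "compact ((\<lambda>s. x + s *\<^sub>R v) ` {0..\<tau>})"
      by (intro compact_continuous_image continuous_intros) auto
    moreover have "(\<lambda>s. x + s *\<^sub>R v) ` {0..\<tau>} \<subseteq> \<Omega>" using path by auto
    ultimately obtain e where e: "e > 0" "(\<Union>y\<in>(\<lambda>s. x + s *\<^sub>R v) ` {0..\<tau>}. ball y e) \<subseteq> \<Omega>"
      using compact_subset_open_imp_ball_epsilon_subset \<open>open \<Omega>\<close> by metis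
    show ?thesis
    proof (rule that[OF e(1)])
      fix s :: real and h :: 'a assume "s \<in> {0..\<tau>}" "norm h < e"
      then have "x + s *\<^sub>R v + h \<in> (\<Union>y\<in>(\<lambda>s. x + s *\<^sub>R v) ` {0..\<tau>}. ball y e)"
        by (auto simp: dist_norm intro!: bexI[of _ s])
      then show "x + s *\<^sub>R v + h \<in> \<Omega>" using e(2) by blast
    qed
  qed
  obtain \<rho>2 where \<rho>2: "0 < \<rho>2" "\<And>y z p. norm (y - z) < \<rho>2 \<Longrightarrow> norm p \<le> R \<Longrightarrow> \<bar>K y p - K z p\<bar> < \<eta>"
  proof -
    obtain d where d: "0 < d" "\<And>z w. z \<in> UNIV \<times> cball 0 R \<Longrightarrow> w \<in> UNIV \<times> cball 0 R \<Longrightarrow>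
        dist w z < d \<Longrightarrow> dist (case w of (x, p) \<Rightarrow> K x p) (case z of (x, p) \<Rightarrow> K x p) < \<eta>"
      using K \<eta> unfolding uniformly_continuous_on_def by metis
    show ?thesis
    proof (rule that[OF d(1)])
      fix y z p :: 'a assume "norm (y - z) < d" "norm p \<le> R"
      then show "\<bar>K y p - K z p\<bar> < \<eta>"
        using d(2)[of "(z, p)" "(y, p)"] by (auto simp: dist_Pair_Pair dist_norm)
    qed
  qed
  obtain \<rho>3 where \<rho>3: "0 < \<rho>3" "\<And>h. norm h < \<rho>3 \<Longrightarrow> w (x + h, t) \<le> w (x, t) + \<eta> * \<tau>'"
  proof -
    have "(x, t) \<in> \<Omega> \<times> {0..}" using x\<Omega> t by simp
    then obtain d where d: "0 < d" "\<And>z. z \<in> \<Omega> \<times> {0..} \<Longrightarrow> dist z (x, t) < d \<Longrightarrow> dist (w z) (w (x, t)) < \<eta> * \<tau>'"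
      using cont \<eta> \<tau> unfolding continuous_on_iff by (metis mult_pos_pos)
    show ?thesis
    proof (rule that[of "min d \<rho>1"])
      fix h :: 'a assume h: "norm h < min d \<rho>1"
      then have "x + h \<in> \<Omega>" using \<rho>1(2)[of 0 h] \<tau> by simp
      then show "w (x + h, t) \<le> w (x, t) + \<eta> * \<tau>'"
        using d(2)[of "(x + h, t)"] h t by (auto simp: dist_Pair_Pair dist_norm abs_less_iff)
    qed (use d \<rho>1 in auto)
  qed
  define \<rho> where "\<rho> = min \<rho>1 (min \<rho>2 \<rho>3) / 2"
  have \<rho>: "0 < \<rho>" "\<rho> < \<rho>1" "\<rho> < \<rho>2" "\<rho> < \<rho>3" using \<rho>1(1) \<rho>2(1) \<rho>3(1) by (auto simp: \<rho>_def)
  let ?Q = "cball (0 :: 'a) \<rho> \<times> {0..\<tau>}"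
  let ?g = "\<lambda>z :: 'a \<times> real. (x + snd z *\<^sub>R v + fst z, t + snd z)"
  have cpt: "compact ?Q" by (intro compact_Times) auto
  have cw: "continuous_on ?Q (\<lambda>z. w (?g z))"
    by (intro continuous_on_compose2[OF cont] continuous_intros)
       (use \<rho>1(2) \<rho> t in \<open>auto simp: dist_norm\<close>)
  obtain W where W: "\<And>z. z \<in> ?Q \<Longrightarrow> \<bar>w (?g z)\<bar> \<le> W"
  proof -
    obtain W where W: "\<forall>y\<in>(\<lambda>z. w (?g z)) ` ?Q. norm y \<le> W"
      using compact_imp_bounded[OF compact_continuous_image[OF cw cpt]] unfolding bounded_iff by blast
    show ?thesis
    proof (rule that[of W])
      fix z assume "z \<in> ?Q"
      then have "norm (w (?g z)) \<le> W" using W by (blast intro: imageI)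
      then show "\<bar>w (?g z)\<bar> \<le> W" by simp
    qed
  qed
  define M where "M = W + \<bar>l + 2 * \<eta>\<bar> * \<tau> - w (x, t) + 1"
  have M: "0 < M"
  proof -
    have "w (x, t) \<le> W" using W[of "(0, 0)"] \<tau> \<rho> by simp
    moreover have "0 \<le> \<bar>l + 2 * \<eta>\<bar> * \<tau>" using \<tau> by simp
    ultimately show ?thesis unfolding M_def by linarith
  qed
  define A where "A = \<eta> * \<tau>' / 2"
  have A: "0 < A" using \<eta> \<tau> by (simp add: A_def)
  \<comment> \<open>\<open>k\<close> and \<open>B\<close> raise the barrier to at least
    \<open>M\<close> at time \<open>\<tau>\<close> and on the lateral boundary, while on the axis at
    the target time \<open>\<tau>'\<close> it costs only \<open>A\<close>. The constant
    \<open>M\<close> is too large for a maximum to occur at either place.\<close>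
  define k where "k = M / (A * (\<tau> - \<tau>'))"
  define B where "B = M / \<rho>\<^sup>2"
  have k: "0 < k" and B: "0 < B" using M A \<tau> \<rho> by (auto simp: k_def B_def)
  define F where "F z = w (?g z) - (l + 2 * \<eta>) * snd z - A * exp (k * (snd z - \<tau>')) - B * (norm (fst z))\<^sup>2" for z
  have "continuous_on ?Q F" unfolding F_def by (intro continuous_intros cw)
  moreover have "(0, 0) \<in> ?Q" using \<rho> \<tau> by simp
  ultimately obtain z0 where z0: "z0 \<in> ?Q" "\<And>z. z \<in> ?Q \<Longrightarrow> F z \<le> F z0"
    using continuous_attains_sup[OF cpt, of F] by blast
  obtain h0 s0 where hs: "z0 = (h0, s0)" by fastforce
  have h0: "norm h0 \<le> \<rho>" and s0: "0 \<le> s0" "s0 \<le> \<tau>" using z0(1) by (auto simp: hs)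
  have Fmax: "w (x, t) + 3 / 2 * \<eta> * \<tau>' \<le> F (h0, s0)"
  proof -
    have "F (0, \<tau>') = w (x, t) + 3 / 2 * \<eta> * \<tau>'"
      using gap by (simp add: F_def A_def algebra_simps)
    then show ?thesis using z0(2)[of "(0, \<tau>')"] \<tau> \<rho> by (simp add: hs)
  qed
  have pos: "0 < \<eta> * \<tau>'" using \<eta> \<tau> by simp
  have upper: "w (?g (h0, s0)) - (l + 2 * \<eta>) * s0 \<le> M + w (x, t) - 1"
  proof -
    have "- ((l + 2 * \<eta>) * s0) \<le> \<bar>l + 2 * \<eta>\<bar> * s0"
      using s0 by (metis abs_ge_minus_self abs_mult abs_of_nonneg)
    also have "\<dots> \<le> \<bar>l + 2 * \<eta>\<bar> * \<tau>" using s0 by (intro mult_left_mono) auto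
    finally show ?thesis using W[of "(h0, s0)"] z0(1) by (simp add: M_def hs abs_le_iff)
  qed
  have sq: "0 \<le> B * (norm h0)\<^sup>2" using B by simp
  have ex: "0 < A * exp (k * (s0 - \<tau>'))" using A by simp
  have s0_pos: "0 < s0"
  proof (rule ccontr)
    assume "\<not> 0 < s0"
    then have "s0 = 0" using s0 by simp
    then have "F (h0, s0) \<le> w (x + h0, t)" using ex sq by (simp add: F_def)
    also have "\<dots> \<le> w (x, t) + \<eta> * \<tau>'" using \<rho>3(2)[of h0] h0 \<rho> by simp
    finally show False using Fmax pos by simp
  qed
  have s0_less: "s0 < \<tau>"
  proof (rule ccontr)
    assume "\<not> s0 < \<tau>"
    then have "s0 = \<tau>" using s0 by simp
    moreover have "M \<le> A * exp (k * (\<tau> - \<tau>'))"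
    proof -
      have "M = A * (k * (\<tau> - \<tau>'))" using A \<tau> by (simp add: k_def)
      also have "\<dots> \<le> A * exp (k * (\<tau> - \<tau>'))"
        using A exp_ge_add_one_self[of "k * (\<tau> - \<tau>')"] by (intro mult_left_mono) linarith+
      finally show ?thesis .
    qed
    ultimately have "F (h0, s0) \<le> w (x, t) - 1" using upper sq by (simp add: F_def)
    then show False using Fmax pos by simp
  qed
  have h0_less: "norm h0 < \<rho>"
  proof (rule ccontr)
    assume "\<not> norm h0 < \<rho>"
    then have "norm h0 = \<rho>" using h0 by simp
    then have "B * (norm h0)\<^sup>2 = M" using \<rho> by (simp add: B_def)
    then have "F (h0, s0) \<le> w (x, t) - 1" using upper ex by (simp add: F_def)
    then show False using Fmax pos by simp
  qed
  define y0 where "y0 = x + s0 *\<^sub>R v + h0"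
  define p where "p = (2 * B) *\<^sub>R h0"
  define \<sigma> where "\<sigma> = l + 2 * \<eta> + A * k * exp (k * (s0 - \<tau>')) - p \<bullet> v"
  let ?\<phi> = "\<lambda>z. ((l + 2 * \<eta>) * (snd z - t) + A * exp (k * (snd z - t - \<tau>'))) +
    B * (norm (fst z - x - (snd z - t) *\<^sub>R v))\<^sup>2"
  have y0: "y0 \<in> \<Omega>" using \<rho>1(2)[of s0 h0] h0_less \<rho> s0 by (simp add: y0_def)
  have zin: "(y0, t + s0) \<in> \<Omega> \<times> {0<..}" using y0 s0_pos t by simp
  have "C1_with_gradient UNIV (\<lambda>z :: 'a \<times> real. (l + 2 * \<eta>) * (snd z - t) + A * exp (k * (snd z - t - \<tau>')))
    (\<lambda>z. (0, l + 2 * \<eta> + A * (exp (k * (snd z - t - \<tau>')) * k)))"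
    by (rule C1_snd[where f = "\<lambda>r. (l + 2 * \<eta>) * (r - t) + A * exp (k * (r - t - \<tau>'))"
          and f' = "\<lambda>r. l + 2 * \<eta> + A * (exp (k * (r - t - \<tau>')) * k)"])
       (auto intro!: derivative_eq_intros continuous_intros)
  note C1 = C1_add[OF this C1_cmult[OF C1_moving_square[of x t v], of B]]
  have grad: "(0, l + 2 * \<eta> + A * (exp (k * (snd (y0, t + s0) - t - \<tau>')) * k)) +
      B *\<^sub>R (2 *\<^sub>R (fst (y0, t + s0) - x - (snd (y0, t + s0) - t) *\<^sub>R v),
        - 2 * ((fst (y0, t + s0) - x - (snd (y0, t + s0) - t) *\<^sub>R v) \<bullet> v)) = (p, \<sigma>)"
    by (simp add: y0_def p_def \<sigma>_def algebra_simps)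
  have ev: "\<forall>\<^sub>F z in at (y0, t + s0) within \<Omega> \<times> {0<..}. w z - ?\<phi> z \<le> w (y0, t + s0) - ?\<phi> (y0, t + s0)"
  proof -
    have "((\<lambda>z :: 'a \<times> real. norm (fst z - x - (snd z - t) *\<^sub>R v)) \<longlongrightarrow> norm (y0 - x - s0 *\<^sub>R v)) (at (y0, t + s0) within \<Omega> \<times> {0<..})"
      by (auto intro!: tendsto_eq_intros)
    then have "\<forall>\<^sub>F z in at (y0, t + s0) within \<Omega> \<times> {0<..}. norm (fst z - x - (snd z - t) *\<^sub>R v) < \<rho>"
      by (rule order_tendstoD) (simp add: y0_def h0_less)
    moreover have lim: "((\<lambda>z :: 'a \<times> real. snd z - t) \<longlongrightarrow> s0) (at (y0, t + s0) within \<Omega> \<times> {0<..})"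
      by (auto intro!: tendsto_eq_intros)
    have "\<forall>\<^sub>F z :: 'a \<times> real in at (y0, t + s0) within \<Omega> \<times> {0<..}. 0 < snd z - t"
      using order_tendstoD(1)[OF lim s0_pos] .
    moreover have "\<forall>\<^sub>F z :: 'a \<times> real in at (y0, t + s0) within \<Omega> \<times> {0<..}. snd z - t < \<tau>"
      using order_tendstoD(2)[OF lim s0_less] .
    ultimately show ?thesis
    proof eventually_elim
      case (elim z)
      have "(fst z - x - (snd z - t) *\<^sub>R v, snd z - t) \<in> ?Q" using elim by simp
      from z0(2)[OF this] show ?case
        by (simp add: F_def hs y0_def algebra_simps)
    qed
  qed
  have ineq: "\<sigma> + K y0 p \<le> 0"
    using sub[unfolded viscosity_subsolution_def, rule_format, OF zin conjI[OF UNIV_I conjI[OF C1 ev]]]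
    unfolding grad by (simp add: evolution_operator_def)
  \<comment> \<open>The lower bound on the growth of \<open>w\<close> in time passes to the test
    function, and the equation turns it into an energy bound for \<open>p\<close>.\<close>
  have "- C \<le> (0, 1) \<bullet> (p, \<sigma>)"
  proof (rule touching_directional[OF C1 UNIV_I ev, unfolded grad])
    show "\<forall>\<^sub>F h in at_right 0. (y0, t + s0) + h *\<^sub>R (0, 1) \<in> \<Omega> \<times> {0<..}"
      using eventually_at_right_less[of 0] by eventually_elim (use y0 t s0_pos in auto)
    show "\<forall>\<^sub>F h in at_right 0. w (y0, t + s0) - C * h \<le> w ((y0, t + s0) + h *\<^sub>R (0, 1))"
      using eventually_at_right_less[of 0] by eventually_elim (use lower[of y0 "t + s0"] y0 t s0_pos in auto)
  qed
  then have "K y0 p \<le> C" using ineq by simp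
  then have pR: "norm p \<le> R" using coercive y0 by blast
  have "p \<bullet> v - K (x + s0 *\<^sub>R v) p \<le> l"
    using path[of s0] s0 pR by (simp add: admissible_def)
  moreover have "\<bar>K y0 p - K (x + s0 *\<^sub>R v) p\<bar> < \<eta>"
    using \<rho>2(2)[of y0 "x + s0 *\<^sub>R v" p] pR h0_less \<rho> by (simp add: y0_def)
  moreover have "0 < A * k * exp (k * (s0 - \<tau>'))" using A k by simp
  ultimately show False using ineq \<eta> unfolding \<sigma>_def by (simp add: abs_less_iff)
qed

lemma stepE:
  assumes "step \<Omega> H R x (\<tau>, \<Delta>, c)"
  obtains v l where "0 \<le> \<tau>" "\<Delta> = \<tau> *\<^sub>R v" "c = \<tau> * l"
    "\<And>s. s \<in> {0..\<tau>} \<Longrightarrow> x + s *\<^sub>R v \<in> \<Omega> \<and> admissible H R (x + s *\<^sub>R v) v l"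
proof -
  obtain \<tau>' v l where *: "0 \<le> \<tau>'" "(\<tau>, \<Delta>, c) = (\<tau>', \<tau>' *\<^sub>R v, \<tau>' * l)"
    "\<forall>s\<in>{0..\<tau>'}. x + s *\<^sub>R v \<in> \<Omega> \<and> admissible H R (x + s *\<^sub>R v) v l"
    using assms unfolding step_def by blast
  show ?thesis by (rule that[of v l]) (use * in blast)+
qed

lemma stepI:
  assumes "0 \<le> \<tau>" "\<And>s. 0 \<le> s \<Longrightarrow> s \<le> \<tau> \<Longrightarrow> x + s *\<^sub>R v \<in> \<Omega> \<and> admissible H R (x + s *\<^sub>R v) v l"
  shows "step \<Omega> H R x (\<tau>, \<tau> *\<^sub>R v, \<tau> * l)"
  unfolding step_def using assms by fastforce

definition step_subsolution ::
    "'a::real_inner set \<Rightarrow> ('a \<Rightarrow> 'a \<Rightarrow> real) \<Rightarrow> real \<Rightarrow> ('a \<times> real \<Rightarrow> real) \<Rightarrow> bool" where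
  "step_subsolution \<Omega> H R f \<longleftrightarrow> (\<forall>x \<tau> \<Delta> c t. step \<Omega> H R x (\<tau>, \<Delta>, c) \<longrightarrow> 0 \<le> t \<longrightarrow>
     f (x + \<Delta>, t + \<tau>) \<le> f (x, t) + c)"

lemma uniformly_continuous_on_cball_snd:
  assumes "uniformly_continuous_on (UNIV \<times> cball 0 R) (\<lambda>(x :: 'a::euclidean_space, p :: 'a). K x p :: real)" "0 < \<eta>"
  obtains d where "0 < d" "\<And>y z p. norm (y - z) < d \<Longrightarrow> norm p \<le> R \<Longrightarrow> \<bar>K y p - K z p\<bar> < \<eta>"
proof -
  obtain d where d: "0 < d" "\<And>z w. z \<in> UNIV \<times> cball 0 R \<Longrightarrow> w \<in> UNIV \<times> cball 0 R \<Longrightarrow>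
      dist w z < d \<Longrightarrow> dist (case w of (x, p) \<Rightarrow> K x p) (case z of (x, p) \<Rightarrow> K x p) < \<eta>"
    using assms unfolding uniformly_continuous_on_def by metis
  show ?thesis
  proof (rule that[OF d(1)])
    fix y z p :: 'a assume "norm (y - z) < d" "norm p \<le> R"
    then show "\<bar>K y p - K z p\<bar> < \<eta>"
      using d(2)[of "(z, p)" "(y, p)"] by (auto simp: dist_Pair_Pair dist_norm)
  qed
qed

text \<open>Interior times come from the barrier argument, the final time from continuity along the
  segment.\<close>

lemma viscosity_subsolution_imp_step:
  fixes w :: "'a::euclidean_space \<times> real \<Rightarrow> real"
  assumes "open \<Omega>" and K: "uniformly_continuous_on (UNIV \<times> cball 0 R) (\<lambda>(x, p). K x p)"
    and cont: "continuous_on (\<Omega> \<times> {0..}) w"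
    and sub: "viscosity_subsolution (\<Omega> \<times> {0<..}) (evolution_operator K) w"
    and lower: "\<And>x t h. x \<in> \<Omega> \<Longrightarrow> 0 < t \<Longrightarrow> 0 \<le> h \<Longrightarrow> w (x, t) - C * h \<le> w (x, t + h)"
    and coercive: "\<And>x p. x \<in> \<Omega> \<Longrightarrow> K x p \<le> C \<Longrightarrow> norm p \<le> R"
  shows "step_subsolution \<Omega> K R w"
  unfolding step_subsolution_def
proof (intro allI impI)
  fix x \<tau> \<Delta> c and t :: real
  assume st: "step \<Omega> K R x (\<tau>, \<Delta>, c)" and t: "0 \<le> t"
  from st obtain v l where v: "0 \<le> \<tau>" "\<Delta> = \<tau> *\<^sub>R v" "c = \<tau> * l"
    and path: "\<And>s. s \<in> {0..\<tau>} \<Longrightarrow> x + s *\<^sub>R v \<in> \<Omega> \<and> admissible K R (x + s *\<^sub>R v) v l"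
    by (rule stepE) blast
  show "w (x + \<Delta>, t + \<tau>) \<le> w (x, t) + c"
  proof (cases "\<tau> = 0")
    case True
    then show ?thesis using v by simp
  next
    case False
    then have \<tau>: "0 < \<tau>" using v by simp
    have cl: "closure {0<..<\<tau>} = {0..\<tau>}" using \<tau> by simp
    have "w (x + \<tau> *\<^sub>R v, t + \<tau>) - \<tau> * l \<le> w (x, t)"
    proof (rule continuous_le_on_closure[of "{0<..<\<tau>}" "\<lambda>s. w (x + s *\<^sub>R v, t + s) - s * l"])
      show "continuous_on (closure {0<..<\<tau>}) (\<lambda>s. w (x + s *\<^sub>R v, t + s) - s * l)"
        unfolding cl by (intro continuous_intros continuous_on_compose2[OF cont]) (use path t in auto)
      show "w (x + s *\<^sub>R v, t + s) - s * l \<le> w (x, t)" if "s \<in> {0<..<\<tau>}" for s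
      proof -
        have "w (x + s *\<^sub>R v, t + s) \<le> w (x, t) + s * l"
          by (rule viscosity_subsolution_step_strict[where \<tau> = \<tau>, OF assms path _ _ t]) (use that in auto)
        then show ?thesis by simp
      qed
    qed (use \<tau> in auto)
    then show ?thesis by (simp add: v)
  qed
qed

text \<open>The inequality is asked for one velocity per momentum, up to \<open>\<eta>\<close>, and
  only for \<open>norm p \<le> B\<close>: no other momenta occur as gradients of functions that
  touch an \<open>f\<close> with this Lipschitz constant from above.\<close>

lemma backward_inequality_viscosity_subsolution:
  fixes f :: "'a::euclidean_space \<times> real \<Rightarrow> real"
  assumes "open \<Omega>" "0 \<le> B"
    and lip: "\<And>x y t. x \<in> \<Omega> \<Longrightarrow> y \<in> \<Omega> \<Longrightarrow> 0 < t \<Longrightarrow> \<bar>f (x, t) - f (y, t)\<bar> \<le> B * norm (x - y)"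
    and bwd: "\<And>x t p \<eta>. x \<in> \<Omega> \<Longrightarrow> 0 < t \<Longrightarrow> norm p \<le> B \<Longrightarrow> 0 < \<eta> \<Longrightarrow>
      \<exists>q. \<forall>\<^sub>F \<tau> in at_right 0. f (x, t) \<le> f (x - \<tau> *\<^sub>R q, t - \<tau>) + \<tau> * (p \<bullet> q - K x p + \<eta>)"
  shows "viscosity_subsolution (\<Omega> \<times> {0<..}) (evolution_operator K) f"
  unfolding viscosity_subsolution_def
proof (intro ballI allI impI, elim conjE)
  fix z0 U \<phi> D\<phi>
  assume z0: "z0 \<in> \<Omega> \<times> {0<..}" "z0 \<in> U" and C1: "C1_with_gradient U \<phi> D\<phi>"
    and max: "\<forall>\<^sub>F z in at z0 within \<Omega> \<times> {0<..}. f z - \<phi> z \<le> f z0 - \<phi> z0"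
  obtain x t where xt: "z0 = (x, t)" "x \<in> \<Omega>" "0 < t" using z0 by auto
  obtain p \<sigma> where grad: "D\<phi> z0 = (p, \<sigma>)" by fastforce
  have op: "open (\<Omega> \<times> {0 :: real<..})" using assms(1) by (intro open_Times) auto
  have "norm (fst (D\<phi> z0)) \<le> B"
    by (rule touching_gradient_bound[OF C1 z0(2) op z0(1) max]) (use lip assms(2) in auto)
  then have p: "norm p \<le> B" by (simp add: grad)
  have "\<sigma> + K x p \<le> 0"
  proof (rule field_le_epsilon)
    fix \<eta> :: real assume "0 < \<eta>"
    from bwd[OF xt(2,3) p this] obtain q where
      q: "\<forall>\<^sub>F \<tau> in at_right 0. f (x, t) \<le> f (x - \<tau> *\<^sub>R q, t - \<tau>) + \<tau> * (p \<bullet> q - K x p + \<eta>)" by blast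
    have "- (p \<bullet> q - K x p + \<eta>) \<le> (- q, - 1) \<bullet> D\<phi> z0"
    proof (rule touching_directional[OF C1 z0(2) max])
      have "((\<lambda>h. z0 + h *\<^sub>R (- q, - 1)) \<longlongrightarrow> z0) (at_right 0)"
        by (auto intro!: tendsto_eq_intros simp: xt zero_prod_def[symmetric])
      then show "\<forall>\<^sub>F h in at_right 0. z0 + h *\<^sub>R (- q, - 1) \<in> \<Omega> \<times> {0<..}"
        using op z0(1) by (rule topological_tendstoD)
      show "\<forall>\<^sub>F h in at_right 0. f z0 - (p \<bullet> q - K x p + \<eta>) * h \<le> f (z0 + h *\<^sub>R (- q, - 1))"
        using q by eventually_elim (simp add: xt algebra_simps)
    qed
    then show "\<sigma> + K x p \<le> 0 + \<eta>" by (simp add: grad inner_commute)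
  qed
  then show "evolution_operator K z0 (D\<phi> z0) \<le> 0"
    unfolding grad by (simp add: evolution_operator_def xt)
qed

text \<open>If \<open>q\<close> is a subgradient of \<open>K x\<close> at \<open>p\<close>, the
  Legendre transform at \<open>q\<close> equals \<open>p \<bullet> q - K x p\<close>, so velocity
  \<open>q\<close> is the right one to test against \<open>p\<close>. Uniform continuity keeps this
  rate admissible near \<open>x\<close> after adding \<open>\<eta>\<close>.\<close>

lemma step_subsolution_imp_viscosity:
  fixes f :: "'a::euclidean_space \<times> real \<Rightarrow> real"
  assumes "open \<Omega>" "0 \<le> B"
    and K: "uniformly_continuous_on (UNIV \<times> cball 0 R) (\<lambda>(x, p). K x p)"
    and conv: "\<And>x. convex_on UNIV (K x)"
    and lip: "\<And>x y t. x \<in> \<Omega> \<Longrightarrow> y \<in> \<Omega> \<Longrightarrow> 0 < t \<Longrightarrow> \<bar>f (x, t) - f (y, t)\<bar> \<le> B * norm (x - y)"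
    and step: "step_subsolution \<Omega> K R f"
  shows "viscosity_subsolution (\<Omega> \<times> {0<..}) (evolution_operator K) f"
proof (rule backward_inequality_viscosity_subsolution[OF assms(1,2) lip])
  fix x p :: 'a and t \<eta> :: real
  assume x: "x \<in> \<Omega>" and t: "0 < t" and \<eta>: "0 < \<eta>"
  obtain q where q: "\<And>p'. K x p + q \<bullet> (p' - p) \<le> K x p'"
    using convex_subgradient[OF conv] by blast
  obtain d where d: "0 < d" "\<And>y z p. norm (y - z) < d \<Longrightarrow> norm p \<le> R \<Longrightarrow> \<bar>K y p - K z p\<bar> < \<eta>"
    using uniformly_continuous_on_cball_snd[OF K \<eta>] by blast
  obtain r where r: "0 < r" "ball x r \<subseteq> \<Omega>" using x assms(1) open_contains_ball by blast
  let ?l = "p \<bullet> q - K x p + \<eta>"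
  have adm: "z \<in> \<Omega> \<and> admissible K R z q ?l" if "norm (z - x) < min d r" for z
  proof
    show "z \<in> \<Omega>" using that r by (auto simp: dist_norm norm_minus_commute)
    show "admissible K R z q ?l"
      unfolding admissible_def
    proof (intro allI impI)
      fix p' :: 'a assume "norm p' \<le> R"
      then have "\<bar>K z p' - K x p'\<bar> < \<eta>" using d(2) that by simp
      then show "p' \<bullet> q - K z p' \<le> ?l"
        using q[of p'] by (simp add: inner_diff_right inner_commute abs_less_iff)
    qed
  qed
  have lim: "((\<lambda>\<tau>. \<tau> * norm q) \<longlongrightarrow> 0) (at_right 0)" by (auto intro!: tendsto_eq_intros)
  have "\<forall>\<^sub>F \<tau> in at_right 0. \<tau> * norm q < min d r"
    by (rule order_tendstoD(2)[OF lim]) (use d r in auto)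
  moreover have "\<forall>\<^sub>F \<tau> in at_right 0. \<tau> < t"
    using t by (intro order_tendstoD(2)[of "\<lambda>\<tau>. \<tau>" 0]) auto
  ultimately have "\<forall>\<^sub>F \<tau> in at_right 0. f (x, t) \<le> f (x - \<tau> *\<^sub>R q, t - \<tau>) + \<tau> * ?l"
    using eventually_at_right_less[of 0]
  proof eventually_elim
    case (elim \<tau>)
    have "step \<Omega> K R (x - \<tau> *\<^sub>R q) (\<tau>, \<tau> *\<^sub>R q, \<tau> * ?l)"
    proof (rule stepI)
      fix s assume s: "0 \<le> s" "s \<le> \<tau>"
      have "norm (x - \<tau> *\<^sub>R q + s *\<^sub>R q - x) = norm ((\<tau> - s) *\<^sub>R q)"
        by (simp add: scaleR_diff_left norm_minus_commute)
      also have "\<dots> \<le> \<tau> * norm q" using s by (auto intro!: mult_right_mono)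
      also have "\<dots> < min d r" using elim by simp
      finally have n: "norm (x - \<tau> *\<^sub>R q + s *\<^sub>R q - x) < min d r" .
      show "x - \<tau> *\<^sub>R q + s *\<^sub>R q \<in> \<Omega> \<and> admissible K R (x - \<tau> *\<^sub>R q + s *\<^sub>R q) q ?l"
        by (rule adm[OF n])
    qed (use elim in auto)
    then show ?case
      using step elim unfolding step_subsolution_def
      by (metis diff_add_cancel less_eq_real_def diff_ge_0_iff_ge)
  qed
  then show "\<exists>q. \<forall>\<^sub>F \<tau> in at_right 0. f (x, t) \<le> f (x - \<tau> *\<^sub>R q, t - \<tau>) + \<tau> * (p \<bullet> q - K x p + \<eta>)"
    by blast
qed

section \<open>Periodic domains\<close>

lemma integer_lattice_0 [simp]: "0 \<in> integer_lattice"
  by (simp add: integer_lattice_def)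

lemma integer_lattice_add: "y \<in> integer_lattice \<Longrightarrow> z \<in> integer_lattice \<Longrightarrow> y + z \<in> integer_lattice"
  by (simp add: integer_lattice_def)

lemma integer_lattice_minus: "z \<in> integer_lattice \<Longrightarrow> - z \<in> integer_lattice"
  by (simp add: integer_lattice_def)

lemma integer_lattice_diff: "y \<in> integer_lattice \<Longrightarrow> z \<in> integer_lattice \<Longrightarrow> y - z \<in> integer_lattice"
  by (simp add: integer_lattice_def)

lemma integer_lattice_of_nat: "z \<in> integer_lattice \<Longrightarrow> of_nat n *\<^sub>R z \<in> integer_lattice"
  by (simp add: integer_lattice_def)

lemma integer_lattice_axis: "axis i 1 \<in> integer_lattice"
  by (simp add: integer_lattice_def axis_def)

lemma translate_into_unit_cube:
  fixes x :: "real ^ 'n"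
  obtains z where "z \<in> integer_lattice" "x + z \<in> cbox 0 1"
proof
  show "(\<chi> i. - of_int \<lfloor>x $ i\<rfloor>) \<in> (integer_lattice :: (real ^ 'n) set)"
    by (simp add: integer_lattice_def)
  show "x + (\<chi> i. - of_int \<lfloor>x $ i\<rfloor>) \<in> cbox 0 1"
    by (simp add: mem_box_cart) linarith
qed

section \<open>Polygonal connections and their lengths\<close>

inductive connects :: "'a::real_normed_vector set \<Rightarrow> 'a \<Rightarrow> 'a \<Rightarrow> real \<Rightarrow> bool" for \<Omega> where
  connects_refl: "x \<in> \<Omega> \<Longrightarrow> connects \<Omega> x x 0"
| connects_segment: "connects \<Omega> x y l \<Longrightarrow> closed_segment y z \<subseteq> \<Omega> \<Longrightarrow> connects \<Omega> x z (l + dist y z)"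

lemma connects_nonneg: "connects \<Omega> x y l \<Longrightarrow> 0 \<le> l"
  by (induction rule: connects.induct) auto

lemma connects_trans: "connects \<Omega> y z m \<Longrightarrow> connects \<Omega> x y l \<Longrightarrow> connects \<Omega> x z (l + m)"
proof (induction rule: connects.induct)
  case (connects_segment u v m z)
  then show ?case using connects.connects_segment[of \<Omega> x v "l + m" z] by (simp add: add.assoc)
qed simp

lemma connects_single: "closed_segment x y \<subseteq> \<Omega> \<Longrightarrow> connects \<Omega> x y (dist x y)"
  using connects.connects_segment[OF connects.connects_refl, of x \<Omega> y] by auto

lemma connects_sym: "connects \<Omega> x y l \<Longrightarrow> connects \<Omega> y x l"
proof (induction rule: connects.induct)
  case (connects_segment x y l z)
  then have "connects \<Omega> z y (dist z y)"
    by (intro connects_single) (simp add: closed_segment_commute)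
  from connects_trans[OF connects_segment.IH this] show ?case
    by (simp add: dist_commute add.commute)
qed (rule connects.connects_refl)

lemma connects_translate:
  assumes "connects \<Omega> x y l" "\<And>u. u \<in> \<Omega> \<Longrightarrow> u + a \<in> \<Omega>"
  shows "connects \<Omega> (x + a) (y + a) l"
  using assms(1)
proof (induction rule: connects.induct)
  case (connects_refl x)
  then show ?case by (intro connects.connects_refl assms)
next
  case (connects_segment x y l z)
  have "closed_segment (y + a) (z + a) = (\<lambda>u. a + u) ` closed_segment y z"
    unfolding closed_segment_translation[symmetric] by (simp only: add.commute)
  then have "closed_segment (y + a) (z + a) \<subseteq> \<Omega>"
    using connects_segment.hyps assms(2) by (auto simp: add.commute)
  from connects.connects_segment[OF connects_segment.IH this] show ?case by simp
qed

lemma connected_imp_connects: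
  assumes "open \<Omega>" "connected \<Omega>" "x \<in> \<Omega>" "y \<in> \<Omega>"
  shows "\<exists>l. connects \<Omega> x y l"
proof (rule connected_equivalence_relation[OF assms(2,3,4), of "\<lambda>x y. \<exists>l. connects \<Omega> x y l"])
  show "\<exists>l. connects \<Omega> v u l" if "\<exists>l. connects \<Omega> u v l" for u v
    using that connects_sym by blast
  show "\<exists>l. connects \<Omega> u w l" if "\<exists>l. connects \<Omega> u v l" "\<exists>l. connects \<Omega> v w l" for u v w
    using that connects_trans by blast
  show "\<exists>T. openin (top_of_set \<Omega>) T \<and> a \<in> T \<and> (\<forall>x\<in>T. \<exists>l. connects \<Omega> a x l)" if a: "a \<in> \<Omega>" for a
  proof -
    obtain r where r: "0 < r" "ball a r \<subseteq> \<Omega>" using openE[OF assms(1) a] by auto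
    have "\<exists>l. connects \<Omega> a x l" if "x \<in> ball a r" for x
    proof (rule exI, rule connects_single)
      have "closed_segment a x \<subseteq> ball a r"
        using that r(1) by (intro closed_segment_subset convex_ball) auto
      then show "closed_segment a x \<subseteq> \<Omega>" using r(2) by blast
    qed
    moreover have "openin (top_of_set \<Omega>) (ball a r)"
      using r(2) by (intro open_subset) auto
    ultimately show ?thesis using r(1) by (intro exI[of _ "ball a r"] conjI ballI) auto
  qed
qed

locale periodic_domain =
  fixes \<Omega> :: "(real ^ 'n) set"
  assumes open_domain: "open \<Omega>" and connected_domain: "connected \<Omega>"
    and nonempty: "\<Omega> \<noteq> {}" and cone: "cone_condition \<Omega>"
    and periodic: "\<And>x z. x \<in> \<Omega> \<Longrightarrow> z \<in> integer_lattice \<Longrightarrow> x + z \<in> \<Omega>"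
begin

lemma closure_periodic:
  assumes "x \<in> closure \<Omega>" "z \<in> integer_lattice"
  shows "x + z \<in> closure \<Omega>"
proof -
  have "(\<lambda>u. z + u) ` closure \<Omega> = closure ((\<lambda>u. z + u) ` \<Omega>)"
    by (simp add: closure_translation)
  also have "\<dots> \<subseteq> closure \<Omega>"
    using periodic assms(2) by (intro closure_mono) (auto simp: add.commute)
  finally show ?thesis using assms(1) by (auto simp: add.commute)
qed

text \<open>The closed domain is compact modulo the lattice; this is how local constants become
  uniform ones.\<close>

lemma finite_periodic_cover:
  assumes "\<And>x. x \<in> closure \<Omega> \<Longrightarrow> 0 < r x"
  obtains F where "finite F" "F \<subseteq> closure \<Omega>"
    "\<And>y. y \<in> closure \<Omega> \<Longrightarrow> \<exists>z\<in>integer_lattice. \<exists>x\<in>F. y + z \<in> ball x (r x)"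
proof -
  have c1: "compact (closure \<Omega> \<inter> cbox 0 1)"
    by (intro closed_Int_compact) auto
  have c2: "closure \<Omega> \<inter> cbox 0 1 \<subseteq> (\<Union>x\<in>closure \<Omega> \<inter> cbox 0 1. ball x (r x))"
    using assms by auto
  obtain F where F: "F \<subseteq> closure \<Omega> \<inter> cbox 0 1" "finite F"
    "closure \<Omega> \<inter> cbox 0 1 \<subseteq> (\<Union>x\<in>F. ball x (r x))"
    by (rule compactE_image[OF c1 _ c2]) simp
  show ?thesis
  proof (rule that[OF F(2)])
    fix y assume y: "y \<in> closure \<Omega>"
    obtain z where z: "z \<in> integer_lattice" "y + z \<in> cbox 0 1" by (rule translate_into_unit_cube)
    then have "y + z \<in> closure \<Omega> \<inter> cbox 0 1" using closure_periodic y by blast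
    then show "\<exists>z\<in>integer_lattice. \<exists>x\<in>F. y + z \<in> ball x (r x)" using F(3) z(1) by blast
  qed (use F in blast)
qed

text \<open>Both points are lifted along the cone axis by \<open>k = dist u v / c\<close>, just high
  enough for the cone to contain the segment between the lifted points. The total length is thus
  proportional to \<open>dist u v\<close>.\<close>

lemma local_connection:
  assumes x: "x \<in> closure \<Omega>"
  obtains d K where "0 < d" "0 \<le> K"
    "\<And>u v. u \<in> \<Omega> \<Longrightarrow> v \<in> \<Omega> \<Longrightarrow> dist x u < d \<Longrightarrow> dist x v < d \<Longrightarrow> \<exists>l. connects \<Omega> u v l \<and> l \<le> K * dist u v"
proof -
  obtain e r c where erc: "0 < r" "0 < c"
    "\<And>y k w. y \<in> closure \<Omega> \<Longrightarrow> y \<in> ball x r \<Longrightarrow> 0 < k \<Longrightarrow> k < r \<Longrightarrow> norm w \<le> c \<Longrightarrow> y + k *\<^sub>R (e + w) \<in> \<Omega>"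
    using cone x unfolding cone_condition_def by (metis IntI)
  define d where "d = min r (c * r / 2)"
  have d: "0 < d" "d \<le> r" "2 * d \<le> c * r" using erc by (auto simp: d_def)
  show ?thesis
  proof (rule that[OF d(1)])
    show "0 \<le> 2 * norm e / c + 1" using erc by simp
    fix u v assume uv: "u \<in> \<Omega>" "v \<in> \<Omega>" "dist x u < d" "dist x v < d"
    show "\<exists>l. connects \<Omega> u v l \<and> l \<le> (2 * norm e / c + 1) * dist u v"
    proof (cases "u = v")
      case True
      then show ?thesis using uv connects.connects_refl by fastforce
    next
      case False
      define k where "k = dist u v / c"
      have "dist u v < 2 * d" using uv dist_triangle3[of u v x] by simp
      then have k: "0 < k" "k < r" using False erc d by (auto simp: k_def field_simps)
      have cl: "u \<in> closure \<Omega>" "v \<in> closure \<Omega>" "u \<in> ball x r" "v \<in> ball x r"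
        using uv closure_subset d by auto
      have up: "closed_segment a (a + k *\<^sub>R e) \<subseteq> \<Omega>" if a: "a \<in> \<Omega>" "a \<in> closure \<Omega>" "a \<in> ball x r" for a
      proof
        fix y assume "y \<in> closed_segment a (a + k *\<^sub>R e)"
        then obtain t where t: "0 \<le> t" "t \<le> 1" "y = a + (t * k) *\<^sub>R e"
          unfolding closed_segment_def by (auto simp: algebra_simps)
        show "y \<in> \<Omega>"
        proof (cases "t = 0")
          case True
          then show ?thesis using t a by simp
        next
          case False
          then have "0 < t * k" using t k by simp
          moreover have "t * k \<le> 1 * k" using t k by (intro mult_right_mono) auto
          then have "t * k < r" using k(2) by linarith
          ultimately have "0 < t * k" "t * k < r" .
          then show ?thesis using erc(3)[OF a(2,3), of "t * k" 0] t erc(2) by simp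
        qed
      qed
      have across: "closed_segment (u + k *\<^sub>R e) (v + k *\<^sub>R e) \<subseteq> \<Omega>"
      proof
        fix y assume "y \<in> closed_segment (u + k *\<^sub>R e) (v + k *\<^sub>R e)"
        then obtain t where t: "0 \<le> t" "t \<le> 1" "y = (1 - t) *\<^sub>R (u + k *\<^sub>R e) + t *\<^sub>R (v + k *\<^sub>R e)"
          unfolding closed_segment_def by auto
        then have "y = u + k *\<^sub>R (e + (t / k) *\<^sub>R (v - u))"
          using k by (simp add: algebra_simps)
        moreover have "norm ((t / k) *\<^sub>R (v - u)) \<le> c"
        proof -
          have "norm ((t / k) *\<^sub>R (v - u)) = t * c"
            using t(1) k False erc(2) by (simp add: k_def dist_norm norm_minus_commute)
          then show ?thesis using t erc by (simp add: mult_left_le_one_le)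
        qed
        ultimately show "y \<in> \<Omega>" using erc(3)[OF cl(1,3) k] by simp
      qed
      have 1: "connects \<Omega> u (u + k *\<^sub>R e) (k * norm e)"
        using connects_single[OF up[OF uv(1) cl(1,3)]] k by (simp add: dist_norm)
      have 2: "connects \<Omega> (u + k *\<^sub>R e) (v + k *\<^sub>R e) (dist u v)"
        using connects_single[OF across] by simp
      have 3: "connects \<Omega> (v + k *\<^sub>R e) v (k * norm e)"
        using connects_sym[OF connects_single[OF up[OF uv(2) cl(2,4)]]] k by (simp add: dist_norm)
      have "connects \<Omega> u v (k * norm e + dist u v + k * norm e)"
        using connects_trans[OF 3 connects_trans[OF 2 1]] .
      moreover have "k * norm e + dist u v + k * norm e = (2 * norm e / c + 1) * dist u v"
        using erc by (simp add: k_def field_simps)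
      ultimately show ?thesis by auto
    qed
  qed
qed

lemma quasiconvexity:
  obtains d K where "0 < d" "0 \<le> K"
    "\<And>u v. u \<in> \<Omega> \<Longrightarrow> v \<in> \<Omega> \<Longrightarrow> dist u v < d \<Longrightarrow> \<exists>l. connects \<Omega> u v l \<and> l \<le> K * dist u v"
proof -
  have "\<forall>x\<in>closure \<Omega>. \<exists>d K. 0 < d \<and> 0 \<le> K \<and> (\<forall>u v. u \<in> \<Omega> \<longrightarrow> v \<in> \<Omega> \<longrightarrow> dist x u < d \<longrightarrow> dist x v < d \<longrightarrow>
      (\<exists>l. connects \<Omega> u v l \<and> l \<le> K * dist u v))"
    using local_connection by (metis (no_types, lifting))
  then obtain d K where dK: "\<And>x. x \<in> closure \<Omega> \<Longrightarrow> 0 < d x" "\<And>x. x \<in> closure \<Omega> \<Longrightarrow> 0 \<le> K x"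
    "\<And>x u v. x \<in> closure \<Omega> \<Longrightarrow> u \<in> \<Omega> \<Longrightarrow> v \<in> \<Omega> \<Longrightarrow> dist x u < d x \<Longrightarrow> dist x v < d x \<Longrightarrow>
      \<exists>l. connects \<Omega> u v l \<and> l \<le> K x * dist u v"
    by metis
  obtain F where F: "finite F" "F \<subseteq> closure \<Omega>"
    "\<And>y. y \<in> closure \<Omega> \<Longrightarrow> \<exists>z\<in>integer_lattice. \<exists>x\<in>F. y + z \<in> ball x (d x / 2)"
    using finite_periodic_cover[of "\<lambda>x. d x / 2"] dK(1) by (metis half_gt_zero)
  \<comment> \<open>The cover uses half radii, so a point within \<open>d'\<close> of one in a half
    ball still lies in the full ball.\<close>
  define d' where "d' = Min (insert 1 ((\<lambda>x. d x / 2) ` F))"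
  define K' where "K' = Max (insert 0 (K ` F))"
  have d': "d' \<le> d x / 2" if "x \<in> F" for x
    unfolding d'_def using F that by (intro Min_le) auto
  have d'0: "0 < d'"
    unfolding d'_def using F dK(1) by (auto simp: Min_gr_iff)
  have K': "0 \<le> K'" "\<And>x. x \<in> F \<Longrightarrow> K x \<le> K'" unfolding K'_def using F by auto
  show ?thesis
  proof (rule that[OF d'0 K'(1)])
    fix u v assume uv: "u \<in> \<Omega>" "v \<in> \<Omega>" "dist u v < d'"
    obtain z x where zx: "z \<in> integer_lattice" "x \<in> F" "u + z \<in> ball x (d x / 2)"
      using F(3)[of u] uv closure_subset by blast
    have xu: "dist x (u + z) < d x / 2" using zx(3) by simp
    then have "dist x (u + z) < d x" using zero_le_dist[of x "u + z"] by linarith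
    moreover have "dist (u + z) (v + z) = dist u v" by simp
    then have "dist x (v + z) < d x"
      using xu uv(3) d'[OF zx(2)] dist_triangle[of x "v + z" "u + z"] by linarith
    ultimately obtain l where l: "connects \<Omega> (u + z) (v + z) l" "l \<le> K x * dist u v"
      using dK(3)[of x "u + z" "v + z"] F(2) zx periodic uv by auto
    have "connects \<Omega> (u + z + - z) (v + z + - z) l"
      using l(1) by (rule connects_translate) (use periodic integer_lattice_minus zx in blast)
    moreover have "K x * dist u v \<le> K' * dist u v" using K' zx by (intro mult_right_mono) auto
    ultimately show "\<exists>l. connects \<Omega> u v l \<and> l \<le> K' * dist u v" using l(2) by fastforce
  qed
qed

text \<open>Each ball of a finite cover has a hub. Every point reaches a hub after a lattice
  translation, and the finitely many hubs are connected pairwise because the domain is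
  connected.\<close>

lemma bounded_connection:
  obtains D where "0 \<le> D"
    "\<And>u v. u \<in> \<Omega> \<Longrightarrow> v \<in> \<Omega> \<Longrightarrow> \<exists>z\<in>integer_lattice. \<exists>l\<le>D. connects \<Omega> u (v + z) l"
proof -
  have "\<forall>x\<in>closure \<Omega>. \<exists>d a D. 0 < d \<and> a \<in> \<Omega> \<and> (\<forall>u\<in>\<Omega>. dist x u < d \<longrightarrow> (\<exists>l\<le>D. connects \<Omega> u a l))"
  proof
    fix x assume x: "x \<in> closure \<Omega>"
    obtain d K where dK: "0 < d" "0 \<le> K"
      "\<And>u v. u \<in> \<Omega> \<Longrightarrow> v \<in> \<Omega> \<Longrightarrow> dist x u < d \<Longrightarrow> dist x v < d \<Longrightarrow> \<exists>l. connects \<Omega> u v l \<and> l \<le> K * dist u v"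
      using local_connection[OF x] by blast
    obtain a where a: "a \<in> \<Omega>" "dist a x < d" using x dK(1) closure_approachable by blast
    have "\<exists>l\<le>K * (2 * d). connects \<Omega> u a l" if u: "u \<in> \<Omega>" "dist x u < d" for u
    proof -
      obtain l where l: "connects \<Omega> u a l" "l \<le> K * dist u a"
        using dK(3)[OF u(1) a(1) u(2)] a(2) by (auto simp: dist_commute)
      have "dist u a \<le> 2 * d" using dist_triangle3[of u a x] u a(2) by (simp add: dist_commute)
      then have "K * dist u a \<le> K * (2 * d)" using dK(2) by (rule mult_left_mono)
      then show ?thesis using l by (meson order_trans)
    qed
    then show "\<exists>d a D. 0 < d \<and> a \<in> \<Omega> \<and> (\<forall>u\<in>\<Omega>. dist x u < d \<longrightarrow> (\<exists>l\<le>D. connects \<Omega> u a l))"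
      using dK(1) a(1) by blast
  qed
  then obtain d a D where daD: "\<And>x. x \<in> closure \<Omega> \<Longrightarrow> 0 < d x" "\<And>x. x \<in> closure \<Omega> \<Longrightarrow> a x \<in> \<Omega>"
    "\<And>x u. x \<in> closure \<Omega> \<Longrightarrow> u \<in> \<Omega> \<Longrightarrow> dist x u < d x \<Longrightarrow> \<exists>l\<le>D x. connects \<Omega> u (a x) l"
    by metis
  obtain F where F: "finite F" "F \<subseteq> closure \<Omega>"
    "\<And>y. y \<in> closure \<Omega> \<Longrightarrow> \<exists>z\<in>integer_lattice. \<exists>x\<in>F. y + z \<in> ball x (d x)"
    using finite_periodic_cover[of d] daD(1) by metis
  define g where "g x y = (SOME l. connects \<Omega> (a x) (a y) l)" for x y
  have g: "connects \<Omega> (a x) (a y) (g x y)" if "x \<in> F" "y \<in> F" for x y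
    unfolding g_def by (rule someI_ex, rule connected_imp_connects[OF open_domain connected_domain])
      (use daD F that in blast)+
  define D' where "D' = Max (insert 0 (D ` F))"
  define G where "G = Max (insert 0 ((\<lambda>(x, y). g x y) ` (F \<times> F)))"
  have D': "0 \<le> D'" "\<And>x. x \<in> F \<Longrightarrow> D x \<le> D'" unfolding D'_def using F(1) by auto
  have G: "0 \<le> G" "\<And>x y. x \<in> F \<Longrightarrow> y \<in> F \<Longrightarrow> g x y \<le> G"
    unfolding G_def using F(1) by (auto intro!: Max_ge)
  show ?thesis
  proof (rule that[of "D' + G + D'"])
    fix u v assume uv: "u \<in> \<Omega>" "v \<in> \<Omega>"
    have near: "\<exists>z\<in>integer_lattice. \<exists>x\<in>F. \<exists>l\<le>D'. connects \<Omega> (u + z) (a x) l" if u: "u \<in> \<Omega>" for u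
    proof -
      obtain z x where zx: "z \<in> integer_lattice" "x \<in> F" "u + z \<in> ball x (d x)"
        using F(3)[of u] u closure_subset by blast
      obtain l where "l \<le> D x" "connects \<Omega> (u + z) (a x) l"
        using daD(3)[of x "u + z"] zx periodic[OF u zx(1)] F(2) by auto
      then show ?thesis using zx D'(2)[OF zx(2)] by (meson order_trans)
    qed
    obtain z1 x1 l1 where 1: "z1 \<in> integer_lattice" "x1 \<in> F" "l1 \<le> D'" "connects \<Omega> (u + z1) (a x1) l1"
      using near[OF uv(1)] by blast
    obtain z2 x2 l2 where 2: "z2 \<in> integer_lattice" "x2 \<in> F" "l2 \<le> D'" "connects \<Omega> (v + z2) (a x2) l2"
      using near[OF uv(2)] by blast
    have "connects \<Omega> (u + z1) (v + z2) (l1 + g x1 x2 + l2)"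
      using connects_trans[OF connects_sym[OF 2(4)] connects_trans[OF g[OF 1(2) 2(2)] 1(4)]] .
    then have "connects \<Omega> (u + z1 + - z1) (v + z2 + - z1) (l1 + g x1 x2 + l2)"
      by (rule connects_translate) (use periodic integer_lattice_minus 1 in blast)
    then have "connects \<Omega> u (v + (z2 - z1)) (l1 + g x1 x2 + l2)"
      by (simp add: algebra_simps)
    moreover have "l1 + g x1 x2 + l2 \<le> D' + G + D'" using 1 2 G(2)[OF 1(2) 2(2)] by simp
    moreover have "z2 - z1 \<in> integer_lattice" using 1 2 integer_lattice_diff by blast
    ultimately show "\<exists>z\<in>integer_lattice. \<exists>l\<le>D' + G + D'. connects \<Omega> u (v + z) l" by blast
  qed (use D' G in simp)
qed

end

section \<open>Paths and their increments\<close>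

locale periodic_hamiltonian = periodic_domain \<Omega> for \<Omega> :: "(real ^ 'n) set" +
  fixes H :: "real ^ 'n \<Rightarrow> real ^ 'n \<Rightarrow> real"
  assumes H_continuous: "continuous_on UNIV (\<lambda>(y, p). H y p)"
    and H_periodic: "\<And>y p z. z \<in> integer_lattice \<Longrightarrow> H (y + z) p = H y p"
    and H_coercive: "\<And>B. \<exists>R. \<forall>y p. H y p \<le> B \<longrightarrow> norm p \<le> R"
    and H_convex: "\<And>y. convex_on UNIV (H y)"
begin

lemma H_uniformly_continuous: "uniformly_continuous_on (UNIV \<times> cball 0 B) (\<lambda>(y, p). H y p)"
  unfolding uniformly_continuous_on_def
proof (intro allI impI)
  fix e :: real assume "0 < e"
  \<comment> \<open>The box exceeds the unit cube by one on every side, so it contains every point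
    at distance less than 1 from the translated one.\<close>
  let ?K = "cbox (- 1) (2 :: real ^ 'n) \<times> cball (0 :: real ^ 'n) B"
  have "uniformly_continuous_on ?K (\<lambda>(y, p). H y p)"
    by (intro compact_uniformly_continuous continuous_on_subset[OF H_continuous] compact_Times) auto
  then obtain d where d: "0 < d" "\<And>u v. u \<in> ?K \<Longrightarrow> v \<in> ?K \<Longrightarrow> dist v u < d \<Longrightarrow>
      dist (case v of (y, p) \<Rightarrow> H y p) (case u of (y, p) \<Rightarrow> H y p) < e"
    using \<open>0 < e\<close> unfolding uniformly_continuous_on_def by metis
  show "\<exists>d>0. \<forall>u\<in>UNIV \<times> cball 0 B. \<forall>v\<in>UNIV \<times> cball 0 B. dist v u < d \<longrightarrow>
      dist (case v of (y, p) \<Rightarrow> H y p) (case u of (y, p) \<Rightarrow> H y p) < e"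
  proof (intro exI[of _ "min d 1"] conjI ballI impI)
    fix u v :: "(real ^ 'n) \<times> (real ^ 'n)"
    assume uv: "u \<in> UNIV \<times> cball 0 B" "v \<in> UNIV \<times> cball 0 B" "dist v u < min d 1"
    obtain x p y q where xy: "u = (x, p)" "v = (y, q)" by (cases u, cases v)
    obtain z where z: "z \<in> integer_lattice" "x + z \<in> cbox 0 1" by (rule translate_into_unit_cube)
    have xz: "0 \<le> x $ i + z $ i \<and> x $ i + z $ i \<le> 1" for i
      using z(2) by (simp add: mem_box_cart)
    have "dist y x < 1" using uv(3) dist_fst_le[of v u] by (simp add: xy)
    then have near: "\<bar>y $ i - x $ i\<bar> < 1" for i
      using component_le_norm_cart[of "y - x" i] by (simp add: dist_norm)
    have "x + z \<in> cbox (- 1) 2" "y + z \<in> cbox (- 1) 2"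
      unfolding mem_box_cart using xz near by (auto simp: abs_less_iff) (smt (verit) xz near)+
    moreover have "dist (y + z, q) (x + z, p) < d"
      using uv(3) by (simp add: xy dist_Pair_Pair)
    ultimately have "dist (H (y + z) q) (H (x + z) p) < e"
      using d(2)[of "(x + z, p)" "(y + z, q)"] uv by (simp add: xy)
    then show "dist (case v of (y, p) \<Rightarrow> H y p) (case u of (y, p) \<Rightarrow> H y p) < e"
      using H_periodic[OF z(1)] by (simp add: xy)
  qed (use d in auto)
qed

lemma H_bounded: "\<exists>B\<ge>0. \<forall>y p. norm p \<le> R \<longrightarrow> \<bar>H y p\<bar> \<le> B"
proof -
  let ?K = "cbox 0 (1 :: real ^ 'n) \<times> cball (0 :: real ^ 'n) R"
  have "compact ((\<lambda>(y, p). H y p) ` ?K)"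
    by (intro compact_continuous_image continuous_on_subset[OF H_continuous] compact_Times) auto
  from compact_imp_bounded[OF this, unfolded bounded_iff]
  obtain B where B: "\<forall>h\<in>(\<lambda>(y, p). H y p) ` ?K. norm h \<le> B"
    by blast
  have "\<bar>H y p\<bar> \<le> max B 0" if p: "norm p \<le> R" for y p
  proof -
    obtain z where z: "z \<in> integer_lattice" "y + z \<in> cbox 0 1" by (rule translate_into_unit_cube)
    have "H (y + z) p \<in> (\<lambda>(y, p). H y p) ` ?K"
      by (rule image_eqI[where x = "(y + z, p)"]) (use z(2) p in auto)
    then have "norm (H (y + z) p) \<le> B" using B by blast
    then show ?thesis using H_periodic[OF z(1)] by simp
  qed
  then show ?thesis by (intro exI[of _ "max B 0"]) auto
qed

definition hmax :: "real \<Rightarrow> real" where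
  "hmax R = (SOME B. 0 \<le> B \<and> (\<forall>y p. norm p \<le> R \<longrightarrow> \<bar>H y p\<bar> \<le> B))"

lemma hmax: "0 \<le> hmax R" "norm p \<le> R \<Longrightarrow> \<bar>H y p\<bar> \<le> hmax R"
  using someI_ex[of "\<lambda>B. 0 \<le> B \<and> (\<forall>y p. norm p \<le> R \<longrightarrow> \<bar>H y p\<bar> \<le> B)"] H_bounded[of R]
  unfolding hmax_def by auto

lemma H_bounded_below: "\<exists>h\<ge>0. \<forall>y p. - h \<le> H y p"
proof -
  obtain R where R: "\<And>y p. H y p \<le> 0 \<Longrightarrow> norm p \<le> R" using H_coercive by blast
  have "- hmax R \<le> H y p" for y p
    using R[of y p] hmax(1)[of R] hmax(2)[of p R y] by (cases "H y p \<le> 0") auto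
  then show ?thesis using hmax(1) by blast
qed

definition hmin :: real where
  "hmin = (SOME h. 0 \<le> h \<and> (\<forall>y p. - h \<le> H y p))"

lemma hmin: "0 \<le> hmin" "- hmin \<le> H y p"
  using someI_ex[of "\<lambda>h. 0 \<le> h \<and> (\<forall>y p. - h \<le> H y p)"] H_bounded_below
  unfolding hmin_def by auto

lemma admissible_bounded_speed: "0 \<le> R \<Longrightarrow> norm v \<le> 1 \<Longrightarrow> admissible H R z v (R + hmin)"
  unfolding admissible_def
proof (intro allI impI)
  fix p :: "real ^ 'n" assume *: "0 \<le> R" "norm v \<le> 1" "norm p \<le> R"
  have "p \<bullet> v \<le> norm p * norm v" by (rule norm_cauchy_schwarz)
  also have "\<dots> \<le> R * 1" using * by (intro mult_mono) auto
  finally show "p \<bullet> v - H z p \<le> R + hmin" using hmin(2)[of z p] by simp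
qed

lemma admissible_rest: "admissible H R z 0 hmin"
  unfolding admissible_def using hmin(2) by (simp add: minus_le_iff)

text \<open>Testing with the momentum of norm \<open>R\<close> in the direction of \<open>v\<close>
  shows that the rate grows linearly in the speed with slope \<open>R\<close>. This slope later
  absorbs the Lipschitz constant of the data.\<close>

lemma admissible_lower:
  assumes "admissible H R z v l" "0 \<le> R"
  shows "R * norm v - hmax R \<le> l"
proof (cases "v = 0")
  case True
  have "0 \<bullet> v - H z 0 \<le> l" using assms unfolding admissible_def by (metis norm_zero)
  then show ?thesis using True hmax(2)[of 0 R z] assms(2) by simp
next
  case False
  let ?p = "(R / norm v) *\<^sub>R v"
  have "norm ?p \<le> R" using False assms(2) by simp
  then have "?p \<bullet> v - H z ?p \<le> l" "\<bar>H z ?p\<bar> \<le> hmax R"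
    using assms(1) hmax(2) unfolding admissible_def by blast+
  moreover have "?p \<bullet> v = R * norm v"
    using False by (simp add: power2_norm_eq_inner[symmetric] power2_eq_square)
  ultimately show ?thesis by simp
qed

text \<open>Only the total increment is kept. Sets of such increments can be added and halved as
  sets of vectors.\<close>

inductive path :: "real \<Rightarrow> real ^ 'n \<Rightarrow> real \<times> (real ^ 'n) \<times> real \<Rightarrow> bool" for R where
  path_refl: "x \<in> \<Omega> \<Longrightarrow> path R x 0"
| path_step: "path R x \<zeta> \<Longrightarrow> step \<Omega> H R (x + fst (snd \<zeta>)) \<sigma> \<Longrightarrow> path R x (\<zeta> + \<sigma>)"

lemma step_in:
  assumes "step \<Omega> H R x \<sigma>"
  shows "x \<in> \<Omega>" "x + fst (snd \<sigma>) \<in> \<Omega>" "0 \<le> fst \<sigma>"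
proof -
  obtain \<tau> \<Delta> c where \<sigma>: "\<sigma> = (\<tau>, \<Delta>, c)" by (cases \<sigma>)
  obtain v l where v: "0 \<le> \<tau>" "\<Delta> = \<tau> *\<^sub>R v" "c = \<tau> * l"
    "\<And>s. s \<in> {0..\<tau>} \<Longrightarrow> x + s *\<^sub>R v \<in> \<Omega> \<and> admissible H R (x + s *\<^sub>R v) v l"
    using assms unfolding \<sigma> by (rule stepE) blast
  show "x \<in> \<Omega>" "x + fst (snd \<sigma>) \<in> \<Omega>" "0 \<le> fst \<sigma>"
    using v(4)[of 0] v(4)[of \<tau>] v(1,2) by (auto simp: \<sigma>)
qed

lemma step_translate:
  assumes "step \<Omega> H R x \<sigma>" "z \<in> integer_lattice"
  shows "step \<Omega> H R (x + z) \<sigma>"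
proof -
  obtain \<tau> \<Delta> c where \<sigma>: "\<sigma> = (\<tau>, \<Delta>, c)" by (cases \<sigma>)
  obtain v l where v: "0 \<le> \<tau>" "\<Delta> = \<tau> *\<^sub>R v" "c = \<tau> * l"
    "\<And>s. s \<in> {0..\<tau>} \<Longrightarrow> x + s *\<^sub>R v \<in> \<Omega> \<and> admissible H R (x + s *\<^sub>R v) v l"
    using assms(1) unfolding \<sigma> by (rule stepE) blast
  have "x + z + s *\<^sub>R v \<in> \<Omega> \<and> admissible H R (x + z + s *\<^sub>R v) v l" if "0 \<le> s" "s \<le> \<tau>" for s
  proof -
    have "x + z + s *\<^sub>R v = x + s *\<^sub>R v + z" by simp
    moreover have "x + s *\<^sub>R v + z \<in> \<Omega> \<and> admissible H R (x + s *\<^sub>R v + z) v l"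
      using v(4)[of s] that periodic assms(2) H_periodic[OF assms(2)] by (simp add: admissible_def)
    ultimately show ?thesis by (simp only:)
  qed
  then show ?thesis unfolding \<sigma> v(2,3) by (intro stepI v(1))
qed

lemma substep:
  assumes "step \<Omega> H R x \<sigma>" "0 \<le> a" "0 \<le> b" "a + b \<le> 1"
  shows "step \<Omega> H R (x + a *\<^sub>R fst (snd \<sigma>)) (b *\<^sub>R \<sigma>)"
proof -
  obtain \<tau> \<Delta> c where \<sigma>: "\<sigma> = (\<tau>, \<Delta>, c)" by (cases \<sigma>)
  obtain v l where v: "0 \<le> \<tau>" "\<Delta> = \<tau> *\<^sub>R v" "c = \<tau> * l"
    "\<And>s. s \<in> {0..\<tau>} \<Longrightarrow> x + s *\<^sub>R v \<in> \<Omega> \<and> admissible H R (x + s *\<^sub>R v) v l"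
    using assms(1) unfolding \<sigma> by (rule stepE) blast
  have "step \<Omega> H R (x + (a * \<tau>) *\<^sub>R v) (b * \<tau>, (b * \<tau>) *\<^sub>R v, (b * \<tau>) * l)"
  proof (rule stepI)
    fix s assume s: "0 \<le> s" "s \<le> b * \<tau>"
    have "(a + b) * \<tau> \<le> 1 * \<tau>" using assms v(1) by (intro mult_right_mono) auto
    then have "a * \<tau> + s \<in> {0..\<tau>}" using s assms v(1) by (simp add: distrib_right)
    from v(4)[OF this] show "x + (a * \<tau>) *\<^sub>R v + s *\<^sub>R v \<in> \<Omega> \<and> admissible H R (x + (a * \<tau>) *\<^sub>R v + s *\<^sub>R v) v l"
      by (simp add: scaleR_add_left add.assoc)
  qed (use assms v in simp)
  then show ?thesis by (simp add: \<sigma> v mult.assoc)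
qed

lemma path_in:
  "path R x \<zeta> \<Longrightarrow> x \<in> \<Omega> \<and> x + fst (snd \<zeta>) \<in> \<Omega> \<and> 0 \<le> fst \<zeta>"
proof (induction rule: path.induct)
  case (path_step x \<zeta> \<sigma>)
  then show ?case using step_in[OF path_step.hyps(2)] by (auto simp: add.assoc)
qed auto

lemma path_trans: "path R y \<sigma> \<Longrightarrow> path R x \<zeta> \<Longrightarrow> y = x + fst (snd \<zeta>) \<Longrightarrow> path R x (\<zeta> + \<sigma>)"
proof (induction rule: path.induct)
  case (path_step y \<sigma> \<rho>)
  then have "step \<Omega> H R (x + fst (snd (\<zeta> + \<sigma>))) \<rho>" by (simp add: add.assoc)
  moreover have "path R x (\<zeta> + \<sigma>)" using path_step by blast
  ultimately have "path R x ((\<zeta> + \<sigma>) + \<rho>)" using path.path_step by blast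
  then show ?case by (simp only: add.assoc)
qed simp

lemma path_translate: "path R x \<zeta> \<Longrightarrow> z \<in> integer_lattice \<Longrightarrow> path R (x + z) \<zeta>"
proof (induction rule: path.induct)
  case (path_refl x)
  then show ?case by (intro path.path_refl periodic)
next
  case (path_step x \<zeta> \<sigma>)
  then have "step \<Omega> H R (x + z + fst (snd \<zeta>)) \<sigma>"
    using step_translate[of R "x + fst (snd \<zeta>)" \<sigma> z] by (simp add: algebra_simps)
  then show ?case using path_step by (intro path.path_step) auto
qed

lemma path_wait: "path R x \<zeta> \<Longrightarrow> 0 \<le> \<tau> \<Longrightarrow> path R x (\<zeta> + (\<tau>, 0, \<tau> * hmin))"
proof (rule path_step)
  assume *: "path R x \<zeta>" "0 \<le> \<tau>"
  have "step \<Omega> H R (x + fst (snd \<zeta>)) (\<tau>, \<tau> *\<^sub>R 0, \<tau> * hmin)"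
    using * path_in[OF *(1)] admissible_rest by (intro stepI) auto
  then show "step \<Omega> H R (x + fst (snd \<zeta>)) (\<tau>, 0, \<tau> * hmin)" by simp
qed

lemma path_cost_lower:
  "path R x \<zeta> \<Longrightarrow> 0 \<le> R \<Longrightarrow> R * norm (fst (snd \<zeta>)) - hmax R * fst \<zeta> \<le> snd (snd \<zeta>)"
proof (induction rule: path.induct)
  case (path_step x \<zeta> \<sigma>)
  obtain \<tau> \<Delta> c where \<sigma>: "\<sigma> = (\<tau>, \<Delta>, c)" by (cases \<sigma>)
  obtain v l where v: "0 \<le> \<tau>" "\<Delta> = \<tau> *\<^sub>R v" "c = \<tau> * l"
    "\<And>s. s \<in> {0..\<tau>} \<Longrightarrow> x + fst (snd \<zeta>) + s *\<^sub>R v \<in> \<Omega> \<and> admissible H R (x + fst (snd \<zeta>) + s *\<^sub>R v) v l"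
    using path_step.hyps(2) unfolding \<sigma> by (rule stepE) blast
  have "R * norm v - hmax R \<le> l" using v(4)[of 0] v(1) admissible_lower path_step.prems by auto
  then have "\<tau> * (R * norm v - hmax R) \<le> \<tau> * l" using v(1) by (rule mult_left_mono)
  moreover have "R * norm (fst (snd \<zeta>) + \<Delta>) \<le> R * (norm (fst (snd \<zeta>)) + norm \<Delta>)"
    using path_step.prems by (intro mult_left_mono norm_triangle_ineq)
  ultimately show ?case using path_step.IH[OF path_step.prems] v(1) by (simp add: \<sigma> v(2,3) algebra_simps)
qed simp

text \<open>Speed and rate are parameters: for fixed \<open>R\<close> unit speed is convenient,
  whereas coercivity of the effective Hamiltonian requires a rate that does not depend on
  \<open>R\<close>.\<close>

lemma connects_imp_path:
  assumes adm: "\<And>z v. norm v \<le> s \<Longrightarrow> admissible H R z v l" and "0 < s"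
  shows "connects \<Omega> x y m \<Longrightarrow> path R x (m / s, y - x, m / s * l)"
proof (induction rule: connects.induct)
  case (connects_refl x)
  then show ?case using path_refl by (simp add: zero_prod_def)
next
  case (connects_segment x y m z)
  show ?case
  proof (cases "z = y")
    case True
    then show ?thesis using connects_segment by simp
  next
    case False
    define v where "v = (s / dist y z) *\<^sub>R (z - y)"
    let ?\<tau> = "dist y z / s"
    have "norm v \<le> s" using \<open>0 < s\<close> False by (simp add: v_def dist_norm norm_minus_commute)
    have \<tau>v: "?\<tau> *\<^sub>R v = z - y" using \<open>0 < s\<close> False by (simp add: v_def)
    have "step \<Omega> H R y (?\<tau>, ?\<tau> *\<^sub>R v, ?\<tau> * l)"
    proof (rule stepI)
      fix r assume r: "0 \<le> r" "r \<le> ?\<tau>"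
      have "y + r *\<^sub>R v = (1 - r / ?\<tau>) *\<^sub>R y + (r / ?\<tau>) *\<^sub>R z"
        using \<open>0 < s\<close> False by (simp add: v_def algebra_simps)
      moreover have "0 \<le> r / ?\<tau>" "r / ?\<tau> \<le> 1"
        using r \<open>0 < s\<close> False by (auto simp: divide_le_eq pos_le_divide_eq)
      ultimately have "y + r *\<^sub>R v \<in> closed_segment y z" unfolding closed_segment_def by blast
      then show "y + r *\<^sub>R v \<in> \<Omega> \<and> admissible H R (y + r *\<^sub>R v) v l"
        using connects_segment.hyps adm[OF \<open>norm v \<le> s\<close>] by blast
    qed (use \<open>0 < s\<close> in simp)
    then have "path R x ((m / s, y - x, m / s * l) + (?\<tau>, z - y, ?\<tau> * l))"
      unfolding \<tau>v by (intro path_step connects_segment.IH) simp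
    then show ?thesis by (simp add: add_divide_distrib algebra_simps)
  qed
qed

lemma connects_dist: "connects \<Omega> x y m \<Longrightarrow> dist x y \<le> m"
proof (induction rule: connects.induct)
  case (connects_segment x y l z)
  then show ?case using dist_triangle[of x z y] by simp
qed simp

lemma connects_imp_path_unit:
  assumes "connects \<Omega> x y m" "0 \<le> R"
  shows "path R x (m, y - x, m * (R + hmin))" "norm (m, y - x, m * (R + hmin)) \<le> m * (2 + R + hmin)"
proof -
  show "path R x (m, y - x, m * (R + hmin))"
    using connects_imp_path[OF admissible_bounded_speed[OF assms(2)] zero_less_one assms(1)] by simp
  have m: "0 \<le> m" using assms(1) connects_nonneg by blast
  have "norm (m, y - x, m * (R + hmin)) \<le> norm m + (norm (y - x) + norm (m * (R + hmin)))"
    using norm_Pair_le[of m "(y - x, m * (R + hmin))"] norm_Pair_le[of "y - x" "m * (R + hmin)"] by linarith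
  also have "\<dots> \<le> m + (m + m * (R + hmin))"
    using connects_dist[OF assms(1)] m assms(2) hmin(1) by (simp add: dist_norm norm_minus_commute abs_mult)
  finally show "norm (m, y - x, m * (R + hmin)) \<le> m * (2 + R + hmin)" by (simp add: algebra_simps)
qed

lemma bounded_path_connection:
  assumes "0 \<le> R"
  obtains D where "0 \<le> D" "\<And>u v. u \<in> \<Omega> \<Longrightarrow> v \<in> \<Omega> \<Longrightarrow>
    \<exists>z\<in>integer_lattice. \<exists>\<zeta>. path R u \<zeta> \<and> u + fst (snd \<zeta>) = v + z \<and> norm \<zeta> \<le> D"
proof -
  obtain D where D: "0 \<le> D"
    "\<And>u v. u \<in> \<Omega> \<Longrightarrow> v \<in> \<Omega> \<Longrightarrow> \<exists>z\<in>integer_lattice. \<exists>l\<le>D. connects \<Omega> u (v + z) l"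
    using bounded_connection by blast
  show ?thesis
  proof (rule that[of "D * (2 + R + hmin)"])
    fix u v assume "u \<in> \<Omega>" "v \<in> \<Omega>"
    then obtain z l where z: "z \<in> integer_lattice" "l \<le> D" "connects \<Omega> u (v + z) l" using D(2) by blast
    have "l * (2 + R + hmin) \<le> D * (2 + R + hmin)"
      using z(2) assms hmin(1) by (intro mult_right_mono) auto
    then show "\<exists>z\<in>integer_lattice. \<exists>\<zeta>. path R u \<zeta> \<and> u + fst (snd \<zeta>) = v + z \<and> norm \<zeta> \<le> D * (2 + R + hmin)"
      using connects_imp_path_unit[OF z(3) assms] z(1) by (intro bexI[of _ z] exI conjI) auto
  qed (use D assms hmin in auto)
qed

lemma step_subsolution_path:
  assumes "step_subsolution \<Omega> H R f"
  shows "path R x \<zeta> \<Longrightarrow> 0 \<le> t \<Longrightarrow> f (x + fst (snd \<zeta>), t + fst \<zeta>) \<le> f (x, t) + snd (snd \<zeta>)"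
proof (induction rule: path.induct)
  case (path_step x \<zeta> \<sigma>)
  have "f (x + fst (snd \<zeta>) + fst (snd \<sigma>), t + fst \<zeta> + fst \<sigma>) \<le> f (x + fst (snd \<zeta>), t + fst \<zeta>) + snd (snd \<sigma>)"
    using assms path_step.hyps path_in[OF path_step.hyps(1)] path_step.prems
    unfolding step_subsolution_def by (metis add_nonneg_nonneg prod.collapse)
  then show ?case using path_step by (simp add: algebra_simps)
qed simp

end

lemma nonpos_if_linear_bounded:
  fixes a :: real
  assumes "\<And>s. 0 \<le> s \<Longrightarrow> s * a \<le> B"
  shows "a \<le> 0"
proof (rule ccontr)
  assume "\<not> a \<le> 0"
  then have "(\<bar>B\<bar> + 1) / a * a \<le> B" by (intro assms) auto
  then show False using \<open>\<not> a \<le> 0\<close> by simp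
qed

section \<open>Sets closed under sums and halves up to a bounded error\<close>

locale approximate_halving_set =
  fixes P :: "'e::real_normed_vector set" and C :: real
  assumes C_nonneg: "0 \<le> C" and zero_in: "0 \<in> P"
    and approx_add: "\<And>z w. z \<in> P \<Longrightarrow> w \<in> P \<Longrightarrow> \<exists>u\<in>P. norm (u - (z + w)) \<le> C"
    and approx_half: "\<And>z. z \<in> P \<Longrightarrow> \<exists>u\<in>P. norm (u - (1 / 2) *\<^sub>R z) \<le> C"
begin

text \<open>Each halving also halves the error made so far, so the errors sum to at most
  \<open>2 * C\<close> for every \<open>k\<close>.\<close>

lemma iterated_half: "z \<in> P \<Longrightarrow> \<exists>u\<in>P. norm (u - (1 / 2 ^ k) *\<^sub>R z) \<le> 2 * C"
proof (induction k)
  case 0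
  then show ?case using C_nonneg by (intro bexI[of _ z]) auto
next
  case (Suc k)
  then obtain u where u: "u \<in> P" "norm (u - (1 / 2 ^ k) *\<^sub>R z) \<le> 2 * C" by blast
  obtain w where w: "w \<in> P" "norm (w - (1 / 2) *\<^sub>R u) \<le> C" using approx_half[OF u(1)] by blast
  have "w - (1 / 2 ^ Suc k) *\<^sub>R z = (w - (1 / 2) *\<^sub>R u) + (1 / 2) *\<^sub>R (u - (1 / 2 ^ k) *\<^sub>R z)"
    by (simp add: algebra_simps)
  then have "norm (w - (1 / 2 ^ Suc k) *\<^sub>R z) \<le> norm (w - (1 / 2) *\<^sub>R u) + norm ((1 / 2) *\<^sub>R (u - (1 / 2 ^ k) *\<^sub>R z))"
    by (simp only: norm_triangle_ineq)
  also have "\<dots> \<le> C + (1 / 2) * (2 * C)" using w u by simp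
  finally show ?case using w(1) by auto
qed

text \<open>The directions whose whole ray stays within a fixed distance of \<open>P\<close>. The
  distance is what iterated halving contributes, plus 1 for a remainder that can be made
  small.\<close>

definition cone_hull :: "'e set" where
  "cone_hull = {\<zeta>. \<forall>s\<ge>0. \<exists>z\<in>P. norm (z - s *\<^sub>R \<zeta>) \<le> 2 * C + 1}"

text \<open>Error bounds improve themselves: approximate a far multiple with error \<open>B\<close>
  and halve \<open>k\<close> times. This shrinks \<open>B\<close> to at most 1 and adds at most
  \<open>2 * C\<close>, however large \<open>B\<close> was.\<close>

lemma cone_hull_from_dyadic:
  assumes "\<And>s k :: nat. \<And>r. 0 \<le> r \<Longrightarrow> \<exists>z\<in>P. norm (z - (2 ^ k * r) *\<^sub>R \<zeta>) \<le> B"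
  shows "\<zeta> \<in> cone_hull"
  unfolding cone_hull_def
proof (intro CollectI allI impI)
  fix s :: real assume s: "0 \<le> s"
  obtain k :: nat where k: "B < 2 ^ k" using real_arch_pow[of 2 B] by auto
  obtain z where z: "z \<in> P" "norm (z - (2 ^ k * s) *\<^sub>R \<zeta>) \<le> B" using assms[OF s] by blast
  obtain u where u: "u \<in> P" "norm (u - (1 / 2 ^ k) *\<^sub>R z) \<le> 2 * C" using iterated_half[OF z(1)] by blast
  have "u - s *\<^sub>R \<zeta> = (u - (1 / 2 ^ k) *\<^sub>R z) + (1 / 2 ^ k) *\<^sub>R (z - (2 ^ k * s) *\<^sub>R \<zeta>)"
    by (simp add: scaleR_diff_right)
  then have "norm (u - s *\<^sub>R \<zeta>) \<le> norm (u - (1 / 2 ^ k) *\<^sub>R z) + norm ((1 / 2 ^ k) *\<^sub>R (z - (2 ^ k * s) *\<^sub>R \<zeta>))"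
    by (simp only: norm_triangle_ineq)
  also have "\<dots> \<le> 2 * C + 1"
  proof (rule add_mono[OF u(2)])
    have "norm ((1 / 2 ^ k) *\<^sub>R (z - (2 ^ k * s) *\<^sub>R \<zeta>)) = norm (z - (2 ^ k * s) *\<^sub>R \<zeta>) / 2 ^ k" by simp
    also have "\<dots> \<le> 1" using z(2) k by (simp add: divide_le_eq)
    finally show "norm ((1 / 2 ^ k) *\<^sub>R (z - (2 ^ k * s) *\<^sub>R \<zeta>)) \<le> 1" .
  qed
  finally show "\<exists>z\<in>P. norm (z - s *\<^sub>R \<zeta>) \<le> 2 * C + 1" using u(1) by blast
qed

lemma cone_hull_scale: "\<zeta> \<in> cone_hull \<Longrightarrow> 0 \<le> c \<Longrightarrow> c *\<^sub>R \<zeta> \<in> cone_hull"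
  unfolding cone_hull_def by auto

lemma cone_hull_add:
  assumes "\<zeta> \<in> cone_hull" "\<xi> \<in> cone_hull"
  shows "\<zeta> + \<xi> \<in> cone_hull"
proof (rule cone_hull_from_dyadic[where B = "(2 * C + 1) + (2 * C + 1) + C"])
  fix k :: nat and r :: real assume "0 \<le> r"
  then have r: "0 \<le> 2 ^ k * r" by simp
  let ?r = "2 ^ k * r"
  obtain z w where zw: "z \<in> P" "norm (z - ?r *\<^sub>R \<zeta>) \<le> 2 * C + 1" "w \<in> P" "norm (w - ?r *\<^sub>R \<xi>) \<le> 2 * C + 1"
    using assms r unfolding cone_hull_def by blast
  obtain u where u: "u \<in> P" "norm (u - (z + w)) \<le> C" using approx_add[OF zw(1,3)] by blast
  have "norm (u - ?r *\<^sub>R (\<zeta> + \<xi>)) = norm ((u - (z + w)) + ((z - ?r *\<^sub>R \<zeta>) + (w - ?r *\<^sub>R \<xi>)))"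
    by (simp add: algebra_simps)
  then have "norm (u - ?r *\<^sub>R (\<zeta> + \<xi>)) \<le> norm (u - (z + w)) + (norm (z - ?r *\<^sub>R \<zeta>) + norm (w - ?r *\<^sub>R \<xi>))"
    using norm_triangle_ineq[of "u - (z + w)" "(z - ?r *\<^sub>R \<zeta>) + (w - ?r *\<^sub>R \<xi>)"]
      norm_triangle_ineq[of "z - ?r *\<^sub>R \<zeta>" "w - ?r *\<^sub>R \<xi>"] by linarith
  then show "\<exists>z\<in>P. norm (z - ?r *\<^sub>R (\<zeta> + \<xi>)) \<le> (2 * C + 1) + (2 * C + 1) + C"
    using u zw by (intro bexI[of _ u]) linarith+
qed

text \<open>Rounding a real multiple down to an integer one costs at most
  \<open>norm \<zeta>\<close>, a bound that is then improved automatically.\<close>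

lemma cone_hull_multiples:
  assumes "\<And>m :: nat. of_nat m *\<^sub>R \<zeta> \<in> P"
  shows "\<zeta> \<in> cone_hull"
proof (rule cone_hull_from_dyadic[where B = "norm \<zeta>"])
  fix k :: nat and r :: real assume "0 \<le> r"
  let ?r = "2 ^ k * r"
  let ?m = "nat \<lfloor>?r\<rfloor>"
  have r: "0 \<le> ?r" using \<open>0 \<le> r\<close> by simp
  have "\<bar>of_nat ?m - ?r\<bar> \<le> 1" using r by linarith
  then have "norm ((of_nat ?m - ?r) *\<^sub>R \<zeta>) \<le> 1 * norm \<zeta>"
    unfolding norm_scaleR by (intro mult_right_mono) auto
  then show "\<exists>z\<in>P. norm (z - ?r *\<^sub>R \<zeta>) \<le> norm \<zeta>"
    using assms[of ?m] by (intro bexI[of _ "of_nat ?m *\<^sub>R \<zeta>"]) (simp_all add: scaleR_diff_left)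
qed

end

section \<open>Halving the increments of paths\<close>

context periodic_hamiltonian
begin

definition increments :: "real \<Rightarrow> (real \<times> (real ^ 'n) \<times> real) set" where
  "increments R = {\<zeta>. \<exists>x. path R x \<zeta>}"

text \<open>\<open>\<xi> i\<close> is the increment accumulated after \<open>i\<close> steps. The
  norm bound 1 on single steps is the one required for halving a sequence of vectors.\<close>

definition small_steps :: "real \<Rightarrow> real ^ 'n \<Rightarrow> nat \<Rightarrow> (nat \<Rightarrow> real \<times> (real ^ 'n) \<times> real) \<Rightarrow> bool" where
  "small_steps R x N \<xi> \<longleftrightarrow> \<xi> 0 = 0 \<and> (\<forall>i<N. norm (\<xi> (Suc i) - \<xi> i) \<le> 1 \<and>
     step \<Omega> H R (x + fst (snd (\<xi> i))) (\<xi> (Suc i) - \<xi> i))"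

lemma small_steps_extend:
  assumes "small_steps R x N \<xi>" "norm \<sigma> \<le> 1" "step \<Omega> H R (x + fst (snd (\<xi> N))) \<sigma>"
  shows "small_steps R x (Suc N) (\<xi>(Suc N := \<xi> N + \<sigma>))"
  using assms unfolding small_steps_def by (auto simp: less_Suc_eq)

lemma small_steps_extend_long:
  assumes "small_steps R x N \<xi>" "step \<Omega> H R (x + fst (snd (\<xi> N))) \<sigma>"
  shows "\<exists>N' \<xi>'. small_steps R x N' \<xi>' \<and> \<xi>' N' = \<xi> N + \<sigma>"
proof -
  define M where "M = Suc (nat \<lceil>norm \<sigma>\<rceil>)"
  have M: "0 < M" "norm \<sigma> \<le> real M" unfolding M_def by (simp, linarith)
  have "\<exists>N' \<xi>'. small_steps R x N' \<xi>' \<and> \<xi>' N' = \<xi> N + (real k / real M) *\<^sub>R \<sigma>" if "k \<le> M" for k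
    using that
  proof (induction k)
    case 0
    then show ?case using assms(1) by auto
  next
    case (Suc k)
    then obtain N' \<xi>' where IH: "small_steps R x N' \<xi>'" "\<xi>' N' = \<xi> N + (real k / real M) *\<^sub>R \<sigma>" by auto
    have "step \<Omega> H R (x + fst (snd (\<xi> N)) + (real k / real M) *\<^sub>R fst (snd \<sigma>)) ((1 / real M) *\<^sub>R \<sigma>)"
      using Suc.prems M by (intro substep[OF assms(2)]) (auto simp: field_simps)
    then have "step \<Omega> H R (x + fst (snd (\<xi>' N'))) ((1 / real M) *\<^sub>R \<sigma>)"
      by (simp add: IH(2) add.assoc)
    moreover have "norm ((1 / real M) *\<^sub>R \<sigma>) \<le> 1" using M by (simp add: divide_le_eq)
    ultimately have "small_steps R x (Suc N') (\<xi>'(Suc N' := \<xi>' N' + (1 / real M) *\<^sub>R \<sigma>))"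
      using small_steps_extend[OF IH(1)] by blast
    moreover have "\<xi>' N' + (1 / real M) *\<^sub>R \<sigma> = \<xi> N + (real (Suc k) / real M) *\<^sub>R \<sigma>"
      by (simp add: IH(2) add_divide_distrib scaleR_add_left add.assoc add.commute)
    ultimately show ?case by (metis fun_upd_same)
  qed
  from this[of M] show ?thesis using M by simp
qed

lemma path_refinement:
  "path R x \<zeta> \<Longrightarrow> \<exists>N \<xi>. small_steps R x N \<xi> \<and> \<xi> N = \<zeta>"
proof (induction rule: path.induct)
  case (path_refl x)
  then show ?case by (intro exI[of _ 0] exI[of _ "\<lambda>_. 0"]) (simp add: small_steps_def)
next
  case (path_step x \<zeta> \<sigma>)
  then show ?case using small_steps_extend_long by metis
qed

lemma sign_changes_mono: "m \<le> n \<Longrightarrow> sign_changes m s \<le> sign_changes n s"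
  unfolding sign_changes_def by (intro card_mono) auto

lemma sign_changes_Suc:
  assumes "0 < m" "s (m - 1) \<noteq> s m"
  shows "sign_changes (Suc m) s = sign_changes m s + 1"
proof -
  have "{j. Suc j < Suc m \<and> s j \<noteq> s (Suc j)} = insert (m - 1) {j. Suc j < m \<and> s j \<noteq> s (Suc j)}"
    using assms by (auto simp: less_Suc_eq)
  then show ?thesis
    unfolding sign_changes_def by (simp only:) (subst card_insert_disjoint, use assms in auto)
qed

text \<open>Only the selected steps are performed. Within a block they continue each other up to a
  lattice translation. When a new block begins after a gap, a connection of norm at most
  \<open>D\<close> is inserted, and the sign change at that place pays for it. The last clause says
  when the current endpoint can be continued directly.\<close>

lemma collect_blocks:
  assumes D: "0 \<le> D" "\<And>u v. u \<in> \<Omega> \<Longrightarrow> v \<in> \<Omega> \<Longrightarrow>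
      \<exists>z\<in>integer_lattice. \<exists>\<zeta>. path R u \<zeta> \<and> u + fst (snd \<zeta>) = v + z \<and> norm \<zeta> \<le> D"
    and x: "x \<in> \<Omega>" and \<xi>: "small_steps R x N \<xi>" and m: "m \<le> N"
  shows "\<exists>y z. path R y z \<and>
    norm (z - (\<Sum>j<m. if s j then \<xi> (Suc j) - \<xi> j else 0)) \<le> D * real (sign_changes m s) \<and>
    ((m = 0 \<or> s (m - 1)) \<longrightarrow> (\<exists>k\<in>integer_lattice. y + fst (snd z) = x + fst (snd (\<xi> m)) + k))"
  using m
proof (induction m)
  case 0
  show ?case
    by (rule exI[of _ x], rule exI[of _ 0]) (use \<xi> x path_refl D(1) in \<open>auto simp: small_steps_def intro!: bexI[of _ 0]\<close>)
next
  case (Suc m)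
  let ?S = "\<lambda>m. \<Sum>j<m. if s j then \<xi> (Suc j) - \<xi> j else 0"
  obtain y z where yz: "path R y z" "norm (z - ?S m) \<le> D * real (sign_changes m s)"
    "(m = 0 \<or> s (m - 1)) \<longrightarrow> (\<exists>k\<in>integer_lattice. y + fst (snd z) = x + fst (snd (\<xi> m)) + k)"
    using Suc by auto
  have mono: "D * real (sign_changes m s) \<le> D * real (sign_changes (Suc m) s)"
    using D(1) sign_changes_mono[of m "Suc m" s] by (intro mult_left_mono) auto
  show ?case
  proof (cases "s m")
    case False
    then show ?thesis using yz mono by (intro exI[of _ y] exI[of _ z]) auto
  next
    case True
    define \<sigma> where "\<sigma> = \<xi> (Suc m) - \<xi> m"
    have st: "step \<Omega> H R (x + fst (snd (\<xi> m))) \<sigma>"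
      using \<xi> Suc.prems by (simp add: small_steps_def \<sigma>_def)
    have fin: ?thesis if y: "path R y z'" "norm (z' - ?S m) \<le> D * real (sign_changes (Suc m) s)"
        "k \<in> integer_lattice" "y + fst (snd z') = x + fst (snd (\<xi> m)) + k" for z' k
    proof (rule exI[of _ y], rule exI[of _ "z' + \<sigma>"], intro conjI impI)
      show "path R y (z' + \<sigma>)"
        using y(1) step_translate[OF st y(3)] by (intro path_step) (simp_all add: y(4))
      show "norm (z' + \<sigma> - ?S (Suc m)) \<le> D * real (sign_changes (Suc m) s)"
        using y(2) True by (simp add: \<sigma>_def)
      show "\<exists>k\<in>integer_lattice. y + fst (snd (z' + \<sigma>)) = x + fst (snd (\<xi> (Suc m))) + k"
      proof (rule bexI[OF _ y(3)])
        have "y + fst (snd (z' + \<sigma>)) = (y + fst (snd z')) + fst (snd \<sigma>)" by (simp add: add.assoc)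
        also have "\<dots> = x + fst (snd (\<xi> (Suc m))) + k" by (simp add: y(4) \<sigma>_def)
        finally show "y + fst (snd (z' + \<sigma>)) = x + fst (snd (\<xi> (Suc m))) + k" .
      qed
    qed
    show ?thesis
    proof (cases "m = 0 \<or> s (m - 1)")
      case True
      then show ?thesis using yz mono fin by (meson order_trans)
    next
      case False
      have "y + fst (snd z) \<in> \<Omega>" "x + fst (snd (\<xi> m)) \<in> \<Omega>"
        using path_in[OF yz(1)] step_in[OF st] by auto
      then obtain k \<zeta> where k: "k \<in> integer_lattice" "path R (y + fst (snd z)) \<zeta>"
        "y + fst (snd z) + fst (snd \<zeta>) = x + fst (snd (\<xi> m)) + k" "norm \<zeta> \<le> D"
        using D(2) by blast
      show ?thesis
      proof (rule fin[of "z + \<zeta>" k])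
        show "path R y (z + \<zeta>)" using path_trans[OF k(2) yz(1)] by simp
        have "norm (z + \<zeta> - ?S m) \<le> norm (z - ?S m) + norm \<zeta>"
          using norm_triangle_ineq[of "z - ?S m" \<zeta>] by (simp add: algebra_simps)
        also have "\<dots> \<le> D * real (sign_changes m s) + D" using yz(2) k(4) by simp
        also have "\<dots> = D * real (sign_changes (Suc m) s)"
          using sign_changes_Suc[of m s] False True by (simp add: distrib_left)
        finally show "norm (z + \<zeta> - ?S m) \<le> D * real (sign_changes (Suc m) s)" .
        show "y + fst (snd (z + \<zeta>)) = x + fst (snd (\<xi> m)) + k" using k(3) by (simp add: add.assoc)
      qed (rule k(1))
    qed
  qed
qed

text \<open>
  A sign pattern with few changes halves the small steps of a path up to a bounded error. The
  selected blocks are joined by bounded connections modulo the lattice, so they form a path again.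
\<close>

lemma increments_halving:
  assumes "0 \<le> R"
  obtains C where "approximate_halving_set (increments R) C"
proof -
  obtain D where D: "0 \<le> D" "\<And>u v. u \<in> \<Omega> \<Longrightarrow> v \<in> \<Omega> \<Longrightarrow>
      \<exists>z\<in>integer_lattice. \<exists>\<zeta>. path R u \<zeta> \<and> u + fst (snd \<zeta>) = v + z \<and> norm \<zeta> \<le> D"
    using bounded_path_connection[OF assms] by blast
  let ?d = "DIM(real \<times> (real ^ 'n) \<times> real)"
  \<comment> \<open>One connection per sign change, plus the bound on the signed sum.\<close>
  define C where "C = D * real (?d + 1) + 8 * real ?d * (real ?d + 2)"
  have C: "D \<le> C" "0 \<le> C" using D(1) by (simp_all add: C_def algebra_simps)
  show ?thesis
  proof (rule that[of C], unfold_locales)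
    show "0 \<le> C" by (rule C)
    show "0 \<in> increments R" using nonempty path_refl unfolding increments_def by blast
    show "\<exists>u\<in>increments R. norm (u - (z + w)) \<le> C" if zw: "z \<in> increments R" "w \<in> increments R" for z w
    proof -
      obtain x y where xy: "path R x z" "path R y w" using zw unfolding increments_def by blast
      obtain k \<zeta> where k: "k \<in> integer_lattice" "path R (x + fst (snd z)) \<zeta>"
        "x + fst (snd z) + fst (snd \<zeta>) = y + k" "norm \<zeta> \<le> D"
        using D(2) path_in[OF xy(1)] path_in[OF xy(2)] by blast
      have "path R x (z + \<zeta>)" using path_trans[OF k(2) xy(1)] by simp
      then have "path R x (z + \<zeta> + w)"
        using path_trans[OF path_translate[OF xy(2) k(1)], of x "z + \<zeta>"] k(3) by (simp add: add.assoc)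
      moreover have "norm (z + \<zeta> + w - (z + w)) \<le> C" using k(4) C by simp
      ultimately show ?thesis unfolding increments_def by blast
    qed
    show "\<exists>u\<in>increments R. norm (u - (1 / 2) *\<^sub>R z) \<le> C" if z: "z \<in> increments R" for z
    proof -
      obtain x where x: "path R x z" using z unfolding increments_def by blast
      obtain N \<xi> where \<xi>: "small_steps R x N \<xi>" "\<xi> N = z" using path_refinement[OF x] by blast
      let ?w = "\<lambda>j. \<xi> (Suc j) - \<xi> j"
      have "norm (?w j) \<le> 1" if "j < N" for j using \<xi>(1) that by (simp add: small_steps_def)
      then obtain s where s: "sign_changes N s \<le> ?d + 1"
        "norm (\<Sum>j<N. if s j then ?w j else - ?w j) \<le> 8 * real ?d * (real ?d + 2)"
        by (rule approximate_vector_halving)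
      obtain y u where u: "path R y u" "norm (u - (\<Sum>j<N. if s j then ?w j else 0)) \<le> D * real (sign_changes N s)"
        using collect_blocks[OF D _ \<xi>(1) order_refl, of s] path_in[OF x] by blast
      have tot: "(\<Sum>j<N. ?w j) = z"
        using \<xi> by (simp add: sum_lessThan_telescope small_steps_def)
      \<comment> \<open>The selected sum is half of the total plus half of the signed sum, and the
        latter is bounded.\<close>
      have "(\<Sum>j<N. if s j then ?w j else 0) = (\<Sum>j<N. (1 / 2) *\<^sub>R ?w j + (1 / 2) *\<^sub>R (if s j then ?w j else - ?w j))"
      proof (intro sum.cong refl)
        have "v = (1 / 2) *\<^sub>R v + (1 / 2) *\<^sub>R v" for v :: "real \<times> (real ^ 'n) \<times> real"
          by (simp flip: scaleR_add_left)
        then show "(if s j then ?w j else 0) = (1 / 2) *\<^sub>R ?w j + (1 / 2) *\<^sub>R (if s j then ?w j else - ?w j)" for j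
          by (cases "s j") (simp_all only: if_True if_False scaleR_minus_right right_minus)
      qed
      also have "\<dots> = (1 / 2) *\<^sub>R z + (1 / 2) *\<^sub>R (\<Sum>j<N. if s j then ?w j else - ?w j)"
        by (simp only: sum.distrib scaleR_sum_right[symmetric] tot)
      finally have eq: "(\<Sum>j<N. if s j then ?w j else 0) - (1 / 2) *\<^sub>R z =
          (1 / 2) *\<^sub>R (\<Sum>j<N. if s j then ?w j else - ?w j)" by simp
      have "norm (u - (1 / 2) *\<^sub>R z) \<le> norm (u - (\<Sum>j<N. if s j then ?w j else 0)) +
          norm ((\<Sum>j<N. if s j then ?w j else 0) - (1 / 2) *\<^sub>R z)"
        using norm_triangle_ineq[of "u - (\<Sum>j<N. if s j then ?w j else 0)" "(\<Sum>j<N. if s j then ?w j else 0) - (1 / 2) *\<^sub>R z"]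
        by simp
      also have "norm ((\<Sum>j<N. if s j then ?w j else 0) - (1 / 2) *\<^sub>R z) \<le> 8 * real ?d * (real ?d + 2)"
        unfolding eq by (rule order_trans[OF _ s(2)]) simp
      also have "D * real (sign_changes N s) \<le> D * real (?d + 1)"
        using D(1) s(1) by (intro mult_left_mono) auto
      then have "norm (u - (\<Sum>j<N. if s j then ?w j else 0)) \<le> D * real (?d + 1)" using u(2) by linarith
      finally have "norm (u - (1 / 2) *\<^sub>R z) \<le> C" by (simp add: C_def)
      then show ?thesis using u(1) unfolding increments_def by blast
    qed
  qed
qed

text \<open>A path that closes modulo the lattice can be repeated, so all integer multiples of its
  increment occur without error.\<close>

lemma loop_multiples:
  assumes "path R x \<zeta>" "fst (snd \<zeta>) \<in> integer_lattice"
  shows "path R x (of_nat m *\<^sub>R \<zeta>)"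
proof (induction m)
  case 0
  then show ?case using path_in[OF assms(1)] path_refl by simp
next
  case (Suc m)
  have "path R (x + of_nat m *\<^sub>R fst (snd \<zeta>)) \<zeta>"
    using assms integer_lattice_of_nat by (intro path_translate)
  from path_trans[OF this Suc] show ?case by (simp add: scaleR_add_left add.commute)
qed

end

section \<open>The cell problem\<close>

context periodic_domain
begin

text \<open>One constant serves all functions. Pairs closer than \<open>d\<close> are joined by a
  chain of length proportional to their distance; for the others the oscillation bound
  \<open>K * D\<close> is already at most \<open>K * (D / d) * dist x y\<close>.\<close>

lemma geometric_bound:
  "\<exists>G\<ge>0. \<forall>(v :: real ^ 'n \<Rightarrow> real) K. 0 \<le> K \<longrightarrow> (\<forall>x y l. connects \<Omega> x y l \<longrightarrow> \<bar>v x - v y\<bar> \<le> K * l) \<longrightarrow>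
     (\<forall>x\<in>\<Omega>. \<forall>z\<in>integer_lattice. v (x + z) = v x) \<longrightarrow>
     (\<forall>x\<in>\<Omega>. \<forall>y\<in>\<Omega>. \<bar>v x - v y\<bar> \<le> K * G \<and> \<bar>v x - v y\<bar> \<le> K * G * dist x y)"
proof -
  obtain d Q where Q: "0 < d" "0 \<le> Q"
    "\<And>u v. u \<in> \<Omega> \<Longrightarrow> v \<in> \<Omega> \<Longrightarrow> dist u v < d \<Longrightarrow> \<exists>l. connects \<Omega> u v l \<and> l \<le> Q * dist u v"
    by (rule quasiconvexity) blast
  obtain D where D: "0 \<le> D"
    "\<And>u v. u \<in> \<Omega> \<Longrightarrow> v \<in> \<Omega> \<Longrightarrow> \<exists>z\<in>integer_lattice. \<exists>l\<le>D. connects \<Omega> u (v + z) l"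
    by (rule bounded_connection) blast
  define G where "G = Q + D + D / d"
  have G: "0 \<le> G" "D \<le> G" "Q \<le> G" "D / d \<le> G" using Q D by (simp_all add: G_def)
  have "\<bar>v x - v y\<bar> \<le> K * G \<and> \<bar>v x - v y\<bar> \<le> K * G * dist x y"
    if K: "0 \<le> K" and c: "\<And>x y l. connects \<Omega> x y l \<Longrightarrow> \<bar>v x - v y\<bar> \<le> K * l"
      and p: "\<And>x z. x \<in> \<Omega> \<Longrightarrow> z \<in> integer_lattice \<Longrightarrow> v (x + z) = v x"
      and xy: "x \<in> \<Omega>" "y \<in> \<Omega>" for v :: "real ^ 'n \<Rightarrow> real" and K x y
  proof
    obtain z l where zl: "z \<in> integer_lattice" "l \<le> D" "connects \<Omega> x (y + z) l" using D(2)[OF xy] by blast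
    have "\<bar>v x - v y\<bar> \<le> K * l" using c[OF zl(3)] p[OF xy(2) zl(1)] by simp
    also have "\<dots> \<le> K * D" using zl(2) K by (rule mult_left_mono)
    finally have osc: "\<bar>v x - v y\<bar> \<le> K * D" .
    also have "\<dots> \<le> K * G" using G K by (intro mult_left_mono)
    finally show "\<bar>v x - v y\<bar> \<le> K * G" .
    show "\<bar>v x - v y\<bar> \<le> K * G * dist x y"
    proof (cases "dist x y < d")
      case True
      obtain l where l: "connects \<Omega> x y l" "l \<le> Q * dist x y" using Q(3)[OF xy True] by blast
      have "l \<le> G * dist x y" using l(2) mult_right_mono[OF G(3), of "dist x y"] by simp
      then have "K * l \<le> K * (G * dist x y)" using K by (rule mult_left_mono)
      then show ?thesis using c[OF l(1)] by (simp add: mult.assoc)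
    next
      case False
      have "D = D / d * d" using Q(1) by simp
      also have "\<dots> \<le> G * dist x y" using False G Q by (intro mult_mono) auto
      finally have "K * D \<le> K * (G * dist x y)" using K by (rule mult_left_mono)
      then show ?thesis using osc by (simp add: mult.assoc)
    qed
  qed
  then show ?thesis using G(1) by (intro exI[of _ G]) auto
qed

definition geo :: real where
  "geo = (SOME G. 0 \<le> G \<and> (\<forall>(v :: real ^ 'n \<Rightarrow> real) K. 0 \<le> K \<longrightarrow> (\<forall>x y l. connects \<Omega> x y l \<longrightarrow> \<bar>v x - v y\<bar> \<le> K * l) \<longrightarrow>
     (\<forall>x\<in>\<Omega>. \<forall>z\<in>integer_lattice. v (x + z) = v x) \<longrightarrow>
     (\<forall>x\<in>\<Omega>. \<forall>y\<in>\<Omega>. \<bar>v x - v y\<bar> \<le> K * G \<and> \<bar>v x - v y\<bar> \<le> K * G * dist x y)))"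

lemma geo:
  shows "0 \<le> geo"
    and "0 \<le> K \<Longrightarrow> (\<And>x y l. connects \<Omega> x y l \<Longrightarrow> \<bar>v x - v y\<bar> \<le> K * l) \<Longrightarrow>
      (\<And>x z. x \<in> \<Omega> \<Longrightarrow> z \<in> integer_lattice \<Longrightarrow> v (x + z) = v x) \<Longrightarrow> x \<in> \<Omega> \<Longrightarrow> y \<in> \<Omega> \<Longrightarrow>
      \<bar>v x - v y\<bar> \<le> K * geo \<and> \<bar>v x - v y\<bar> \<le> K * geo * dist x y"
proof -
  note * = someI_ex[OF geometric_bound, folded geo_def]
  show "0 \<le> geo" using * by blast
  assume "0 \<le> K" "\<And>x y l. connects \<Omega> x y l \<Longrightarrow> \<bar>v x - v y\<bar> \<le> K * l"
    "\<And>x z. x \<in> \<Omega> \<Longrightarrow> z \<in> integer_lattice \<Longrightarrow> v (x + z) = v x" "x \<in> \<Omega>" "y \<in> \<Omega>"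
  then show "\<bar>v x - v y\<bar> \<le> K * geo \<and> \<bar>v x - v y\<bar> \<le> K * geo * dist x y"
    using conjunct2[OF *, rule_format, of K v x y] by blast
qed

lemma closure_pair_le:
  assumes "continuous_on (closure \<Omega>) v" "continuous_on UNIV b"
    and "\<And>x y. x \<in> \<Omega> \<Longrightarrow> y \<in> \<Omega> \<Longrightarrow> v x - v y \<le> b (dist x y)"
    and "x \<in> closure \<Omega>" "y \<in> closure \<Omega>"
  shows "v x - v y \<le> (b (dist x y) :: real)"
proof -
  have "v (fst z) - v (snd z) - b (dist (fst z) (snd z)) \<le> 0" if "z \<in> closure (\<Omega> \<times> \<Omega>)" for z
  proof (rule continuous_le_on_closure[OF _ that])
    have "continuous_on (closure (\<Omega> \<times> \<Omega>)) (\<lambda>z. v (fst z))" "continuous_on (closure (\<Omega> \<times> \<Omega>)) (\<lambda>z. v (snd z))"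
      unfolding closure_Times by (auto intro!: continuous_on_compose2[OF assms(1)] continuous_intros)
    moreover have "continuous_on (closure (\<Omega> \<times> \<Omega>)) (\<lambda>z. b (dist (fst z) (snd z)))"
      by (intro continuous_on_compose2[OF assms(2)] continuous_intros) auto
    ultimately show "continuous_on (closure (\<Omega> \<times> \<Omega>)) (\<lambda>z. v (fst z) - v (snd z) - b (dist (fst z) (snd z)))"
      by (intro continuous_on_diff)
  qed (use assms(3) in auto)
  from this[of "(x, y)"] show ?thesis using assms(4,5) by (simp add: closure_Times)
qed

text \<open>McShane's extension as an infimum of cones. Translations preserve the domain, the values
  and the distance, so the extension is periodic as well.\<close>

lemma periodic_lipschitz_extension:
  assumes lip: "\<And>x y. x \<in> \<Omega> \<Longrightarrow> y \<in> \<Omega> \<Longrightarrow> \<bar>v x - v y\<bar> \<le> L * dist x y" and "0 \<le> L"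
    and per: "\<And>x z. x \<in> \<Omega> \<Longrightarrow> z \<in> integer_lattice \<Longrightarrow> v (x + z) = v x"
  obtains u where "\<And>x. x \<in> \<Omega> \<Longrightarrow> u x = (v x :: real)" "continuous_on UNIV u"
    "\<And>x z. z \<in> integer_lattice \<Longrightarrow> u (x + z) = u x"
proof -
  define u where "u x = (INF y\<in>\<Omega>. v y + L * dist x y)" for x
  obtain a where a: "a \<in> \<Omega>" using nonempty by blast
  have bdd: "bdd_below ((\<lambda>y. v y + L * dist x y) ` \<Omega>)" for x
  proof (rule bdd_belowI2[where m = "v a - L * dist a x"])
    fix y assume y: "y \<in> \<Omega>"
    have "v a - v y \<le> L * dist a y" using lip[OF a y] by linarith
    also have "\<dots> \<le> L * (dist a x + dist x y)" using \<open>0 \<le> L\<close> by (intro mult_left_mono dist_triangle)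
    finally show "v a - L * dist a x \<le> v y + L * dist x y" by (simp add: distrib_left)
  qed
  have le: "u x \<le> u x' + L * dist x x'" for x x'
  proof -
    have "u x - L * dist x x' \<le> u x'"
      unfolding u_def[of x']
    proof (rule cINF_greatest)
      fix y assume y: "y \<in> \<Omega>"
      have "u x \<le> v y + L * dist x y" unfolding u_def by (rule cINF_lower[OF bdd y])
      also have "\<dots> \<le> v y + L * (dist x x' + dist x' y)"
        using \<open>0 \<le> L\<close> by (intro add_left_mono mult_left_mono dist_triangle)
      finally show "u x - L * dist x x' \<le> v y + L * dist x' y" by (simp add: distrib_left)
    qed (use nonempty in auto)
    then show ?thesis by simp
  qed
  have "L-lipschitz_on UNIV u"
  proof (rule lipschitz_onI)
    show "dist (u x) (u y) \<le> L * dist x y" for x y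
      using le[of x y] le[of y x] by (simp add: dist_real_def dist_commute abs_le_iff)
  qed fact
  moreover have "u x = v x" if x: "x \<in> \<Omega>" for x
  proof (rule antisym)
    have "u x \<le> v x + L * dist x x" unfolding u_def by (rule cINF_lower[OF bdd x])
    then show "u x \<le> v x" by simp
    show "v x \<le> u x" unfolding u_def
    proof (rule cINF_greatest)
      fix y assume "y \<in> \<Omega>"
      then show "v x \<le> v y + L * dist x y" using lip[OF x, of y] by linarith
    qed (use nonempty in auto)
  qed
  moreover have "u (x + z) = u x" if z: "z \<in> integer_lattice" for x z
  proof -
    have *: "u (x + z) \<le> u x" if z: "z \<in> integer_lattice" for x z
      unfolding u_def[of x]
    proof (rule cINF_greatest)
      fix y assume y: "y \<in> \<Omega>"
      have "u (x + z) \<le> v (y + z) + L * dist (x + z) (y + z)"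
        unfolding u_def by (rule cINF_lower[OF bdd]) (use periodic y z in blast)
      then show "u (x + z) \<le> v y + L * dist x y" using per[OF y z] by simp
    qed (use nonempty in auto)
    show ?thesis using *[OF z, of x] *[OF integer_lattice_minus[OF z], of "x + z"] by simp
  qed
  ultimately show ?thesis using that lipschitz_on_continuous_on by blast
qed

end

section \<open>The critical value and subsolutions of the cell problem\<close>

context periodic_hamiltonian
begin

text \<open>Subsolutions of the cell problem at level \<open>c\<close>, expressed along steps. In
  this form suprema and averages of subsolutions can be checked directly.\<close>

definition cell_sub :: "real \<Rightarrow> real ^ 'n \<Rightarrow> real \<Rightarrow> (real ^ 'n \<Rightarrow> real) \<Rightarrow> bool" where
  "cell_sub R p c v \<longleftrightarrow> continuous_on (closure \<Omega>) v \<and>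
     (\<forall>x\<in>closure \<Omega>. \<forall>z\<in>integer_lattice. v (x + z) = v x) \<and>
     (\<forall>x \<tau> \<Delta> k. step \<Omega> H R x (\<tau>, \<Delta>, k) \<longrightarrow> v (x + \<Delta>) + p \<bullet> \<Delta> \<le> v x + k + c * \<tau>)"

definition loop_rates :: "real \<Rightarrow> real ^ 'n \<Rightarrow> real set" where
  "loop_rates R p = {(p \<bullet> \<Delta> - k) / \<tau> | x \<tau> \<Delta> k. path R x (\<tau>, \<Delta>, k) \<and> 0 < \<tau> \<and> \<Delta> \<in> integer_lattice}"

text \<open>The Mane critical value of the Lagrangian tilted by \<open>p\<close>, here with
  truncated momenta.\<close>

definition crit :: "real \<Rightarrow> real ^ 'n \<Rightarrow> real" where
  "crit R p = Sup (loop_rates R p)"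

lemma step_inequality_path:
  assumes step: "\<And>x \<tau> \<Delta> k. step \<Omega> H R x (\<tau>, \<Delta>, k) \<Longrightarrow> v (x + \<Delta>) + p \<bullet> \<Delta> \<le> v x + k + c * \<tau>"
  shows "path R x \<zeta> \<Longrightarrow> v (x + fst (snd \<zeta>)) + p \<bullet> fst (snd \<zeta>) \<le> v x + snd (snd \<zeta>) + c * fst \<zeta>"
proof (induction rule: path.induct)
  case (path_step x \<zeta> \<sigma>)
  have "v (x + fst (snd \<zeta>) + fst (snd \<sigma>)) + p \<bullet> fst (snd \<sigma>) \<le> v (x + fst (snd \<zeta>)) + snd (snd \<sigma>) + c * fst \<sigma>"
    using path_step.hyps(2) by (intro step) simp
  then show ?case using path_step.IH by (simp add: inner_add_right distrib_left add.assoc)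
qed simp

lemma path_inner_upper:
  assumes "norm p \<le> P" "P \<le> R"
  shows "path R x \<zeta> \<Longrightarrow> p \<bullet> fst (snd \<zeta>) - snd (snd \<zeta>) \<le> hmax P * fst \<zeta>"
proof -
  assume "path R x \<zeta>"
  moreover have "0 + p \<bullet> \<Delta> \<le> 0 + k + hmax P * \<tau>" if st: "step \<Omega> H R x (\<tau>, \<Delta>, k)" for x \<tau> \<Delta> k
  proof -
    obtain v l where v: "0 \<le> \<tau>" "\<Delta> = \<tau> *\<^sub>R v" "k = \<tau> * l"
      "\<And>s. s \<in> {0..\<tau>} \<Longrightarrow> x + s *\<^sub>R v \<in> \<Omega> \<and> admissible H R (x + s *\<^sub>R v) v l"
      using st by (rule stepE) blast
    have "p \<bullet> v - H x p \<le> l" using v(4)[of 0] v(1) assms by (simp add: admissible_def)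
    then have "p \<bullet> v \<le> l + hmax P" using hmax(2)[of p P x] assms(1) by (simp add: abs_le_iff)
    then have "\<tau> * (p \<bullet> v) \<le> \<tau> * (l + hmax P)" using v(1) by (rule mult_left_mono)
    then show ?thesis by (simp add: v algebra_simps)
  qed
  ultimately show ?thesis using step_inequality_path[of R "\<lambda>_. 0" p "hmax P" x \<zeta>] by fastforce
qed

lemma rest_path: "x \<in> \<Omega> \<Longrightarrow> 0 \<le> \<tau> \<Longrightarrow> path R x (\<tau>, 0, \<tau> * hmin)"
  using path_wait[OF path_refl, of x \<tau> R] by simp

lemma loop_rates_bounds:
  assumes "norm p \<le> R"
  shows "loop_rates R p \<noteq> {}" "bdd_above (loop_rates R p)" "- hmin \<le> crit R p"
    "norm p \<le> P \<Longrightarrow> P \<le> R \<Longrightarrow> crit R p \<le> hmax P"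
proof -
  obtain a where "a \<in> \<Omega>" using nonempty by blast
  then have r: "- hmin \<in> loop_rates R p"
    unfolding loop_rates_def using rest_path[of a 1 R] integer_lattice_0
    by (intro CollectI exI[of _ a] exI[of _ 1] exI[of _ 0] exI[of _ hmin]) auto
  then show ne: "loop_rates R p \<noteq> {}" by blast
  have le: "r \<le> hmax P" if r: "r \<in> loop_rates R p" and P: "norm p \<le> P" "P \<le> R" for r P
  proof -
    obtain x \<tau> \<Delta> k where *: "r = (p \<bullet> \<Delta> - k) / \<tau>" "path R x (\<tau>, \<Delta>, k)" "0 < \<tau>"
      using r unfolding loop_rates_def by blast
    then show ?thesis using path_inner_upper[OF P *(2)] by (simp add: divide_le_eq)
  qed
  show bd: "bdd_above (loop_rates R p)" by (rule bdd_aboveI[where M = "hmax R"]) (use le assms in blast)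
  show "crit R p \<le> hmax P" if "norm p \<le> P" "P \<le> R" unfolding crit_def using ne le[OF _ that] by (rule cSup_least)
  show "- hmin \<le> crit R p" unfolding crit_def using r bd by (rule cSup_upper)
qed

text \<open>A loop of zero duration has no rate. Waiting a short time at rate \<open>hmin\<close>
  makes the duration positive, and the time waited is then sent to 0.\<close>

lemma loop_cost:
  assumes "norm p \<le> R" "path R x (\<tau>, \<Delta>, k)" "\<Delta> \<in> integer_lattice"
  shows "p \<bullet> \<Delta> - k \<le> crit R p * \<tau>"
proof -
  have pos: "p \<bullet> \<Delta> - k \<le> crit R p * \<tau>" if "path R x (\<tau>, \<Delta>, k)" "0 < \<tau>" for \<tau> k
  proof -
    have "(p \<bullet> \<Delta> - k) / \<tau> \<le> crit R p"
      unfolding crit_def using that assms(3) loop_rates_bounds(2)[OF assms(1)]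
      by (intro cSup_upper) (auto simp: loop_rates_def)
    then show ?thesis using that(2) by (simp add: divide_le_eq)
  qed
  have "0 \<le> \<tau>" using path_in[OF assms(2)] by simp
  show ?thesis
  proof (rule field_le_epsilon)
    fix e :: real assume e: "0 < e"
    define m where "m = \<bar>crit R p\<bar> + hmin + 1"
    have m: "0 < m" using hmin(1) by (simp add: m_def)
    define s where "s = e / m"
    have s: "0 < s" using e m by (simp add: s_def)
    have "path R x (\<tau> + s, \<Delta>, k + s * hmin)"
      using path_wait[OF assms(2), of s] s by simp
    then have "p \<bullet> \<Delta> - (k + s * hmin) \<le> crit R p * (\<tau> + s)"
      using \<open>0 \<le> \<tau>\<close> s by (intro pos) auto
    moreover have "s * (crit R p + hmin) \<le> s * m" using s by (intro mult_left_mono) (auto simp: m_def)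
    moreover have "s * m = e" using m by (simp add: s_def)
    ultimately show "p \<bullet> \<Delta> - k \<le> crit R p * \<tau> + e" by (simp add: algebra_simps)
  qed
qed

lemma step_inequality_connects:
  assumes "0 \<le> R" and step: "\<And>x \<tau> \<Delta> k. step \<Omega> H R x (\<tau>, \<Delta>, k) \<Longrightarrow> v (x + \<Delta>) + p \<bullet> \<Delta> \<le> v x + k + c * \<tau>"
    and "connects \<Omega> x y l"
  shows "\<bar>v x - v y\<bar> \<le> (R + hmin + norm p + \<bar>c\<bar>) * l"
proof -
  have *: "v y - v x \<le> (R + hmin + norm p + \<bar>c\<bar>) * l" if con: "connects \<Omega> x y l" for x y
  proof -
    have l: "0 \<le> l" using con connects_nonneg by blast
    have "v y + p \<bullet> (y - x) \<le> v x + l * (R + hmin) + c * l"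
      using step_inequality_path[OF step connects_imp_path_unit(1)[OF con assms(1)]] by simp
    moreover have "- (p \<bullet> (y - x)) \<le> norm p * l"
    proof -
      have "- (p \<bullet> (y - x)) \<le> norm p * norm (y - x)"
        using Cauchy_Schwarz_ineq2[of p "y - x"] by (simp add: abs_le_iff)
      also have "\<dots> \<le> norm p * l"
        using connects_dist[OF con] by (intro mult_left_mono) (auto simp: dist_norm norm_minus_commute)
      finally show ?thesis .
    qed
    moreover have "c * l \<le> \<bar>c\<bar> * l" using l by (intro mult_right_mono) auto
    ultimately show ?thesis by (simp add: algebra_simps)
  qed
  show ?thesis using *[OF assms(3)] *[OF connects_sym[OF assms(3)]] by (simp add: abs_le_iff)
qed

lemma step_inequality_lipschitz:
  assumes "0 \<le> R" and step: "\<And>x \<tau> \<Delta> k. step \<Omega> H R x (\<tau>, \<Delta>, k) \<Longrightarrow> v (x + \<Delta>) + p \<bullet> \<Delta> \<le> v x + k + c * \<tau>"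
    and per: "\<And>x z. x \<in> \<Omega> \<Longrightarrow> z \<in> integer_lattice \<Longrightarrow> v (x + z) = v x"
    and "x \<in> \<Omega>" "y \<in> \<Omega>"
  shows "\<bar>v x - v y\<bar> \<le> (R + hmin + norm p + \<bar>c\<bar>) * geo"
    "\<bar>v x - v y\<bar> \<le> (R + hmin + norm p + \<bar>c\<bar>) * geo * dist x y"
proof -
  have K: "0 \<le> R + hmin + norm p + \<bar>c\<bar>" using assms(1) hmin(1) by simp
  have "\<And>x y l. connects \<Omega> x y l \<Longrightarrow> \<bar>v x - v y\<bar> \<le> (R + hmin + norm p + \<bar>c\<bar>) * l"
    using step_inequality_connects[OF assms(1) step] by blast
  from geo(2)[OF K this per assms(4,5)]
  show "\<bar>v x - v y\<bar> \<le> (R + hmin + norm p + \<bar>c\<bar>) * geo"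
    "\<bar>v x - v y\<bar> \<le> (R + hmin + norm p + \<bar>c\<bar>) * geo * dist x y" by blast+
qed

lemma cell_sub_lipschitz:
  assumes "0 \<le> R" "cell_sub R p c v" "x \<in> closure \<Omega>" "y \<in> closure \<Omega>"
  shows "v x - v y \<le> (R + hmin + norm p + \<bar>c\<bar>) * geo"
    "v x - v y \<le> (R + hmin + norm p + \<bar>c\<bar>) * geo * dist x y"
proof -
  let ?K = "(R + hmin + norm p + \<bar>c\<bar>) * geo"
  have v: "continuous_on (closure \<Omega>) v" "\<And>x z. x \<in> \<Omega> \<Longrightarrow> z \<in> integer_lattice \<Longrightarrow> v (x + z) = v x"
    "\<And>x \<tau> \<Delta> k. step \<Omega> H R x (\<tau>, \<Delta>, k) \<Longrightarrow> v (x + \<Delta>) + p \<bullet> \<Delta> \<le> v x + k + c * \<tau>"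
    using assms(2) closure_subset unfolding cell_sub_def by blast+
  have *: "v x - v y \<le> ?K" "v x - v y \<le> ?K * dist x y" if "x \<in> \<Omega>" "y \<in> \<Omega>" for x y
    using step_inequality_lipschitz[where v = v, OF assms(1) v(3,2) that] by (auto simp: abs_le_iff)
  show "v x - v y \<le> ?K"
    using closure_pair_le[of v "\<lambda>_. ?K"] v(1) * assms(3,4) by (auto intro: continuous_intros)
  show "v x - v y \<le> ?K * dist x y"
    by (rule closure_pair_le[of v "\<lambda>d. ?K * d"]) (use v(1) * assms(3,4) in \<open>auto intro!: continuous_intros\<close>)
qed

text \<open>Along a loop modulo the lattice the values of \<open>v\<close> cancel, so the level
  dominates the rate of every loop.\<close>

lemma cell_sub_imp_crit_le:
  assumes "norm p \<le> R" "cell_sub R p c v"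
  shows "crit R p \<le> c"
  unfolding crit_def
proof (rule cSup_least)
  show "loop_rates R p \<noteq> {}" using loop_rates_bounds[OF assms(1)] by blast
  fix r assume "r \<in> loop_rates R p"
  then obtain x \<tau> \<Delta> k where *: "r = (p \<bullet> \<Delta> - k) / \<tau>" "path R x (\<tau>, \<Delta>, k)" "0 < \<tau>" "\<Delta> \<in> integer_lattice"
    unfolding loop_rates_def by blast
  have v: "\<And>x \<tau> \<Delta> k. step \<Omega> H R x (\<tau>, \<Delta>, k) \<Longrightarrow> v (x + \<Delta>) + p \<bullet> \<Delta> \<le> v x + k + c * \<tau>"
    using assms(2) unfolding cell_sub_def by blast
  have "x \<in> closure \<Omega>" using path_in[OF *(2)] closure_subset by blast
  then have "v (x + \<Delta>) = v x" using assms(2) *(4) unfolding cell_sub_def by blast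
  then show "r \<le> c" using step_inequality_path[OF v *(2)] *(3) by (simp add: *(1) divide_le_eq)
qed

text \<open>\<open>v x\<close> is the least action from a base point to \<open>x\<close> modulo the
  lattice. It is bounded below because every path can be closed to a loop at bounded cost, and at
  the critical level loops have nonnegative action.\<close>

lemma cell_sub_exists:
  assumes "norm p \<le> R"
  obtains v where "cell_sub R p (crit R p) v"
proof -
  let ?c = "crit R p"
  have R: "0 \<le> R" using assms norm_ge_zero order_trans by blast
  obtain a where a: "a \<in> \<Omega>" using nonempty by blast
  obtain D where D: "0 \<le> D" "\<And>u v. u \<in> \<Omega> \<Longrightarrow> v \<in> \<Omega> \<Longrightarrow>
      \<exists>z\<in>integer_lattice. \<exists>\<zeta>. path R u \<zeta> \<and> u + fst (snd \<zeta>) = v + z \<and> norm \<zeta> \<le> D"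
    by (rule bounded_path_connection[OF R]) blast
  define act where "act \<zeta> = snd (snd \<zeta>) - p \<bullet> fst (snd \<zeta>) + ?c * fst \<zeta>" for \<zeta> :: "real \<times> (real ^ 'n) \<times> real"
  have act_add: "act (\<zeta> + \<sigma>) = act \<zeta> + act \<sigma>" for \<zeta> \<sigma>
    by (simp add: act_def inner_add_right algebra_simps)
  have act_le: "act \<zeta> \<le> (1 + norm p + \<bar>?c\<bar>) * norm \<zeta>" for \<zeta>
  proof -
    obtain \<tau> \<Delta> k where \<zeta>: "\<zeta> = (\<tau>, \<Delta>, k)" by (cases \<zeta>)
    have n: "\<bar>\<tau>\<bar> \<le> norm \<zeta>" "norm \<Delta> \<le> norm \<zeta>" "\<bar>k\<bar> \<le> norm \<zeta>"
      using norm_fst_le[of \<tau> "(\<Delta>, k)"] norm_snd_le[of "(\<Delta>, k)" \<tau>] norm_fst_le[of \<Delta> k] norm_snd_le[of k \<Delta>]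
      unfolding \<zeta> by simp_all
    have "- (p \<bullet> \<Delta>) \<le> norm p * norm \<Delta>" using Cauchy_Schwarz_ineq2[of p \<Delta>] by (simp add: abs_le_iff)
    also have "\<dots> \<le> norm p * norm \<zeta>" using n by (intro mult_left_mono) auto
    finally have 1: "- (p \<bullet> \<Delta>) \<le> norm p * norm \<zeta>" .
    have "?c * \<tau> \<le> \<bar>?c\<bar> * \<bar>\<tau>\<bar>" by (metis abs_ge_self abs_mult)
    also have "\<dots> \<le> \<bar>?c\<bar> * norm \<zeta>" using n by (intro mult_left_mono) auto
    finally have 2: "?c * \<tau> \<le> \<bar>?c\<bar> * norm \<zeta>" .
    show ?thesis using 1 2 n(3) by (simp add: act_def \<zeta> algebra_simps abs_le_iff)
  qed
  define A where "A x = {act \<zeta> | \<zeta>. path R a \<zeta> \<and> a + fst (snd \<zeta>) - x \<in> integer_lattice}" for x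
  define v where "v x = Inf (A x)" for x
  have ne: "A x \<noteq> {}" if x: "x \<in> \<Omega>" for x
  proof -
    obtain z \<zeta> where "z \<in> integer_lattice" "path R a \<zeta>" "a + fst (snd \<zeta>) = x + z" using D(2)[OF a x] by blast
    then have "path R a \<zeta> \<and> a + fst (snd \<zeta>) - x \<in> integer_lattice" by simp
    then show ?thesis unfolding A_def by blast
  qed
  have bdd: "bdd_below (A x)" if x: "x \<in> \<Omega>" for x
  proof (rule bdd_belowI)
    fix r assume "r \<in> A x"
    then obtain \<zeta> where \<zeta>: "r = act \<zeta>" "path R a \<zeta>" "a + fst (snd \<zeta>) - x \<in> integer_lattice"
      unfolding A_def by blast
    obtain z \<sigma> where \<sigma>: "z \<in> integer_lattice" "path R (a + fst (snd \<zeta>)) \<sigma>"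
      "a + fst (snd \<zeta>) + fst (snd \<sigma>) = a + z" "norm \<sigma> \<le> D"
      using D(2) path_in[OF \<zeta>(2)] a by blast
    have "path R a (\<zeta> + \<sigma>)" using path_trans[OF \<sigma>(2) \<zeta>(2)] by simp
    moreover have "fst (snd (\<zeta> + \<sigma>)) = z" using \<sigma>(3) by (simp add: add.assoc)
    ultimately have "p \<bullet> z - snd (snd (\<zeta> + \<sigma>)) \<le> ?c * fst (\<zeta> + \<sigma>)"
      using \<sigma>(1) loop_cost[OF assms, of a "fst (\<zeta> + \<sigma>)" z "snd (snd (\<zeta> + \<sigma>))"] by (metis prod.collapse)
    then have "0 \<le> act (\<zeta> + \<sigma>)" using \<open>fst (snd (\<zeta> + \<sigma>)) = z\<close> by (simp add: act_def)
    then have "0 \<le> r + act \<sigma>" by (simp add: act_add \<zeta>(1))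
    moreover have "(1 + norm p + \<bar>?c\<bar>) * norm \<sigma> \<le> (1 + norm p + \<bar>?c\<bar>) * D"
      using \<sigma>(4) by (intro mult_left_mono) auto
    ultimately show "- ((1 + norm p + \<bar>?c\<bar>) * D) \<le> r" using act_le[of \<sigma>] by linarith
  qed
  have per: "v (x + z) = v x" if z: "z \<in> integer_lattice" for x z
  proof -
    have "y - (x + z) \<in> integer_lattice \<longleftrightarrow> y - x \<in> integer_lattice" for y
      using integer_lattice_add[OF _ z, of "y - (x + z)"] integer_lattice_diff[OF _ z, of "y - x"]
      by (auto simp: algebra_simps)
    then show ?thesis by (simp add: v_def A_def)
  qed
  have st: "v (x + \<Delta>) + p \<bullet> \<Delta> \<le> v x + k + ?c * \<tau>" if st: "step \<Omega> H R x (\<tau>, \<Delta>, k)" for x \<tau> \<Delta> k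
  proof -
    have x: "x \<in> \<Omega>" "x + \<Delta> \<in> \<Omega>" using step_in[OF st] by auto
    have "v (x + \<Delta>) - act (\<tau>, \<Delta>, k) \<le> v x"
      unfolding v_def[of x]
    proof (rule cInf_greatest[OF ne[OF x(1)]])
      fix r assume "r \<in> A x"
      then obtain \<zeta> where \<zeta>: "r = act \<zeta>" "path R a \<zeta>" "a + fst (snd \<zeta>) - x \<in> integer_lattice"
        unfolding A_def by blast
      have "step \<Omega> H R (a + fst (snd \<zeta>)) (\<tau>, \<Delta>, k)"
        using step_translate[OF st \<zeta>(3)] by simp
      then have "path R a (\<zeta> + (\<tau>, \<Delta>, k))" by (intro path_step \<zeta>(2))
      moreover have "a + fst (snd (\<zeta> + (\<tau>, \<Delta>, k))) - (x + \<Delta>) \<in> integer_lattice"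
        using \<zeta>(3) by (simp add: algebra_simps)
      ultimately have "act (\<zeta> + (\<tau>, \<Delta>, k)) \<in> A (x + \<Delta>)" unfolding A_def by blast
      then have "v (x + \<Delta>) \<le> act (\<zeta> + (\<tau>, \<Delta>, k))" unfolding v_def by (intro cInf_lower bdd x)
      then show "v (x + \<Delta>) - act (\<tau>, \<Delta>, k) \<le> r" by (simp add: act_add \<zeta>(1))
    qed
    then show ?thesis by (simp add: act_def)
  qed
  let ?L = "(R + hmin + norm p + \<bar>?c\<bar>) * geo"
  have lip: "\<bar>v x - v y\<bar> \<le> ?L * dist x y" if xy: "x \<in> \<Omega>" "y \<in> \<Omega>" for x y
    by (rule step_inequality_lipschitz(2)[where v = v, OF R st per xy])
  have L: "0 \<le> ?L" using R hmin(1) geo(1) by simp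
  obtain u where u: "\<And>x. x \<in> \<Omega> \<Longrightarrow> u x = v x" "continuous_on UNIV u"
    "\<And>x z. z \<in> integer_lattice \<Longrightarrow> u (x + z) = u x"
    by (rule periodic_lipschitz_extension[where v = v, OF lip L per]) blast+
  have "u (x + \<Delta>) + p \<bullet> \<Delta> \<le> u x + k + ?c * \<tau>" if "step \<Omega> H R x (\<tau>, \<Delta>, k)" for x \<tau> \<Delta> k
    using st[OF that] step_in[OF that] u(1) by simp
  then have "cell_sub R p ?c u"
    unfolding cell_sub_def using u continuous_on_subset by blast
  then show ?thesis by (rule that)
qed

end

section \<open>Local modification of subsolutions\<close>

lemma lattice_points_unique:
  assumes "z \<in> integer_lattice" "z' \<in> integer_lattice" "dist (x :: real ^ 'n) (y + z) < 1 / 2" "dist x (y + z') < 1 / 2"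
  shows "z = z'"
proof -
  have "dist (y + z) (y + z') < 1" using assms(3,4) dist_triangle2[of "y + z" "y + z'" x] by (simp add: dist_commute)
  then have n: "norm (z - z') < 1" by (simp add: dist_norm)
  have "z $ i = z' $ i" for i
  proof -
    have "z $ i - z' $ i \<in> \<int>" using assms(1,2) by (auto simp: integer_lattice_def)
    then obtain m :: int where m: "z $ i - z' $ i = of_int m" by (auto elim: Ints_cases)
    have "\<bar>(z - z') $ i\<bar> < 1" using n component_le_norm_cart[of "z - z'" i] by linarith
    then have "\<bar>of_int m :: real\<bar> < 1" using m by simp
    then have "m = 0" by linarith
    then show ?thesis using m by simp
  qed
  then show ?thesis by (simp add: vec_eq_iff)
qed

context periodic_hamiltonian
begin

text \<open>Steps subdivide exactly, so inequalities for short displacements add up. A modification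
  near one point then has to be examined only along short segments.\<close>

lemma step_inequality_local:
  assumes "0 < r" and loc: "\<And>x \<tau> \<Delta> k. step \<Omega> H R x (\<tau>, \<Delta>, k) \<Longrightarrow> norm \<Delta> < r \<Longrightarrow> f (x + \<Delta>) + p \<bullet> \<Delta> \<le> f x + k + c * \<tau>"
    and st: "step \<Omega> H R x (\<tau>, \<Delta>, k)"
  shows "f (x + \<Delta>) + p \<bullet> \<Delta> \<le> f x + k + c * (\<tau> :: real)"
proof -
  obtain M :: nat where M0: "norm \<Delta> / r < real M" using reals_Archimedean2 by blast
  have M: "0 < M" using M0 \<open>0 < r\<close> by (metis divide_nonneg_pos gr0I linorder_not_less norm_ge_zero of_nat_0)
  have small: "norm ((1 / real M) *\<^sub>R \<Delta>) < r" using M0 M \<open>0 < r\<close> by (simp add: field_simps)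
  have "f (x + (real j / real M) *\<^sub>R \<Delta>) + (real j / real M) * (p \<bullet> \<Delta>) \<le> f x + (real j / real M) * k + c * ((real j / real M) * \<tau>)"
    if "j \<le> M" for j
    using that
  proof (induction j)
    case (Suc j)
    let ?a = "real j / real M"
    have "step \<Omega> H R (x + ?a *\<^sub>R \<Delta>) ((1 / real M) * \<tau>, (1 / real M) *\<^sub>R \<Delta>, (1 / real M) * k)"
      using substep[OF st, of ?a "1 / real M"] Suc.prems M by (simp add: field_simps)
    from loc[OF this small]
    have "f (x + ?a *\<^sub>R \<Delta> + (1 / real M) *\<^sub>R \<Delta>) + (1 / real M) * (p \<bullet> \<Delta>) \<le>
        f (x + ?a *\<^sub>R \<Delta>) + (1 / real M) * k + c * ((1 / real M) * \<tau>)" by simp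
    moreover have "x + ?a *\<^sub>R \<Delta> + (1 / real M) *\<^sub>R \<Delta> = x + (real (Suc j) / real M) *\<^sub>R \<Delta>"
      by (simp add: add_divide_distrib scaleR_add_left add.assoc add.commute)
    moreover have "real (Suc j) / real M = ?a + 1 / real M" by (simp add: add_divide_distrib)
    ultimately show ?case using Suc by (simp add: distrib_left distrib_right)
  qed simp
  from this[of M] show ?thesis using M by simp
qed

text \<open>By the mean value theorem a single intermediate point matters. Admissibility there is
  tested with \<open>p + D\<psi>\<close>, which therefore has to lie in the ball of radius
  \<open>R\<close>.\<close>

lemma C1_step_inequality:
  assumes "C1_with_gradient U \<psi> D\<psi>" "convex B" "B \<subseteq> U" and st: "step \<Omega> H R x (\<tau>, \<Delta>, k)"
    and B: "x \<in> B" "x + \<Delta> \<in> B"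
    and H: "\<And>y. y \<in> B \<Longrightarrow> H y (p + D\<psi> y) \<le> c \<and> norm (p + D\<psi> y) \<le> R"
  shows "\<psi> (x + \<Delta>) + p \<bullet> \<Delta> \<le> \<psi> x + k + c * \<tau>"
proof -
  obtain v l where v: "0 \<le> \<tau>" "\<Delta> = \<tau> *\<^sub>R v" "k = \<tau> * l"
    "\<And>s. s \<in> {0..\<tau>} \<Longrightarrow> x + s *\<^sub>R v \<in> \<Omega> \<and> admissible H R (x + s *\<^sub>R v) v l"
    using st by (rule stepE) blast
  show ?thesis
  proof (cases "\<tau> = 0")
    case True
    then show ?thesis by (simp add: v)
  next
    case False
    then have \<tau>: "0 < \<tau>" using v(1) by simp
    have seg: "x + s *\<^sub>R v \<in> B" if "0 \<le> s" "s \<le> \<tau>" for s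
    proof -
      have "(1 - s / \<tau>) *\<^sub>R x + (s / \<tau>) *\<^sub>R (x + \<Delta>) \<in> B"
        using that \<tau> B by (intro convexD[OF assms(2)]) (auto simp: divide_le_eq)
      moreover have "(1 - s / \<tau>) *\<^sub>R x + (s / \<tau>) *\<^sub>R (x + \<Delta>) = x + s *\<^sub>R v"
        using \<tau> by (simp add: v(2) algebra_simps)
      ultimately show ?thesis by simp
    qed
    have "\<exists>s>0. s < \<tau> \<and> \<psi> (x + \<tau> *\<^sub>R v) - \<psi> (x + 0 *\<^sub>R v) = (\<tau> - 0) * (v \<bullet> D\<psi> (x + s *\<^sub>R v))"
    proof (rule MVT2[OF \<tau>])
      fix s assume s: "0 \<le> s" "s \<le> \<tau>"
      have "(\<psi> has_derivative (\<lambda>h. h \<bullet> D\<psi> (x + s *\<^sub>R v))) (at (x + s *\<^sub>R v))"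
        using assms(1,3) seg[OF s] by (auto simp: C1_with_gradient_def gderiv_def)
      then have "((\<lambda>s. \<psi> (x + s *\<^sub>R v)) has_derivative (\<lambda>h. (h *\<^sub>R v) \<bullet> D\<psi> (x + s *\<^sub>R v))) (at s)"
        by (intro has_derivative_compose[where g = \<psi> and f = "\<lambda>s. x + s *\<^sub>R v"])
           (auto intro!: derivative_eq_intros)
      then show "DERIV (\<lambda>s. \<psi> (x + s *\<^sub>R v)) s :> v \<bullet> D\<psi> (x + s *\<^sub>R v)"
        by (simp add: has_field_derivative_def mult_commute_abs)
    qed
    then obtain s where s: "0 < s" "s < \<tau>" "\<psi> (x + \<Delta>) - \<psi> x = \<tau> * (v \<bullet> D\<psi> (x + s *\<^sub>R v))"
      by (auto simp: v(2))
    let ?y = "x + s *\<^sub>R v"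
    have "(p + D\<psi> ?y) \<bullet> v - H ?y (p + D\<psi> ?y) \<le> l"
      using v(4)[of s] s H[OF seg[of s]] unfolding admissible_def by auto
    then have "v \<bullet> D\<psi> ?y + p \<bullet> v \<le> l + c"
      using H[OF seg[of s]] s by (simp add: inner_add_left inner_add_right inner_commute)
    then have "\<tau> * (v \<bullet> D\<psi> ?y + p \<bullet> v) \<le> \<tau> * (l + c)" using v(1) by (rule mult_left_mono)
    then show ?thesis using s(3) by (simp add: v(2,3) algebra_simps)
  qed
qed

text \<open>Perron's method: where the supersolution test fails, the test function, bent down
  quadratically and raised a little, is a strict subsolution that exceeds \<open>v\<close> at
  \<open>y1\<close> and lies below it on a surrounding ring. The maximum of the two is glued in at
  all lattice translates of \<open>y1\<close>. It is larger at \<open>y1\<close>, unchanged far from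
  the translates and strict near \<open>y1\<close>.\<close>

lemma perron_bump:
  assumes sub: "cell_sub R p c v" and small: "\<And>y q. H y q \<le> c \<Longrightarrow> norm q \<le> R"
    and y1: "y1 \<in> closure \<Omega>" "y1 \<in> U" and C1: "C1_with_gradient U \<phi> D\<phi>"
    and min: "\<forall>\<^sub>F y in at y1 within closure \<Omega>. v y1 - \<phi> y1 \<le> v y - \<phi> y"
    and strict: "H y1 (p + D\<phi> y1) < c" and "0 < r0"
  obtains u r \<eta> where "cell_sub R p c u" "0 < r" "0 < \<eta>" "v y1 < u y1"
    "\<And>y. y \<in> closure \<Omega> \<Longrightarrow> (\<And>z. z \<in> integer_lattice \<Longrightarrow> r0 \<le> dist y (y1 + z)) \<Longrightarrow> u y = v y"
    "\<And>x \<tau> \<Delta> k. step \<Omega> H R x (\<tau>, \<Delta>, k) \<Longrightarrow> x \<in> ball y1 r \<Longrightarrow> x + \<Delta> \<in> ball y1 r \<Longrightarrow>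
      u (x + \<Delta>) + p \<bullet> \<Delta> \<le> u x + k + (c - \<eta>) * \<tau>"
proof -
  have vc: "continuous_on (closure \<Omega>) v" and vper: "\<And>x z. x \<in> closure \<Omega> \<Longrightarrow> z \<in> integer_lattice \<Longrightarrow> v (x + z) = v x"
    and vst: "\<And>x \<tau> \<Delta> k. step \<Omega> H R x (\<tau>, \<Delta>, k) \<Longrightarrow> v (x + \<Delta>) + p \<bullet> \<Delta> \<le> v x + k + c * \<tau>"
    using sub unfolding cell_sub_def by blast+
  define \<eta> where "\<eta> = (c - H y1 (p + D\<phi> y1)) / 2"
  have \<eta>: "0 < \<eta>" using strict by (simp add: \<eta>_def)
  define F where "F x = H x (p + (D\<phi> x - 2 *\<^sub>R (x - y1)))" for x
  have op: "open U" and cD: "continuous_on U D\<phi>" using C1 by (auto simp: C1_with_gradient_def)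
  have "continuous_on U (\<lambda>x. case (x, p + (D\<phi> x - 2 *\<^sub>R (x - y1))) of (y, q) \<Rightarrow> H y q)"
    by (rule continuous_on_compose2[OF H_continuous, of U "\<lambda>x. (x, p + (D\<phi> x - 2 *\<^sub>R (x - y1)))"])
       (intro continuous_intros cD, auto)
  then have cF: "continuous_on U F" by (simp add: F_def)
  have "open (U \<inter> F -` {..< c - \<eta>})" using cF op by (intro continuous_open_preimage) auto
  moreover have "y1 \<in> U \<inter> F -` {..< c - \<eta>}" using y1 \<eta> by (simp add: F_def \<eta>_def field_simps)
  ultimately obtain d1 where d1: "0 < d1" "ball y1 d1 \<subseteq> U \<inter> F -` {..< c - \<eta>}" by (rule openE)
  obtain d2 where d2: "0 < d2" "\<And>y. y \<in> closure \<Omega> \<Longrightarrow> y \<noteq> y1 \<Longrightarrow> dist y y1 < d2 \<Longrightarrow> v y1 - \<phi> y1 \<le> v y - \<phi> y"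
    using min unfolding eventually_at by blast
  \<comment> \<open>\<open>2 * r < 1 / 2\<close> separates the balls around different lattice
    translates, and \<open>2 * r < r0\<close> confines the change to the prescribed
    neighbourhood.\<close>
  define r where "r = min (min d1 d2) (min r0 (1 / 2)) / 4"
  have r: "0 < r" "2 * r < d1" "2 * r < d2" "2 * r < r0" "2 * r < 1 / 2"
    using d1(1) d2(1) \<open>0 < r0\<close> by (auto simp: r_def min_def)
  \<comment> \<open>The offset \<open>r\<^sup>2 / 2\<close> lifts \<open>\<psi>\<close> above
    \<open>v\<close> at \<open>y1\<close>; from distance \<open>r\<close> on, the quadratic term has
    outweighed it.\<close>
  define \<psi> where "\<psi> x = (\<phi> x + (v y1 - \<phi> y1 + r\<^sup>2 / 2)) + (- 1) * (norm (x - y1))\<^sup>2" for x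
  let ?D\<psi> = "\<lambda>x. (D\<phi> x + 0) + (- 1) *\<^sub>R (2 *\<^sub>R (x - y1))"
  have C1\<psi>: "C1_with_gradient U \<psi> ?D\<psi>"
    unfolding \<psi>_def by (intro C1_add C1 C1_const C1_cmult C1_norm_square op)
  have c\<psi>: "continuous_on U \<psi>" using C1\<psi> by (rule C1_continuous_on)
  have H\<psi>: "H y (p + ?D\<psi> y) \<le> c - \<eta> \<and> norm (p + ?D\<psi> y) \<le> R" if "y \<in> ball y1 (2 * r)" for y
  proof -
    have "y \<in> ball y1 d1" using that r(2) by simp
    then have "F y < c - \<eta>" using d1(2) by blast
    then show ?thesis using small[of y "p + ?D\<psi> y"] \<eta> by (simp add: F_def)
  qed
  have \<psi>st: "\<psi> (x + \<Delta>) + p \<bullet> \<Delta> \<le> \<psi> x + k + (c - \<eta>) * \<tau>"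
    if "step \<Omega> H R x (\<tau>, \<Delta>, k)" "x \<in> ball y1 (2 * r)" "x + \<Delta> \<in> ball y1 (2 * r)" for x \<tau> \<Delta> k
  proof (rule C1_step_inequality[OF C1\<psi> convex_ball _ that H\<psi>])
    show "ball y1 (2 * r) \<subseteq> U" using d1(2) r(2) by (meson subset_ball less_imp_le subset_trans le_inf_iff)
  qed
  have low: "\<psi> y < v y" if "y \<in> closure \<Omega>" "r \<le> dist y y1" "dist y y1 < 2 * r" for y
  proof -
    have "y \<noteq> y1" using that(2) r(1) by auto
    then have "v y1 - \<phi> y1 \<le> v y - \<phi> y" using d2(2)[of y] that r(3) by simp
    moreover have "r\<^sup>2 \<le> (norm (y - y1))\<^sup>2" using that(2) r(1) by (intro power_mono) (auto simp: dist_norm)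
    moreover have "0 < r\<^sup>2" using r(1) by simp
    ultimately show ?thesis unfolding \<psi>_def by linarith
  qed
  define near where "near x z \<longleftrightarrow> z \<in> integer_lattice \<and> dist x (y1 + z) < 2 * r" for x z
  have near_unique: "z = z'" if "near x z" "near x z'" for x z z'
    using lattice_points_unique[of z z' x y1] that r(5) by (auto simp: near_def)
  define u where "u x = (if \<exists>z. near x z then max (v x) (\<psi> (x - (SOME z. near x z))) else v x)" for x
  have u_near: "u x = max (v x) (\<psi> (x - z))" if "near x z" for x z
  proof -
    have "(SOME z. near x z) = z" using that near_unique by (intro some_equality) auto
    then show ?thesis using that by (auto simp: u_def)
  qed
  have u_far: "u x = v x" if x: "x \<in> closure \<Omega>" "\<And>z. z \<in> integer_lattice \<Longrightarrow> r \<le> dist x (y1 + z)" for x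
  proof (cases "\<exists>z. near x z")
    case True
    then obtain z where z: "near x z" by blast
    have "x - z \<in> closure \<Omega>"
      using closure_periodic[OF x(1) integer_lattice_minus[of z]] z by (simp add: near_def)
    moreover have "dist (x - z) y1 = dist x (y1 + z)" by (simp add: dist_norm algebra_simps)
    ultimately have "\<psi> (x - z) < v (x - z)" using x(2)[of z] z by (intro low) (auto simp: near_def)
    moreover have "v (x - z) = v x" using vper[OF x(1) integer_lattice_minus[of z]] z by (simp add: near_def)
    ultimately show ?thesis using u_near[OF z] by simp
  qed (simp add: u_def)
  have cs: "cell_sub R p c u"
    unfolding cell_sub_def
  proof (intro conjI ballI allI impI)
    show "continuous_on (closure \<Omega>) u"
      unfolding continuous_on_eq_continuous_within
    proof
      fix x assume x: "x \<in> closure \<Omega>"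
      have vx: "continuous (at x within closure \<Omega>) v" using vc x by (simp add: continuous_on_eq_continuous_within)
      show "continuous (at x within closure \<Omega>) u"
      proof (cases "\<exists>z. near x z")
        case True
        then obtain z where z: "near x z" by blast
        have "x - z \<in> U"
        proof -
          have "dist y1 (x - z) = dist x (y1 + z)" using norm_minus_commute[of x "y1 + z"] by (simp add: dist_norm algebra_simps)
          then have "x - z \<in> ball y1 d1" using z r(2) by (simp add: near_def)
          then show ?thesis using d1(2) by blast
        qed
        then have i\<psi>: "isCont \<psi> (x - z)" using c\<psi> op continuous_on_eq_continuous_at by blast
        have "isCont (\<lambda>y. \<psi> (y - z)) x"
          by (rule isCont_o2[of x "\<lambda>y. y - z" \<psi>, OF _ i\<psi>]) (intro continuous_intros)
        then have "continuous (at x within closure \<Omega>) (\<lambda>y. \<psi> (y - z))"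
          by (rule continuous_at_imp_continuous_within)
        with vx have "continuous (at x within closure \<Omega>) (\<lambda>y. max (v y) (\<psi> (y - z)))"
          unfolding continuous_within by (rule tendsto_max)
        then show ?thesis
        proof (rule continuous_transform_within)
          show "0 < 2 * r - dist x (y1 + z)" using z by (simp add: near_def)
          show "max (v y) (\<psi> (y - z)) = u y" if "y \<in> closure \<Omega>" "dist y x < 2 * r - dist x (y1 + z)" for y
          proof -
            have "near y z" using that(2) z dist_triangle[of y "y1 + z" x] by (simp add: near_def)
            then show ?thesis by (simp add: u_near)
          qed
        qed (rule x)
      next
        case False
        show ?thesis
        proof (rule continuous_transform_within[OF vx r(1) x])
          fix y assume y: "y \<in> closure \<Omega>" "dist y x < r"
          have "u y = v y"
          proof (rule u_far[OF y(1)])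
            fix z assume "z \<in> (integer_lattice :: (real ^ 'n) set)"
            then have "2 * r \<le> dist x (y1 + z)" using False by (auto simp: near_def)
            then show "r \<le> dist y (y1 + z)" using y(2) dist_triangle[of x "y1 + z" y] by (simp add: dist_commute)
          qed
          then show "v y = u y" by simp
        qed
      qed
    qed
    show "u (x + z) = u x" if x: "x \<in> closure \<Omega>" and z: "z \<in> integer_lattice" for x z
    proof (cases "\<exists>w. near x w")
      case True
      then obtain w where w: "near x w" by blast
      have "dist (x + z) (y1 + (w + z)) = dist x (y1 + w)" by (simp add: dist_norm algebra_simps)
      then have "near (x + z) (w + z)"
        using w integer_lattice_add[OF _ z] unfolding near_def by metis
      then show ?thesis using u_near[OF w] u_near[of "x + z" "w + z"] vper[OF x z] by simp
    next
      case False
      have "\<not> near (x + z) w" for w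
      proof
        assume w: "near (x + z) w"
        have "dist x (y1 + (w - z)) = dist (x + z) (y1 + w)" by (simp add: dist_norm algebra_simps)
        then have "near x (w - z)" using w integer_lattice_diff[OF _ z] unfolding near_def by metis
        then show False using False by blast
      qed
      then show ?thesis using False vper[OF x z] by (simp add: u_def)
    qed
    show "u (x + \<Delta>) + p \<bullet> \<Delta> \<le> u x + k + c * \<tau>" if st: "step \<Omega> H R x (\<tau>, \<Delta>, k)" for x \<tau> \<Delta> k
    proof (rule step_inequality_local[OF _ _ st])
      show "0 < r / 2" using r by simp
      fix x \<tau> \<Delta> k assume st: "step \<Omega> H R x (\<tau>, \<Delta>, k)" and nd: "norm \<Delta> < r / 2"
      have x: "x \<in> closure \<Omega>" "x + \<Delta> \<in> closure \<Omega>" "0 \<le> \<tau>" using step_in[OF st] closure_subset by auto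
      \<comment> \<open>A displacement shorter than \<open>r / 2\<close> cannot cross the ring
        between \<open>r\<close> and \<open>2 * r\<close>. Starting within \<open>3 / 2 * r\<close>
        of a translate, both ends are in its ball; otherwise \<open>u = v\<close> at both
        ends.\<close>
      show "u (x + \<Delta>) + p \<bullet> \<Delta> \<le> u x + k + c * \<tau>"
      proof (cases "\<exists>z\<in>integer_lattice. dist x (y1 + z) < 3 / 2 * r")
        case True
        then obtain z where z: "z \<in> integer_lattice" "dist x (y1 + z) < 3 / 2 * r" by blast
        have n1: "near x z" using z r(1) by (simp add: near_def)
        have "dist (x + \<Delta>) x = norm \<Delta>" by (simp add: dist_norm)
        then have n2: "near (x + \<Delta>) z"
          using z nd dist_triangle[of "x + \<Delta>" "y1 + z" x] by (simp add: near_def)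
        have "step \<Omega> H R (x - z) (\<tau>, \<Delta>, k)" using step_translate[OF st integer_lattice_minus[OF z(1)]] by simp
        moreover have "x - z \<in> ball y1 (2 * r)" "x - z + \<Delta> \<in> ball y1 (2 * r)"
          using n1 n2 norm_minus_commute[of x "y1 + z"] norm_minus_commute[of "x + \<Delta>" "y1 + z"]
          by (auto simp: near_def dist_norm algebra_simps)
        ultimately have "\<psi> (x - z + \<Delta>) + p \<bullet> \<Delta> \<le> \<psi> (x - z) + k + (c - \<eta>) * \<tau>" by (rule \<psi>st)
        moreover have "(c - \<eta>) * \<tau> \<le> c * \<tau>" using \<eta> x(3) by (intro mult_right_mono) auto
        moreover have "\<psi> (x + \<Delta> - z) = \<psi> (x - z + \<Delta>)" by (rule arg_cong[of _ _ \<psi>]) simp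
        ultimately have "\<psi> (x + \<Delta> - z) + p \<bullet> \<Delta> \<le> \<psi> (x - z) + k + c * \<tau>" by linarith
        then show ?thesis using vst[OF st] unfolding u_near[OF n1] u_near[OF n2] by linarith
      next
        case False
        have "u x = v x"
          using False r(1) by (intro u_far x) (force simp: not_less)
        moreover have "u (x + \<Delta>) = v (x + \<Delta>)"
        proof (rule u_far[OF x(2)])
          fix z assume "z \<in> (integer_lattice :: (real ^ 'n) set)"
          then have "3 / 2 * r \<le> dist x (y1 + z)" using False by auto
          moreover have "dist x (x + \<Delta>) = norm \<Delta>" by (simp add: dist_norm)
          ultimately show "r \<le> dist (x + \<Delta>) (y1 + z)" using nd dist_triangle[of x "y1 + z" "x + \<Delta>"] by simp
        qed
        ultimately show ?thesis using vst[OF st] by simp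
      qed
    qed
  qed
  have n0: "near y1 0" using r(1) by (simp add: near_def)
  have \<psi>1: "v y1 < \<psi> y1" using r(1) by (simp add: \<psi>_def)
  have i1: "isCont \<psi> y1" using c\<psi> op y1(2) continuous_on_eq_continuous_at by blast
  have i2: "continuous (at y1 within closure \<Omega>) v"
    using vc y1(1) by (simp add: continuous_on_eq_continuous_within)
  have i3: "continuous (at y1 within closure \<Omega>) (\<lambda>y. \<psi> y - v y)"
    by (rule continuous_diff[OF continuous_at_imp_continuous_within[OF i1] i2])
  have "0 < \<psi> y1 - v y1" using \<psi>1 by simp
  from i3[unfolded continuous_within_eps_delta, rule_format, OF this]
  obtain d3 where d3: "0 < d3" "\<And>y. y \<in> closure \<Omega> \<Longrightarrow> dist y y1 < d3 \<Longrightarrow> dist (\<psi> y - v y) (\<psi> y1 - v y1) < \<psi> y1 - v y1"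
    by blast
  have u\<psi>: "u y = \<psi> y" if "y \<in> closure \<Omega>" "y \<in> ball y1 (min d3 (2 * r))" for y
  proof -
    have "dist y y1 < d3" "dist y y1 < 2 * r" using that by (simp_all add: dist_commute)
    then have "v y < \<psi> y" "near y 0" using d3(2)[OF that(1)] by (auto simp: dist_real_def near_def abs_less_iff)
    then show ?thesis using u_near[of y 0] by simp
  qed
  show ?thesis
  proof (rule that[OF cs _ \<eta>])
    show "0 < min d3 (2 * r)" using d3 r by simp
    show "v y1 < u y1" using u_near[OF n0] \<psi>1 by simp
    show "u y = v y" if "y \<in> closure \<Omega>" "\<And>z. z \<in> integer_lattice \<Longrightarrow> r0 \<le> dist y (y1 + z)" for y
    proof (rule u_far[OF that(1)])
      fix z assume "z \<in> (integer_lattice :: (real ^ 'n) set)"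
      then show "r \<le> dist y (y1 + z)" using that(2)[of z] r(1,4) by linarith
    qed
    show "u (x + \<Delta>) + p \<bullet> \<Delta> \<le> u x + k + (c - \<eta>) * \<tau>"
      if st: "step \<Omega> H R x (\<tau>, \<Delta>, k)" and "x \<in> ball y1 (min d3 (2 * r))" "x + \<Delta> \<in> ball y1 (min d3 (2 * r))" for x \<tau> \<Delta> k
    proof -
      have "x \<in> closure \<Omega>" "x + \<Delta> \<in> closure \<Omega>" using step_in[OF st] closure_subset by auto
      then have "u x = \<psi> x" "u (x + \<Delta>) = \<psi> (x + \<Delta>)" using u\<psi> that by blast+
      then show ?thesis using \<psi>st[OF st] that by simp
    qed
  qed
qed

end

section \<open>Transfer between the cell problem and the evolution equation\<close>

lemma C1_slice:
  fixes \<Phi> :: "'a::euclidean_space \<times> real \<Rightarrow> real"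
  assumes "C1_with_gradient U \<Phi> D\<Phi>"
  shows "C1_with_gradient {x. (x, t0) \<in> U} (\<lambda>x. \<Phi> (x, t0) - p \<bullet> x) (\<lambda>x. fst (D\<Phi> (x, t0)) - p)"
  unfolding C1_with_gradient_def
proof (intro conjI ballI)
  have "open ((\<lambda>x. (x, t0)) -` U)"
    using assms by (intro open_vimage continuous_intros) (auto simp: C1_with_gradient_def)
  then show "open {x. (x, t0) \<in> U}" by (simp add: vimage_def)
  have "continuous_on U D\<Phi>" using assms by (simp add: C1_with_gradient_def)
  then show "continuous_on {x. (x, t0) \<in> U} (\<lambda>x. fst (D\<Phi> (x, t0)) - p)"
    by (intro continuous_intros continuous_on_compose2[of U D\<Phi> _ "\<lambda>x. (x, t0)"]) auto
  fix x assume "x \<in> {x. (x, t0) \<in> U}"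
  then have "(\<Phi> has_derivative (\<lambda>h. h \<bullet> D\<Phi> (x, t0))) (at (x, t0))"
    using assms by (auto simp: C1_with_gradient_def gderiv_def)
  then have "((\<lambda>x. \<Phi> (x, t0)) has_derivative (\<lambda>h. (h, 0) \<bullet> D\<Phi> (x, t0))) (at x)"
    by (intro has_derivative_compose[where g = \<Phi> and f = "\<lambda>x. (x, t0)"])
       (auto intro!: derivative_eq_intros)
  then have "((\<lambda>x. \<Phi> (x, t0) - p \<bullet> x) has_derivative (\<lambda>h. (h, 0) \<bullet> D\<Phi> (x, t0) - p \<bullet> h)) (at x)"
    by (auto intro!: derivative_eq_intros)
  then show "GDERIV (\<lambda>x. \<Phi> (x, t0) - p \<bullet> x) x :> fst (D\<Phi> (x, t0)) - p"
    by (simp add: gderiv_def inner_prod_def inner_diff_right inner_commute)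
qed

text \<open>This reflection lets statements on supersolutions be read off from those on
  subsolutions; the momentum changes sign together with the function.\<close>

lemma viscosity_supersolution_iff_neg:
  "viscosity_supersolution S F w \<longleftrightarrow> viscosity_subsolution S (\<lambda>z q. - F z (- q)) (\<lambda>z. - w z)"
proof -
  have C1m: "C1_with_gradient U (\<lambda>x. - \<phi> x) (\<lambda>x. - D\<phi> x)" if "C1_with_gradient U \<phi> D\<phi>" for U \<phi> and D\<phi> :: "'a \<Rightarrow> 'a"
    using C1_cmult[OF that, of "- 1"] by simp
  show ?thesis
  proof
    assume *: "viscosity_supersolution S F w"
    show "viscosity_subsolution S (\<lambda>z q. - F z (- q)) (\<lambda>z. - w z)"
      unfolding viscosity_subsolution_def
    proof (intro ballI allI impI, elim conjE)
      fix z0 U \<phi> D\<phi>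
      assume a: "z0 \<in> S" "z0 \<in> U" "C1_with_gradient U \<phi> D\<phi>"
        "\<forall>\<^sub>F z in at z0 within S. - w z - \<phi> z \<le> - w z0 - \<phi> z0"
      have "\<forall>\<^sub>F z in at z0 within S. w z - - \<phi> z \<ge> w z0 - - \<phi> z0"
        using a(4) by eventually_elim simp
      then show "- F z0 (- D\<phi> z0) \<le> 0"
        using *[unfolded viscosity_supersolution_def, rule_format, OF a(1) conjI[OF a(2) conjI[OF C1m[OF a(3)]]]] by simp
    qed
  next
    assume *: "viscosity_subsolution S (\<lambda>z q. - F z (- q)) (\<lambda>z. - w z)"
    show "viscosity_supersolution S F w"
      unfolding viscosity_supersolution_def
    proof (intro ballI allI impI, elim conjE)
      fix z0 U \<phi> D\<phi>
      assume a: "z0 \<in> S" "z0 \<in> U" "C1_with_gradient U \<phi> D\<phi>"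
        "\<forall>\<^sub>F z in at z0 within S. w z - \<phi> z \<ge> w z0 - \<phi> z0"
      have "\<forall>\<^sub>F z in at z0 within S. - w z - - \<phi> z \<le> - w z0 - - \<phi> z0"
        using a(4) by eventually_elim simp
      then show "0 \<le> F z0 (D\<phi> z0)"
        using *[unfolded viscosity_subsolution_def, rule_format, OF a(1) conjI[OF a(2) conjI[OF C1m[OF a(3)]]]] by simp
    qed
  qed
qed

text \<open>A test function on space-time yields two facts: its slice at the contact time tests the
  cell problem, and moving backwards in time shows that its time derivative is at most
  \<open>- c\<close>.\<close>

lemma cell_imp_evolution_sub:
  fixes v :: "'a::euclidean_space \<Rightarrow> real"
  assumes "viscosity_subsolution S (\<lambda>y q. K y (p + q) - c) v"
  shows "viscosity_subsolution (S \<times> {0<..}) (evolution_operator K) (\<lambda>z. p \<bullet> fst z + v (fst z) - c * snd z)"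
  unfolding viscosity_subsolution_def
proof (intro ballI allI impI, elim conjE)
  fix z0 U \<Phi> D\<Phi>
  let ?W = "\<lambda>z :: 'a \<times> real. p \<bullet> fst z + v (fst z) - c * snd z"
  assume z0: "z0 \<in> S \<times> {0<..}" "z0 \<in> U" and C1: "C1_with_gradient U \<Phi> D\<Phi>"
    and max: "\<forall>\<^sub>F z in at z0 within S \<times> {0<..}. ?W z - \<Phi> z \<le> ?W z0 - \<Phi> z0"
  obtain y0 t0 where yt: "z0 = (y0, t0)" "y0 \<in> S" "0 < t0" using z0 by auto
  have "filterlim (\<lambda>y. (y, t0)) (at (y0, t0) within S \<times> {0<..}) (at y0 within S)"
    unfolding filterlim_at
  proof
    show "((\<lambda>y. (y, t0)) \<longlongrightarrow> (y0, t0)) (at y0 within S)" by (auto intro!: tendsto_eq_intros)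
    show "\<forall>\<^sub>F x in at y0 within S. (x, t0) \<in> S \<times> {0<..} \<and> (x, t0) \<noteq> (y0, t0)"
      using yt(3) by (auto simp: eventually_at_filter)
  qed
  from eventually_compose_filterlim[OF max[unfolded yt(1)] this]
  have ev: "\<forall>\<^sub>F y in at y0 within S. v y - (\<Phi> (y, t0) - p \<bullet> y) \<le> v y0 - (\<Phi> (y0, t0) - p \<bullet> y0)"
    by eventually_elim simp
  have "y0 \<in> {x. (x, t0) \<in> U}" using z0 yt by simp
  from assms[unfolded viscosity_subsolution_def, rule_format, OF yt(2) conjI[OF this conjI[OF C1_slice[OF C1] ev]]]
  have 1: "K y0 (fst (D\<Phi> (y0, t0))) \<le> c" by simp
  have "- (- c) \<le> (0, - 1) \<bullet> D\<Phi> z0"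
  proof (rule touching_directional[OF C1 z0(2) max])
    have "\<forall>\<^sub>F h in at_right 0. h < t0"
      using yt(3) by (intro order_tendstoD(2)[of "\<lambda>\<tau>. \<tau>" 0]) auto
    then show "\<forall>\<^sub>F h in at_right 0. z0 + h *\<^sub>R (0, - 1) \<in> S \<times> {0<..}"
      by eventually_elim (use yt in auto)
    show "\<forall>\<^sub>F h in at_right 0. ?W z0 - - c * h \<le> ?W (z0 + h *\<^sub>R (0, - 1))"
      by (auto simp: yt(1) algebra_simps)
  qed
  then have "snd (D\<Phi> z0) \<le> - c" by (simp add: inner_prod_def)
  then show "evolution_operator K z0 (D\<Phi> z0) \<le> 0"
    using 1 by (simp add: evolution_operator_def yt(1) case_prod_unfold)
qed

lemma cell_imp_evolution_super:
  fixes v :: "'a::euclidean_space \<Rightarrow> real"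
  assumes "viscosity_supersolution S (\<lambda>y q. K y (p + q) - c) v"
  shows "viscosity_supersolution (S \<times> {0<..}) (evolution_operator K) (\<lambda>z. p \<bullet> fst z + v (fst z) - c * snd z)"
proof -
  let ?K = "\<lambda>y q. - K y (- q)"
  have "(\<lambda>z q. - (K z (p + - q) - c)) = (\<lambda>y q. ?K y (- p + q) - - c)" by simp
  then have "viscosity_subsolution S (\<lambda>y q. ?K y (- p + q) - - c) (\<lambda>z. - v z)"
    using assms unfolding viscosity_supersolution_iff_neg by simp
  from cell_imp_evolution_sub[where K = ?K, OF this]
  have "viscosity_subsolution (S \<times> {0<..}) (evolution_operator ?K) (\<lambda>z. - (p \<bullet> fst z + v (fst z) - c * snd z))"
    by (rule back_subst[of "\<lambda>f. viscosity_subsolution _ _ f"]) (auto simp: fun_eq_iff)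
  moreover have "evolution_operator ?K = (\<lambda>z q. - evolution_operator K z (- q))"
    by (auto simp: fun_eq_iff evolution_operator_def)
  ultimately show ?thesis unfolding viscosity_supersolution_iff_neg by simp
qed

lemma evolution_imp_cell_sub:
  fixes v :: "'a::euclidean_space \<Rightarrow> real"
  assumes "viscosity_subsolution (S \<times> {0<..}) (evolution_operator K) (\<lambda>z. p \<bullet> fst z + v (fst z) - c * snd z)"
  shows "viscosity_subsolution S (\<lambda>y q. K y (p + q) - c) v"
  unfolding viscosity_subsolution_def
proof (intro ballI allI impI, elim conjE)
  fix y0 U \<phi> D\<phi>
  let ?W = "\<lambda>z :: 'a \<times> real. p \<bullet> fst z + v (fst z) - c * snd z"
  assume y0: "y0 \<in> S" "y0 \<in> U" and C1: "C1_with_gradient U \<phi> D\<phi>"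
    and max: "\<forall>\<^sub>F y in at y0 within S. v y - \<phi> y \<le> v y0 - \<phi> y0"
  have "C1_with_gradient U (\<lambda>x. p \<bullet> x) (\<lambda>x. p)"
    using C1 unfolding C1_with_gradient_def gderiv_def
    by (auto intro!: derivative_eq_intros simp: inner_commute)
  note s = C1_fst[OF C1_add[OF C1 this]]
  have t: "C1_with_gradient UNIV (\<lambda>z :: 'a \<times> real. - c * snd z) (\<lambda>z. (0, - c))"
    by (rule C1_snd[where f = "\<lambda>t. - c * t" and f' = "\<lambda>t. - c"]) (auto intro!: derivative_eq_intros)
  have opU: "open (U \<times> (UNIV :: real set))" using C1 by (auto simp: C1_with_gradient_def intro: open_Times)
  note C = C1_add[OF s C1_subset[OF t subset_UNIV opU]]
  have "\<forall>\<^sub>F z in at (y0, 1 :: real) within S \<times> {0<..}. v (fst z) - \<phi> (fst z) \<le> v y0 - \<phi> y0"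
  proof -
    obtain d where d: "0 < d" "\<And>y. y \<in> S \<Longrightarrow> y \<noteq> y0 \<Longrightarrow> dist y y0 < d \<Longrightarrow> v y - \<phi> y \<le> v y0 - \<phi> y0"
      using max unfolding eventually_at by blast
    show ?thesis
    proof (rule eventually_at_within_subset_ball[OF d(1)])
      fix z assume z: "z \<in> S \<times> {0 :: real<..}" "dist z (y0, 1) < d"
      then have "dist (fst z) y0 < d" using dist_fst_le[of z "(y0, 1)"] by simp
      then show "v (fst z) - \<phi> (fst z) \<le> v y0 - \<phi> y0" using d(2)[of "fst z"] z(1) by (cases "fst z = y0") auto
    qed
  qed
  then have ev: "\<forall>\<^sub>F z in at (y0, 1) within S \<times> {0<..}. ?W z - (\<phi> (fst z) + p \<bullet> fst z + - c * snd z) \<le>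
      ?W (y0, 1) - (\<phi> (fst (y0, 1 :: real)) + p \<bullet> fst (y0, 1 :: real) + - c * snd (y0, 1 :: real))"
    by eventually_elim simp
  have in1: "(y0, 1) \<in> S \<times> {0 :: real<..}" "(y0, 1) \<in> U \<times> (UNIV :: real set)" using y0 by auto
  from assms[unfolded viscosity_subsolution_def, rule_format, OF in1(1) conjI[OF in1(2) conjI[OF C ev]]]
  show "K y0 (p + D\<phi> y0) - c \<le> 0" by (simp add: evolution_operator_def add.commute)
qed

context periodic_hamiltonian
begin

lemma cell_sub_step_subsolution:
  assumes "cell_sub R p c v"
  shows "step_subsolution \<Omega> H R (\<lambda>z. p \<bullet> fst z + v (fst z) - c * snd z)"
  unfolding step_subsolution_def
proof (intro allI impI)
  fix x \<tau> \<Delta> k and t :: real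
  assume "step \<Omega> H R x (\<tau>, \<Delta>, k)"
  then have "v (x + \<Delta>) + p \<bullet> \<Delta> \<le> v x + k + c * \<tau>" using assms unfolding cell_sub_def by blast
  then show "p \<bullet> fst (x + \<Delta>, t + \<tau>) + v (fst (x + \<Delta>, t + \<tau>)) - c * snd (x + \<Delta>, t + \<tau>)
      \<le> p \<bullet> fst (x, t) + v (fst (x, t)) - c * snd (x, t) + k"
    by (simp add: inner_add_right distrib_left)
qed

lemma cell_sub_evolution_lipschitz:
  assumes "0 \<le> R" "cell_sub R p c v"
  shows "(norm p + (R + hmin + norm p + \<bar>c\<bar>) * geo + \<bar>c\<bar>)-lipschitz_on (closure \<Omega> \<times> {0..})
    (\<lambda>z. p \<bullet> fst z + v (fst z) - c * snd z)"
proof (rule lipschitz_onI)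
  let ?K = "(R + hmin + norm p + \<bar>c\<bar>) * geo"
  fix z w assume zw: "z \<in> closure \<Omega> \<times> {0 :: real..}" "w \<in> closure \<Omega> \<times> {0 :: real..}"
  have n: "norm (fst z - fst w) \<le> norm (z - w)" "\<bar>snd z - snd w\<bar> \<le> norm (z - w)"
    by (rule norm_fst_snd_diff_le)+
  have K: "0 \<le> ?K" using assms(1) hmin(1) geo(1) by simp
  have "\<bar>p \<bullet> (fst z - fst w)\<bar> \<le> norm p * norm (fst z - fst w)" by (rule Cauchy_Schwarz_ineq2)
  also have "\<dots> \<le> norm p * norm (z - w)" using n by (intro mult_left_mono) auto
  finally have 1: "\<bar>p \<bullet> fst z - p \<bullet> fst w\<bar> \<le> norm p * norm (z - w)" by (simp add: inner_diff_right)
  have "\<bar>v (fst z) - v (fst w)\<bar> \<le> ?K * dist (fst z) (fst w)"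
    using cell_sub_lipschitz(2)[OF assms, of "fst z" "fst w"] cell_sub_lipschitz(2)[OF assms, of "fst w" "fst z"] zw
    by (auto simp: abs_le_iff dist_commute)
  also have "\<dots> \<le> ?K * norm (z - w)" using n K by (intro mult_left_mono) (auto simp: dist_norm)
  finally have 2: "\<bar>v (fst z) - v (fst w)\<bar> \<le> ?K * norm (z - w)" .
  have "\<bar>c * snd z - c * snd w\<bar> = \<bar>c\<bar> * \<bar>snd z - snd w\<bar>" by (simp add: abs_mult[symmetric] right_diff_distrib)
  also have "\<dots> \<le> \<bar>c\<bar> * norm (z - w)" using n by (intro mult_left_mono) auto
  finally have 3: "\<bar>c * snd z - c * snd w\<bar> \<le> \<bar>c\<bar> * norm (z - w)" .
  show "dist (p \<bullet> fst z + v (fst z) - c * snd z) (p \<bullet> fst w + v (fst w) - c * snd w)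
      \<le> (norm p + ?K + \<bar>c\<bar>) * dist z w"
    using 1 2 3 by (simp add: dist_real_def dist_norm[of z w] distrib_right abs_le_iff)
next
  show "0 \<le> norm p + (R + hmin + norm p + \<bar>c\<bar>) * geo + \<bar>c\<bar>" using assms(1) hmin(1) geo(1) by simp
qed

text \<open>The detour through \<open>p \<bullet> x + v x - c * t\<close> makes the evolutionary
  passage from steps to viscosity subsolutions available for the cell problem.\<close>

lemma cell_sub_viscosity:
  assumes "0 \<le> R" "cell_sub R p c v"
  shows "viscosity_subsolution \<Omega> (\<lambda>y q. H y (p + q) - c) v"
proof (rule evolution_imp_cell_sub, rule step_subsolution_imp_viscosity[OF open_domain _ H_uniformly_continuous H_convex])
  let ?L = "norm p + (R + hmin + norm p + \<bar>c\<bar>) * geo + \<bar>c\<bar>"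
  note L = cell_sub_evolution_lipschitz[OF assms]
  show "0 \<le> ?L" using L lipschitz_on_nonneg by blast
  show "step_subsolution \<Omega> H R (\<lambda>z. p \<bullet> fst z + v (fst z) - c * snd z)"
    by (rule cell_sub_step_subsolution[OF assms(2)])
  fix x y and t :: real assume xy: "x \<in> \<Omega>" "y \<in> \<Omega>" "0 < t"
  have "(x, t) \<in> closure \<Omega> \<times> {0..}" "(y, t) \<in> closure \<Omega> \<times> {0..}" using xy closure_subset by auto
  from lipschitz_onD[OF L this]
  show "\<bar>(p \<bullet> fst (x, t) + v (fst (x, t)) - c * snd (x, t)) - (p \<bullet> fst (y, t) + v (fst (y, t)) - c * snd (y, t))\<bar> \<le> ?L * norm (x - y)"
    by (simp add: dist_real_def dist_Pair_Pair dist_norm)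
qed

lemma cell_solution_imp_cell_sub:
  assumes "cell_solution \<Omega> H p c v" "\<And>y q. H y q \<le> c \<Longrightarrow> norm q \<le> R"
  shows "cell_sub R p c v"
proof -
  let ?W = "\<lambda>z. p \<bullet> fst z + v (fst z) - c * snd z"
  have v: "continuous_on (closure \<Omega>) v" "\<And>y z. y \<in> closure \<Omega> \<Longrightarrow> z \<in> integer_lattice \<Longrightarrow> v (y + z) = v y"
    "viscosity_subsolution \<Omega> (\<lambda>y q. H y (p + q) - c) v"
    using assms(1) unfolding cell_solution_def by auto
  have "continuous_on \<Omega> v" using v(1) closure_subset continuous_on_subset by blast
  then have "continuous_on (\<Omega> \<times> {0 :: real..}) ?W"
    by (intro continuous_intros continuous_on_compose2[of \<Omega> v _ fst]) auto
  then have st: "step_subsolution \<Omega> H R ?W"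
    using assms(2) by (intro viscosity_subsolution_imp_step[where C = c, OF open_domain H_uniformly_continuous _ cell_imp_evolution_sub[OF v(3)]])
      (auto simp: algebra_simps)
  have "v (x + \<Delta>) + p \<bullet> \<Delta> \<le> v x + k + c * \<tau>" if "step \<Omega> H R x (\<tau>, \<Delta>, k)" for x \<tau> \<Delta> k
    using st[unfolded step_subsolution_def, rule_format, OF that, of 0] by (simp add: inner_add_right)
  then show ?thesis using v unfolding cell_sub_def by blast
qed

text \<open>The two solutions give evolutions that are affine in time and initially ordered after
  adding a constant. Comparison keeps them ordered for all times, so \<open>(c2 - c1) * t\<close>
  stays bounded.\<close>

lemma cell_constant_unique:
  assumes "cell_solution \<Omega> H p c1 v1" "cell_solution \<Omega> H p c2 v2"
  shows "c2 \<le> c1"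
proof -
  obtain R where R: "\<And>y q. H y q \<le> max c1 c2 \<Longrightarrow> norm q \<le> R" using H_coercive by blast
  define R' where "R' = max R 0"
  have R': "0 \<le> R'" "\<And>y q. H y q \<le> c1 \<Longrightarrow> norm q \<le> R'" "\<And>y q. H y q \<le> c2 \<Longrightarrow> norm q \<le> R'"
    using R by (auto simp: R'_def le_max_iff_disj)
  have s: "cell_sub R' p c1 v1" "cell_sub R' p c2 v2"
    using cell_solution_imp_cell_sub assms R' by blast+
  obtain a where a: "a \<in> closure \<Omega>" using nonempty closure_subset by blast
  let ?K = "\<lambda>c. (R' + hmin + norm p + \<bar>c\<bar>) * geo"
  \<comment> \<open>By the two oscillation bounds \<open>C\<close> is at least
    \<open>v1 x - v2 x\<close> for every \<open>x\<close>.\<close>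
  define C where "C = v1 a - v2 a + ?K c1 + ?K c2"
  let ?W1 = "\<lambda>z. p \<bullet> fst z + v1 (fst z) - c1 * snd z"
  let ?W2 = "\<lambda>z. p \<bullet> fst z + (v2 (fst z) + C) - c2 * snd z"
  have s2: "cell_sub R' p c2 (\<lambda>y. v2 y + C)"
    unfolding cell_sub_def
  proof (intro conjI allI impI ballI)
    show "continuous_on (closure \<Omega>) (\<lambda>y. v2 y + C)"
      using s(2) unfolding cell_sub_def by (auto intro!: continuous_intros)
    show "v2 (x + z) + C = v2 x + C" if "x \<in> closure \<Omega>" "z \<in> integer_lattice" for x z
      using s(2) that unfolding cell_sub_def by simp
    show "v2 (x + \<Delta>) + C + p \<bullet> \<Delta> \<le> v2 x + C + k + c2 * \<tau>" if "step \<Omega> H R' x (\<tau>, \<Delta>, k)" for x \<tau> \<Delta> k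
    proof -
      have "v2 (x + \<Delta>) + p \<bullet> \<Delta> \<le> v2 x + k + c2 * \<tau>" using s(2) that unfolding cell_sub_def by blast
      then show ?thesis by simp
    qed
  qed
  have "viscosity_supersolution (closure \<Omega>) (\<lambda>y q. H y (p + q) - c2) v2"
    using assms(2) unfolding cell_solution_def by blast
  then have "viscosity_supersolution (closure \<Omega>) (\<lambda>y q. H y (p + q) - c2) (\<lambda>y. v2 y + C)"
    unfolding viscosity_supersolution_def by simp
  note sup = cell_imp_evolution_super[OF this]
  have "viscosity_subsolution \<Omega> (\<lambda>y q. H y (p + q) - c1) v1" using assms(1) unfolding cell_solution_def by blast
  note sub = cell_imp_evolution_sub[OF this]
  have le: "?W1 (a, t) \<le> ?W2 (a, t)" if "0 \<le> t" for t
  proof (rule comparison_principle[OF open_domain cone H_uniformly_continuous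
        cell_sub_evolution_lipschitz[OF R'(1) s(1)] sub cell_sub_evolution_lipschitz[OF R'(1) s2] sup _ a that])
    fix x assume x: "x \<in> closure \<Omega>"
    show "?W1 (x, 0) \<le> ?W2 (x, 0)"
      using cell_sub_lipschitz(1)[OF R'(1) s(1) x a] cell_sub_lipschitz(1)[OF R'(1) s(2) a x] by (simp add: C_def)
  qed
  have "s * (c2 - c1) \<le> v2 a + C - v1 a" if "0 \<le> s" for s
    using le[OF that] by (simp add: algebra_simps)
  from nonpos_if_linear_bounded[OF this] show ?thesis by simp
qed

end

section \<open>Existence of solutions of the cell problem at the critical value\<close>

context periodic_hamiltonian
begin

text \<open>As a function of \<open>x\<close> this is the largest critical subsolution that vanishes
  at \<open>a\<close>, an intrinsic distance from \<open>a\<close> also known as the Mane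
  potential.\<close>

definition peierls :: "real \<Rightarrow> real ^ 'n \<Rightarrow> real ^ 'n \<Rightarrow> real ^ 'n \<Rightarrow> real" where
  "peierls R p a x = (SUP v\<in>{v. cell_sub R p (crit R p) v}. v x - v a)"

context
  fixes R :: real and p :: "real ^ 'n"
  assumes p: "norm p \<le> R" and small: "\<And>y q. H y q \<le> crit R p \<Longrightarrow> norm q \<le> R"
begin

lemma R_nonneg: "0 \<le> R"
  using p norm_ge_zero order_trans by blast

lemma peierls_upper:
  assumes "cell_sub R p (crit R p) v" "a \<in> closure \<Omega>" "x \<in> closure \<Omega>"
  shows "v x - v a \<le> peierls R p a x"
  unfolding peierls_def
proof (rule cSUP_upper)
  show "bdd_above ((\<lambda>v. v x - v a) ` {v. cell_sub R p (crit R p) v})"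
    using cell_sub_lipschitz(1)[OF R_nonneg _ assms(3,2)] by (intro bdd_aboveI2) blast
qed (use assms in simp)

lemma peierls_least:
  assumes "\<And>v. cell_sub R p (crit R p) v \<Longrightarrow> v x - v a \<le> B"
  shows "peierls R p a x \<le> B"
  unfolding peierls_def using cell_sub_exists[OF p] assms by (intro cSUP_least) blast+

lemma peierls_self: "a \<in> closure \<Omega> \<Longrightarrow> peierls R p a a = 0"
proof (rule antisym)
  assume a: "a \<in> closure \<Omega>"
  show "peierls R p a a \<le> 0" by (rule peierls_least) simp
  obtain v where "cell_sub R p (crit R p) v" using cell_sub_exists[OF p] by blast
  then show "0 \<le> peierls R p a a" using peierls_upper[OF _ a a] by fastforce
qed

lemma peierls_cell_sub:
  assumes a: "a \<in> closure \<Omega>"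
  shows "cell_sub R p (crit R p) (peierls R p a)"
  unfolding cell_sub_def
proof (intro conjI ballI allI impI)
  let ?c = "crit R p"
  let ?K = "(R + hmin + norm p + \<bar>?c\<bar>) * geo"
  have le: "peierls R p a x \<le> peierls R p a y + ?K * dist x y" if "x \<in> closure \<Omega>" "y \<in> closure \<Omega>" for x y
  proof (rule peierls_least)
    fix v assume v: "cell_sub R p ?c v"
    show "v x - v a \<le> peierls R p a y + ?K * dist x y"
      using cell_sub_lipschitz(2)[OF R_nonneg v that] peierls_upper[OF v a that(2)] by linarith
  qed
  have "?K-lipschitz_on (closure \<Omega>) (peierls R p a)"
  proof (rule lipschitz_onI)
    show "dist (peierls R p a x) (peierls R p a y) \<le> ?K * dist x y" if "x \<in> closure \<Omega>" "y \<in> closure \<Omega>" for x y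
      using le[OF that] le[OF that(2,1)] by (simp add: dist_real_def dist_commute abs_le_iff)
    show "0 \<le> ?K" using R_nonneg hmin(1) geo(1) by simp
  qed
  then show "continuous_on (closure \<Omega>) (peierls R p a)" by (rule lipschitz_on_continuous_on)
  show "peierls R p a (x + z) = peierls R p a x" if "x \<in> closure \<Omega>" "z \<in> integer_lattice" for x z
    unfolding peierls_def using that by (intro SUP_cong) (auto simp: cell_sub_def)
  fix x \<tau> \<Delta> k assume st: "step \<Omega> H R x (\<tau>, \<Delta>, k)"
  have x: "x \<in> closure \<Omega>" using step_in[OF st] closure_subset by auto
  have "peierls R p a (x + \<Delta>) \<le> peierls R p a x + k + ?c * \<tau> - p \<bullet> \<Delta>"
  proof (rule peierls_least)
    fix v assume v: "cell_sub R p ?c v"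
    then have "v (x + \<Delta>) + p \<bullet> \<Delta> \<le> v x + k + ?c * \<tau>" using st unfolding cell_sub_def by blast
    then show "v (x + \<Delta>) - v a \<le> peierls R p a x + k + ?c * \<tau> - p \<bullet> \<Delta>"
      using peierls_upper[OF v a x] by linarith
  qed
  then show "peierls R p a (x + \<Delta>) + p \<bullet> \<Delta> \<le> peierls R p a x + k + ?c * \<tau>" by simp
qed

definition strict_near :: "real ^ 'n \<Rightarrow> (real ^ 'n \<Rightarrow> real) \<Rightarrow> real \<Rightarrow> real \<Rightarrow> bool" where
  "strict_near a u r \<eta> \<longleftrightarrow> cell_sub R p (crit R p) u \<and> 0 < r \<and> 0 < \<eta> \<and>
    (\<forall>x \<tau> \<Delta> k. step \<Omega> H R x (\<tau>, \<Delta>, k) \<longrightarrow> x \<in> ball a r \<longrightarrow> x + \<Delta> \<in> ball a r \<longrightarrow>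
      u (x + \<Delta>) + p \<bullet> \<Delta> \<le> u x + k + (crit R p - \<eta>) * \<tau>)"

text \<open>Away from the translates of \<open>a\<close> the supersolution test cannot fail: a bump
  there would keep the value at \<open>a\<close> and contradict maximality. So it fails at a
  translate of \<open>a\<close>, the bump is strict there, and periodicity moves the strictness to
  \<open>a\<close> itself.\<close>

lemma strict_near_exists:
  assumes a: "a \<in> closure \<Omega>"
    and fail: "\<not> viscosity_supersolution (closure \<Omega>) (\<lambda>y q. H y (p + q) - crit R p) (peierls R p a)"
  shows "\<exists>u r \<eta>. strict_near a u r \<eta>"
proof -
  let ?c = "crit R p" and ?S = "peierls R p a"
  obtain y1 U \<phi> D\<phi> where y1: "y1 \<in> closure \<Omega>" "y1 \<in> U" "C1_with_gradient U \<phi> D\<phi>"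
    "\<forall>\<^sub>F y in at y1 within closure \<Omega>. ?S y1 - \<phi> y1 \<le> ?S y - \<phi> y" "H y1 (p + D\<phi> y1) < ?c"
    using fail unfolding viscosity_supersolution_def by (auto simp: not_le)
  have "\<exists>z\<in>integer_lattice. y1 = a + z"
  proof (rule ccontr)
    assume neq: "\<not> ?thesis"
    have "\<exists>r0>0. \<forall>z\<in>integer_lattice. r0 \<le> dist y1 (a + z)"
    proof (cases "\<exists>z\<in>integer_lattice. dist y1 (a + z) < 1 / 2")
      case True
      then obtain z where z: "z \<in> integer_lattice" "dist y1 (a + z) < 1 / 2" by blast
      show ?thesis
      proof (intro exI[of _ "dist y1 (a + z)"] conjI ballI)
        show "0 < dist y1 (a + z)" using neq z by auto
        fix w assume w: "w \<in> (integer_lattice :: (real ^ 'n) set)"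
        show "dist y1 (a + z) \<le> dist y1 (a + w)"
        proof (rule ccontr)
          assume "\<not> ?thesis"
          then have "dist y1 (a + w) < 1 / 2" "z \<noteq> w" using z by auto
          then show False using lattice_points_unique[OF z(1) w z(2)] by blast
        qed
      qed
    next
      case False
      then show ?thesis by (intro exI[of _ "1 / 2"]) (auto simp: not_less)
    qed
    then obtain r0 where r0: "0 < r0" "\<And>z. z \<in> integer_lattice \<Longrightarrow> r0 \<le> dist y1 (a + z)" by blast
    obtain u r \<eta> where u: "cell_sub R p ?c u" "?S y1 < u y1"
      "\<And>y. y \<in> closure \<Omega> \<Longrightarrow> (\<And>z. z \<in> integer_lattice \<Longrightarrow> r0 \<le> dist y (y1 + z)) \<Longrightarrow> u y = ?S y"
      by (rule perron_bump[OF peierls_cell_sub[OF a] _ y1 r0(1)]) (erule small, blast)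
    have "u a = ?S a"
    proof (rule u(3)[OF a])
      fix z assume z: "z \<in> (integer_lattice :: (real ^ 'n) set)"
      have "dist a (y1 + z) = dist y1 (a + (- z))"
        using norm_minus_commute[of a "y1 + z"] by (simp add: dist_norm algebra_simps)
      then show "r0 \<le> dist a (y1 + z)" using r0(2)[OF integer_lattice_minus[OF z]] by simp
    qed
    then have "u a = 0" using peierls_self[OF a] by simp
    then show False using peierls_upper[OF u(1) a y1(1)] u(2) by simp
  qed
  then obtain z where z: "z \<in> integer_lattice" "y1 = a + z" by blast
  obtain u r \<eta> where u: "cell_sub R p ?c u" "0 < r" "0 < \<eta>"
    "\<And>x \<tau> \<Delta> k. step \<Omega> H R x (\<tau>, \<Delta>, k) \<Longrightarrow> x \<in> ball y1 r \<Longrightarrow> x + \<Delta> \<in> ball y1 r \<Longrightarrow>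
      u (x + \<Delta>) + p \<bullet> \<Delta> \<le> u x + k + (?c - \<eta>) * \<tau>"
    by (rule perron_bump[OF peierls_cell_sub[OF a] _ y1 zero_less_one]) (erule small, blast)
  have "u (x + \<Delta>) + p \<bullet> \<Delta> \<le> u x + k + (?c - \<eta>) * \<tau>"
    if st: "step \<Omega> H R x (\<tau>, \<Delta>, k)" and b: "x \<in> ball a r" "x + \<Delta> \<in> ball a r" for x \<tau> \<Delta> k
  proof -
    have e: "x + z + \<Delta> = x + \<Delta> + z" by simp
    have "dist y1 (x + z) = dist a x" "dist y1 (x + \<Delta> + z) = dist a (x + \<Delta>)" by (simp_all add: z(2))
    then have "x + z \<in> ball y1 r" "x + z + \<Delta> \<in> ball y1 r" using b unfolding e by simp_all
    from u(4)[OF step_translate[OF st z(1)] this]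
    have "u (x + \<Delta> + z) + p \<bullet> \<Delta> \<le> u (x + z) + k + (?c - \<eta>) * \<tau>" unfolding e .
    moreover have "u (x + \<Delta> + z) = u (x + \<Delta>)" "u (x + z) = u x"
      using u(1) z(1) step_in[OF st] closure_subset unfolding cell_sub_def by auto
    ultimately show ?thesis by simp
  qed
  then show ?thesis unfolding strict_near_def using u(1-3) by blast
qed

text \<open>
  If every \<open>peierls R p a\<close> failed to be a supersolution, it would fail at its vertex \<open>a\<close> and could be
  bumped to be strict near \<open>a\<close>. Averaging over a finite periodic cover would then give a subsolution
  strict everywhere, at a level below the critical one.
\<close>

lemma cell_solution_exists:
  "\<exists>v. cell_solution \<Omega> H p (crit R p) v \<and> cell_sub R p (crit R p) v"
proof (rule ccontr)
  let ?c = "crit R p"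
  assume contra: "\<not> ?thesis"
  have fail: "\<not> viscosity_supersolution (closure \<Omega>) (\<lambda>y q. H y (p + q) - ?c) (peierls R p a)" if a: "a \<in> closure \<Omega>" for a
  proof
    assume "viscosity_supersolution (closure \<Omega>) (\<lambda>y q. H y (p + q) - ?c) (peierls R p a)"
    then have "cell_solution \<Omega> H p ?c (peierls R p a)"
      using peierls_cell_sub[OF a] cell_sub_viscosity[OF R_nonneg peierls_cell_sub[OF a]]
      unfolding cell_solution_def cell_sub_def by blast
    then show False using contra peierls_cell_sub[OF a] by blast
  qed
  have "\<forall>a\<in>closure \<Omega>. \<exists>u r \<eta>. strict_near a u r \<eta>" using strict_near_exists fail by blast
  then obtain u r \<eta> where sn: "\<And>a. a \<in> closure \<Omega> \<Longrightarrow> strict_near a (u a) (r a) (\<eta> a)" by metis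
  have u: "cell_sub R p ?c (u a)" "0 < r a" "0 < \<eta> a"
    "\<And>x \<tau> \<Delta> k. step \<Omega> H R x (\<tau>, \<Delta>, k) \<Longrightarrow> x \<in> ball a (r a) \<Longrightarrow> x + \<Delta> \<in> ball a (r a) \<Longrightarrow>
      u a (x + \<Delta>) + p \<bullet> \<Delta> \<le> u a x + k + (?c - \<eta> a) * \<tau>" if "a \<in> closure \<Omega>" for a
    using sn[OF that] unfolding strict_near_def by blast+
  obtain F where F: "finite F" "F \<subseteq> closure \<Omega>"
    "\<And>y. y \<in> closure \<Omega> \<Longrightarrow> \<exists>z\<in>integer_lattice. \<exists>x\<in>F. y + z \<in> ball x (r x / 2)"
    by (rule finite_periodic_cover[of "\<lambda>a. r a / 2"]) (use u(2) in auto)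
  obtain b where b: "b \<in> \<Omega>" using nonempty by blast
  have "F \<noteq> {}" using F(3)[of b] b closure_subset by blast
  then have cF: "0 < card F" using F(1) by (simp add: card_gt_0_iff)
  define \<eta>' where "\<eta>' = Min (\<eta> ` F)"
  define r' where "r' = Min ((\<lambda>a. r a / 2) ` F)"
  have \<eta>': "0 < \<eta>'" "\<And>a. a \<in> F \<Longrightarrow> \<eta>' \<le> \<eta> a"
    unfolding \<eta>'_def using F \<open>F \<noteq> {}\<close> u(3) by (auto simp: Min_gr_iff)
  have r': "0 < r'"
    unfolding r'_def using F(1,2) \<open>F \<noteq> {}\<close> u(2) by (auto simp: Min_gr_iff)
  have r'2: "r' \<le> r a / 2" if "a \<in> F" for a
    unfolding r'_def using F(1) that by (intro Min_le) auto
  define w where "w x = (\<Sum>a\<in>F. u a x) / card F" for x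
  \<comment> \<open>Every short step is strict for at least one of the \<open>card F\<close>
    functions, so the average gains \<open>\<eta>' / card F\<close>.\<close>
  let ?c' = "?c - \<eta>' / card F"
  have "cell_sub R p ?c' w"
    unfolding cell_sub_def
  proof (intro conjI ballI allI impI)
    show "continuous_on (closure \<Omega>) w"
      unfolding w_def using u(1) F(2) cF unfolding cell_sub_def by (intro continuous_intros) auto
    show "w (x + z) = w x" if "x \<in> closure \<Omega>" "z \<in> integer_lattice" for x z
    proof -
      have "(\<Sum>a\<in>F. u a (x + z)) = (\<Sum>a\<in>F. u a x)"
        using u(1) F(2) that unfolding cell_sub_def by (intro sum.cong) blast+
      then show ?thesis by (simp add: w_def)
    qed
    fix x \<tau> \<Delta> k assume st: "step \<Omega> H R x (\<tau>, \<Delta>, k)"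
    show "w (x + \<Delta>) + p \<bullet> \<Delta> \<le> w x + k + ?c' * \<tau>"
    proof (rule step_inequality_local[OF r' _ st])
      fix x \<tau> \<Delta> k assume st: "step \<Omega> H R x (\<tau>, \<Delta>, k)" and small: "norm \<Delta> < r'"
      have x: "x \<in> closure \<Omega>" "x + \<Delta> \<in> closure \<Omega>" "0 \<le> \<tau>" using step_in[OF st] closure_subset by auto
      obtain z a where za: "z \<in> integer_lattice" "a \<in> F" "x + z \<in> ball a (r a / 2)" using F(3)[OF x(1)] by blast
      have aC: "a \<in> closure \<Omega>" using za F by blast
      have d: "dist a (x + z) < r a / 2" using za by simp
      have "dist a (x + z + \<Delta>) \<le> dist a (x + z) + norm \<Delta>"
        using dist_triangle[of a "x + z + \<Delta>" "x + z"] by (simp add: dist_norm)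
      then have b: "x + z \<in> ball a (r a)" "x + z + \<Delta> \<in> ball a (r a)"
        using d small r'2[OF za(2)] u(2)[OF aC] by auto
      have strict: "u a (x + \<Delta>) + p \<bullet> \<Delta> \<le> u a x + k + (?c - \<eta>') * \<tau>"
      proof -
        have "u a (x + z + \<Delta>) + p \<bullet> \<Delta> \<le> u a (x + z) + k + (?c - \<eta> a) * \<tau>"
          by (rule u(4)[OF aC step_translate[OF st za(1)] b])
        moreover have "u a (x + \<Delta> + z) = u a (x + \<Delta>)" "u a (x + z) = u a x"
          using u(1)[OF aC] za(1) x unfolding cell_sub_def by blast+
        moreover have "x + \<Delta> + z = x + z + \<Delta>" by simp
        moreover have "(?c - \<eta> a) * \<tau> \<le> (?c - \<eta>') * \<tau>" using \<eta>'(2)[OF za(2)] x(3) by (intro mult_right_mono) auto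
        ultimately show ?thesis by simp
      qed
      have "(\<Sum>b\<in>F. u b (x + \<Delta>) + p \<bullet> \<Delta>) \<le> (\<Sum>b\<in>F. u b x + k + (?c - (if b = a then \<eta>' else 0)) * \<tau>)"
      proof (rule sum_mono)
        fix b assume "b \<in> F"
        then show "u b (x + \<Delta>) + p \<bullet> \<Delta> \<le> u b x + k + (?c - (if b = a then \<eta>' else 0)) * \<tau>"
          using strict u(1)[of b] F(2) st unfolding cell_sub_def by auto
      qed
      also have "\<dots> = (\<Sum>b\<in>F. u b x) + card F * (k + ?c * \<tau>) - \<eta>' * \<tau>"
      proof -
        have "(\<Sum>b\<in>F. u b x + k + (?c - (if b = a then \<eta>' else 0)) * \<tau>) =
            (\<Sum>b\<in>F. (u b x + (k + ?c * \<tau>)) - (if b = a then \<eta>' * \<tau> else 0))"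
          by (intro sum.cong) (auto simp: algebra_simps)
        also have "\<dots> = (\<Sum>b\<in>F. u b x) + (\<Sum>b\<in>F. k + ?c * \<tau>) - (\<Sum>b\<in>F. if b = a then \<eta>' * \<tau> else 0)"
          by (simp only: sum_subtractf sum.distrib)
        also have "(\<Sum>b\<in>F. if b = a then \<eta>' * \<tau> else 0) = \<eta>' * \<tau>" using F(1) za(2) by simp
        finally show ?thesis by simp
      qed
      finally have "(\<Sum>b\<in>F. u b (x + \<Delta>)) + card F * (p \<bullet> \<Delta>) \<le> (\<Sum>b\<in>F. u b x) + card F * (k + ?c * \<tau>) - \<eta>' * \<tau>"
        by (simp add: sum.distrib)
      then have "((\<Sum>b\<in>F. u b (x + \<Delta>)) + card F * (p \<bullet> \<Delta>)) / card F \<le>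
          ((\<Sum>b\<in>F. u b x) + card F * (k + ?c * \<tau>) - \<eta>' * \<tau>) / card F"
        by (rule divide_right_mono) simp
      then show "w (x + \<Delta>) + p \<bullet> \<Delta> \<le> w x + k + ?c' * \<tau>"
        using cF by (simp add: w_def add_divide_distrib diff_divide_distrib left_diff_distrib)
    qed
  qed
  then have "?c \<le> ?c'" by (rule cell_sub_imp_crit_le[OF p])
  moreover have "0 < \<eta>' / card F" using \<eta>'(1) cF by simp
  ultimately show False by simp
qed

lemma effective_hamiltonian_eq_crit: "effective_hamiltonian \<Omega> H p = crit R p"
  unfolding effective_hamiltonian_def
proof (rule the_equality)
  show "\<exists>v. cell_solution \<Omega> H p (crit R p) v" using cell_solution_exists by blast
  fix c assume "\<exists>v. cell_solution \<Omega> H p c v"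
  then show "c = crit R p" using cell_constant_unique cell_solution_exists by (meson order_antisym)
qed

end

section \<open>Structure of the effective Hamiltonian: convexity, continuity, coercivity\<close>

lemma effective_hamiltonian_crit:
  obtains R0 where "0 \<le> R0" "P \<le> R0"
    "\<And>R p. R0 \<le> R \<Longrightarrow> norm p \<le> P \<Longrightarrow> effective_hamiltonian \<Omega> H p = crit R p"
    "\<And>R p y q. R0 \<le> R \<Longrightarrow> norm p \<le> P \<Longrightarrow> H y q \<le> crit R p \<Longrightarrow> norm q \<le> R"
    "\<And>R p. R0 \<le> R \<Longrightarrow> norm p \<le> P \<Longrightarrow> \<exists>v. cell_solution \<Omega> H p (crit R p) v \<and> cell_sub R p (crit R p) v"
proof -
  obtain R1 where R1: "\<And>y q. H y q \<le> hmax P \<Longrightarrow> norm q \<le> R1" using H_coercive by blast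
  \<comment> \<open>For \<open>R \<ge> R0\<close> the critical value is at most
    \<open>hmax P\<close>, so every momentum of energy up to the critical value has norm at most
    \<open>R1\<close>. From there on the truncation is not felt, uniformly for
    \<open>norm p \<le> P\<close>.\<close>
  define R0 where "R0 = max (max P 0) R1"
  have R0: "0 \<le> R0" "P \<le> R0" "R1 \<le> R0" by (auto simp: R0_def)
  have small: "norm q \<le> R" if "R0 \<le> R" "norm p \<le> P" "H y q \<le> crit R p" for R p y q
  proof -
    have "crit R p \<le> hmax P" using that R0 by (intro loop_rates_bounds(4)) auto
    then have "norm q \<le> R1" using R1[of y q] that(3) by linarith
    then show ?thesis using that(1) R0(3) by linarith
  qed
  have pR: "norm p \<le> R" if "R0 \<le> R" "norm p \<le> P" for R and p :: "real ^ 'n" using that R0 by linarith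
  show ?thesis
  proof (rule that[OF R0(1,2)])
    show "effective_hamiltonian \<Omega> H p = crit R p" if "R0 \<le> R" "norm p \<le> P" for R p
      using effective_hamiltonian_eq_crit[OF pR[OF that]] small[OF that] by blast
    show "\<exists>v. cell_solution \<Omega> H p (crit R p) v \<and> cell_sub R p (crit R p) v" if "R0 \<le> R" "norm p \<le> P" for R p
      using cell_solution_exists[OF pR[OF that]] small[OF that] by blast
  qed (use small in blast)
qed

text \<open>A supremum of functions affine in \<open>p\<close>, taken over a family of loops that
  does not depend on \<open>p\<close>.\<close>

lemma crit_convex:
  assumes "norm p \<le> R" "norm q \<le> R" "0 \<le> u" "0 \<le> v" "u + v = 1"
  shows "crit R (u *\<^sub>R p + v *\<^sub>R q) \<le> u * crit R p + v * crit R q"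
proof -
  let ?m = "u *\<^sub>R p + v *\<^sub>R q"
  have "norm ?m \<le> u * R + v * R"
    using norm_triangle_ineq[of "u *\<^sub>R p" "v *\<^sub>R q"] assms mult_left_mono[OF assms(1,3)] mult_left_mono[OF assms(2,4)]
    by simp
  also have "\<dots> = R" using assms(5) by (simp add: distrib_right[symmetric])
  finally have m: "norm ?m \<le> R" .
  show ?thesis
    unfolding crit_def[of R ?m]
  proof (rule cSup_least[OF loop_rates_bounds(1)[OF m]])
    fix r assume "r \<in> loop_rates R ?m"
    then obtain x \<tau> \<Delta> k where *: "r = (?m \<bullet> \<Delta> - k) / \<tau>" "path R x (\<tau>, \<Delta>, k)" "0 < \<tau>" "\<Delta> \<in> integer_lattice"
      unfolding loop_rates_def by blast
    have "u * (p \<bullet> \<Delta> - k) \<le> u * (crit R p * \<tau>)" "v * (q \<bullet> \<Delta> - k) \<le> v * (crit R q * \<tau>)"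
      using loop_cost[OF assms(1) *(2,4)] loop_cost[OF assms(2) *(2,4)] assms(3,4) by (auto intro: mult_left_mono)
    moreover have "?m \<bullet> \<Delta> - k = u * (p \<bullet> \<Delta> - k) + v * (q \<bullet> \<Delta> - k)"
    proof -
      have "k = (u + v) * k" using assms(5) by simp
      then show ?thesis by (simp add: inner_add_left algebra_simps)
    qed
    ultimately have "?m \<bullet> \<Delta> - k \<le> (u * crit R p + v * crit R q) * \<tau>" by (simp add: algebra_simps)
    then show "r \<le> u * crit R p + v * crit R q" using *(1,3) by (simp add: divide_le_eq)
  qed
qed

lemma effective_hamiltonian_convex: "convex_on UNIV (effective_hamiltonian \<Omega> H)"
  unfolding convex_on_def
proof (intro conjI ballI allI impI)
  fix p q :: "real ^ 'n" and u v :: real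
  assume uv: "0 \<le> u" "0 \<le> v" "u + v = 1"
  define P where "P = max (norm p) (norm q)"
  have P: "norm p \<le> P" "norm q \<le> P" by (auto simp: P_def)
  have "norm (u *\<^sub>R p + v *\<^sub>R q) \<le> u * P + v * P"
    using norm_triangle_ineq[of "u *\<^sub>R p" "v *\<^sub>R q"] uv mult_left_mono[OF P(1) uv(1)] mult_left_mono[OF P(2) uv(2)]
    by simp
  also have "\<dots> = P" using uv(3) by (simp add: distrib_right[symmetric])
  finally have m: "norm (u *\<^sub>R p + v *\<^sub>R q) \<le> P" .
  obtain R where R: "0 \<le> R" "P \<le> R" "\<And>p. norm p \<le> P \<Longrightarrow> effective_hamiltonian \<Omega> H p = crit R p"
    by (rule effective_hamiltonian_crit[of P]) blast
  show "effective_hamiltonian \<Omega> H (u *\<^sub>R p + v *\<^sub>R q) \<le> u * effective_hamiltonian \<Omega> H p + v * effective_hamiltonian \<Omega> H q"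
    using crit_convex[of p R q u v] P R(2) uv by (simp add: R(3) m)
qed simp

lemma effective_hamiltonian_continuous: "continuous_on UNIV (effective_hamiltonian \<Omega> H)"
  using effective_hamiltonian_convex by (intro convex_on_continuous) auto

text \<open>Coercivity provides a gain of 1 over the values at momentum 0 on the sphere of radius
  \<open>R2\<close>; convexity along rays from 0 carries this gain linearly to infinity.\<close>

lemma H_linear_growth: "\<exists>\<alpha>>0. \<forall>y p. \<alpha> * norm p - (1 + hmin) \<le> H y p"
proof -
  let ?B = "hmax 0"
  obtain R1 where R1: "\<And>y p. H y p \<le> ?B + 1 \<Longrightarrow> norm p \<le> R1" using H_coercive by blast
  define R2 where "R2 = max R1 0 + 1"
  have R2: "0 < R2" "R1 < R2" by (auto simp: R2_def)
  have "norm p / R2 - (1 + hmin) \<le> H y p" for y p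
  proof (cases "norm p \<le> R2")
    case True
    then have "norm p / R2 \<le> 1" using R2(1) by simp
    then show ?thesis using hmin(2)[of y p] by linarith
  next
    case False
    define l where "l = R2 / norm p"
    have p0: "0 < norm p" using False R2(1) by linarith
    have l: "0 < l" "l \<le> 1" using False R2(1) p0 by (auto simp: l_def)
    have "norm (l *\<^sub>R p) = R2" using l p0 R2(1) by (simp add: l_def)
    then have 1: "?B + 1 < H y (l *\<^sub>R p)" using R1[of y "l *\<^sub>R p"] R2(2) by (cases "H y (l *\<^sub>R p) \<le> ?B + 1") auto
    have "H y ((1 - l) *\<^sub>R 0 + l *\<^sub>R p) \<le> (1 - l) * H y 0 + l * H y p"
      using l by (intro convex_onD[OF H_convex]) auto
    also have "(1 - l) * H y 0 \<le> (1 - l) * ?B"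
      using hmax(2)[of 0 0 y] l by (intro mult_left_mono) auto
    finally have "?B + 1 < (1 - l) * ?B + l * H y p" using 1 by simp
    then have "1 < l * (H y p - ?B)" by (simp add: algebra_simps)
    then have "1 / l < H y p - ?B" using l(1) by (simp add: field_simps)
    moreover have "1 / l = norm p / R2" by (simp add: l_def)
    ultimately show ?thesis using hmax(1)[of 0] hmin(1) by linarith
  qed
  then show ?thesis using R2(1) by (intro exI[of _ "1 / R2"]) auto
qed

text \<open>Loops with displacement \<open>axis i 1\<close> and its negative bound the coordinates
  of \<open>p\<close>. Their cost must not depend on \<open>R\<close>, which is chosen after
  \<open>p\<close>; by linear growth of \<open>H\<close>, speeds up to \<open>\<alpha>\<close> are
  admissible at one rate for all \<open>R\<close>.\<close>

lemma effective_hamiltonian_coercive: "\<exists>R. \<forall>p. effective_hamiltonian \<Omega> H p \<le> B \<longrightarrow> norm p \<le> R"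
proof -
  obtain \<alpha> where \<alpha>: "0 < \<alpha>" "\<And>y p. \<alpha> * norm p - (1 + hmin) \<le> H y p" using H_linear_growth by blast
  let ?C = "1 + hmin"
  have adm: "admissible H R z v ?C" if "norm v \<le> \<alpha>" for R z v
    unfolding admissible_def
  proof (intro allI impI)
    fix q :: "real ^ 'n"
    have "q \<bullet> v \<le> norm q * norm v" by (rule norm_cauchy_schwarz)
    also have "\<dots> \<le> norm q * \<alpha>" using that by (intro mult_left_mono) auto
    finally show "q \<bullet> v - H z q \<le> ?C" using \<alpha>(2)[of q z] by (simp add: mult.commute)
  qed
  obtain a where a: "a \<in> \<Omega>" using nonempty by blast
  have "\<exists>l. connects \<Omega> a (a + z) l" if "z \<in> integer_lattice" for z
    by (rule connected_imp_connects[OF open_domain connected_domain a periodic[OF a that]])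
  then obtain len where len: "\<And>z. z \<in> integer_lattice \<Longrightarrow> connects \<Omega> a (a + z) (len z)" by metis
  define m where "m z = len z / \<alpha>" for z
  have m: "0 \<le> m z" if "z \<in> integer_lattice" for z
    using connects_nonneg[OF len[OF that]] \<alpha>(1) by (simp add: m_def)
  define Q where "Q = (\<Sum>i\<in>UNIV. (max 0 (B + ?C)) * (m (axis i 1) + m (- axis i 1)))"
  have "norm p \<le> Q" if B: "effective_hamiltonian \<Omega> H p \<le> B" for p
  proof -
    obtain R where R: "0 \<le> R" "norm p \<le> R" "effective_hamiltonian \<Omega> H p = crit R p"
      by (rule effective_hamiltonian_crit[of "norm p"]) blast
    have dir: "p \<bullet> z \<le> max 0 (B + ?C) * m z" if z: "z \<in> integer_lattice" for z
    proof -
      have "path R a (m z, z, m z * ?C)"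
        using connects_imp_path[OF adm \<alpha>(1) len[OF z]] by (simp add: m_def)
      from loop_cost[OF R(2) this z] have "p \<bullet> z \<le> (crit R p + ?C) * m z" by (simp add: algebra_simps)
      also have "\<dots> \<le> max 0 (B + ?C) * m z" using m[OF z] B R(3) by (intro mult_right_mono) auto
      finally show ?thesis .
    qed
    have "\<bar>p $ i\<bar> \<le> max 0 (B + ?C) * (m (axis i 1) + m (- axis i 1))" for i
    proof -
      have "p $ i \<le> max 0 (B + ?C) * m (axis i 1)" "- (p $ i) \<le> max 0 (B + ?C) * m (- axis i 1)"
        using dir[OF integer_lattice_axis[of i]] dir[OF integer_lattice_minus[OF integer_lattice_axis[of i]]]
        by (simp_all add: inner_axis)
      moreover have "0 \<le> max 0 (B + ?C) * m (axis i 1)" "0 \<le> max 0 (B + ?C) * m (- axis i 1)"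
        using m integer_lattice_axis[of i] integer_lattice_minus[OF integer_lattice_axis[of i]] by simp_all
      ultimately show ?thesis unfolding distrib_left by linarith
    qed
    then have "(\<Sum>i\<in>UNIV. \<bar>p $ i\<bar>) \<le> Q" unfolding Q_def by (intro sum_mono)
    then show ?thesis using norm_le_l1_cart[of p] by linarith
  qed
  then show ?thesis by blast
qed

end

section \<open>The Lipschitz constant as an essential supremum\<close>

lemma gradient_ess_bounded_nonneg:
  assumes "gradient_ess_bounded (g :: 'a::euclidean_space \<Rightarrow> real) M"
  shows "0 \<le> M"
proof -
  have "AE x in (lborel :: 'a measure). 0 \<le> M"
    using assms unfolding gradient_ess_bounded_def
    by eventually_elim (metis norm_ge_zero order_trans)
  moreover have "ae_filter (lborel :: 'a measure) \<noteq> bot"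
    by (simp add: ae_filter_eq_bot_iff)
  ultimately show ?thesis using eventually_happens' by blast
qed

lemma AE_lborel_translate:
  assumes "AE x in (lborel :: 'a::euclidean_space measure). P x"
  shows "AE x in lborel. P (x + a)"
proof -
  obtain N where N: "{x. \<not> P x} \<subseteq> N" "N \<in> null_sets lborel"
  proof (rule AE_E[OF assms])
    fix N assume "{x \<in> space lborel. \<not> P x} \<subseteq> N" "emeasure lborel N = 0" "N \<in> sets lborel"
    then show thesis by (intro that[of N]) (auto simp: null_sets_def)
  qed
  have "{x. x - (- a) \<in> N} \<in> null_sets lborel"
    by (rule null_sets_translation[OF N(2)])
  then show ?thesis
    by (rule AE_I') (use N(1) in auto)
qed

text \<open>
  The segment between two points may lie in the null set where the gradient bound fails. Averages
  over balls do not see this set.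
\<close>

lemma lipschitz_average_derivative:
  fixes g :: "'a::euclidean_space \<Rightarrow> real"
  defines "N r x \<equiv> restrict_space lborel (ball (x :: 'a) r)"
  assumes lip: "L-lipschitz_on UNIV g" and grad: "gradient_ess_bounded g M"
  shows "\<exists>D. ((\<lambda>s. LINT z|N r x. g (z + s *\<^sub>R e)) has_real_derivative D) (at s) \<and> D \<le> M * norm e * measure (N r x) (space (N r x))"
proof -
  let ?N = "N r x"
  have fin: "finite_measure ?N"
    unfolding N_def
    by (intro finite_measureI) (simp add: space_restrict_space emeasure_restrict_space emeasure_lborel_ball_finite[THEN less_imp_neq, unfolded infinity_ennreal_def])
  interpret finite_measure ?N by (rule fin)
  have cont: "continuous_on UNIV g" using lip by (rule lipschitz_on_continuous_on)
  have meas: "(\<lambda>z. g (z + c)) \<in> borel_measurable ?N" for c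
    unfolding N_def
    by (intro measurable_restrict_space1) (auto intro!: borel_measurable_continuous_onI continuous_intros continuous_on_compose2[OF cont])
  have L0: "0 \<le> L" using lip lipschitz_on_nonneg by blast
  have glip: "\<bar>g y - g z\<bar> \<le> L * norm (y - z)" for y z
    using lipschitz_onD[OF lip, of y z] by (simp add: dist_norm)
  have int_g: "integrable ?N (\<lambda>z. g (z + c))" for c
  proof (rule integrable_const_bound[where B = "\<bar>g (x + c)\<bar> + L * r"])
    have "\<bar>g (z + c)\<bar> \<le> \<bar>g (x + c)\<bar> + L * r" if "z \<in> ball x r" for z
    proof -
      have "\<bar>g (z + c) - g (x + c)\<bar> \<le> L * norm (z - x)" using glip[of "z + c" "x + c"] by simp
      also have "\<dots> \<le> L * r" using that L0 by (intro mult_left_mono) (auto simp: dist_norm norm_minus_commute)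
      finally show ?thesis by linarith
    qed
    then show "AE z in ?N. norm (g (z + c)) \<le> \<bar>g (x + c)\<bar> + L * r"
      by (intro AE_I2) (auto simp: N_def space_restrict_space)
  qed (rule meas)
  define Q where "Q h z = (g (z + (s + h) *\<^sub>R e) - g (z + s *\<^sub>R e)) / h" for h z
  have Qm: "Q h \<in> borel_measurable ?N" for h
    unfolding Q_def by (intro borel_measurable_divide borel_measurable_diff meas borel_measurable_const)
  have Qb: "\<bar>Q h z\<bar> \<le> L * norm e" if "h \<noteq> 0" for h z
  proof -
    have "\<bar>g (z + (s + h) *\<^sub>R e) - g (z + s *\<^sub>R e)\<bar> \<le> L * norm (h *\<^sub>R e)"
      using glip[of "z + (s + h) *\<^sub>R e" "z + s *\<^sub>R e"] by (simp add: algebra_simps)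
    then show ?thesis using that by (simp add: Q_def divide_le_eq mult_ac)
  qed
  have Qi: "(LINT z|?N. Q h z) = ((LINT z|?N. g (z + (s + h) *\<^sub>R e)) - (LINT z|?N. g (z + s *\<^sub>R e))) / h" for h
    unfolding Q_def by (simp add: int_g)
  \<comment> \<open>A limit along one fixed sequence is measurable; almost everywhere it is the
    derivative in direction \<open>e\<close>.\<close>
  define F where "F z = lim (\<lambda>n. Q (1 / real (Suc n)) z)" for z
  have l: "(\<lambda>n. 1 / real (Suc n)) \<longlonglongrightarrow> 0" by (rule LIMSEQ_Suc[OF lim_1_over_n])
  have Fm: "F \<in> borel_measurable ?N"
    unfolding F_def by (rule borel_measurable_lim_metric) (rule Qm)
  \<comment> \<open>All sequences tending to 0 are treated at once, outside one common null set,
    because the derivative of the average is obtained through sequential limits and dominated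
    convergence.\<close>
  have conv: "AE z in ?N. (\<forall>X. (\<forall>i. X i \<noteq> 0) \<longrightarrow> X \<longlonglongrightarrow> 0 \<longrightarrow> (\<lambda>i. Q (X i) z) \<longlonglongrightarrow> F z) \<and> F z \<le> M * norm e"
  proof -
    have "AE z in lborel. \<exists>D. (GDERIV g (z + s *\<^sub>R e) :> D) \<and> norm D \<le> M"
      using grad unfolding gradient_ess_bounded_def by (rule AE_lborel_translate)
    then have "AE z in lborel. (\<forall>X. (\<forall>i. X i \<noteq> 0) \<longrightarrow> X \<longlonglongrightarrow> 0 \<longrightarrow> (\<lambda>i. Q (X i) z) \<longlonglongrightarrow> F z) \<and> F z \<le> M * norm e"
    proof eventually_elim
      case (elim z)
      then obtain D where D: "(g has_derivative (\<lambda>h. h \<bullet> D)) (at (z + s *\<^sub>R e))" "norm D \<le> M"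
        unfolding gderiv_def by blast
      have "((\<lambda>h. g (z + (s + h) *\<^sub>R e)) has_derivative (\<lambda>h. (h *\<^sub>R e) \<bullet> D)) (at 0)"
        using D(1) by (intro has_derivative_compose[where g = g and f = "\<lambda>h. z + (s + h) *\<^sub>R e"])
          (auto intro!: derivative_eq_intros)
      then have "((\<lambda>h. g (z + (s + h) *\<^sub>R e)) has_real_derivative (e \<bullet> D)) (at 0)"
        by (simp add: has_field_derivative_def mult_commute_abs)
      then have "((\<lambda>h. Q h z) \<longlongrightarrow> e \<bullet> D) (at 0)"
        by (simp add: has_field_derivative_iff Q_def)
      then have seq: "(\<lambda>i. Q (X i) z) \<longlonglongrightarrow> e \<bullet> D" if "\<forall>i. X i \<noteq> 0" "X \<longlonglongrightarrow> 0" for X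
        using that unfolding tendsto_at_iff_sequentially by (auto simp: comp_def)
      have "(\<lambda>n. Q (1 / real (Suc n)) z) \<longlonglongrightarrow> e \<bullet> D"
        by (rule seq[OF _ l]) simp
      then have Fz: "F z = e \<bullet> D" unfolding F_def by (rule limI)
      have "e \<bullet> D \<le> norm e * norm D" by (rule norm_cauchy_schwarz)
      also have "\<dots> \<le> norm e * M" using D(2) by (intro mult_left_mono) auto
      finally show ?case using seq Fz by (simp add: mult.commute)
    qed
    then have "AE z in lborel. z \<in> ball x r \<longrightarrow> (\<forall>X. (\<forall>i. X i \<noteq> 0) \<longrightarrow> X \<longlonglongrightarrow> 0 \<longrightarrow> (\<lambda>i. Q (X i) z) \<longlonglongrightarrow> F z) \<and> F z \<le> M * norm e"
      by (rule eventually_mono) blast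
    then show ?thesis unfolding N_def by (subst AE_restrict_space_iff) simp_all
  qed
  have intF: "integrable ?N F" and limF: "X \<longlonglongrightarrow> 0 \<Longrightarrow> (\<And>i. X i \<noteq> 0) \<Longrightarrow> (\<lambda>i. LINT z|?N. Q (X i) z) \<longlonglongrightarrow> (LINT z|?N. F z)" for X
  proof -
    have *: "integrable ?N F \<and> (\<lambda>i. LINT z|?N. Q (X i) z) \<longlonglongrightarrow> (LINT z|?N. F z)" if "X \<longlonglongrightarrow> 0" "\<And>i. X i \<noteq> 0" for X
    proof
      have ae: "AE z in ?N. (\<lambda>i. Q (X i) z) \<longlonglongrightarrow> F z" using conv by eventually_elim (use that in blast)
      have bd: "\<And>i. AE z in ?N. norm (Q (X i) z) \<le> L * norm e" using Qb that(2) by simp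
      show "integrable ?N F"
        by (rule integrable_dominated_convergence[OF Fm Qm _ ae bd]) simp
      show "(\<lambda>i. LINT z|?N. Q (X i) z) \<longlonglongrightarrow> (LINT z|?N. F z)"
        by (rule integral_dominated_convergence[OF Fm Qm _ ae bd]) simp
    qed
    show "integrable ?N F" using *[OF l] by simp
    show "X \<longlonglongrightarrow> 0 \<Longrightarrow> (\<And>i. X i \<noteq> 0) \<Longrightarrow> (\<lambda>i. LINT z|?N. Q (X i) z) \<longlonglongrightarrow> (LINT z|?N. F z)" for X using * by blast
  qed
  have "((\<lambda>h. LINT z|?N. Q h z) \<longlongrightarrow> (LINT z|?N. F z)) (at 0)"
    unfolding tendsto_at_iff_sequentially using limF by (auto simp: comp_def)
  then have "((\<lambda>s. LINT z|?N. g (z + s *\<^sub>R e)) has_real_derivative (LINT z|?N. F z)) (at s)"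
    unfolding Qi DERIV_def .
  moreover have "(LINT z|?N. F z) \<le> (LINT z|?N. M * norm e)"
    using conv by (intro integral_mono_AE intF) (auto elim!: eventually_mono)
  ultimately show ?thesis by (auto simp: mult_ac)
qed

text \<open>The averages over balls of radius \<open>r\<close> satisfy the mean value estimate with
  the constant \<open>M\<close>. Replacing \<open>g\<close> by its average costs at most
  \<open>L * r\<close> at each of the two endpoints, and \<open>r\<close> makes the sum at most
  \<open>\<epsilon>\<close>.\<close>

lemma lipschitz_of_gradient_bound:
  fixes g :: "'a::euclidean_space \<Rightarrow> real"
  assumes lip: "L-lipschitz_on UNIV g" and grad: "gradient_ess_bounded g M"
  shows "g y - g x \<le> M * norm (y - x)"
proof (rule field_le_epsilon)
  fix \<epsilon> :: real assume \<epsilon>: "0 < \<epsilon>"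
  have L0: "0 \<le> L" using lip lipschitz_on_nonneg by blast
  have glip: "\<bar>g y - g z\<bar> \<le> L * norm (y - z)" for y z
    using lipschitz_onD[OF lip, of y z] by (simp add: dist_norm)
  define e where "e = y - x"
  define r where "r = \<epsilon> / (2 * L + 1)"
  have r: "0 < r" "2 * L * r \<le> \<epsilon>" using \<epsilon> L0 by (auto simp: r_def field_simps)
  let ?N = "restrict_space lborel (ball x r)"
  let ?V = "measure ?N (space ?N)"
  let ?\<Phi> = "\<lambda>s. LINT z|?N. g (z + s *\<^sub>R e)"
  have fin: "finite_measure ?N"
    by (intro finite_measureI) (simp add: space_restrict_space emeasure_restrict_space emeasure_lborel_ball_finite[THEN less_imp_neq, unfolded infinity_ennreal_def])
  interpret finite_measure ?N by (rule fin)
  have "?V = measure lborel (ball x r)" by (simp add: measure_restrict_space space_restrict_space)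
  then have V: "0 < ?V" using r(1) by (simp add: content_ball_pos)
  have cont: "continuous_on UNIV g" using lip by (rule lipschitz_on_continuous_on)
  have meas: "(\<lambda>z. g (z + c)) \<in> borel_measurable ?N" for c
    by (intro measurable_restrict_space1) (auto intro!: borel_measurable_continuous_onI continuous_intros continuous_on_compose2[OF cont])
  have int_g: "integrable ?N (\<lambda>z. g (z + c))" for c
  proof (rule integrable_const_bound[where B = "\<bar>g (x + c)\<bar> + L * r"])
    have "\<bar>g (z + c)\<bar> \<le> \<bar>g (x + c)\<bar> + L * r" if "z \<in> ball x r" for z
    proof -
      have "\<bar>g (z + c) - g (x + c)\<bar> \<le> L * norm (z - x)" using glip[of "z + c" "x + c"] by simp
      also have "\<dots> \<le> L * r" using that L0 by (intro mult_left_mono) (auto simp: dist_norm norm_minus_commute)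
      finally show ?thesis by linarith
    qed
    then show "AE z in ?N. norm (g (z + c)) \<le> \<bar>g (x + c)\<bar> + L * r"
      by (intro AE_I2) (auto simp: space_restrict_space)
  qed (rule meas)
  obtain D where D: "\<And>s. (?\<Phi> has_real_derivative D s) (at s)" "\<And>s. D s \<le> M * norm e * ?V"
    using lipschitz_average_derivative[OF lip grad, where x = x and r = r and e = e] by metis
  obtain s where "?\<Phi> 1 - ?\<Phi> 0 = (1 - 0) * D s"
    using MVT2[of 0 1 ?\<Phi> D] D(1) by auto
  then have up: "?\<Phi> 1 - ?\<Phi> 0 \<le> M * norm e * ?V" using D(2)[of s] by simp
  have "(LINT z|?N. g (x + e) - g x - 2 * L * r) \<le> (LINT z|?N. g (z + 1 *\<^sub>R e) - g (z + 0 *\<^sub>R e))"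
  proof (rule integral_mono)
    fix z assume "z \<in> space ?N"
    then have z: "norm (z - x) \<le> r" by (simp add: space_restrict_space dist_norm norm_minus_commute)
    have "L * norm (z - x) \<le> L * r" using z L0 by (rule mult_left_mono)
    moreover have "\<bar>g (z + e) - g (x + e)\<bar> \<le> L * norm (z - x)" using glip[of "z + e" "x + e"] by simp
    moreover have "\<bar>g z - g x\<bar> \<le> L * norm (z - x)" by (rule glip)
    ultimately show "g (x + e) - g x - 2 * L * r \<le> g (z + 1 *\<^sub>R e) - g (z + 0 *\<^sub>R e)" by simp
  qed (use int_g int_g[of 0] in \<open>auto intro!: Bochner_Integration.integrable_diff\<close>)
  also have "\<dots> = ?\<Phi> 1 - ?\<Phi> 0" by (rule Bochner_Integration.integral_diff) (rule int_g)+
  finally have "(g (x + e) - g x - 2 * L * r) * ?V \<le> M * norm e * ?V" using up by (simp add: mult.commute)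
  then have "g (x + e) - g x - 2 * L * r \<le> M * norm e" using V by simp
  then show "g y - g x \<le> M * norm (y - x) + \<epsilon>" using r(2) by (simp add: e_def)
qed

section \<open>Comparison with the homogenized problem\<close>

lemma C1_time_shift:
  fixes \<phi> :: "'a::euclidean_space \<times> real \<Rightarrow> real"
  assumes "C1_with_gradient U \<phi> D\<phi>"
  shows "C1_with_gradient ((\<lambda>z. z + a) -` U) (\<lambda>z. \<phi> (z + a)) (\<lambda>z. D\<phi> (z + a))"
proof -
  have "GDERIV (\<lambda>z. \<phi> (z + a)) z :> D\<phi> (z + a)" if z: "z + a \<in> U" for z
  proof -
    have "(\<phi> has_derivative (\<lambda>h. h \<bullet> D\<phi> (z + a))) (at (z + a))"
      using assms z by (auto simp: C1_with_gradient_def gderiv_def)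
    moreover have "((\<lambda>z. z + a) has_derivative (\<lambda>h. h)) (at z)"
      by (auto intro!: derivative_eq_intros)
    ultimately show ?thesis
      unfolding gderiv_def using has_derivative_compose[of "\<lambda>z. z + a" "\<lambda>h. h" z UNIV \<phi>] by auto
  qed
  moreover have "open ((\<lambda>z. z + a) -` U)"
    using assms by (intro open_vimage continuous_intros) (auto simp: C1_with_gradient_def)
  moreover have "continuous_on ((\<lambda>z. z + a) -` U) (\<lambda>z. D\<phi> (z + a))"
    by (rule continuous_on_compose2[of U D\<phi>])
      (use assms in \<open>auto simp: C1_with_gradient_def intro!: continuous_intros\<close>)
  ultimately show ?thesis by (auto simp: C1_with_gradient_def)
qed

lemma viscosity_supersolution_time_shift:
  fixes w :: "'a::euclidean_space \<times> real \<Rightarrow> real"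
  assumes sup: "viscosity_supersolution (S \<times> {0<..}) (evolution_operator K) w" and "0 \<le> h"
  shows "viscosity_supersolution (S \<times> {0<..}) (evolution_operator K) (\<lambda>z. w (z + (0, h)))"
  unfolding viscosity_supersolution_def
proof (intro ballI allI impI)
  fix z0 U \<phi> D\<phi>
  assume z0: "z0 \<in> S \<times> {0<..}" and as: "z0 \<in> U \<and> C1_with_gradient U \<phi> D\<phi> \<and>
    (\<forall>\<^sub>F z in at z0 within S \<times> {0<..}. w (z + (0, h)) - \<phi> z \<ge> w (z0 + (0, h)) - \<phi> z0)"
  then obtain r where r: "r > 0" "\<And>z. z \<in> S \<times> {0<..} \<Longrightarrow> z \<noteq> z0 \<Longrightarrow> dist z z0 < r \<Longrightarrow>
      w (z + (0, h)) - \<phi> z \<ge> w (z0 + (0, h)) - \<phi> z0"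
    unfolding eventually_at by blast
  let ?z = "z0 + (0, h)"
  have shift: "?z + - (0, h) = z0" by (cases z0) simp
  have "\<forall>\<^sub>F z in at ?z within S \<times> {0<..}. w z - \<phi> (z + - (0, h)) \<ge> w ?z - \<phi> (?z + - (0, h))"
  proof (rule eventually_at_within_subset_ball[of "min r (snd z0)"])
    show "0 < min r (snd z0)" using r z0 by auto
  next
    fix z assume z: "z \<in> S \<times> {0<..}" "dist z ?z < min r (snd z0)"
    then have "\<bar>snd z - snd ?z\<bar> < snd z0"
      using norm_fst_snd_diff_le(2)[of z ?z] by (simp add: dist_norm)
    then have "z + - (0, h) \<in> S \<times> {0<..}" using z(1) by (cases z) (auto simp: abs_if split: if_splits)
    moreover have "dist (z + - (0, h)) z0 < r"
    proof -
      have eq: "z + - (0, h) - z0 = z - ?z" by (cases z, cases z0) simp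
      show ?thesis using z(2) unfolding dist_norm eq by simp
    qed
    moreover define y where "y = z + - (0, h)"
    ultimately have "w (y + (0, h)) - \<phi> y \<ge> w ?z - \<phi> z0"
      using r(2)[of y] by (cases "y = z0") auto
    moreover have "y + (0, h) = z" unfolding y_def by (cases z) simp
    ultimately show "w z - \<phi> (z + - (0, h)) \<ge> w ?z - \<phi> (?z + - (0, h))"
      unfolding y_def shift by (simp only:)
  qed
  moreover have "C1_with_gradient ((\<lambda>z. z + - (0, h)) -` U) (\<lambda>z. \<phi> (z + - (0, h))) (\<lambda>z. D\<phi> (z + - (0, h)))"
    using C1_time_shift as by blast
  moreover have "?z \<in> S \<times> {0<..}" using z0 \<open>0 \<le> h\<close> by (cases z0) auto
  moreover have "?z \<in> (\<lambda>z. z + - (0, h)) -` U" using as unfolding vimage_def mem_Collect_eq shift by blast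
  ultimately have "evolution_operator K ?z (D\<phi> (?z + - (0, h))) \<ge> 0"
    using sup[unfolded viscosity_supersolution_def, rule_format, of ?z "(\<lambda>z. z + - (0, h)) -` U"
      "\<lambda>z. \<phi> (z + - (0, h))" "\<lambda>z. D\<phi> (z + - (0, h))"] by simp
  then show "evolution_operator K z0 (D\<phi> z0) \<ge> 0"
    unfolding shift by (cases z0) (simp add: evolution_operator_def split: prod.splits)
qed

lemma viscosity_subsolution_minus_const:
  assumes "viscosity_subsolution S F w"
  shows "viscosity_subsolution S F (\<lambda>z. w z - c)"
proof -
  have *: "w z - c - \<phi> z \<le> w z0 - c - \<phi> z0 \<longleftrightarrow> w z - \<phi> z \<le> w z0 - \<phi> z0" for z z0 \<phi> by linarith
  show ?thesis using assms unfolding viscosity_subsolution_def * .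
qed

lemma lipschitz_on_prodI:
  fixes f :: "'a::euclidean_space \<times> real \<Rightarrow> real"
  assumes "0 \<le> A" "0 \<le> B"
    and x: "\<And>x y t. x \<in> X \<Longrightarrow> y \<in> X \<Longrightarrow> 0 \<le> t \<Longrightarrow> f (x, t) - f (y, t) \<le> A * norm (x - y)"
    and t: "\<And>x s t. x \<in> X \<Longrightarrow> 0 \<le> s \<Longrightarrow> 0 \<le> t \<Longrightarrow> f (x, s) - f (x, t) \<le> B * \<bar>s - t\<bar>"
  shows "(A + B)-lipschitz_on (X \<times> {0..}) f"
proof (rule lipschitz_onI)
  have *: "f z - f z' \<le> (A + B) * norm (z - z')" if "z \<in> X \<times> {0..}" "z' \<in> X \<times> {0..}" for z z'
  proof -
    obtain x t y s where z: "z = (x, t)" "z' = (y, s)" by (cases z, cases z') auto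
    have "f (x, t) - f (y, t) \<le> A * norm (x - y)" "f (y, t) - f (y, s) \<le> B * \<bar>t - s\<bar>"
      using x[of x y t] t[of y t s] that z by auto
    moreover have "A * norm (x - y) \<le> A * norm (z - z')" "B * \<bar>t - s\<bar> \<le> B * norm (z - z')"
      using norm_fst_snd_diff_le[of z z'] z assms(1,2) by (auto intro: mult_left_mono)
    ultimately show ?thesis unfolding z by (simp add: algebra_simps)
  qed
  show "dist (f z) (f z') \<le> (A + B) * dist z z'" if "z \<in> X \<times> {0..}" "z' \<in> X \<times> {0..}" for z z'
    using *[OF that] *[OF that(2,1)] by (simp add: dist_norm norm_minus_commute abs_le_iff)
  show "0 \<le> A + B" using assms by simp
qed

text \<open>Covers the oscillating problem on the periodic domain and the homogenized problem on the
  whole space, with the same constants \<open>M\<close>, \<open>C\<close> and \<open>h\<close> for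
  both.\<close>

locale cauchy_solution =
  fixes W :: "'a::euclidean_space set" and K g and w :: "'a \<times> real \<Rightarrow> real" and M C h :: real
  assumes W: "open W" "cone_condition W"
    and K: "\<And>B. uniformly_continuous_on (UNIV \<times> cball 0 B) (\<lambda>(x, p). K x p)"
    and K_le: "\<And>x p. norm p \<le> M \<Longrightarrow> K x p \<le> C" and K_ge: "\<And>x p. - h \<le> K x p"
    and nonneg: "0 \<le> M" "0 \<le> C" "0 \<le> h"
    and g: "\<And>x y. g y - g x \<le> M * norm (y - x)"
    and sol: "state_constraint_solution W K g w"
begin

lemma solution:
  obtains L where "L-lipschitz_on (closure W \<times> {0..}) w"
    and "viscosity_subsolution (W \<times> {0<..}) (evolution_operator K) w"
    and "viscosity_supersolution (closure W \<times> {0<..}) (evolution_operator K) w"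
  using sol unfolding state_constraint_solution_def by blast

lemma initial: "x \<in> closure W \<Longrightarrow> w (x, 0) = g x"
  using sol unfolding state_constraint_solution_def by blast

lemma continuous_solution: "continuous_on (closure W \<times> {0..}) w"
  using solution lipschitz_on_continuous_on by metis

text \<open>\<open>g x - C * t\<close> is a subsolution, since gradients that touch it have norm at
  most \<open>M\<close> and hence energy at most \<open>C\<close>.\<close>

lemma initial_lower:
  assumes "x \<in> closure W" "0 \<le> t"
  shows "g x - C * t \<le> w (x, t)"
proof -
  obtain L where L: "L-lipschitz_on (closure W \<times> {0..}) w"
    and sup: "viscosity_supersolution (closure W \<times> {0<..}) (evolution_operator K) w"
    by (rule solution)
  let ?f = "\<lambda>z :: 'a \<times> real. g (fst z) - C * snd z"
  have g_abs: "\<bar>g x - g y\<bar> \<le> M * norm (x - y)" for x y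
    using g[of x y] g[of y x] by (simp add: norm_minus_commute abs_le_iff)
  have f: "viscosity_subsolution (W \<times> {0<..}) (evolution_operator K) ?f"
  proof (rule backward_inequality_viscosity_subsolution[OF W(1) nonneg(1)])
    show "\<bar>?f (x, t) - ?f (y, t)\<bar> \<le> M * norm (x - y)" for x y t using g_abs[of x y] by simp
  next
    fix x p :: 'a and t \<eta> :: real assume p: "norm p \<le> M" and "0 < \<eta>"
    have "?f (x, t) \<le> ?f (x - \<tau> *\<^sub>R 0, t - \<tau>) + \<tau> * (p \<bullet> 0 - K x p + \<eta>)" if "0 < \<tau>" for \<tau>
    proof -
      have "0 \<le> \<tau> * (C - K x p + \<eta>)" using K_le[OF p] \<open>0 < \<eta>\<close> that by (intro mult_nonneg_nonneg) (auto simp: add_nonneg_nonneg)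
      then show ?thesis by (simp add: algebra_simps)
    qed
    then show "\<exists>q. \<forall>\<^sub>F \<tau> in at_right 0. ?f (x, t) \<le> ?f (x - \<tau> *\<^sub>R q, t - \<tau>) + \<tau> * (p \<bullet> q - K x p + \<eta>)"
      by (intro exI[of _ 0]) (simp add: eventually_at_right_less eventually_mono[OF eventually_at_right_less])
  qed
  have lip: "(M + C)-lipschitz_on (closure W \<times> {0..}) ?f"
    by (rule lipschitz_on_prodI) (use nonneg g in \<open>auto simp flip: right_diff_distrib intro!: mult_left_mono\<close>)
  have "?f (x, t) \<le> w (x, t)"
    by (rule comparison_principle[OF W K lip f L sup]) (use assms initial in auto)
  then show ?thesis by simp
qed

text \<open>The solution lowered by \<open>C * s\<close> is compared with the solution restarted at
  time \<open>s\<close>; they are ordered initially by the preceding bound.\<close>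

lemma time_lower:
  assumes "x \<in> closure W" "0 \<le> t" "0 \<le> s"
  shows "w (x, t) - C * s \<le> w (x, t + s)"
proof -
  obtain L where L: "L-lipschitz_on (closure W \<times> {0..}) w"
    and sub: "viscosity_subsolution (W \<times> {0<..}) (evolution_operator K) w"
    and sup: "viscosity_supersolution (closure W \<times> {0<..}) (evolution_operator K) w"
    by (rule solution)
  have "L-lipschitz_on (closure W \<times> {0..}) (\<lambda>z. w z - C * s)"
    using L by (simp add: lipschitz_on_def dist_norm)
  moreover have "L-lipschitz_on (closure W \<times> {0..}) (\<lambda>z :: 'a \<times> real. w (z + (0, s)))"
  proof (rule lipschitz_onI)
    fix z z' :: "'a \<times> real" assume z: "z \<in> closure W \<times> {0..}" "z' \<in> closure W \<times> {0..}"
    show "dist (w (z + (0, s))) (w (z' + (0, s))) \<le> L * dist z z'"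
      using lipschitz_onD[OF L, of "z + (0, s)" "z' + (0, s)"] z \<open>0 \<le> s\<close>
      by (cases z, cases z') (simp add: dist_norm)
  qed (use L lipschitz_on_nonneg in blast)
  ultimately have "w (x, t) - C * s \<le> w ((x, t) + (0, s))"
    by (rule comparison_principle[OF W K _ viscosity_subsolution_minus_const[OF sub]
        _ viscosity_supersolution_time_shift[OF sup \<open>0 \<le> s\<close>]])
      (use assms initial_lower initial in auto)
  then show ?thesis by simp
qed

lemma solution_step_subsolution:
  assumes "\<And>x p. K x p \<le> C \<Longrightarrow> norm p \<le> R"
  shows "step_subsolution W K R w"
proof (rule viscosity_subsolution_imp_step[OF W(1) K])
  show "continuous_on (W \<times> {0..}) w"
    by (rule continuous_on_subset[OF continuous_solution]) (auto dest: subsetD[OF closure_subset])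
  show "viscosity_subsolution (W \<times> {0<..}) (evolution_operator K) w" by (rule solution)
  show "w (x, t) - C * s \<le> w (x, t + s)" if "x \<in> W" "0 < t" "0 \<le> s" for x t s
    using time_lower[of x t s] closure_subset that by auto
qed (use assms in auto)

lemma closure_induct:
  assumes "continuous_on (closure W) a" "continuous_on (closure W) b"
    and "\<And>x. x \<in> W \<Longrightarrow> a x \<le> (b x :: real)" "x \<in> closure W"
  shows "a x \<le> b x"
  using continuous_le_on_closure[of W "\<lambda>x. a x - b x" x 0] assms
  by (simp add: continuous_on_diff)

lemma slice_continuous: "0 \<le> t \<Longrightarrow> continuous_on (closure W) (\<lambda>x. w (x, t))"
  by (rule continuous_on_compose2[OF continuous_solution]) (auto intro!: continuous_intros)

text \<open>Standing still is admissible at rate \<open>h\<close>, because \<open>- K\<close> is at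
  most \<open>h\<close>.\<close>

lemma time_upper:
  assumes "x \<in> closure W" "0 \<le> t" "0 \<le> s" and R: "\<And>x p. K x p \<le> C \<Longrightarrow> norm p \<le> R"
  shows "w (x, t + s) \<le> w (x, t) + h * s"
proof (rule closure_induct[OF _ _ _ assms(1)])
  fix x assume x: "x \<in> W"
  have "step W K R x (s, s *\<^sub>R 0, s * h)"
  proof (rule stepI)
    have "- K y p \<le> h" for y p using K_ge[of y p] by linarith
    then show "x + r *\<^sub>R 0 \<in> W \<and> admissible K R (x + r *\<^sub>R 0) 0 h" for r
      using x by (auto simp: admissible_def)
  qed (use assms in auto)
  then show "w (x, t + s) \<le> w (x, t) + h * s"
    using solution_step_subsolution[OF R] \<open>0 \<le> t\<close> unfolding step_subsolution_def by (fastforce simp: mult.commute)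
qed (use assms slice_continuous in \<open>auto intro!: continuous_intros\<close>)

end

lemma step_start: "step \<Omega> H R x (\<tau>, \<Delta>, c) \<Longrightarrow> x \<in> \<Omega> \<and> x + \<Delta> \<in> \<Omega> \<and> 0 \<le> \<tau>"
  by (elim stepE) (force dest: spec[of _ 0])

lemma step_subsolution_add_const:
  "step_subsolution \<Omega> H R f \<Longrightarrow> step_subsolution \<Omega> H R (\<lambda>z. a + f z)"
  unfolding step_subsolution_def by (simp add: algebra_simps)

lemma step_subsolution_SUP:
  assumes "I \<noteq> {}" and f: "\<And>i. i \<in> I \<Longrightarrow> step_subsolution \<Omega> H R (f i)"
    and bdd: "\<And>x t. x \<in> \<Omega> \<Longrightarrow> 0 \<le> t \<Longrightarrow> bdd_above ((\<lambda>i. f i (x, t)) ` I)"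
  shows "step_subsolution \<Omega> H R (\<lambda>z. SUP i\<in>I. f i z)"
  unfolding step_subsolution_def
proof (intro allI impI)
  fix x \<tau> \<Delta> c t assume s: "step \<Omega> H R x (\<tau>, \<Delta>, c)" and t: "0 \<le> (t :: real)"
  show "(SUP i\<in>I. f i (x + \<Delta>, t + \<tau>)) \<le> (SUP i\<in>I. f i (x, t)) + c"
  proof (rule cSUP_least[OF assms(1)])
    fix i assume i: "i \<in> I"
    have "f i (x + \<Delta>, t + \<tau>) \<le> f i (x, t) + c"
      using f[OF i] s t unfolding step_subsolution_def by blast
    also have "f i (x, t) \<le> (SUP i\<in>I. f i (x, t))"
      by (rule cSUP_upper[OF i bdd]) (use step_start[OF s] t in auto)
    finally show "f i (x + \<Delta>, t + \<tau>) \<le> (SUP i\<in>I. f i (x, t)) + c" by simp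
  qed
qed

text \<open>Infima of viscosity subsolutions are not subsolutions for a general Hamiltonian. Along
  steps they are as harmless as suprema, and convexity of \<open>H\<close> turns the result back
  into a viscosity subsolution.\<close>

lemma step_subsolution_INF:
  assumes "I \<noteq> {}" and f: "\<And>i. i \<in> I \<Longrightarrow> step_subsolution \<Omega> H R (f i)"
    and bdd: "\<And>x t. x \<in> \<Omega> \<Longrightarrow> 0 \<le> t \<Longrightarrow> bdd_below ((\<lambda>i. f i (x, t)) ` I)"
  shows "step_subsolution \<Omega> H R (\<lambda>z. INF i\<in>I. f i z)"
  unfolding step_subsolution_def
proof (intro allI impI)
  fix x \<tau> \<Delta> c t assume s: "step \<Omega> H R x (\<tau>, \<Delta>, c)" and t: "0 \<le> (t :: real)"
  have "(INF i\<in>I. f i (x + \<Delta>, t + \<tau>)) - c \<le> (INF i\<in>I. f i (x, t))"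
  proof (rule cINF_greatest[OF assms(1)])
    fix i assume i: "i \<in> I"
    have "(INF i\<in>I. f i (x + \<Delta>, t + \<tau>)) \<le> f i (x + \<Delta>, t + \<tau>)"
      by (rule cINF_lower[OF bdd i]) (use step_start[OF s] t in auto)
    also have "\<dots> \<le> f i (x, t) + c"
      using f[OF i] s t unfolding step_subsolution_def by blast
    finally show "(INF i\<in>I. f i (x + \<Delta>, t + \<tau>)) - c \<le> f i (x, t)" by simp
  qed
  then show "(INF i\<in>I. f i (x + \<Delta>, t + \<tau>)) \<le> (INF i\<in>I. f i (x, t)) + c" by simp
qed

lemma lipschitz_on_SUP:
  fixes f :: "'i \<Rightarrow> 'a::metric_space \<Rightarrow> real"
  assumes "I \<noteq> {}" and f: "\<And>i. i \<in> I \<Longrightarrow> L-lipschitz_on X (f i)"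
    and bdd: "\<And>x. x \<in> X \<Longrightarrow> bdd_above ((\<lambda>i. f i x) ` I)"
  shows "L-lipschitz_on X (\<lambda>x. SUP i\<in>I. f i x)"
proof (rule lipschitz_onI)
  show "0 \<le> L" using f assms(1) lipschitz_on_nonneg by blast
  have *: "(SUP i\<in>I. f i x) \<le> (SUP i\<in>I. f i y) + L * dist x y" if xy: "x \<in> X" "y \<in> X" for x y
  proof (rule cSUP_least[OF assms(1)])
    fix i assume i: "i \<in> I"
    have "f i x \<le> f i y + L * dist x y"
      using lipschitz_onD[OF f[OF i] xy] by (simp add: dist_norm abs_le_iff)
    then show "f i x \<le> (SUP i\<in>I. f i y) + L * dist x y"
      using cSUP_upper[OF i bdd[OF xy(2)]] by linarith
  qed
  show "dist (SUP i\<in>I. f i x) (SUP i\<in>I. f i y) \<le> L * dist x y" if "x \<in> X" "y \<in> X" for x y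
    using *[OF that] *[OF that(2,1)] dist_commute[of x y] by (simp add: dist_real_def abs_le_iff)
qed

lemma lipschitz_on_INF:
  fixes f :: "'i \<Rightarrow> 'a::metric_space \<Rightarrow> real"
  assumes "I \<noteq> {}" and f: "\<And>i. i \<in> I \<Longrightarrow> L-lipschitz_on X (f i)"
    and bdd: "\<And>x. x \<in> X \<Longrightarrow> bdd_below ((\<lambda>i. f i x) ` I)"
  shows "L-lipschitz_on X (\<lambda>x. INF i\<in>I. f i x)"
proof (rule lipschitz_onI)
  show "0 \<le> L" using f assms(1) lipschitz_on_nonneg by blast
  have *: "(INF i\<in>I. f i x) - L * dist x y \<le> (INF i\<in>I. f i y)" if xy: "x \<in> X" "y \<in> X" for x y
  proof (rule cINF_greatest[OF assms(1)])
    fix i assume i: "i \<in> I"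
    have "f i x \<le> f i y + L * dist x y"
      using lipschitz_onD[OF f[OF i] xy] by (simp add: dist_norm abs_le_iff)
    then show "(INF i\<in>I. f i x) - L * dist x y \<le> f i y"
      using cINF_lower[OF bdd[OF xy(1)] i] by linarith
  qed
  show "dist (INF i\<in>I. f i x) (INF i\<in>I. f i y) \<le> L * dist x y" if "x \<in> X" "y \<in> X" for x y
    using *[OF that] *[OF that(2,1)] dist_commute[of x y] by (simp add: dist_real_def abs_le_iff)
qed

section \<open>Lower bound on the oscillating solution\<close>

context periodic_hamiltonian
begin

text \<open>
  The Hopf formula for the homogenized problem with each plane \<open>p \<bullet> x\<close> replaced by the corrected
  plane \<open>p \<bullet> x + v p x\<close>: it stays within a bounded distance of the homogenized solution and is
  a subsolution of the oscillating problem.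
\<close>

definition inf_sup_envelope ::
    "real \<Rightarrow> (real ^ 'n \<Rightarrow> real ^ 'n \<Rightarrow> real) \<Rightarrow> (real ^ 'n \<Rightarrow> real) \<Rightarrow> (real ^ 'n) \<times> real \<Rightarrow> real" where
  "inf_sup_envelope P v g z = (INF y. SUP p\<in>cball 0 P.
     (g y - p \<bullet> y) + (p \<bullet> fst z + v p (fst z) - effective_hamiltonian \<Omega> H p * snd z))"

lemma effective_hamiltonian_bounds:
  "norm p \<le> M \<Longrightarrow> effective_hamiltonian \<Omega> H p \<le> hmax M" "- hmin \<le> effective_hamiltonian \<Omega> H p"
proof -
  obtain R where R: "M \<le> R" "\<And>q. norm q \<le> M \<Longrightarrow> effective_hamiltonian \<Omega> H q = crit R q"
    using effective_hamiltonian_crit[of M] by (metis order_refl)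
  show "effective_hamiltonian \<Omega> H p \<le> hmax M" if "norm p \<le> M"
    using R that loop_rates_bounds(4)[of p R M] by auto
  obtain R' where R': "norm p \<le> R'" "effective_hamiltonian \<Omega> H p = crit R' p"
    using effective_hamiltonian_crit[of "norm p"] by (metis order_refl)
  then show "- hmin \<le> effective_hamiltonian \<Omega> H p"
    using loop_rates_bounds(3)[of p R'] by simp
qed

context
  fixes g :: "real ^ 'n \<Rightarrow> real" and M P B L :: real and v :: "real ^ 'n \<Rightarrow> real ^ 'n \<Rightarrow> real" and R
  assumes g: "\<And>x y. g y - g x \<le> M * norm (y - x)" and M: "0 \<le> M" "M \<le> P"
    and v_bound: "\<And>p x. norm p \<le> P \<Longrightarrow> x \<in> closure \<Omega> \<Longrightarrow> \<bar>v p x\<bar> \<le> B"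
    and v_step: "\<And>p. norm p \<le> P \<Longrightarrow>
      step_subsolution \<Omega> H R (\<lambda>z. p \<bullet> fst z + v p (fst z) - effective_hamiltonian \<Omega> H p * snd z)"
    and v_lip: "\<And>p. norm p \<le> P \<Longrightarrow> L-lipschitz_on (closure \<Omega> \<times> {0..})
      (\<lambda>z. p \<bullet> fst z + v p (fst z) - effective_hamiltonian \<Omega> H p * snd z)"
begin

abbreviation (input) branch where
  "branch y p z \<equiv> (g y - p \<bullet> y) + (p \<bullet> fst z + v p (fst z) - effective_hamiltonian \<Omega> H p * snd z)"

lemma branch_upper:
  assumes "norm p \<le> P" "x \<in> closure \<Omega>" "0 \<le> t"
  shows "branch y p (x, t) \<le> g y + P * norm (x - y) + B + hmin * t"
proof -
  have "p \<bullet> (x - y) \<le> norm p * norm (x - y)" by (rule norm_cauchy_schwarz)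
  also have "\<dots> \<le> P * norm (x - y)" using assms by (intro mult_right_mono) auto
  finally have "p \<bullet> x - p \<bullet> y \<le> P * norm (x - y)" by (simp add: inner_diff_right)
  moreover have "- hmin * t \<le> effective_hamiltonian \<Omega> H p * t"
    using effective_hamiltonian_bounds(2) assms by (intro mult_right_mono) auto
  ultimately show ?thesis using v_bound[OF assms(1,2)] by auto
qed

lemma branch_bdd:
  assumes "x \<in> closure \<Omega>" "0 \<le> t"
  shows "bdd_above ((\<lambda>p. branch y p (x, t)) ` cball 0 P)"
  by (rule bdd_aboveI2[where M = "g y + P * norm (x - y) + B + hmin * t"])
    (use branch_upper[of _ x t y] assms in auto)

lemma branch_le_SUP:
  assumes "x \<in> closure \<Omega>" "0 \<le> t" "norm p \<le> P"
  shows "branch y p (x, t) \<le> (SUP p\<in>cball 0 P. branch y p (x, t))"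
  by (rule cSUP_upper[OF _ branch_bdd[OF assms(1,2)]]) (use assms in auto)

text \<open>The slope \<open>M *\<^sub>R sgn (x - y)\<close> compensates the largest possible fall
  of \<open>g\<close> from \<open>x\<close> to \<open>y\<close>, which makes the infimum over
  \<open>y\<close> finite.\<close>

lemma SUP_branch_lower:
  assumes "x \<in> closure \<Omega>" "0 \<le> t"
  shows "g x - B - hmax M * t \<le> (SUP p\<in>cball 0 P. branch y p (x, t))"
proof -
  define p where "p = M *\<^sub>R sgn (x - y)"
  have p: "norm p \<le> M" using M by (simp add: p_def norm_sgn)
  have "p \<bullet> (x - y) = M * norm (x - y)"
    by (cases "x = y") (auto simp: p_def sgn_div_norm inner_commute power2_norm_eq_inner[symmetric] power2_eq_square)
  moreover have "effective_hamiltonian \<Omega> H p * t \<le> hmax M * t"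
    using effective_hamiltonian_bounds(1)[OF p] assms by (intro mult_right_mono) auto
  moreover have "\<bar>v p x\<bar> \<le> B" using v_bound p M assms by auto
  ultimately have "g x - B - hmax M * t \<le> branch y p (x, t)"
    using g[of x y] by (simp add: inner_diff_right)
  also have "\<dots> \<le> (SUP p\<in>cball 0 P. branch y p (x, t))"
    by (rule branch_le_SUP) (use assms p M in auto)
  finally show ?thesis .
qed

lemma envelope_bdd:
  assumes "x \<in> closure \<Omega>" "0 \<le> t"
  shows "bdd_below (range (\<lambda>y. SUP p\<in>cball 0 P. branch y p (x, t)))"
  by (rule bdd_belowI2[where m = "g x - B - hmax M * t"]) (use SUP_branch_lower assms in auto)

lemma envelope_step: "step_subsolution \<Omega> H R (inf_sup_envelope P v g)"
  unfolding inf_sup_envelope_def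
proof (intro step_subsolution_INF step_subsolution_SUP step_subsolution_add_const v_step)
  show "cball 0 P \<noteq> {}" using M by simp
  show "bdd_above ((\<lambda>p. branch y p (x, t)) ` cball 0 P)" if "x \<in> \<Omega>" "0 \<le> t" for x y t
    by (rule branch_bdd) (use that closure_subset in auto)
  show "bdd_below (range (\<lambda>y. SUP p\<in>cball 0 P. branch y p (x, t)))" if "x \<in> \<Omega>" "0 \<le> t" for x t
    by (rule envelope_bdd) (use that closure_subset in auto)
qed auto

lemma envelope_lipschitz: "L-lipschitz_on (closure \<Omega> \<times> {0..}) (inf_sup_envelope P v g)"
  unfolding inf_sup_envelope_def
proof (intro lipschitz_on_INF lipschitz_on_SUP)
  show "cball 0 P \<noteq> {}" using M by simp
  show "bdd_above ((\<lambda>p. branch y p z) ` cball 0 P)" if "z \<in> closure \<Omega> \<times> {0..}" for z y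
    using branch_bdd[of "fst z" "snd z" y] that by auto
  show "bdd_below (range (\<lambda>y. SUP p\<in>cball 0 P. branch y p z))" if "z \<in> closure \<Omega> \<times> {0..}" for z
    using envelope_bdd[of "fst z" "snd z"] that by auto
  show "L-lipschitz_on (closure \<Omega> \<times> {0..}) (branch y p)" if "p \<in> cball 0 P" for y p
    using v_lip[of p] that by (simp add: lipschitz_on_def dist_norm)
qed auto

lemma envelope_viscosity:
  assumes "0 \<le> L"
  shows "viscosity_subsolution (\<Omega> \<times> {0<..}) (evolution_operator H) (inf_sup_envelope P v g)"
proof (rule step_subsolution_imp_viscosity[OF open_domain assms H_uniformly_continuous H_convex _ envelope_step])
  show "\<bar>inf_sup_envelope P v g (x, t) - inf_sup_envelope P v g (y, t)\<bar> \<le> L * norm (x - y)"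
    if "x \<in> \<Omega>" "y \<in> \<Omega>" "0 < t" for x y t
    using lipschitz_onD[OF envelope_lipschitz, of "(x, t)" "(y, t)"] that closure_subset[of \<Omega>]
    by (auto simp: dist_norm)
qed

lemma envelope_initial:
  assumes "x \<in> closure \<Omega>"
  shows "inf_sup_envelope P v g (x, 0) \<le> g x + B"
proof -
  have "inf_sup_envelope P v g (x, 0) \<le> (SUP p\<in>cball 0 P. branch x p (x, 0))"
    unfolding inf_sup_envelope_def by (rule cINF_lower[OF envelope_bdd]) (use assms in auto)
  also have "\<dots> \<le> g x + B"
    by (rule cSUP_least) (use M branch_upper[of _ x 0 x] assms in auto)
  finally show ?thesis .
qed

text \<open>After subtracting \<open>g y\<close>, the supremum over slopes is, up to
  \<open>B\<close>, \<open>t\<close> times the truncated effective Lagrangian at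
  \<open>(x - y) / t\<close>. So the straight motion from \<open>y\<close> to \<open>x\<close> is
  admissible at the rate this supremum defines, and \<open>u\<close> obeys the step inequality along
  it.\<close>

lemma envelope_lower:
  assumes u: "step_subsolution UNIV (\<lambda>x. effective_hamiltonian \<Omega> H) P u" "\<And>y. u (y, 0) = g y"
    and x: "x \<in> closure \<Omega>" "0 < t"
  shows "u (x, t) - B \<le> inf_sup_envelope P v g (x, t)"
  unfolding inf_sup_envelope_def
proof (rule cINF_greatest)
  fix y
  let ?G = "SUP p\<in>cball 0 P. branch y p (x, t)"
  have "step UNIV (\<lambda>x. effective_hamiltonian \<Omega> H) P y
    (t, t *\<^sub>R ((1 / t) *\<^sub>R (x - y)), t * ((?G + B - g y) / t))"
  proof (rule stepI)
    have "p \<bullet> ((1 / t) *\<^sub>R (x - y)) - effective_hamiltonian \<Omega> H p \<le> (?G + B - g y) / t" if p: "norm p \<le> P" for p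
    proof -
      have "branch y p (x, t) \<le> ?G" using branch_le_SUP[of x t p y] x p by simp
      moreover have "\<bar>v p x\<bar> \<le> B" using v_bound p x by auto
      ultimately have "p \<bullet> (x - y) - effective_hamiltonian \<Omega> H p * t \<le> ?G + B - g y"
        by (simp add: inner_diff_right)
      then have "(p \<bullet> (x - y) - effective_hamiltonian \<Omega> H p * t) / t \<le> (?G + B - g y) / t"
        using x by (intro divide_right_mono) auto
      then show ?thesis using x by (simp add: diff_divide_distrib)
    qed
    then show "y + s *\<^sub>R ((1 / t) *\<^sub>R (x - y)) \<in> UNIV \<and> admissible (\<lambda>x. effective_hamiltonian \<Omega> H) P
      (y + s *\<^sub>R ((1 / t) *\<^sub>R (x - y))) ((1 / t) *\<^sub>R (x - y)) ((?G + B - g y) / t)" for s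
      by (simp add: admissible_def)
  qed (use x in auto)
  then have "u (y + t *\<^sub>R ((1 / t) *\<^sub>R (x - y)), 0 + t) \<le> u (y, 0) + t * ((?G + B - g y) / t)"
    using u(1) unfolding step_subsolution_def by blast
  then have "u (x, t) - B \<le> ?G" using x u(2)[of y] by simp
  then show "u (x, t) - B \<le> (SUP p\<in>cball 0 P. branch y p (x, t))" .
qed auto

end

lemma homogenization_lower_bound:
  assumes M: "0 \<le> M"
  obtains C where "0 \<le> C"
    "\<And>g w u x t. cauchy_solution \<Omega> H g w M (hmax M) hmin \<Longrightarrow>
      cauchy_solution UNIV (\<lambda>x. effective_hamiltonian \<Omega> H) g u M (hmax M) hmin \<Longrightarrow>
      x \<in> closure \<Omega> \<Longrightarrow> 0 \<le> t \<Longrightarrow> u (x, t) - w (x, t) \<le> C"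
proof -
  obtain Rb where Rb: "\<And>p. effective_hamiltonian \<Omega> H p \<le> hmax M \<Longrightarrow> norm p \<le> Rb"
    using effective_hamiltonian_coercive by blast
  \<comment> \<open>Slopes up to \<open>M\<close> control the data; slopes up to \<open>Rb\<close>
    are included because \<open>u\<close> is a step subsolution only with all momenta of effective
    energy at most \<open>hmax M\<close>.\<close>
  define P where "P = max M Rb"
  have P: "M \<le> P" "0 \<le> P" using M by (auto simp: P_def)
  obtain R where R: "0 \<le> R" "P \<le> R"
    and eq: "\<And>p. norm p \<le> P \<Longrightarrow> effective_hamiltonian \<Omega> H p = crit R p"
    and ex: "\<And>p. norm p \<le> P \<Longrightarrow> \<exists>v. cell_sub R p (crit R p) v"
    using effective_hamiltonian_crit[of P] by (metis order_refl)
  from ex obtain v0 where v0: "\<And>p. norm p \<le> P \<Longrightarrow> cell_sub R p (crit R p) (v0 p)" by metis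
  obtain x0 where x0: "x0 \<in> closure \<Omega>" using nonempty closure_subset by blast
  \<comment> \<open>Normalisation at \<open>x0\<close> turns the uniform bound on the oscillation of
    the correctors into one on their size.\<close>
  define v where "v p x = v0 p x - v0 p x0" for p x
  have v: "cell_sub R p (crit R p) (v p)" if "norm p \<le> P" for p
    using v0[OF that] unfolding cell_sub_def v_def by (auto intro!: continuous_intros simp: algebra_simps)
  define A where "A = hmin + hmax P"
  have A: "\<bar>crit R p\<bar> \<le> A" if "norm p \<le> P" for p
    using effective_hamiltonian_bounds(1)[of p P] effective_hamiltonian_bounds(2)[of p] eq[OF that] that hmin(1) hmax(1)[of P]
    by (simp add: A_def abs_le_iff)
  have A0: "0 \<le> A" using hmin(1) hmax(1)[of P] by (simp add: A_def)
  define B where "B = (R + hmin + P + A) * geo"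
  define L where "L = P + B + A"
  have B0: "0 \<le> B" unfolding B_def using R P hmin(1) A0 geo(1) by (intro mult_nonneg_nonneg add_nonneg_nonneg) auto
  then have L0: "0 \<le> L" using P A0 by (simp add: L_def)
  have KB: "(R + hmin + norm p + \<bar>crit R p\<bar>) * geo \<le> B" if "norm p \<le> P" for p
    unfolding B_def using A[OF that] that geo(1) by (intro mult_right_mono) auto
  have v_bound: "\<bar>v p x\<bar> \<le> B" if "norm p \<le> P" "x \<in> closure \<Omega>" for p x
    using cell_sub_lipschitz(1)[OF R(1) v0[OF that(1)] that(2) x0]
      cell_sub_lipschitz(1)[OF R(1) v0[OF that(1)] x0 that(2)] KB[OF that(1)]
    unfolding v_def by linarith
  have v_step: "step_subsolution \<Omega> H R (\<lambda>z. p \<bullet> fst z + v p (fst z) - effective_hamiltonian \<Omega> H p * snd z)"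
    if "norm p \<le> P" for p
    using cell_sub_step_subsolution[OF v[OF that]] by (simp add: eq that)
  have v_lip: "L-lipschitz_on (closure \<Omega> \<times> {0..})
      (\<lambda>z. p \<bullet> fst z + v p (fst z) - effective_hamiltonian \<Omega> H p * snd z)" if "norm p \<le> P" for p
    unfolding eq[OF that]
    by (rule lipschitz_on_le[OF cell_sub_evolution_lipschitz[OF R(1) v[OF that]]])
      (use KB[OF that] A[OF that] that in \<open>simp add: L_def\<close>)
  \<comment> \<open>\<open>B\<close> enters twice: the envelope exceeds the initial data by at most
    \<open>B\<close>, and it falls below \<open>u\<close> by at most \<open>B\<close>.\<close>
  show ?thesis
  proof (rule that[of "2 * B"])
    show "0 \<le> 2 * B" using B0 by simp
    fix g w u x t
    assume cw: "cauchy_solution \<Omega> H g w M (hmax M) hmin"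
      and cu: "cauchy_solution UNIV (\<lambda>x. effective_hamiltonian \<Omega> H) g u M (hmax M) hmin"
      and x: "x \<in> closure \<Omega>" and t: "0 \<le> (t :: real)"
    interpret w: cauchy_solution \<Omega> H g w M "hmax M" hmin by (rule cw)
    interpret u: cauchy_solution UNIV "\<lambda>x. effective_hamiltonian \<Omega> H" g u M "hmax M" hmin by (rule cu)
    note env = envelope_viscosity[OF w.g M P(1) v_bound v_step v_lip L0]
      envelope_lipschitz[OF w.g M P(1) v_bound v_step v_lip]
      envelope_initial[OF w.g M P(1) v_bound v_step v_lip]
      envelope_lower[OF w.g M P(1) v_bound v_step v_lip]
    show "u (x, t) - w (x, t) \<le> 2 * B"
    proof (cases "t = 0")
      case True
      then show ?thesis using w.initial[OF x] u.initial[of x] B0 by simp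
    next
      case False
      obtain Lw where Lw: "Lw-lipschitz_on (closure \<Omega> \<times> {0..}) w"
        "viscosity_supersolution (closure \<Omega> \<times> {0<..}) (evolution_operator H) w"
        by (rule w.solution)
      have "L-lipschitz_on (closure \<Omega> \<times> {0..}) (\<lambda>z. inf_sup_envelope P v g z - B)"
        using env(2) by (simp add: lipschitz_on_def dist_norm)
      then have "inf_sup_envelope P v g (x, t) - B \<le> w (x, t)"
        by (rule comparison_principle[OF open_domain cone H_uniformly_continuous _
              viscosity_subsolution_minus_const[OF env(1)] Lw])
          (use env(3) w.initial x t in fastforce)+
      moreover have "u (x, t) - B \<le> inf_sup_envelope P v g (x, t)"
      proof (rule env(4))
        show "step_subsolution UNIV (\<lambda>x. effective_hamiltonian \<Omega> H) P u"
          by (rule u.solution_step_subsolution) (use Rb in \<open>fastforce simp: P_def\<close>)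
        show "u (y, 0) = g y" for y using u.initial[of y] by simp
      qed (use x t False in auto)
      ultimately show ?thesis by simp
    qed
  qed
qed

end

lemma norm_triple:
  fixes z :: "real \<times> 'a::real_normed_vector \<times> real"
  shows "\<bar>fst z\<bar> \<le> norm z" "norm (fst (snd z)) \<le> norm z" "\<bar>snd (snd z)\<bar> \<le> norm z"
proof -
  have "norm (snd z) \<le> norm z" using norm_snd_le[of "snd z" "fst z"] by simp
  then show "\<bar>fst z\<bar> \<le> norm z" "norm (fst (snd z)) \<le> norm z" "\<bar>snd (snd z)\<bar> \<le> norm z"
    using norm_fst_le[of "fst z" "snd z"] norm_fst_le[of "fst (snd z)" "snd (snd z)"]
      norm_snd_le[of "snd (snd z)" "fst (snd z)"] by auto
qed

section \<open>Upper bound on the oscillating solution\<close>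

context periodic_hamiltonian
begin

context
  fixes R C0 :: real
  assumes R: "0 \<le> R" and halving: "approximate_halving_set (increments R) C0"
begin

interpretation inc: approximate_halving_set "increments R" C0 by (rule halving)

definition directions :: "(real \<times> (real ^ 'n) \<times> real) set" where
  "directions = inc.cone_hull"

lemma directions_approx:
  assumes "\<zeta> \<in> directions" "0 \<le> s"
  obtains z where "z \<in> increments R" "norm (z - s *\<^sub>R \<zeta>) \<le> 2 * C0 + 1"
  using assms unfolding directions_def inc.cone_hull_def by blast

lemma directions_rest: "0 \<le> t \<Longrightarrow> (t, 0, t * hmin) \<in> directions"
proof -
  assume t: "0 \<le> t"
  obtain x where "x \<in> \<Omega>" using nonempty by blast
  then have "of_nat m *\<^sub>R (t, 0, t * hmin) \<in> increments R" for m
    using rest_path[of x "of_nat m * t"] t by (auto simp: increments_def algebra_simps)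
  then show ?thesis unfolding directions_def by (rule inc.cone_hull_multiples)
qed

lemma directions_add: "\<zeta> \<in> directions \<Longrightarrow> \<xi> \<in> directions \<Longrightarrow> \<zeta> + \<xi> \<in> directions"
  unfolding directions_def by (rule inc.cone_hull_add)

lemma directions_scale: "\<zeta> \<in> directions \<Longrightarrow> 0 \<le> c \<Longrightarrow> c *\<^sub>R \<zeta> \<in> directions"
  unfolding directions_def by (rule inc.cone_hull_scale)

text \<open>Linear inequalities that hold on increments hold along a ray up to a constant, and
  dividing by the length of the ray removes the constant.\<close>

lemma directions_lower:
  assumes "(t, \<Delta>, l) \<in> directions"
  shows "0 \<le> t" "R * norm \<Delta> - hmax R * t \<le> l"
proof -
  let ?K = "2 * C0 + 1"
  have *: "0 \<le> fst z \<and> R * norm (fst (snd z)) - hmax R * fst z \<le> snd (snd z)" if "z \<in> increments R" for z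
    using that path_in path_cost_lower[OF _ R] unfolding increments_def by blast
  have "s * (- t) \<le> ?K \<and> s * (R * norm \<Delta> - hmax R * t - l) \<le> (R + hmax R + 1) * ?K" if s: "0 \<le> s" for s
  proof -
    obtain z where z: "z \<in> increments R" "norm (z - s *\<^sub>R (t, \<Delta>, l)) \<le> ?K"
      using directions_approx[OF assms s] .
    obtain a b c where abc: "z = (a, b, c)" by (cases z) auto
    have n: "\<bar>a - s * t\<bar> \<le> ?K" "norm (b - s *\<^sub>R \<Delta>) \<le> ?K" "\<bar>c - s * l\<bar> \<le> ?K"
      using norm_triple[of "z - s *\<^sub>R (t, \<Delta>, l)"] z(2) unfolding abc by auto
    have abc': "0 \<le> a" "R * norm b - hmax R * a \<le> c" using *[OF z(1)] unfolding abc by auto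
    have "s * norm \<Delta> \<le> norm b + ?K"
      using norm_triangle_sub[of "s *\<^sub>R \<Delta>" b] n(2) s by (simp add: norm_minus_commute)
    then have "R * (s * norm \<Delta>) \<le> R * (norm b + ?K)" using R by (rule mult_left_mono)
    moreover have "hmax R * a \<le> hmax R * (s * t + ?K)"
      using n(1) hmax(1) by (intro mult_left_mono) auto
    ultimately have "s * (R * norm \<Delta> - hmax R * t - l) \<le> (R + hmax R + 1) * ?K"
      using abc'(2) n(3) by (simp add: algebra_simps abs_le_iff)
    then show ?thesis using abc'(1) n(1) by auto
  qed
  then have "- t \<le> 0" "R * norm \<Delta> - hmax R * t - l \<le> 0"
    by (blast intro: nonpos_if_linear_bounded)+
  then show "0 \<le> t" "R * norm \<Delta> - hmax R * t \<le> l" by auto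
qed

lemma directions_loop:
  assumes "path R x (T, \<Delta>, k)" "0 < T" "\<Delta> \<in> integer_lattice"
  shows "(1, (1 / T) *\<^sub>R \<Delta>, k / T) \<in> directions"
proof -
  have "of_nat m *\<^sub>R (T, \<Delta>, k) \<in> increments R" for m
    using loop_multiples[OF assms(1), of m] assms(3) unfolding increments_def by auto
  then have "(T, \<Delta>, k) \<in> directions" unfolding directions_def by (rule inc.cone_hull_multiples)
  from directions_scale[OF this, of "1 / T"] show ?thesis using assms(2) by simp
qed

text \<open>A nearly optimal loop, rescaled to unit time, is a direction that realises the critical
  value at \<open>p\<close> up to \<open>\<eta>\<close>.\<close>

lemma directions_crit:
  assumes "norm p \<le> R" "0 < \<eta>"
  obtains q l where "(1, q, l) \<in> directions" "l \<le> p \<bullet> q - crit R p + \<eta>"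
proof -
  have "crit R p - \<eta> < Sup (loop_rates R p)" using assms(2) by (simp add: crit_def)
  then obtain r where "r \<in> loop_rates R p" "crit R p - \<eta> < r"
    using less_cSupD loop_rates_bounds(1)[OF assms(1)] by blast
  then obtain x T \<Delta> k where *: "path R x (T, \<Delta>, k)" "0 < T" "\<Delta> \<in> integer_lattice"
    "crit R p - \<eta> < (p \<bullet> \<Delta> - k) / T"
    unfolding loop_rates_def by blast
  show ?thesis
    by (rule that[OF directions_loop[OF *(1-3)]]) (use * in \<open>simp add: diff_divide_distrib\<close>)
qed

text \<open>A Hopf-Lax formula in which the slice of the convex cone at time \<open>t\<close> takes
  the place of the graph of an effective Lagrangian.\<close>

definition directional_envelope :: "(real ^ 'n \<Rightarrow> real) \<Rightarrow> (real ^ 'n) \<times> real \<Rightarrow> real" where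
  "directional_envelope g z = Inf {g (fst z - \<Delta>) + l | \<Delta> l. (snd z, \<Delta>, l) \<in> directions}"

context
  fixes g :: "real ^ 'n \<Rightarrow> real" and M :: real
  assumes g: "\<And>x y. g y - g x \<le> M * norm (y - x)" and M: "0 \<le> M" "M \<le> R"
begin

lemma envelope_element_lower:
  assumes "(t, \<Delta>, l) \<in> directions"
  shows "g x - hmax R * t \<le> g (x - \<Delta>) + l"
proof -
  have "g x - g (x - \<Delta>) \<le> M * norm \<Delta>" using g[of x "x - \<Delta>"] by simp
  moreover have "M * norm \<Delta> \<le> R * norm \<Delta>" using M by (intro mult_right_mono) auto
  ultimately show ?thesis using directions_lower[OF assms] by linarith
qed

lemma directional_envelope_upper:
  assumes "(t, \<Delta>, l) \<in> directions"
  shows "directional_envelope g (x, t) \<le> g (x - \<Delta>) + l"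
  unfolding directional_envelope_def
proof (rule cInf_lower)
  show "bdd_below {g (fst (x, t) - \<Delta>) + l | \<Delta> l. (snd (x, t), \<Delta>, l) \<in> directions}"
    by (rule bdd_belowI[of _ "g x - hmax R * t"]) (use envelope_element_lower in auto)
qed (use assms in auto)

lemma directional_envelope_greatest:
  assumes "0 \<le> t" "\<And>\<Delta> l. (t, \<Delta>, l) \<in> directions \<Longrightarrow> b \<le> g (x - \<Delta>) + l"
  shows "b \<le> directional_envelope g (x, t)"
  unfolding directional_envelope_def
  by (rule cInf_greatest) (use assms directions_rest[of t] in auto)

lemma directional_envelope_space:
  assumes "0 \<le> t"
  shows "directional_envelope g (x, t) - directional_envelope g (y, t) \<le> M * norm (x - y)"
proof -
  have "directional_envelope g (x, t) - M * norm (x - y) \<le> directional_envelope g (y, t)"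
  proof (rule directional_envelope_greatest[OF assms])
    fix \<Delta> l assume "(t, \<Delta>, l) \<in> directions"
    then show "directional_envelope g (x, t) - M * norm (x - y) \<le> g (y - \<Delta>) + l"
      using directional_envelope_upper[of t \<Delta> l x] g[of "x - \<Delta>" "y - \<Delta>"] by simp
  qed
  then show ?thesis by simp
qed

text \<open>Additivity of the cone becomes one half of the dynamic programming principle.\<close>

lemma directional_envelope_forward:
  assumes "0 \<le> t" "(\<tau>, q, l) \<in> directions"
  shows "directional_envelope g (x, t + \<tau>) \<le> directional_envelope g (x - q, t) + l"
proof -
  have "directional_envelope g (x, t + \<tau>) - l \<le> directional_envelope g (x - q, t)"
  proof (rule directional_envelope_greatest[OF assms(1)])
    fix \<Delta> l' assume "(t, \<Delta>, l') \<in> directions"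
    from directional_envelope_upper[of "t + \<tau>" "\<Delta> + q" "l' + l" x] directions_add[OF this assms(2)]
    show "directional_envelope g (x, t + \<tau>) - l \<le> g (x - q - \<Delta>) + l'"
      by (simp add: algebra_simps)
  qed
  then show ?thesis by simp
qed

text \<open>A direction of duration \<open>t + s\<close> is shortened by the factor
  \<open>c = t / (t + s)\<close>. The displaced foot point costs at most
  \<open>(1 - c) * (M * norm \<Delta>)\<close>, and since \<open>M \<le> R\<close> the lower cost
  bound controls this by the saved cost up to \<open>hmax R * s\<close>.\<close>

lemma directional_envelope_backward:
  assumes "0 \<le> t" "0 < s"
  shows "directional_envelope g (x, t) \<le> directional_envelope g (x, t + s) + hmax R * s"
proof -
  have "directional_envelope g (x, t) - hmax R * s \<le> directional_envelope g (x, t + s)"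
  proof (rule directional_envelope_greatest)
    fix \<Delta> l assume d: "(t + s, \<Delta>, l) \<in> directions"
    define c where "c = t / (t + s)"
    have c: "0 \<le> c" "c \<le> 1" "c * (t + s) = t" "(1 - c) * (t + s) = s" using assms by (auto simp: c_def field_simps)
    have "(t, c *\<^sub>R \<Delta>, c * l) \<in> directions" using directions_scale[OF d c(1)] c(3) by simp
    then have "directional_envelope g (x, t) \<le> g (x - c *\<^sub>R \<Delta>) + c * l"
      by (rule directional_envelope_upper)
    moreover have "g (x - c *\<^sub>R \<Delta>) - g (x - \<Delta>) \<le> (1 - c) * (M * norm \<Delta>)"
    proof -
      have "x - c *\<^sub>R \<Delta> - (x - \<Delta>) = (1 - c) *\<^sub>R \<Delta>" by (simp add: algebra_simps)
      then have "norm (x - c *\<^sub>R \<Delta> - (x - \<Delta>)) = (1 - c) * norm \<Delta>" using c by simp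
      then show ?thesis using g[of "x - c *\<^sub>R \<Delta>" "x - \<Delta>"] by (simp add: mult_ac)
    qed
    moreover have "(1 - c) * (M * norm \<Delta>) \<le> (1 - c) * (l + hmax R * (t + s))"
    proof (rule mult_left_mono)
      have "M * norm \<Delta> \<le> R * norm \<Delta>" using M by (intro mult_right_mono) auto
      then show "M * norm \<Delta> \<le> l + hmax R * (t + s)" using directions_lower(2)[OF d] by linarith
    qed (use c in auto)
    moreover have "(1 - c) * (l + hmax R * (t + s)) = l - c * l + hmax R * s"
    proof -
      have "(1 - c) * (l + hmax R * (t + s)) = l - c * l + hmax R * ((1 - c) * (t + s))"
        by (simp add: algebra_simps)
      then show ?thesis unfolding c(4) .
    qed
    ultimately show "directional_envelope g (x, t) - hmax R * s \<le> g (x - \<Delta>) + l" by linarith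
  qed (use assms in auto)
  then show ?thesis by simp
qed

lemma directional_envelope_lipschitz:
  "(M + (hmin + hmax R))-lipschitz_on (UNIV \<times> {0..}) (directional_envelope g)"
proof (rule lipschitz_on_prodI)
  have up: "directional_envelope g (x, t + s) \<le> directional_envelope g (x, t) + hmin * s" if "0 \<le> t" "0 \<le> s" for x t s
    using directional_envelope_forward[OF that(1) directions_rest[OF that(2)], of x] by (simp add: mult.commute)
  show "directional_envelope g (x, s) - directional_envelope g (x, t) \<le> (hmin + hmax R) * \<bar>s - t\<bar>"
    if "0 \<le> s" "0 \<le> t" for x s t
  proof (cases "t \<le> s")
    case True
    then show ?thesis using up[of t "s - t" x] that True mult_nonneg_nonneg[OF hmax(1)[of R], of "s - t"]
      unfolding distrib_right by (simp add: algebra_simps)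
  next
    case False
    then show ?thesis using directional_envelope_backward[of s "t - s" x] that False mult_nonneg_nonneg[OF hmin(1), of "t - s"]
      unfolding distrib_right by (simp add: algebra_simps)
  qed
qed (use M hmin(1) hmax(1) directional_envelope_space in auto)

lemma directional_envelope_initial: "directional_envelope g (x, 0) \<le> g x"
  using directional_envelope_upper[of 0 0 0 x] directions_rest[of 0] by simp

text \<open>Each momentum is tested with the direction of a nearly optimal loop. Cones contain all
  multiples, so the direction can be followed for arbitrarily short times although the loop itself
  is long.\<close>

lemma directional_envelope_viscosity:
  assumes "\<And>p. norm p \<le> M \<Longrightarrow> effective_hamiltonian \<Omega> H p = crit R p"
  shows "viscosity_subsolution (UNIV \<times> {0<..}) (evolution_operator (\<lambda>x. effective_hamiltonian \<Omega> H)) (directional_envelope g)"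
proof (rule backward_inequality_viscosity_subsolution[OF open_UNIV M(1)])
  show "\<bar>directional_envelope g (x, t) - directional_envelope g (y, t)\<bar> \<le> M * norm (x - y)" if "0 < t" for x y t
    using directional_envelope_space[of t x y] directional_envelope_space[of t y x] that
    by (simp add: abs_le_iff norm_minus_commute)
next
  fix x p :: "real ^ 'n" and t \<eta> :: real
  assume t: "0 < t" and p: "norm p \<le> M" and \<eta>: "0 < \<eta>"
  obtain q l where q: "(1, q, l) \<in> directions" "l \<le> p \<bullet> q - crit R p + \<eta>"
    using directions_crit[of p \<eta>] p M \<eta> by auto
  have "directional_envelope g (x, t) \<le> directional_envelope g (x - \<tau> *\<^sub>R q, t - \<tau>)
      + \<tau> * (p \<bullet> q - effective_hamiltonian \<Omega> H p + \<eta>)" if \<tau>: "0 < \<tau>" "\<tau> < t" for \<tau>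
  proof -
    have "(\<tau>, \<tau> *\<^sub>R q, \<tau> * l) \<in> directions" using directions_scale[OF q(1), of \<tau>] \<tau> by simp
    from directional_envelope_forward[OF _ this, of "t - \<tau>" x]
    have "directional_envelope g (x, t) \<le> directional_envelope g (x - \<tau> *\<^sub>R q, t - \<tau>) + \<tau> * l" using \<tau> by simp
    also have "\<tau> * l \<le> \<tau> * (p \<bullet> q - effective_hamiltonian \<Omega> H p + \<eta>)"
      using q(2) assms[OF p] \<tau> by (intro mult_left_mono) auto
    finally show ?thesis by simp
  qed
  then show "\<exists>q. \<forall>\<^sub>F \<tau> in at_right 0. directional_envelope g (x, t) \<le>
      directional_envelope g (x - \<tau> *\<^sub>R q, t - \<tau>) + \<tau> * (p \<bullet> q - effective_hamiltonian \<Omega> H p + \<eta>)"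
    using t by (intro exI[of _ q]) (auto simp: eventually_at_right_field)
qed

text \<open>A direction is followed, up to a bounded error, by an admissible path of the oscillating problem;
  a lattice translation and a bounded connecting path make it end at the prescribed point.\<close>

lemma solution_le_directional_envelope:
  assumes D: "0 \<le> D" "\<And>u v. u \<in> \<Omega> \<Longrightarrow> v \<in> \<Omega> \<Longrightarrow>
      \<exists>z\<in>integer_lattice. \<exists>\<zeta>. path R u \<zeta> \<and> u + fst (snd \<zeta>) = v + z \<and> norm \<zeta> \<le> D"
    and w: "step_subsolution \<Omega> H R w" "\<And>y. y \<in> \<Omega> \<Longrightarrow> w (y, 0) = g y"
    and time: "0 \<le> A" "\<And>s t. 0 \<le> s \<Longrightarrow> 0 \<le> t \<Longrightarrow> w (x, s) - w (x, t) \<le> A * \<bar>s - t\<bar>"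
    and x: "x \<in> \<Omega>" "0 \<le> t"
  shows "w (x, t) \<le> directional_envelope g (x, t) + (M + A + 1) * (2 * C0 + 1 + D)"
proof -
  let ?K = "2 * C0 + 1" and ?E = "(M + A + 1) * (2 * C0 + 1 + D)"
  have "w (x, t) - ?E \<le> directional_envelope g (x, t)"
  proof (rule directional_envelope_greatest[OF x(2)])
    fix \<Delta> l assume "(t, \<Delta>, l) \<in> directions"
    from directions_approx[OF this, of 1] obtain z where
      z: "z \<in> increments R" "norm (z - (t, \<Delta>, l)) \<le> ?K" by auto
    obtain a b c where abc: "z = (a, b, c)" by (cases z) auto
    from z(1) obtain y where y: "path R y (a, b, c)" unfolding increments_def abc by blast
    obtain k \<zeta> where k: "k \<in> integer_lattice" "path R (y + b) \<zeta>" "y + b + fst (snd \<zeta>) = x + k" "norm \<zeta> \<le> D"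
      using D(2)[of "y + b" x] path_in[OF y] x(1) by auto
    obtain a' b' c' where \<zeta>: "\<zeta> = (a', b', c')" by (cases \<zeta>) auto
    have "path R y ((a, b, c) + \<zeta>)" by (rule path_trans[OF k(2) y]) simp
    from path_translate[OF this integer_lattice_minus[OF k(1)]]
    have path: "path R (y - k) (a + a', b + b', c + c')" by (simp add: \<zeta>)
    have end_eq: "y - k + (b + b') = x" using k(3) by (simp add: \<zeta> algebra_simps)
    have "w (x, a + a') \<le> w (y - k, 0) + (c + c')"
      using step_subsolution_path[OF w(1) path, of 0] end_eq by simp
    moreover have "w (y - k, 0) = g (y - k)" using w(2) path_in[OF path] by simp
    moreover have "g (y - k) - g (x - \<Delta>) \<le> M * (?K + D)"
    proof -
      have "y - k - (x - \<Delta>) = - (b - \<Delta>) - b'" using end_eq by (simp add: algebra_simps)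
      then have "norm (y - k - (x - \<Delta>)) \<le> norm (b - \<Delta>) + norm b'"
        by (metis norm_minus_cancel norm_triangle_ineq4)
      also have "\<dots> \<le> ?K + D"
        using norm_triple(2)[of "z - (t, \<Delta>, l)"] norm_triple(2)[of \<zeta>] z(2) k(4) by (simp add: abc \<zeta>)
      finally show ?thesis
        using g[of "y - k" "x - \<Delta>"] M(1) mult_left_mono[of _ "?K + D" M] by fastforce
    qed
    moreover have "c + c' \<le> l + (?K + D)"
      using norm_triple(3)[of "z - (t, \<Delta>, l)"] norm_triple(3)[of \<zeta>] z(2) k(4) by (simp add: abc \<zeta> abs_le_iff)
    \<comment> \<open>The duration of the path differs from \<open>t\<close> by a bounded amount,
      which the Lipschitz bound in time absorbs.\<close>
    moreover have "w (x, t) - w (x, a + a') \<le> A * (?K + D)"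
    proof -
      have "\<bar>t - (a + a')\<bar> \<le> ?K + D"
        using norm_triple(1)[of "z - (t, \<Delta>, l)"] norm_triple(1)[of \<zeta>] z(2) k(4) by (simp add: abc \<zeta> abs_le_iff)
      then have "A * \<bar>t - (a + a')\<bar> \<le> A * (?K + D)" using time(1) by (rule mult_left_mono)
      moreover have "0 \<le> a + a'" using path_in[OF path] by simp
      ultimately show ?thesis using time(2)[of t "a + a'"] x(2) by linarith
    qed
    ultimately show "w (x, t) - ?E \<le> g (x - \<Delta>) + l" by (simp add: algebra_simps)
  qed
  then show ?thesis by simp
qed

end

end

lemma homogenization_upper_bound:
  assumes M: "0 \<le> M"
  obtains C where "0 \<le> C"
    "\<And>g w u x t. cauchy_solution \<Omega> H g w M (hmax M) hmin \<Longrightarrow>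
      cauchy_solution UNIV (\<lambda>x. effective_hamiltonian \<Omega> H) g u M (hmax M) hmin \<Longrightarrow>
      x \<in> closure \<Omega> \<Longrightarrow> 0 \<le> t \<Longrightarrow> w (x, t) - u (x, t) \<le> C"
proof -
  obtain Rw where Rw: "\<And>y p. H y p \<le> hmax M \<Longrightarrow> norm p \<le> Rw" using H_coercive by blast
  obtain R0 where R0: "0 \<le> R0" "M \<le> R0"
    "\<And>R p. R0 \<le> R \<Longrightarrow> norm p \<le> M \<Longrightarrow> effective_hamiltonian \<Omega> H p = crit R p"
    using effective_hamiltonian_crit[of M] by metis
  \<comment> \<open>\<open>R0\<close> identifies the critical value with the effective Hamiltonian,
    \<open>Rw\<close> makes \<open>w\<close> a step subsolution.\<close>
  define R where "R = max R0 Rw"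
  have R: "0 \<le> R" "M \<le> R" using R0 by (auto simp: R_def)
  have eq: "effective_hamiltonian \<Omega> H p = crit R p" if "norm p \<le> M" for p
    using R0(3)[of R p] that by (simp add: R_def)
  have Rw': "norm p \<le> R" if "H y p \<le> hmax M" for y p
    using Rw[OF that] by (simp add: R_def)
  obtain C0 where halving: "approximate_halving_set (increments R) C0" by (rule increments_halving[OF R(1)])
  obtain D where D: "0 \<le> D" "\<And>u v. u \<in> \<Omega> \<Longrightarrow> v \<in> \<Omega> \<Longrightarrow>
      \<exists>z\<in>integer_lattice. \<exists>\<zeta>. path R u \<zeta> \<and> u + fst (snd \<zeta>) = v + z \<and> norm \<zeta> \<le> D"
    by (rule bounded_path_connection[OF R(1)]) blast
  define A where "A = hmax M + hmin"
  have A: "0 \<le> A" using hmax(1) hmin(1) by (simp add: A_def)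
  define E where "E = (M + A + 1) * (2 * C0 + 1 + D)"
  have E: "0 \<le> E" unfolding E_def using A M D(1) approximate_halving_set.C_nonneg[OF halving]
    by (intro mult_nonneg_nonneg add_nonneg_nonneg) auto
  show ?thesis
  proof (rule that[OF E])
    fix g w u x t
    assume cw: "cauchy_solution \<Omega> H g w M (hmax M) hmin"
      and cu: "cauchy_solution UNIV (\<lambda>x. effective_hamiltonian \<Omega> H) g u M (hmax M) hmin"
      and x: "x \<in> closure \<Omega>" and t: "0 \<le> (t :: real)"
    interpret w: cauchy_solution \<Omega> H g w M "hmax M" hmin by (rule cw)
    interpret u: cauchy_solution UNIV "\<lambda>x. effective_hamiltonian \<Omega> H" g u M "hmax M" hmin by (rule cu)
    have time: "w (y, s) - w (y, t) \<le> A * \<bar>s - t\<bar>" if "y \<in> \<Omega>" "0 \<le> s" "0 \<le> t" for y s t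
    proof -
      have y: "y \<in> closure \<Omega>" using that closure_subset by auto
      show ?thesis
      proof (cases "t \<le> s")
        case True
        then show ?thesis
          using w.time_upper[OF y that(3), of "s - t" R] Rw' True mult_nonneg_nonneg[OF hmax(1)[of M], of "s - t"]
          unfolding A_def distrib_right by (simp add: algebra_simps)
      next
        case False
        then show ?thesis
          using w.time_lower[OF y that(2), of "t - s"] False mult_nonneg_nonneg[OF hmin(1), of "t - s"]
          unfolding A_def distrib_right by (simp add: algebra_simps)
      qed
    qed
    have interior: "w (y, t) \<le> u (y, t) + E" if y: "y \<in> \<Omega>" for y
    proof -
      have "w (y, t) \<le> directional_envelope R C0 g (y, t) + E"
        unfolding E_def
      proof (rule solution_le_directional_envelope[OF R(1) halving w.g M R(2) D])
        show "step_subsolution \<Omega> H R w" by (rule w.solution_step_subsolution[OF Rw'])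
        show "w (y, 0) = g y" if "y \<in> \<Omega>" for y using w.initial that closure_subset by auto
      qed (use A time y t in auto)
      moreover obtain Lu where Lu: "Lu-lipschitz_on (closure UNIV \<times> {0..}) u"
        "viscosity_supersolution (closure UNIV \<times> {0<..}) (evolution_operator (\<lambda>x. effective_hamiltonian \<Omega> H)) u"
        by (rule u.solution)
      have "(M + (hmin + hmax R))-lipschitz_on (closure UNIV \<times> {0..}) (directional_envelope R C0 g)"
        using directional_envelope_lipschitz[OF R(1) halving w.g M R(2)] by simp
      then have "directional_envelope R C0 g (y, t) \<le> u (y, t)"
        by (rule comparison_principle[OF u.W u.K _ directional_envelope_viscosity[OF R(1) halving w.g M R(2) eq] Lu])
          (use directional_envelope_initial[OF R(1) halving w.g M R(2)] u.initial t in auto)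
      ultimately show ?thesis by simp
    qed
    \<comment> \<open>Steps run in the open domain; continuity carries the bound to its
      closure.\<close>
    have "w (x, t) \<le> u (x, t) + E"
    proof (rule w.closure_induct[OF _ _ interior x])
      show "continuous_on (closure \<Omega>) (\<lambda>x. w (x, t))" by (rule w.slice_continuous[OF t])
      show "continuous_on (closure \<Omega>) (\<lambda>x. u (x, t) + E)"
        using u.slice_continuous[OF t] by (auto intro!: continuous_intros intro: continuous_on_subset)
    qed
    then show "w (x, t) - u (x, t) \<le> E" by simp
  qed
qed

text \<open>The constant is fixed before \<open>g\<close>, so it depends on the data only through
  \<open>M\<close>. This uniformity is what survives rescaling, where the data change with
  \<open>\<epsilon>\<close>.\<close>

theorem homogenization_bound:
  assumes M: "0 \<le> M"
  obtains C where "0 < C"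
    "\<And>g w u x t. (\<And>x y. g y - g x \<le> M * norm (y - x)) \<Longrightarrow>
      state_constraint_solution \<Omega> H g w \<Longrightarrow>
      state_constraint_solution UNIV (\<lambda>x. effective_hamiltonian \<Omega> H) g u \<Longrightarrow>
      x \<in> closure \<Omega> \<Longrightarrow> 0 \<le> t \<Longrightarrow> \<bar>w (x, t) - u (x, t)\<bar> \<le> C"
proof -
  obtain C1 where C1: "0 \<le> C1"
    "\<And>g w u x t. cauchy_solution \<Omega> H g w M (hmax M) hmin \<Longrightarrow>
      cauchy_solution UNIV (\<lambda>x. effective_hamiltonian \<Omega> H) g u M (hmax M) hmin \<Longrightarrow>
      x \<in> closure \<Omega> \<Longrightarrow> 0 \<le> t \<Longrightarrow> u (x, t) - w (x, t) \<le> C1"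
    by (rule homogenization_lower_bound[OF M]) blast
  obtain C2 where C2: "0 \<le> C2"
    "\<And>g w u x t. cauchy_solution \<Omega> H g w M (hmax M) hmin \<Longrightarrow>
      cauchy_solution UNIV (\<lambda>x. effective_hamiltonian \<Omega> H) g u M (hmax M) hmin \<Longrightarrow>
      x \<in> closure \<Omega> \<Longrightarrow> 0 \<le> t \<Longrightarrow> w (x, t) - u (x, t) \<le> C2"
    by (rule homogenization_upper_bound[OF M]) blast
  have H_le: "H x p \<le> hmax M" if "norm p \<le> M" for x p
    using hmax(2)[OF that, of x] by linarith
  have K: "uniformly_continuous_on (UNIV \<times> cball 0 B)
      (\<lambda>(x :: real ^ 'n, p). effective_hamiltonian \<Omega> H p)" for B
  proof -
    have "uniformly_continuous_on (cball 0 B) (effective_hamiltonian \<Omega> H)"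
      using continuous_on_subset[OF effective_hamiltonian_continuous] by (intro compact_uniformly_continuous) auto
    then have d: "\<exists>d>0. \<forall>p\<in>cball 0 B. \<forall>q\<in>cball 0 B. dist q p < d \<longrightarrow>
        dist (effective_hamiltonian \<Omega> H q) (effective_hamiltonian \<Omega> H p) < e" if "0 < e" for e
      using that unfolding uniformly_continuous_on_def by blast
    show ?thesis
      unfolding uniformly_continuous_on_def case_prod_beta
    proof (intro allI impI)
      fix e :: real assume "0 < e"
      from d[OF this] obtain d where "0 < d" and d: "\<And>p q. p \<in> cball 0 B \<Longrightarrow> q \<in> cball 0 B \<Longrightarrow> dist q p < d \<Longrightarrow>
          dist (effective_hamiltonian \<Omega> H q) (effective_hamiltonian \<Omega> H p) < e" by blast
      show "\<exists>d>0. \<forall>z\<in>(UNIV :: (real ^ 'n) set) \<times> cball 0 B. \<forall>z'\<in>UNIV \<times> cball 0 B. dist z' z < d \<longrightarrow>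
          dist (effective_hamiltonian \<Omega> H (snd z')) (effective_hamiltonian \<Omega> H (snd z)) < e"
      proof (intro exI[of _ d] conjI ballI impI \<open>0 < d\<close>)
        fix z z' :: "(real ^ 'n) \<times> (real ^ 'n)"
        assume z: "z \<in> UNIV \<times> cball 0 B" "z' \<in> UNIV \<times> cball 0 B" "dist z' z < d"
        show "dist (effective_hamiltonian \<Omega> H (snd z')) (effective_hamiltonian \<Omega> H (snd z)) < e"
          by (rule d) (use z le_less_trans[OF dist_snd_le z(3)] in auto)
      qed
    qed
  qed
  have cone_UNIV: "cone_condition (UNIV :: (real ^ 'n) set)"
    by (rule C1_boundary_cone_condition) (auto simp: C1_boundary_def)
  show ?thesis
  proof (rule that[of "C1 + C2 + 1"])
    fix g w u x t
    assume g: "\<And>x y. g y - g x \<le> M * norm (y - x)" and w: "state_constraint_solution \<Omega> H g w"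
      and u: "state_constraint_solution UNIV (\<lambda>x. effective_hamiltonian \<Omega> H) g u"
      and x: "x \<in> closure \<Omega>" and t: "0 \<le> (t :: real)"
    have cw: "cauchy_solution \<Omega> H g w M (hmax M) hmin"
      by unfold_locales (use open_domain cone H_uniformly_continuous H_le hmin hmax(1) M g w in auto)
    have cu: "cauchy_solution UNIV (\<lambda>x. effective_hamiltonian \<Omega> H) g u M (hmax M) hmin"
      by unfold_locales (use cone_UNIV K effective_hamiltonian_bounds hmin hmax(1) M g u in auto)
    show "\<bar>w (x, t) - u (x, t)\<bar> \<le> C1 + C2 + 1"
      using C1(2)[OF cw cu x t] C2(2)[OF cw cu x t] C1(1) C2(1) by (simp add: abs_le_iff)
  qed (use C1 C2 in auto)
qed

end

section \<open>Rescaling\<close>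

lemma C1_rescale:
  fixes \<phi> :: "'a::euclidean_space \<Rightarrow> real"
  assumes "C1_with_gradient U \<phi> D\<phi>" "0 < \<epsilon>"
  shows "C1_with_gradient ((\<lambda>z. z /\<^sub>R \<epsilon>) -` U) (\<lambda>z. \<epsilon> * \<phi> (z /\<^sub>R \<epsilon>)) (\<lambda>z. D\<phi> (z /\<^sub>R \<epsilon>))"
  unfolding C1_with_gradient_def
proof (intro conjI ballI)
  show "open ((\<lambda>z. z /\<^sub>R \<epsilon>) -` U)"
    using assms by (intro open_vimage continuous_intros) (auto simp: C1_with_gradient_def)
  show "continuous_on ((\<lambda>z. z /\<^sub>R \<epsilon>) -` U) (\<lambda>z. D\<phi> (z /\<^sub>R \<epsilon>))"
    by (rule continuous_on_compose2[of U D\<phi>])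
      (use assms in \<open>auto simp: C1_with_gradient_def intro!: continuous_intros\<close>)
  fix z assume "z \<in> (\<lambda>z. z /\<^sub>R \<epsilon>) -` U"
  then have "(\<phi> has_derivative (\<lambda>h. h \<bullet> D\<phi> (z /\<^sub>R \<epsilon>))) (at (z /\<^sub>R \<epsilon>))"
    using assms(1) by (auto simp: C1_with_gradient_def gderiv_def)
  moreover have "((\<lambda>z. z /\<^sub>R \<epsilon>) has_derivative (\<lambda>h. h /\<^sub>R \<epsilon>)) (at z)"
    by (auto intro!: derivative_eq_intros)
  ultimately have "((\<lambda>z. \<phi> (z /\<^sub>R \<epsilon>)) has_derivative (\<lambda>h. (h /\<^sub>R \<epsilon>) \<bullet> D\<phi> (z /\<^sub>R \<epsilon>))) (at z)"
    using has_derivative_compose[of "\<lambda>z. z /\<^sub>R \<epsilon>" "\<lambda>h. h /\<^sub>R \<epsilon>" z UNIV \<phi>] by blast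
  from has_derivative_mult_right[OF this, of \<epsilon>]
  show "GDERIV (\<lambda>z. \<epsilon> * \<phi> (z /\<^sub>R \<epsilon>)) z :> D\<phi> (z /\<^sub>R \<epsilon>)"
    using assms(2) by (simp add: gderiv_def mult.assoc[symmetric])
qed

lemma viscosity_subsolution_rescale:
  fixes w :: "'a::euclidean_space \<Rightarrow> real"
  assumes sub: "viscosity_subsolution ((*\<^sub>R) \<epsilon> ` S) F w" and \<epsilon>: "0 < \<epsilon>"
  shows "viscosity_subsolution S (\<lambda>z q. F (\<epsilon> *\<^sub>R z) q) (\<lambda>z. w (\<epsilon> *\<^sub>R z) / \<epsilon>)"
  unfolding viscosity_subsolution_def
proof (intro ballI allI impI)
  fix z0 U \<phi> D\<phi>
  assume z0: "z0 \<in> S" and as: "z0 \<in> U \<and> C1_with_gradient U \<phi> D\<phi> \<and>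
    (\<forall>\<^sub>F z in at z0 within S. w (\<epsilon> *\<^sub>R z) / \<epsilon> - \<phi> z \<le> w (\<epsilon> *\<^sub>R z0) / \<epsilon> - \<phi> z0)"
  then obtain r where r: "r > 0" "\<And>z. z \<in> S \<Longrightarrow> z \<noteq> z0 \<Longrightarrow> dist z z0 < r \<Longrightarrow>
      w (\<epsilon> *\<^sub>R z) / \<epsilon> - \<phi> z \<le> w (\<epsilon> *\<^sub>R z0) / \<epsilon> - \<phi> z0"
    unfolding eventually_at by blast
  have z0': "(\<epsilon> *\<^sub>R z0) /\<^sub>R \<epsilon> = z0" using \<epsilon> by simp
  have "\<forall>\<^sub>F z in at (\<epsilon> *\<^sub>R z0) within (*\<^sub>R) \<epsilon> ` S.
      w z - \<epsilon> * \<phi> (z /\<^sub>R \<epsilon>) \<le> w (\<epsilon> *\<^sub>R z0) - \<epsilon> * \<phi> ((\<epsilon> *\<^sub>R z0) /\<^sub>R \<epsilon>)"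
  proof (rule eventually_at_within_subset_ball[of "\<epsilon> * r"])
    fix z assume "z \<in> (*\<^sub>R) \<epsilon> ` S" and d: "dist z (\<epsilon> *\<^sub>R z0) < \<epsilon> * r"
    then obtain y where y: "y \<in> S" "z = \<epsilon> *\<^sub>R y" by blast
    have "dist z (\<epsilon> *\<^sub>R z0) = \<epsilon> * dist y z0"
      using \<epsilon> unfolding y(2) dist_norm scaleR_diff_right[symmetric] by simp
    then have "dist y z0 < r" using d \<epsilon> by simp
    then have "w (\<epsilon> *\<^sub>R y) / \<epsilon> - \<phi> y \<le> w (\<epsilon> *\<^sub>R z0) / \<epsilon> - \<phi> z0"
      using r(2)[OF y(1)] by (cases "y = z0") auto
    then have "\<epsilon> * (w (\<epsilon> *\<^sub>R y) / \<epsilon> - \<phi> y) \<le> \<epsilon> * (w (\<epsilon> *\<^sub>R z0) / \<epsilon> - \<phi> z0)"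
      using \<epsilon> by simp
    then show "w z - \<epsilon> * \<phi> (z /\<^sub>R \<epsilon>) \<le> w (\<epsilon> *\<^sub>R z0) - \<epsilon> * \<phi> ((\<epsilon> *\<^sub>R z0) /\<^sub>R \<epsilon>)"
      using \<epsilon> by (simp add: y(2) right_diff_distrib)
  qed (use r \<epsilon> in auto)
  then have "F (\<epsilon> *\<^sub>R z0) (D\<phi> ((\<epsilon> *\<^sub>R z0) /\<^sub>R \<epsilon>)) \<le> 0"
    using sub[unfolded viscosity_subsolution_def, rule_format, of "\<epsilon> *\<^sub>R z0" "(\<lambda>z. z /\<^sub>R \<epsilon>) -` U"
      "\<lambda>z. \<epsilon> * \<phi> (z /\<^sub>R \<epsilon>)" "\<lambda>z. D\<phi> (z /\<^sub>R \<epsilon>)"] C1_rescale[of U \<phi> D\<phi> \<epsilon>] as z0 \<epsilon> by auto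
  then show "F (\<epsilon> *\<^sub>R z0) (D\<phi> z0) \<le> 0" unfolding z0' .
qed

lemma viscosity_supersolution_rescale:
  fixes w :: "'a::euclidean_space \<Rightarrow> real"
  assumes sup: "viscosity_supersolution ((*\<^sub>R) \<epsilon> ` S) F w" and \<epsilon>: "0 < \<epsilon>"
  shows "viscosity_supersolution S (\<lambda>z q. F (\<epsilon> *\<^sub>R z) q) (\<lambda>z. w (\<epsilon> *\<^sub>R z) / \<epsilon>)"
  using viscosity_subsolution_rescale[OF sup[unfolded viscosity_supersolution_iff_neg] \<epsilon>]
  unfolding viscosity_supersolution_iff_neg by simp

text \<open>The scaling \<open>w (\<epsilon> *\<^sub>R z) / \<epsilon>\<close> leaves space-time
  gradients unchanged, so in the operator only the position is rescaled.\<close>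

lemma state_constraint_solution_rescale:
  fixes w :: "'a::euclidean_space \<times> real \<Rightarrow> real"
  assumes sol: "state_constraint_solution ((*\<^sub>R) \<epsilon> ` W) (\<lambda>x p. K (x /\<^sub>R \<epsilon>) p) g w" and \<epsilon>: "0 < \<epsilon>"
  shows "state_constraint_solution W K (\<lambda>y. g (\<epsilon> *\<^sub>R y) / \<epsilon>) (\<lambda>z. w (\<epsilon> *\<^sub>R z) / \<epsilon>)"
proof -
  have pos: "(*\<^sub>R) \<epsilon> ` (X \<times> {0 :: real<..}) = (*\<^sub>R) \<epsilon> ` X \<times> {0<..}" for X :: "'a set"
  proof (intro equalityI subsetI)
    fix z :: "'a \<times> real" assume "z \<in> (*\<^sub>R) \<epsilon> ` X \<times> {0<..}"
    then obtain x t where "z = \<epsilon> *\<^sub>R (x, t / \<epsilon>)" "x \<in> X" "0 < t" using \<epsilon> by auto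
    then show "z \<in> (*\<^sub>R) \<epsilon> ` (X \<times> {0<..})" using \<epsilon> by (intro image_eqI[of _ _ "(x, t / \<epsilon>)"]) auto
  qed (use \<epsilon> in auto)
  have cl: "closure ((*\<^sub>R) \<epsilon> ` W) = (*\<^sub>R) \<epsilon> ` closure W" by (rule closure_scaleR[symmetric])
  have op: "(\<lambda>z q. evolution_operator (\<lambda>x p. K (x /\<^sub>R \<epsilon>) p) (\<epsilon> *\<^sub>R z) q) = evolution_operator K"
    using \<epsilon> by (auto simp: evolution_operator_def fun_eq_iff split: prod.splits)
  obtain L where L: "L-lipschitz_on ((*\<^sub>R) \<epsilon> ` closure W \<times> {0..}) w"
    using sol unfolding state_constraint_solution_def cl by blast
  have "L-lipschitz_on (closure W \<times> {0..}) (\<lambda>z. w (\<epsilon> *\<^sub>R z) / \<epsilon>)"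
  proof (rule lipschitz_onI)
    fix z z' :: "'a \<times> real" assume z: "z \<in> closure W \<times> {0..}" "z' \<in> closure W \<times> {0..}"
    have "dist (w (\<epsilon> *\<^sub>R z)) (w (\<epsilon> *\<^sub>R z')) \<le> L * dist (\<epsilon> *\<^sub>R z) (\<epsilon> *\<^sub>R z')"
      by (rule lipschitz_onD[OF L]) (use z \<epsilon> in auto)
    also have "dist (\<epsilon> *\<^sub>R z) (\<epsilon> *\<^sub>R z') = \<epsilon> * dist z z'"
      using \<epsilon> by (simp only: dist_norm scaleR_diff_right[symmetric]) simp
    finally have "\<bar>w (\<epsilon> *\<^sub>R z) - w (\<epsilon> *\<^sub>R z')\<bar> / \<epsilon> \<le> (L * (\<epsilon> * dist z z')) / \<epsilon>"
      using \<epsilon> by (intro divide_right_mono) (auto simp: dist_real_def)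
    then show "dist (w (\<epsilon> *\<^sub>R z) / \<epsilon>) (w (\<epsilon> *\<^sub>R z') / \<epsilon>) \<le> L * dist z z'"
      using \<epsilon> by (simp add: dist_real_def diff_divide_distrib[symmetric] abs_divide)
  qed (use L lipschitz_on_nonneg in blast)
  moreover have "viscosity_subsolution (W \<times> {0<..}) (evolution_operator K) (\<lambda>z. w (\<epsilon> *\<^sub>R z) / \<epsilon>)"
  proof -
    have "viscosity_subsolution ((*\<^sub>R) \<epsilon> ` (W \<times> {0<..})) (evolution_operator (\<lambda>x p. K (x /\<^sub>R \<epsilon>) p)) w"
      using sol unfolding pos state_constraint_solution_def by blast
    from viscosity_subsolution_rescale[OF this \<epsilon>] show ?thesis unfolding op .
  qed
  moreover have "viscosity_supersolution (closure W \<times> {0<..}) (evolution_operator K) (\<lambda>z. w (\<epsilon> *\<^sub>R z) / \<epsilon>)"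
  proof -
    have "viscosity_supersolution ((*\<^sub>R) \<epsilon> ` (closure W \<times> {0<..})) (evolution_operator (\<lambda>x p. K (x /\<^sub>R \<epsilon>) p)) w"
      using sol unfolding pos state_constraint_solution_def cl by blast
    from viscosity_supersolution_rescale[OF this \<epsilon>] show ?thesis unfolding op .
  qed
  moreover have "w (\<epsilon> *\<^sub>R (x, 0)) / \<epsilon> = g (\<epsilon> *\<^sub>R x) / \<epsilon>" if "x \<in> closure W" for x
    using sol that unfolding state_constraint_solution_def cl by auto
  ultimately show ?thesis unfolding state_constraint_solution_def by blast
qed

text \<open>The infimum in the hypothesis is a lower bound only for families bounded below;
  compactness of the unit cube and periodicity provide that.\<close>

lemma periodic_coercive:
  fixes H :: "real ^ 'n \<Rightarrow> real ^ 'n \<Rightarrow> real"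
  assumes cont: "continuous_on UNIV (\<lambda>(y, p). H y p)"
    and per: "\<And>y p z. z \<in> integer_lattice \<Longrightarrow> H (y + z) p = H y p"
    and coercive: "filterlim (\<lambda>p. INF y. H y p) at_top at_infinity"
  shows "\<exists>R. \<forall>y p. H y p \<le> B \<longrightarrow> norm p \<le> R"
proof -
  have bdd: "bdd_below (range (\<lambda>y. H y p))" for p
  proof -
    have "continuous_on (cbox 0 1) (\<lambda>y. H y p)"
      using continuous_on_compose2[OF cont continuous_on_Pair[OF continuous_on_id continuous_on_const[of _ p]], of "cbox 0 1"]
      by simp
    then have "bdd_below ((\<lambda>y. H y p) ` cbox 0 1)"
      by (intro bounded_imp_bdd_below compact_imp_bounded compact_continuous_image compact_cbox)
    then obtain m where m: "\<And>y. y \<in> cbox 0 1 \<Longrightarrow> m \<le> H y p" unfolding bdd_below_def by blast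
    have "m \<le> H y p" for y
    proof -
      obtain z where z: "z \<in> integer_lattice" "y + z \<in> cbox 0 1" by (rule translate_into_unit_cube)
      then show ?thesis using m[OF z(2)] per[OF z(1)] by simp
    qed
    then show ?thesis by (auto intro!: bdd_belowI)
  qed
  have "\<forall>\<^sub>F p in at_infinity. B < (INF y. H y p)"
    using coercive unfolding filterlim_at_top_dense by blast
  then obtain b where b: "\<And>p. b \<le> norm p \<Longrightarrow> B < (INF y. H y p)"
    unfolding eventually_at_infinity by blast
  have "norm p \<le> b" if "H y p \<le> B" for y p
  proof (rule ccontr)
    assume "\<not> norm p \<le> b"
    then have "B < (INF y. H y p)" using b by simp
    also have "\<dots> \<le> H y p" by (rule cINF_lower[OF bdd]) simp
    finally show False using that by simp
  qed
  then show ?thesis by blast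
qed

theorem theorem1p1:
  fixes \<Omega> :: "(real ^ 'n) set"
    and H :: "real ^ 'n \<Rightarrow> real ^ 'n \<Rightarrow> real"
    and M :: real
  assumes "CARD('n) \<ge> 2"
    and "open \<Omega>" and "connected \<Omega>" and "C1_boundary \<Omega>"
    and "{x + z | x z. x \<in> \<Omega> \<and> z \<in> integer_lattice} = \<Omega>"
    and "continuous_on UNIV (\<lambda>(y, p). H y p)"
    and "\<forall>p y. \<forall>z\<in>integer_lattice. H (y + z) p = H y p"
    and "filterlim (\<lambda>p. INF y. H y p) at_top at_infinity"
    and "\<forall>y. convex_on UNIV (H y)"
  shows "\<exists>C>0. \<forall>(g :: real ^ 'n \<Rightarrow> real) (\<epsilon> :: real) u\<epsilon> u.
           bounded (range g) \<and> uniformly_continuous_on UNIV g \<and> (\<exists>L. L-lipschitz_on UNIV g) \<and>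
           is_gradient_Linf_norm g M \<and>
           0 < \<epsilon> \<and> \<epsilon> < 1 \<and>
           state_constraint_solution ((*\<^sub>R) \<epsilon> ` \<Omega>) (\<lambda>x p. H (x /\<^sub>R \<epsilon>) p) g u\<epsilon> \<and>
           state_constraint_solution UNIV (\<lambda>x p. effective_hamiltonian \<Omega> H p) g u
           \<longrightarrow> (\<forall>x \<in> closure ((*\<^sub>R) \<epsilon> ` \<Omega>). \<forall>t\<ge>0. \<bar>u\<epsilon> (x, t) - u (x, t)\<bar> \<le> C * \<epsilon>)"
proof (cases "\<Omega> = {} \<or> M < 0")
  \<comment> \<open>Degenerate cases: either there is no point \<open>x\<close> to consider, or no
    \<open>g\<close>, since an essential bound of a gradient norm is nonnegative.\<close>
  case True
  then show ?thesis
    using gradient_ess_bounded_nonneg unfolding is_gradient_Linf_norm_def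
    by (intro exI[of _ 1]) fastforce
next
  case False
  then have "\<Omega> \<noteq> {}" and M: "0 \<le> M" by auto
  interpret periodic_hamiltonian \<Omega> H
  proof unfold_locales
    show "cone_condition \<Omega>" by (rule C1_boundary_cone_condition) fact+
    show "x + z \<in> \<Omega>" if "x \<in> \<Omega>" "z \<in> integer_lattice" for x z using that assms(5) by blast
    show "\<exists>R. \<forall>y p. H y p \<le> B \<longrightarrow> norm p \<le> R" for B
      by (rule periodic_coercive) (use assms in auto)
  qed (use assms \<open>\<Omega> \<noteq> {}\<close> in auto)
  obtain C where C: "0 < C"
    "\<And>g w u x t. (\<And>x y. g y - g x \<le> M * norm (y - x)) \<Longrightarrow>
      state_constraint_solution \<Omega> H g w \<Longrightarrow>
      state_constraint_solution UNIV (\<lambda>x. effective_hamiltonian \<Omega> H) g u \<Longrightarrow>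
      x \<in> closure \<Omega> \<Longrightarrow> 0 \<le> t \<Longrightarrow> \<bar>w (x, t) - u (x, t)\<bar> \<le> C"
    by (rule homogenization_bound[OF M]) blast
  show ?thesis
  proof (intro exI[of _ C] conjI allI impI ballI C(1))
    fix g :: "real ^ 'n \<Rightarrow> real" and \<epsilon> u\<epsilon> u x and t :: real
    assume as: "bounded (range g) \<and> uniformly_continuous_on UNIV g \<and> (\<exists>L. L-lipschitz_on UNIV g) \<and>
        is_gradient_Linf_norm g M \<and> 0 < \<epsilon> \<and> \<epsilon> < 1 \<and>
        state_constraint_solution ((*\<^sub>R) \<epsilon> ` \<Omega>) (\<lambda>x p. H (x /\<^sub>R \<epsilon>) p) g u\<epsilon> \<and>
        state_constraint_solution UNIV (\<lambda>x p. effective_hamiltonian \<Omega> H p) g u"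
      and x: "x \<in> closure ((*\<^sub>R) \<epsilon> ` \<Omega>)" and t: "0 \<le> t"
    have \<epsilon>: "0 < \<epsilon>" using as by blast
    obtain L where "L-lipschitz_on UNIV g" using as by blast
    then have g: "g b - g a \<le> M * norm (b - a)" for a b
      using lipschitz_of_gradient_bound as unfolding is_gradient_Linf_norm_def by blast
    have g': "g (\<epsilon> *\<^sub>R b) / \<epsilon> - g (\<epsilon> *\<^sub>R a) / \<epsilon> \<le> M * norm (b - a)" for a b
    proof -
      have "g (\<epsilon> *\<^sub>R b) - g (\<epsilon> *\<^sub>R a) \<le> M * norm (b - a) * \<epsilon>"
        using g[of "\<epsilon> *\<^sub>R b" "\<epsilon> *\<^sub>R a"] \<epsilon> by (simp add: scaleR_diff_right[symmetric] mult_ac)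
      then show ?thesis using \<epsilon> by (simp add: diff_divide_distrib[symmetric] pos_divide_le_eq)
    qed
    have surj: "(*\<^sub>R) \<epsilon> ` (UNIV :: (real ^ 'n) set) = UNIV"
      using \<epsilon> by (intro surjI[of _ "\<lambda>x. x /\<^sub>R \<epsilon>"]) simp
    have w: "state_constraint_solution \<Omega> H (\<lambda>y. g (\<epsilon> *\<^sub>R y) / \<epsilon>) (\<lambda>z. u\<epsilon> (\<epsilon> *\<^sub>R z) / \<epsilon>)"
      by (rule state_constraint_solution_rescale) (use as in auto)
    \<comment> \<open>The effective Hamiltonian does not depend on the position, so the homogenized
      equation rescales to itself.\<close>
    have u: "state_constraint_solution UNIV (\<lambda>x. effective_hamiltonian \<Omega> H) (\<lambda>y. g (\<epsilon> *\<^sub>R y) / \<epsilon>) (\<lambda>z. u (\<epsilon> *\<^sub>R z) / \<epsilon>)"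
      by (rule state_constraint_solution_rescale) (use as surj in auto)
    obtain y where y: "y \<in> closure \<Omega>" "x = \<epsilon> *\<^sub>R y"
      using x unfolding closure_scaleR[symmetric] by blast
    \<comment> \<open>The bound at unit scale holds for all times, so it may be evaluated at the
      large time \<open>t / \<epsilon>\<close>.\<close>
    have "\<bar>u\<epsilon> (\<epsilon> *\<^sub>R (y, t / \<epsilon>)) / \<epsilon> - u (\<epsilon> *\<^sub>R (y, t / \<epsilon>)) / \<epsilon>\<bar> \<le> C"
      using C(2)[OF g' w u y(1), of "t / \<epsilon>"] t \<epsilon> by simp
    then have "\<bar>u\<epsilon> (x, t) - u (x, t)\<bar> / \<epsilon> \<le> C"
      using \<epsilon> by (simp add: y(2) diff_divide_distrib[symmetric] abs_divide)
    then show "\<bar>u\<epsilon> (x, t) - u (x, t)\<bar> \<le> C * \<epsilon>" using \<epsilon> by (simp add: pos_divide_le_eq)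
  qed
qed

end
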